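(* Let $\mathcal{C}$ be a class of unital $C^*$-algebras of real rank zero (closed under isomorphism) that is closed under taking direct sums and unital corners. If $\mathcal{B}$ is a separable unital $\mathcal{C}$-tracially stable $C^*$-algebra and $X$ is a compact metric space, then $\mathcal{B}\otimes C(X)$ is $\mathcal{C}$-tracially stable. In particular, every separable unital commutative $C^*$-algebra is $\mathcal{C}$-tracially stable.
   Context: A unital $C^*$-algebra has real rank zero if each of its self-adjoint elements can be approximated in norm by self-adjoint elements with finite spectrum. A unital corner of a unital $C^*$-algebra $\mathcal{A}$ is an algebra $p\mathcal{A}p$ with $p\in\mathcal{A}$ a projection, with unit $p$. If $\rho$ is a tracial state on a unital $C^*$-algebra, put $\|x\|_{2,\rho}=\rho(x^*x)^{1/2}$. An ultrafilter $\alpha$ on an infinite set $I$ is nontrivial if there is a sequence $\{E_n\}$ in $\alpha$ with $\bigcap_n E_n=\varnothing$. Given unital $C^*$-algebras $\mathcal{A}_i$ with tracial states $\rho_i$ ($i\in I$), the tracial ultraproduct $\prod_{i\in I}^{\alpha}(\mathcal{A}_i,\rho_i)$ is the $C^*$-product $\prod_{i\in I}\mathcal{A}_i$ (bounded families) modulo the ideal of all $\{a_i\}$ with $\lim_{i\to\alpha}\|a_i\|_{2,\rho_i}=0$; the coset of $\{a_i\}$ is denoted $\{a_i\}_\alpha$. A unital $*$-homomorphism $\pi:\mathcal{A}\to\prod_{i\in I}^{\alpha}(\mathcal{A}_i,\rho_i)$ is approximately liftable if there are a set $E\in\alpha$ and, for every $i\in E$, a unital $*$-homomorphism $\pi_i:\mathcal{A}\to\mathcal{A}_i$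 such that $\pi(a)=\{\pi_i(a)\}_\alpha$ for every $a\in\mathcal{A}$ (where $\pi_i(a)=0$ for $i\notin E$). For a class $\mathcal{C}$ of unital $C^*$-algebras closed under isomorphism, a separable unital $C^*$-algebra $\mathcal{A}$ is $\mathcal{C}$-tracially stable if every unital $*$-homomorphism from $\mathcal{A}$ into any tracial ultraproduct $\prod_{i\in I}^{\alpha}(\mathcal{A}_i,\rho_i)$, with all $\mathcal{A}_i\in\mathcal{C}$, $\rho_i$ any tracial state on $\mathcal{A}_i$, and $\alpha$ any nontrivial ultrafilter, is approximately liftable. *)

theory Defs
  imports
    "HOL-Algebra.QuotRing"
    "HOL-Algebra.Module"
    "HOL-Algebra.Algebraic_Closure_Type"
    "HOL-Analysis.Analysis"
begin

section \<open>Unital C*-algebras\<close>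

abbreviation complex_ring :: "complex ring"
  where "complex_ring \<equiv> ring_of_type_algebra"

record 'a cstar_algebra = "(complex, 'a) module" +
  star :: "'a \<Rightarrow> 'a"
  cnorm :: "'a \<Rightarrow> real"

text \<open>The guard is there because the locale \<^locale>\<open>Metric_space\<close> asks for nonnegativity and
  symmetry of the distance on the whole type, not only on the carrier.\<close>

definition cdist :: "'a cstar_algebra \<Rightarrow> 'a \<Rightarrow> 'a \<Rightarrow> real"
  where "cdist A x y =
    (if x \<in> carrier A \<and> y \<in> carrier A then cnorm A (x \<ominus>\<^bsub>A\<^esub> y) else 0)"

abbreviation norm_topology :: "'a cstar_algebra \<Rightarrow> 'a topology"
  where "norm_topology A \<equiv> Metric_space.mtopology (carrier A) (cdist A)"

text \<open>The zero algebra (with \<open>\<one> = \<zero>\<close>) is admitted, so that the corner at the projection \<open>\<zero>\<close>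
  and the algebra of functions on the empty space are unital C*-algebras. It has no tracial
  state, hence never occurs as a factor of a tracial ultraproduct.\<close>

locale unital_cstar_algebra = module complex_ring A + ring A
  for A :: "'a cstar_algebra" (structure) +
  assumes smult_mult_left:
      "\<lbrakk>x \<in> carrier A; y \<in> carrier A\<rbrakk> \<Longrightarrow> (c \<odot> x) \<otimes> y = c \<odot> (x \<otimes> y)"
    and smult_mult_right:
      "\<lbrakk>x \<in> carrier A; y \<in> carrier A\<rbrakk> \<Longrightarrow> x \<otimes> (c \<odot> y) = c \<odot> (x \<otimes> y)"
    and star_closed: "x \<in> carrier A \<Longrightarrow> star A x \<in> carrier A"
    and star_star: "x \<in> carrier A \<Longrightarrow> star A (star A x) = x"
    and star_add:
      "\<lbrakk>x \<in> carrier A; y \<in> carrier A\<rbrakk> \<Longrightarrow> star A (x \<oplus> y) = star A x \<oplus> star A y"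
    and star_smult: "x \<in> carrier A \<Longrightarrow> star A (c \<odot> x) = cnj c \<odot> star A x"
    and star_mult:
      "\<lbrakk>x \<in> carrier A; y \<in> carrier A\<rbrakk> \<Longrightarrow> star A (x \<otimes> y) = star A y \<otimes> star A x"
    and cnorm_nonneg: "x \<in> carrier A \<Longrightarrow> 0 \<le> cnorm A x"
    and cnorm_eq_zero_iff: "x \<in> carrier A \<Longrightarrow> cnorm A x = 0 \<longleftrightarrow> x = \<zero>"
    and cnorm_triangle:
      "\<lbrakk>x \<in> carrier A; y \<in> carrier A\<rbrakk> \<Longrightarrow> cnorm A (x \<oplus> y) \<le> cnorm A x + cnorm A y"
    and cnorm_smult: "x \<in> carrier A \<Longrightarrow> cnorm A (c \<odot> x) = cmod c * cnorm A x"
    and cnorm_mult: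
      "\<lbrakk>x \<in> carrier A; y \<in> carrier A\<rbrakk> \<Longrightarrow> cnorm A (x \<otimes> y) \<le> cnorm A x * cnorm A y"
    and cstar_identity: "x \<in> carrier A \<Longrightarrow> cnorm A (star A x \<otimes> x) = (cnorm A x)\<^sup>2"
    and complete: "Metric_space.mcomplete (carrier A) (cdist A)"

definition separable_cstar :: "'a cstar_algebra \<Rightarrow> bool"
  where "separable_cstar A \<longleftrightarrow>
    (\<exists>D. D \<subseteq> carrier A \<and> countable D \<and> norm_topology A closure_of D = carrier A)"

definition unital_star_hom :: "'a cstar_algebra \<Rightarrow> 'b cstar_algebra \<Rightarrow> ('a \<Rightarrow> 'b) set"
  where "unital_star_hom A B = {h \<in> ring_hom A B.
    (\<forall>c. \<forall>x \<in> carrier A. h (c \<odot>\<^bsub>A\<^esub> x) = c \<odot>\<^bsub>B\<^esub> h x) \<and>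
    (\<forall>x \<in> carrier A. h (star A x) = star B (h x))}"

definition cstar_isomorphic :: "'a cstar_algebra \<Rightarrow> 'b cstar_algebra \<Rightarrow> bool"
  where "cstar_isomorphic A B \<longleftrightarrow>
    (\<exists>h \<in> unital_star_hom A B. bij_betw h (carrier A) (carrier B))"

definition self_adjoint :: "'a cstar_algebra \<Rightarrow> 'a \<Rightarrow> bool"
  where "self_adjoint A x \<longleftrightarrow> x \<in> carrier A \<and> star A x = x"

definition spectrum :: "'a cstar_algebra \<Rightarrow> 'a \<Rightarrow> complex set"
  where "spectrum A x = {z. z \<odot>\<^bsub>A\<^esub> \<one>\<^bsub>A\<^esub> \<ominus>\<^bsub>A\<^esub> x \<notin> Units A}"

definition real_rank_zero :: "'a cstar_algebra \<Rightarrow> bool"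
  where "real_rank_zero A \<longleftrightarrow>
    (\<forall>x e. self_adjoint A x \<and> e > 0 \<longrightarrow>
      (\<exists>y. self_adjoint A y \<and> finite (spectrum A y) \<and> cnorm A (x \<ominus>\<^bsub>A\<^esub> y) < e))"

definition projection :: "'a cstar_algebra \<Rightarrow> 'a \<Rightarrow> bool"
  where "projection A p \<longleftrightarrow> self_adjoint A p \<and> p \<otimes>\<^bsub>A\<^esub> p = p"

definition unital_corner :: "'a cstar_algebra \<Rightarrow> 'a \<Rightarrow> 'a cstar_algebra"
  where "unital_corner A p =
    A\<lparr>carrier := {p \<otimes>\<^bsub>A\<^esub> x \<otimes>\<^bsub>A\<^esub> p | x. x \<in> carrier A}, one := p\<rparr>"

definition direct_sum :: "'a cstar_algebra \<Rightarrow> 'b cstar_algebra \<Rightarrow> ('a \<times> 'b) cstar_algebra"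
  where "direct_sum A B =
    \<lparr>carrier = carrier A \<times> carrier B,
     monoid.mult = (\<lambda>(x, y) (x', y'). (x \<otimes>\<^bsub>A\<^esub> x', y \<otimes>\<^bsub>B\<^esub> y')),
     one = (\<one>\<^bsub>A\<^esub>, \<one>\<^bsub>B\<^esub>),
     ring.zero = (\<zero>\<^bsub>A\<^esub>, \<zero>\<^bsub>B\<^esub>),
     add = (\<lambda>(x, y) (x', y'). (x \<oplus>\<^bsub>A\<^esub> x', y \<oplus>\<^bsub>B\<^esub> y')),
     module.smult = (\<lambda>c (x, y). (c \<odot>\<^bsub>A\<^esub> x, c \<odot>\<^bsub>B\<^esub> y)),
     star = (\<lambda>(x, y). (star A x, star B y)),
     cnorm = (\<lambda>(x, y). max (cnorm A x) (cnorm B y))\<rparr>"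


section \<open>Classes of C*-algebras\<close>

text \<open>A class of C*-algebras is represented by its members whose elements are taken from one
  type \<open>'u\<close>. As \<open>direct_sum A B\<close> lives on \<open>'u \<times> 'u\<close>, closure under direct sums refers to the
  copies of it on \<open>'u\<close>; these exist since a nonzero algebra forces \<open>'u\<close> to be infinite.\<close>

definition iso_closed :: "'u cstar_algebra set \<Rightarrow> bool"
  where "iso_closed \<C> \<longleftrightarrow>
    (\<forall>A \<in> \<C>. \<forall>B :: 'u cstar_algebra.
      unital_cstar_algebra B \<and> cstar_isomorphic A B \<longrightarrow> B \<in> \<C>)"

definition direct_sum_closed :: "'u cstar_algebra set \<Rightarrow> bool"
  where "direct_sum_closed \<C> \<longleftrightarrow>
    (\<forall>A \<in> \<C>. \<forall>B \<in> \<C>. \<forall>D :: 'u cstar_algebra.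
      unital_cstar_algebra D \<and> cstar_isomorphic (direct_sum A B) D \<longrightarrow> D \<in> \<C>)"

definition corner_closed :: "'u cstar_algebra set \<Rightarrow> bool"
  where "corner_closed \<C> \<longleftrightarrow>
    (\<forall>A \<in> \<C>. \<forall>p. projection A p \<longrightarrow> unital_corner A p \<in> \<C>)"


section \<open>Tracial ultraproducts\<close>

definition tracial_state :: "'a cstar_algebra \<Rightarrow> ('a \<Rightarrow> complex) \<Rightarrow> bool"
  where "tracial_state A \<rho> \<longleftrightarrow>
    (\<forall>x \<in> carrier A. \<forall>y \<in> carrier A. \<rho> (x \<oplus>\<^bsub>A\<^esub> y) = \<rho> x + \<rho> y) \<and>
    (\<forall>c. \<forall>x \<in> carrier A. \<rho> (c \<odot>\<^bsub>A\<^esub> x) = c * \<rho> x) \<and>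
    (\<forall>x \<in> carrier A. \<rho> (star A x \<otimes>\<^bsub>A\<^esub> x) \<in> \<real>\<^sub>\<ge>\<^sub>0) \<and>
    \<rho> \<one>\<^bsub>A\<^esub> = 1 \<and>
    (\<forall>x \<in> carrier A. \<forall>y \<in> carrier A. \<rho> (x \<otimes>\<^bsub>A\<^esub> y) = \<rho> (y \<otimes>\<^bsub>A\<^esub> x))"

definition norm2 :: "'a cstar_algebra \<Rightarrow> ('a \<Rightarrow> complex) \<Rightarrow> 'a \<Rightarrow> real"
  where "norm2 A \<rho> x = sqrt (Re (\<rho> (star A x \<otimes>\<^bsub>A\<^esub> x)))"

definition cstar_product :: "'i set \<Rightarrow> ('i \<Rightarrow> 'a cstar_algebra) \<Rightarrow> ('i \<Rightarrow> 'a) cstar_algebra"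
  where "cstar_product I A =
    \<lparr>carrier = {x \<in> (\<Pi>\<^sub>E i \<in> I. carrier (A i)). bdd_above ((\<lambda>i. cnorm (A i) (x i)) ` I)},
     monoid.mult = (\<lambda>x y. \<lambda>i\<in>I. x i \<otimes>\<^bsub>A i\<^esub> y i),
     one = (\<lambda>i\<in>I. \<one>\<^bsub>A i\<^esub>),
     ring.zero = (\<lambda>i\<in>I. \<zero>\<^bsub>A i\<^esub>),
     add = (\<lambda>x y. \<lambda>i\<in>I. x i \<oplus>\<^bsub>A i\<^esub> y i),
     module.smult = (\<lambda>c x. \<lambda>i\<in>I. c \<odot>\<^bsub>A i\<^esub> x i),
     star = (\<lambda>x. \<lambda>i\<in>I. star (A i) (x i)),
     cnorm = (\<lambda>x. SUP i\<in>I. cnorm (A i) (x i))\<rparr>"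

text \<open>The underlying ring of the quotient is \<^term>\<open>A Quot J\<close>.\<close>

definition cstar_quotient :: "'a cstar_algebra \<Rightarrow> 'a set \<Rightarrow> 'a set cstar_algebra"
  where "cstar_quotient A J =
    \<lparr>carrier = carrier (A Quot J),
     monoid.mult = monoid.mult (A Quot J),
     one = one (A Quot J),
     ring.zero = ring.zero (A Quot J),
     add = add (A Quot J),
     module.smult = (\<lambda>c S. \<Union>x\<in>S. J +>\<^bsub>A\<^esub> (c \<odot>\<^bsub>A\<^esub> x)),
     star = (\<lambda>S. \<Union>x\<in>S. J +>\<^bsub>A\<^esub> star A x),
     cnorm = (\<lambda>S. INF x\<in>S. cnorm A x)\<rparr>"

text \<open>An ultrafilter on the set \<open>I\<close> is represented by a filter \<open>\<alpha>\<close> on the type concentrated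
  on \<open>I\<close>; a set \<open>E \<subseteq> I\<close> belongs to the ultrafilter iff \<open>\<forall>\<^sub>F i in \<alpha>. i \<in> E\<close>.\<close>

definition ultrafilter_on :: "'i set \<Rightarrow> 'i filter \<Rightarrow> bool"
  where "ultrafilter_on I \<alpha> \<longleftrightarrow>
    \<alpha> \<noteq> bot \<and> (\<forall>\<^sub>F i in \<alpha>. i \<in> I) \<and>
    (\<forall>P. (\<forall>\<^sub>F i in \<alpha>. P i) \<or> (\<forall>\<^sub>F i in \<alpha>. \<not> P i))"

definition nontrivial_ultrafilter_on :: "'i set \<Rightarrow> 'i filter \<Rightarrow> bool"
  where "nontrivial_ultrafilter_on I \<alpha> \<longleftrightarrow>
    ultrafilter_on I \<alpha> \<and>
    (\<exists>E :: nat \<Rightarrow> 'i set.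
      (\<forall>n. E n \<subseteq> I \<and> (\<forall>\<^sub>F i in \<alpha>. i \<in> E n)) \<and> (\<Inter>n. E n) = {})"

definition trace_ideal ::
    "'i set \<Rightarrow> 'i filter \<Rightarrow> ('i \<Rightarrow> 'a cstar_algebra) \<Rightarrow> ('i \<Rightarrow> 'a \<Rightarrow> complex) \<Rightarrow> ('i \<Rightarrow> 'a) set"
  where "trace_ideal I \<alpha> A \<rho> =
    {x \<in> carrier (cstar_product I A). ((\<lambda>i. norm2 (A i) (\<rho> i) (x i)) \<longlongrightarrow> 0) \<alpha>}"

definition tracial_ultraproduct ::
    "'i set \<Rightarrow> 'i filter \<Rightarrow> ('i \<Rightarrow> 'a cstar_algebra) \<Rightarrow> ('i \<Rightarrow> 'a \<Rightarrow> complex) \<Rightarrow>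
      ('i \<Rightarrow> 'a) set cstar_algebra"
  where "tracial_ultraproduct I \<alpha> A \<rho> =
    cstar_quotient (cstar_product I A) (trace_ideal I \<alpha> A \<rho>)"

definition coset_of ::
    "'i set \<Rightarrow> 'i filter \<Rightarrow> ('i \<Rightarrow> 'a cstar_algebra) \<Rightarrow> ('i \<Rightarrow> 'a \<Rightarrow> complex) \<Rightarrow>
      ('i \<Rightarrow> 'a) \<Rightarrow> ('i \<Rightarrow> 'a) set"
  where "coset_of I \<alpha> A \<rho> x = trace_ideal I \<alpha> A \<rho> +>\<^bsub>cstar_product I A\<^esub> x"

definition approximately_liftable ::
    "'b cstar_algebra \<Rightarrow> 'i set \<Rightarrow> 'i filter \<Rightarrow> ('i \<Rightarrow> 'a cstar_algebra) \<Rightarrow>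
      ('i \<Rightarrow> 'a \<Rightarrow> complex) \<Rightarrow> ('b \<Rightarrow> ('i \<Rightarrow> 'a) set) \<Rightarrow> bool"
  where "approximately_liftable B I \<alpha> A \<rho> \<pi> \<longleftrightarrow>
    (\<exists>E \<phi>. E \<subseteq> I \<and> (\<forall>\<^sub>F i in \<alpha>. i \<in> E) \<and>
      (\<forall>i \<in> E. \<phi> i \<in> unital_star_hom B (A i)) \<and>
      (\<forall>b \<in> carrier B.
        \<pi> b = coset_of I \<alpha> A \<rho> (\<lambda>i\<in>I. if i \<in> E then \<phi> i b else \<zero>\<^bsub>A i\<^esub>)))"

text \<open>The type argument fixes the type from which the index sets are drawn.\<close>

definition tracially_stable ::
    "'i itself \<Rightarrow> 'u cstar_algebra set \<Rightarrow> 'b cstar_algebra \<Rightarrow> bool"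
  where "tracially_stable (_ :: 'i itself) \<C> B \<longleftrightarrow>
    unital_cstar_algebra B \<and> separable_cstar B \<and>
    (\<forall>(I :: 'i set) \<alpha> A \<rho> \<pi>.
      infinite I \<and> nontrivial_ultrafilter_on I \<alpha> \<and>
      (\<forall>i \<in> I. A i \<in> \<C> \<and> tracial_state (A i) (\<rho> i)) \<and>
      \<pi> \<in> unital_star_hom B (tracial_ultraproduct I \<alpha> A \<rho>) \<longrightarrow>
      approximately_liftable B I \<alpha> A \<rho> \<pi>)"


section \<open>C(K) and tensor products\<close>

text \<open>Functions are extensional outside \<open>K\<close>. The \<open>insert 0\<close> gives norm 0 when \<open>K\<close> is empty.\<close>

definition continuous_functions :: "'x :: metric_space set \<Rightarrow> ('x \<Rightarrow> complex) cstar_algebra"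
  where "continuous_functions K =
    \<lparr>carrier = {f \<in> extensional K. continuous_on K f},
     monoid.mult = (\<lambda>f g. \<lambda>x\<in>K. f x * g x),
     one = (\<lambda>x\<in>K. 1),
     ring.zero = (\<lambda>x\<in>K. 0),
     add = (\<lambda>f g. \<lambda>x\<in>K. f x + g x),
     module.smult = (\<lambda>c f. \<lambda>x\<in>K. c * f x),
     star = (\<lambda>f. \<lambda>x\<in>K. cnj (f x)),
     cnorm = (\<lambda>f. Sup (insert 0 ((\<lambda>x. cmod (f x)) ` K)))\<rparr>"

definition lin_indep :: "'a cstar_algebra \<Rightarrow> nat \<Rightarrow> (nat \<Rightarrow> 'a) \<Rightarrow> bool"
  where "lin_indep A n v \<longleftrightarrow>
    (\<forall>i<n. v i \<in> carrier A) \<and>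
    (\<forall>c :: nat \<Rightarrow> complex. (\<Oplus>\<^bsub>A\<^esub>i\<in>{..<n}. c i \<odot>\<^bsub>A\<^esub> v i) = \<zero>\<^bsub>A\<^esub> \<longrightarrow> (\<forall>i<n. c i = 0))"

text \<open>\<open>T\<close>, with \<open>j a b\<close> in the role of the elementary tensor of \<open>a\<close> and \<open>b\<close>, is a completion of
  the algebraic tensor product *-algebra of \<open>A\<close> and \<open>B\<close> in some C*-norm. The condition on linearly
  independent \<open>b\<close> says that the linear map induced by \<open>j\<close> on the algebraic tensor product is
  injective. If \<open>A\<close> or \<open>B\<close> is nuclear, in particular if one of them is commutative, there is
  only one C*-norm, and \<open>T\<close> is the C*-tensor product.\<close>

definition is_cstar_tensor_product ::
    "'a cstar_algebra \<Rightarrow> 'b cstar_algebra \<Rightarrow> 't cstar_algebra \<Rightarrow> ('a \<Rightarrow> 'b \<Rightarrow> 't) \<Rightarrow> bool"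
  where "is_cstar_tensor_product A B T j \<longleftrightarrow>
    unital_cstar_algebra T \<and>
    (\<forall>a \<in> carrier A. \<forall>b \<in> carrier B. j a b \<in> carrier T) \<and>
    (\<forall>a \<in> carrier A. \<forall>a' \<in> carrier A. \<forall>b \<in> carrier B.
      j (a \<oplus>\<^bsub>A\<^esub> a') b = j a b \<oplus>\<^bsub>T\<^esub> j a' b) \<and>
    (\<forall>a \<in> carrier A. \<forall>b \<in> carrier B. \<forall>b' \<in> carrier B.
      j a (b \<oplus>\<^bsub>B\<^esub> b') = j a b \<oplus>\<^bsub>T\<^esub> j a b') \<and>
    (\<forall>c. \<forall>a \<in> carrier A. \<forall>b \<in> carrier B.
      j (c \<odot>\<^bsub>A\<^esub> a) b = c \<odot>\<^bsub>T\<^esub> j a b \<and> j a (c \<odot>\<^bsub>B\<^esub> b) = c \<odot>\<^bsub>T\<^esub> j a b) \<and>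
    (\<forall>a \<in> carrier A. \<forall>a' \<in> carrier A. \<forall>b \<in> carrier B. \<forall>b' \<in> carrier B.
      j a b \<otimes>\<^bsub>T\<^esub> j a' b' = j (a \<otimes>\<^bsub>A\<^esub> a') (b \<otimes>\<^bsub>B\<^esub> b')) \<and>
    (\<forall>a \<in> carrier A. \<forall>b \<in> carrier B. star T (j a b) = j (star A a) (star B b)) \<and>
    j \<one>\<^bsub>A\<^esub> \<one>\<^bsub>B\<^esub> = \<one>\<^bsub>T\<^esub> \<and>
    (\<forall>(n :: nat) a b. (\<forall>i<n. a i \<in> carrier A) \<and> lin_indep B n b \<and>
      (\<Oplus>\<^bsub>T\<^esub>i\<in>{..<n}. j (a i) (b i)) = \<zero>\<^bsub>T\<^esub> \<longrightarrow> (\<forall>i<n. a i = \<zero>\<^bsub>A\<^esub>)) \<and>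
    norm_topology T closure_of
      {\<Oplus>\<^bsub>T\<^esub>i\<in>{..<n}. j (a i) (b i) | (n :: nat) a b.
        \<forall>i<n. a i \<in> carrier A \<and> b i \<in> carrier B} = carrier T"

end

theory Submission
  imports Defs
begin

text \<open>
  A unital *-homomorphism of a separable algebra \<open>T\<close> into a tracial ultraproduct is handled through
  bounded families of representatives, which satisfy the homomorphism laws up to families that are
  null in 2-norm. Two ideas prove that it lifts.

  The first is to cut along the center. Let \<open>a\<close> be a central self-adjoint element of \<open>T\<close>. Its
  representatives are self-adjoint elements of algebras of real rank zero that commute
  asymptotically with everything. In real rank zero a self-adjoint element is nearly a combination
  of a long chain of its spectral projections, with thresholds placed in gaps of the spectrum of a
  nearby element with finite spectrum. For a chain of projections the mixed terms of the squared
  2-norm of a commutator are nonnegative, so the squares of the commutators of the single projections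
  add up to at most that of the sum, which is small; hence some projection with threshold in the
  middle of the spectrum nearly commutes with any given finite set (\<open>chain_commutators\<close>,
  \<open>almost_central_cut\<close>). Countable incompleteness of the ultrafilter and separability of \<open>T\<close> turn this
  into projections that commute asymptotically with all representatives. Such a family of projections
  splits the representation into two, one in the corners of the projections and one in the corners of
  their complements; these corners belong to the class again, and in each of them the spectrum of \<open>a\<close>
  has shrunk by a fixed factor. Models on both corners add up to a model of the whole. After finitely
  many cuts any given finite set of central elements is almost scalar (\<open>good_by_localization\<close>), and it
  remains to find models in that situation (\<open>tracially_stable_by_local_models\<close>).

  The second idea provides these models by evaluation at a point. The limit of the traces is a state
  of \<open>T\<close>, in which the chosen central elements have small variance, so some point of the underlying
  space takes almost the values of their expectations (\<open>point_from_state\<close>,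
  \<open>character_below_state\<close>). If \<open>T\<close> is a tensor product of \<open>B\<close> with \<open>C(K)\<close>, evaluation at \<open>z\<close> is a
  homomorphism of \<open>T\<close> onto \<open>B\<close> (\<open>ev_hom\<close>), and the restriction of the representation to the copy of \<open>B\<close> in
  \<open>T\<close> lifts because \<open>B\<close> is stable; the composition is the model. If \<open>T\<close> is commutative, the point is a
  character, obtained from a maximal ideal, and the model is its composition with the unit.

  All of this rests on a continuous functional calculus for self-adjoint elements, which is derived
  from the estimate that a polynomial in \<open>a\<close> is bounded by its supremum on \<open>[-R, R]\<close> whenever the norm
  of \<open>a\<close> is below \<open>R\<close>: after dilation of \<open>a\<close> to a unitary, coefficients are bounded by values on the
  circle, and repeated squaring removes the factor lost in this way.
\<close>

section \<open>Elementary facts on C*-algebras\<close>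

lemma complex_ring_simps [simp]:
  "carrier complex_ring = UNIV" "x \<oplus>\<^bsub>complex_ring\<^esub> y = x + y"
  "x \<otimes>\<^bsub>complex_ring\<^esub> y = x * y" "\<one>\<^bsub>complex_ring\<^esub> = 1" "\<zero>\<^bsub>complex_ring\<^esub> = 0"
  by (simp_all add: ring_of_type_algebra_def)

lemma complex_ring_uminus [simp]: "\<ominus>\<^bsub>complex_ring\<^esub> x = - x"
proof -
  interpret ring "complex_ring" by (rule ring_from_type_algebra)
  have "x \<oplus>\<^bsub>complex_ring\<^esub> (\<ominus>\<^bsub>complex_ring\<^esub> x) = 0" using r_neg[of x] by simp
  then show ?thesis by (simp add: add_eq_0_iff)
qed

context unital_cstar_algebra
begin

lemma scal_closed [simp, intro]: "x \<in> carrier A ==> c \<odot> x \<in> carrier A"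
  using smult_closed by simp

lemmas star_closed' [simp, intro] = star_closed

lemma scal_add_left: "x \<in> carrier A ==> (c + d) \<odot> x = c \<odot> x \<oplus> d \<odot> x"
  using smult_l_distr by simp

lemma scal_add_right: "[|x \<in> carrier A; y \<in> carrier A|] ==> c \<odot> (x \<oplus> y) = c \<odot> x \<oplus> c \<odot> y"
  using smult_r_distr by simp

lemma scal_scal [simp]: "x \<in> carrier A ==> c \<odot> (d \<odot> x) = (c * d) \<odot> x"
  using smult_assoc1[of c d x] by simp

lemma scal_one [simp]: "x \<in> carrier A ==> 1 \<odot> x = x"
  using smult_one by simp

lemma scal_null [simp]: "x \<in> carrier A ==> 0 \<odot> x = \<zero>"
  using smult_l_null by simp

lemma scal_zero [simp]: "c \<odot> \<zero> = \<zero>"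
  using smult_r_null by simp

lemma scal_minus: "x \<in> carrier A ==> c \<odot> (\<ominus> x) = \<ominus> (c \<odot> x)"
  using smult_r_minus by simp

lemma scal_uminus: "x \<in> carrier A ==> (- c) \<odot> x = \<ominus> (c \<odot> x)"
  using smult_l_minus by simp

lemma scal_diff_left: "x \<in> carrier A ==> (c - d) \<odot> x = c \<odot> x \<ominus> d \<odot> x"
  using scal_add_left[of x c "- d"] by (simp add: scal_uminus minus_eq)

lemma scal_diff_right:
  "[|x \<in> carrier A; y \<in> carrier A|] ==> c \<odot> (x \<ominus> y) = c \<odot> x \<ominus> c \<odot> y"
  by (simp add: minus_eq scal_add_right scal_minus)

lemma star_zero [simp]: "star A \<zero> = \<zero>"
  using star_smult[of \<zero> 0] by simp

lemma star_minus: "x \<in> carrier A ==> star A (\<ominus> x) = \<ominus> (star A x)"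
  using star_smult[of x "-1"] by (simp add: scal_uminus)

lemma star_diff: "[|x \<in> carrier A; y \<in> carrier A|] ==> star A (x \<ominus> y) = star A x \<ominus> star A y"
  by (simp add: minus_eq star_add star_minus)

lemma star_one [simp]: "star A \<one> = \<one>"
proof -
  have "star A (star A \<one> \<otimes> \<one>) = star A \<one> \<otimes> star A (star A \<one>)"
    by (subst star_mult) auto
  then show ?thesis by (simp add: star_star)
qed

lemmas star_simps = star_star star_add star_smult star_mult star_minus star_diff

lemmas cs = ring_simprules smult_mult_left smult_mult_right scal_add_right scal_minus star_simps

lemma diff_self [simp]: "x \<in> carrier A ==> x \<ominus> x = \<zero>"
  by (simp add: minus_eq r_neg)

lemma diff_zero [simp]: "x \<in> carrier A ==> x \<ominus> \<zero> = x"
  by (simp add: minus_eq)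

lemma diff_eq_zero: "[|x \<in> carrier A; y \<in> carrier A|] ==> x \<ominus> y = \<zero> \<longleftrightarrow> x = y"
  by (simp add: r_right_minus_eq)

lemma diff_add_diff:
  "[|x \<in> carrier A; y \<in> carrier A; z \<in> carrier A|] ==> (x \<ominus> y) \<oplus> (y \<ominus> z) = x \<ominus> z"
  by (simp add: cs)

lemma add_diff_add:
  "[|x \<in> carrier A; y \<in> carrier A; z \<in> carrier A; w \<in> carrier A|]
    ==> (x \<oplus> y) \<ominus> (z \<oplus> w) = (x \<ominus> z) \<oplus> (y \<ominus> w)"
  by (simp add: cs)

lemma diff_distr_left:
  "[|x \<in> carrier A; y \<in> carrier A; z \<in> carrier A|] ==> (x \<ominus> y) \<otimes> z = x \<otimes> z \<ominus> y \<otimes> z"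
  by (simp add: cs)

lemma diff_distr_right:
  "[|x \<in> carrier A; y \<in> carrier A; z \<in> carrier A|] ==> z \<otimes> (x \<ominus> y) = z \<otimes> x \<ominus> z \<otimes> y"
  by (simp add: cs)

lemma cnorm_zero [simp]: "cnorm A \<zero> = 0"
  by (simp add: cnorm_eq_zero_iff)

lemma cnorm_minus [simp]: "x \<in> carrier A ==> cnorm A (\<ominus> x) = cnorm A x"
  using cnorm_smult[of x "-1"] by (simp add: scal_uminus)

lemma cnorm_diff_le: "[|x \<in> carrier A; y \<in> carrier A|] ==> cnorm A (x \<ominus> y) \<le> cnorm A x + cnorm A y"
  using cnorm_triangle[of x "\<ominus> y"] by (simp add: minus_eq)

lemma diff_commute:
  "[|x \<in> carrier A; y \<in> carrier A|] ==> \<ominus> (x \<ominus> y) = y \<ominus> x"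
  by (simp add: cs)

lemma cnorm_diff_commute:
  "[|x \<in> carrier A; y \<in> carrier A|] ==> cnorm A (x \<ominus> y) = cnorm A (y \<ominus> x)"
  using cnorm_minus[of "x \<ominus> y"] by (simp add: diff_commute)

lemma cnorm_diff_triangle:
  "[|x \<in> carrier A; y \<in> carrier A; z \<in> carrier A|]
    ==> cnorm A (x \<ominus> z) \<le> cnorm A (x \<ominus> y) + cnorm A (y \<ominus> z)"
  using cnorm_triangle[of "x \<ominus> y" "y \<ominus> z"] by (simp add: diff_add_diff)

lemma cnorm_le_diff:
  "[|x \<in> carrier A; y \<in> carrier A|] ==> cnorm A x \<le> cnorm A y + cnorm A (x \<ominus> y)"
  using cnorm_diff_triangle[of x y \<zero>] by simp

lemma cnorm_star [simp]: assumes "x \<in> carrier A" shows "cnorm A (star A x) = cnorm A x"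
proof -
  have *: "cnorm A y \<le> cnorm A (star A y)" if y: "y \<in> carrier A" for y
  proof (cases "cnorm A y = 0")
    case False
    have "(cnorm A y)\<^sup>2 \<le> cnorm A (star A y) * cnorm A y"
      using cstar_identity[OF y] cnorm_mult[of "star A y" y] y by auto
    then show ?thesis using False cnorm_nonneg[OF y] by (simp add: power2_eq_square)
  qed (use y cnorm_nonneg in auto)
  show ?thesis using *[of x] *[of "star A x"] assms by (simp add: star_star)
qed

lemma cnorm_one_le: "cnorm A \<one> \<le> 1"
proof -
  have "cnorm A \<one> = (cnorm A \<one>)\<^sup>2" using cstar_identity[of \<one>] by simp
  then show ?thesis
    by (metis cnorm_nonneg one_closed order_refl mult_cancel_right1 power2_eq_square zero_le_one)
qed

lemma cnorm_scal_one_le: "cnorm A (c \<odot> \<one>) \<le> cmod c"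
  using cnorm_one_le cnorm_nonneg[of \<one>] by (simp add: cnorm_smult mult_left_le)

lemma Metric: "Metric_space (carrier A) (cdist A)"
proof
  show "0 \<le> cdist A x y" for x y by (auto simp: cdist_def intro: cnorm_nonneg)
  show "cdist A x y = cdist A y x" for x y by (auto simp: cdist_def cnorm_diff_commute)
  show "cdist A x y = 0 \<longleftrightarrow> x = y" if "x \<in> carrier A" "y \<in> carrier A" for x y
    using that by (simp add: cdist_def cnorm_eq_zero_iff diff_eq_zero)
  show "cdist A x z \<le> cdist A x y + cdist A y z"
    if "x \<in> carrier A" "y \<in> carrier A" "z \<in> carrier A" for x y z
    using that by (simp add: cdist_def cnorm_diff_triangle)
qed

lemma in_closure_iff:
  assumes "S \<subseteq> carrier A"
  shows "x \<in> norm_topology A closure_of S \<longleftrightarrow>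
    x \<in> carrier A \<and> (\<forall>e>0. \<exists>y\<in>S. cnorm A (x \<ominus> y) < e)"
proof -
  interpret Metric_space "carrier A" "cdist A" by (rule Metric)
  show ?thesis
    using assms by (fastforce simp: metric_closure_of mball_def cdist_def)
qed

text \<open>A sequence with a limit is described by a real null sequence of norms.\<close>

lemma Cauchy_limit:
  assumes "!!n. \<xi> n \<in> carrier A"
    and "!!e. e > 0 ==> \<exists>N. \<forall>m\<ge>N. \<forall>n\<ge>N. cnorm A (\<xi> m \<ominus> \<xi> n) < e"
  obtains l where "l \<in> carrier A" "(\<lambda>n. cnorm A (\<xi> n \<ominus> l)) \<longlonglongrightarrow> 0"
proof -
  interpret Metric_space "carrier A" "cdist A" by (rule Metric)
  have "MCauchy \<xi>" using assms by (fastforce simp: MCauchy_def cdist_def)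
  then obtain l where l: "limitin mtopology \<xi> l sequentially"
    using complete by (auto simp: mcomplete_def)
  then have "l \<in> carrier A" "(\<lambda>n. cdist A (\<xi> n) l) \<longlonglongrightarrow> 0"
    by (auto simp: limitin_metric_dist_null)
  then show thesis using that assms(1) by (simp add: cdist_def)
qed

lemma limit_unique:
  assumes "!!n. \<xi> n \<in> carrier A" "l \<in> carrier A" "m \<in> carrier A"
    and "(\<lambda>n. cnorm A (\<xi> n \<ominus> l)) \<longlonglongrightarrow> 0" "(\<lambda>n. cnorm A (\<xi> n \<ominus> m)) \<longlonglongrightarrow> 0"
  shows "l = m"
proof -
  have "(\<lambda>n. cnorm A (\<xi> n \<ominus> l) + cnorm A (\<xi> n \<ominus> m)) \<longlonglongrightarrow> 0 + 0"
    by (intro tendsto_add assms)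
  moreover have "cnorm A (l \<ominus> m) \<le> cnorm A (\<xi> n \<ominus> l) + cnorm A (\<xi> n \<ominus> m)" for n
    using cnorm_diff_triangle[of l "\<xi> n" m] assms(1-3) by (simp add: cnorm_diff_commute[of l])
  ultimately have "cnorm A (l \<ominus> m) \<le> 0"
    by (metis (no_types, lifting) LIMSEQ_le_const add.right_neutral)
  then show ?thesis
    using cnorm_nonneg[of "l \<ominus> m"] assms by (simp add: cnorm_eq_zero_iff diff_eq_zero)
qed

lemma limit_cong_bound:
  assumes "(\<lambda>n. cnorm A (\<xi> n \<ominus> l)) \<longlonglongrightarrow> 0"
    and "!!n. Y n \<in> carrier A" "m \<in> carrier A"
    and "!!n. cnorm A (Y n \<ominus> m) \<le> C * cnorm A (\<xi> n \<ominus> l)"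
  shows "(\<lambda>n. cnorm A (Y n \<ominus> m)) \<longlonglongrightarrow> 0"
proof (rule tendsto_sandwich[OF _ _ tendsto_const])
  show "(\<lambda>n. C * cnorm A (\<xi> n \<ominus> l)) \<longlonglongrightarrow> 0"
    using tendsto_mult_right_zero[OF assms(1)] .
  show "\<forall>\<^sub>F n in sequentially. 0 \<le> cnorm A (Y n \<ominus> m)" by (intro always_eventually allI cnorm_nonneg minus_closed assms)
  show "\<forall>\<^sub>F n in sequentially. cnorm A (Y n \<ominus> m) \<le> C * cnorm A (\<xi> n \<ominus> l)" using assms by auto
qed

lemma limit_star:
  assumes "!!n. \<xi> n \<in> carrier A" "l \<in> carrier A" "(\<lambda>n. cnorm A (\<xi> n \<ominus> l)) \<longlonglongrightarrow> 0"
  shows "(\<lambda>n. cnorm A (star A (\<xi> n) \<ominus> star A l)) \<longlonglongrightarrow> 0"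
  using assms(3) by (simp add: star_diff[symmetric] assms)

lemma limit_mult_right:
  assumes "!!n. \<xi> n \<in> carrier A" "l \<in> carrier A" "z \<in> carrier A" "(\<lambda>n. cnorm A (\<xi> n \<ominus> l)) \<longlonglongrightarrow> 0"
  shows "(\<lambda>n. cnorm A (\<xi> n \<otimes> z \<ominus> l \<otimes> z)) \<longlonglongrightarrow> 0"
proof (rule limit_cong_bound[OF assms(4)])
  fix n show "cnorm A (\<xi> n \<otimes> z \<ominus> l \<otimes> z) \<le> cnorm A z * cnorm A (\<xi> n \<ominus> l)"
    using cnorm_mult[of "\<xi> n \<ominus> l" z] assms by (simp add: diff_distr_left mult.commute)
qed (use assms in auto)

lemma limit_mult_left:
  assumes "!!n. \<xi> n \<in> carrier A" "l \<in> carrier A" "z \<in> carrier A" "(\<lambda>n. cnorm A (\<xi> n \<ominus> l)) \<longlonglongrightarrow> 0"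
  shows "(\<lambda>n. cnorm A (z \<otimes> \<xi> n \<ominus> z \<otimes> l)) \<longlonglongrightarrow> 0"
proof (rule limit_cong_bound[OF assms(4)])
  fix n show "cnorm A (z \<otimes> \<xi> n \<ominus> z \<otimes> l) \<le> cnorm A z * cnorm A (\<xi> n \<ominus> l)"
    using cnorm_mult[of z "\<xi> n \<ominus> l"] assms by (simp add: diff_distr_right)
qed (use assms in auto)

text \<open>The fixed point \<open>y = (b + y\<^sup>2) / 2\<close> of a contraction gives \<open>(1 - y)\<^sup>2 = 1 - b\<close>.\<close>

lemma sqrt_one_minus:
  assumes b: "self_adjoint A b" and nb: "cnorm A b < 1"
  obtains c where "self_adjoint A c" "c \<otimes> c = \<one> \<ominus> b"
    "!!z. z \<in> carrier A ==> z \<otimes> b = b \<otimes> z ==> z \<otimes> c = c \<otimes> z"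
proof -
  have bc [simp]: "b \<in> carrier A" and bs: "star A b = b" using b by (auto simp: self_adjoint_def)
  define r where "r = sqrt (cnorm A b)"
  have r0: "0 \<le> r" and r1: "r < 1" and rr: "r * r = cnorm A b"
    using nb cnorm_nonneg[of b] by (auto simp: r_def real_less_lsqrt)
  define f where "f = (\<lambda>y. (1/2) \<odot> (b \<oplus> y \<otimes> y))"
  define Y where "Y = (\<lambda>n. (f ^^ n) \<zero>)"
  have Y0: "Y 0 = \<zero>" and YS: "Y (Suc n) = f (Y n)" for n by (auto simp: Y_def)
  have Yc [simp]: "Y n \<in> carrier A" for n by (induction n) (auto simp: Y0 YS f_def)
  have Ys: "star A (Y n) = Y n" for n by (induction n) (auto simp: Y0 YS f_def star_simps bs)
  have Ycomm: "z \<otimes> Y n = Y n \<otimes> z" if z: "z \<in> carrier A" "z \<otimes> b = b \<otimes> z" for z n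
  proof (induction n)
    case (Suc n)
    have "z \<otimes> (Y n \<otimes> Y n) = (Y n \<otimes> Y n) \<otimes> z"
      using Suc z by (metis Yc m_assoc)
    then show ?case using z by (simp add: YS f_def cs)
  qed (use z in \<open>auto simp: Y0\<close>)
  have Yr: "cnorm A (Y n) \<le> r" for n
  proof (induction n)
    case (Suc n)
    have "cnorm A (Y (Suc n)) = 1/2 * cnorm A (b \<oplus> Y n \<otimes> Y n)" by (simp add: YS f_def cnorm_smult)
    also have "\<dots> \<le> 1/2 * (cnorm A b + cnorm A (Y n) * cnorm A (Y n))"
      using cnorm_triangle[of b "Y n \<otimes> Y n"] cnorm_mult[of "Y n" "Y n"] by simp
    also have "\<dots> \<le> 1/2 * (r * r + r * r)"
      using Suc mult_mono[OF Suc Suc] r0 cnorm_nonneg[of "Y n"] by (simp add: rr)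
    also have "\<dots> \<le> r" using r0 r1 by (simp add: mult_left_le)
    finally show ?case .
  qed (use r0 in \<open>auto simp: Y0\<close>)
  have contr: "cnorm A (f x \<ominus> f y) \<le> r * cnorm A (x \<ominus> y)"
    if x: "x \<in> carrier A" "cnorm A x \<le> r" and y: "y \<in> carrier A" "cnorm A y \<le> r" for x y
  proof -
    have "f x \<ominus> f y = (1/2) \<odot> (x \<otimes> x \<ominus> y \<otimes> y)"
      unfolding f_def using x y by (simp add: cs)
    also have "x \<otimes> x \<ominus> y \<otimes> y = x \<otimes> (x \<ominus> y) \<oplus> (x \<ominus> y) \<otimes> y" using x y by (simp add: cs)
    finally have "cnorm A (f x \<ominus> f y) = 1/2 * cnorm A (x \<otimes> (x \<ominus> y) \<oplus> (x \<ominus> y) \<otimes> y)"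
      using x y by (simp add: cnorm_smult)
    also have "\<dots> \<le> 1/2 * (cnorm A x * cnorm A (x \<ominus> y) + cnorm A (x \<ominus> y) * cnorm A y)"
      using cnorm_triangle[of "x \<otimes> (x \<ominus> y)" "(x \<ominus> y) \<otimes> y"] cnorm_mult[of x "x \<ominus> y"]
        cnorm_mult[of "x \<ominus> y" y] x y by simp
    also have "\<dots> \<le> 1/2 * (r * cnorm A (x \<ominus> y) + cnorm A (x \<ominus> y) * r)"
      using x y cnorm_nonneg[of "x \<ominus> y"] by (intro mult_left_mono add_mono mult_right_mono) auto
    finally show ?thesis by simp
  qed
  have step: "cnorm A (Y (n + k) \<ominus> Y n) \<le> r ^ n * r" for n k
  proof (induction n)
    case 0 show ?case using Yr[of k] by (simp add: Y0)
  next
    case (Suc n)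
    show ?case using contr[OF Yc Yr Yc Yr, of "n + k" n] Suc mult_left_mono[OF Suc r0]
      by (simp add: YS)
  qed
  have cau: "\<exists>N. \<forall>m\<ge>N. \<forall>n\<ge>N. cnorm A (Y m \<ominus> Y n) < e" if e: "e > 0" for e
  proof -
    have "(\<lambda>n. r ^ n * r) \<longlonglongrightarrow> 0 * r" using r0 r1 by (intro tendsto_mult_right LIMSEQ_realpow_zero)
    then obtain N where N: "!!n. n \<ge> N ==> r ^ n * r < e"
      using e order_tendstoD(2)[of _ 0 sequentially e] by (auto simp: eventually_sequentially)
    have "cnorm A (Y m \<ominus> Y n) < e" if mn: "m \<ge> N" "n \<ge> N" for m n
    proof (cases "m \<le> n")
      case True
      then show ?thesis
        using step[of m "n - m"] N[OF mn(1)] by (simp add: cnorm_diff_commute[of "Y m"])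
    next
      case False
      then show ?thesis using step[of n "m - n"] N[OF mn(2)] by simp
    qed
    then show ?thesis by blast
  qed
  obtain y where y [simp]: "y \<in> carrier A" and ylim: "(\<lambda>n. cnorm A (Y n \<ominus> y)) \<longlonglongrightarrow> 0"
    using Cauchy_limit[OF Yc cau] by blast
  have yr: "cnorm A y \<le> r"
  proof -
    have "(\<lambda>n. r + cnorm A (Y n \<ominus> y)) \<longlonglongrightarrow> r + 0" by (intro tendsto_intros ylim)
    moreover have "cnorm A y \<le> r + cnorm A (Y n \<ominus> y)" for n
      using cnorm_le_diff[of y "Y n"] Yr[of n] by (simp add: cnorm_diff_commute[of y])
    ultimately show ?thesis by (metis (no_types, lifting) LIMSEQ_le_const add.right_neutral)
  qed
  have "(\<lambda>n. cnorm A (f (Y n) \<ominus> f y)) \<longlonglongrightarrow> 0"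
    by (rule limit_cong_bound[OF ylim, where C = r]) (auto simp: f_def intro!: contr[unfolded f_def] Yr yr)
  moreover have "(\<lambda>n. cnorm A (Y (Suc n) \<ominus> y)) \<longlonglongrightarrow> 0" using LIMSEQ_Suc[OF ylim] .
  ultimately have fy: "f y = y"
    by (intro limit_unique[of "\<lambda>n. Y (Suc n)"]) (auto simp: YS f_def)
  have ys: "star A y = y"
    by (rule limit_unique[OF Yc]) (use limit_star[OF Yc y ylim] ylim in \<open>auto simp: Ys\<close>)
  have ycomm: "z \<otimes> y = y \<otimes> z" if z: "z \<in> carrier A" "z \<otimes> b = b \<otimes> z" for z
    by (rule limit_unique[of "\<lambda>n. z \<otimes> Y n"])
      (use z limit_mult_left[OF Yc y z(1) ylim] limit_mult_right[OF Yc y z(1) ylim] in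
        \<open>auto simp: Ycomm[OF z]\<close>)
  have two: "y \<oplus> y = b \<oplus> y \<otimes> y"
  proof -
    have "y \<oplus> y = f y \<oplus> f y" by (simp add: fy)
    also have "\<dots> = (1/2 + 1/2) \<odot> (b \<oplus> y \<otimes> y)"
      unfolding f_def by (subst scal_add_left) auto
    finally show ?thesis by simp
  qed
  show thesis
  proof (rule that[of "\<one> \<ominus> y"])
    show "self_adjoint A (\<one> \<ominus> y)" by (simp add: self_adjoint_def star_diff ys)
    have "(\<one> \<ominus> y) \<otimes> (\<one> \<ominus> y) = \<one> \<ominus> (y \<oplus> y) \<oplus> y \<otimes> y" by (simp add: cs)
    then show "(\<one> \<ominus> y) \<otimes> (\<one> \<ominus> y) = \<one> \<ominus> b" unfolding two by (simp add: cs)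
    show "z \<otimes> (\<one> \<ominus> y) = (\<one> \<ominus> y) \<otimes> z" if "z \<in> carrier A" "z \<otimes> b = b \<otimes> z" for z
      using that ycomm[OF that] by (simp add: cs)
  qed
qed

lemma cnorm_square_self_adjoint: "self_adjoint A a ==> cnorm A (a \<otimes> a) = (cnorm A a)\<^sup>2"
  using cstar_identity[of a] by (auto simp: self_adjoint_def)

text \<open>\<open>u = a + i (1 - a\<^sup>2)\<^sup>1\<^sup>/\<^sup>2\<close>\<close>

lemma unitary_dilation:
  assumes a: "self_adjoint A a" and na: "cnorm A a < 1"
  obtains u where "u \<in> carrier A" "star A u \<otimes> u = \<one>" "u \<otimes> star A u = \<one>"
    "a = (1/2) \<odot> (u \<oplus> star A u)"
    "!!z. z \<in> carrier A ==> z \<otimes> a = a \<otimes> z ==> z \<otimes> u = u \<otimes> z"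
proof -
  have ac [simp]: "a \<in> carrier A" and as: "star A a = a" using a by (auto simp: self_adjoint_def)
  have sa: "self_adjoint A (a \<otimes> a)" by (simp add: self_adjoint_def star_mult as)
  have "cnorm A (a \<otimes> a) < 1"
    using na cnorm_nonneg[of a] by (simp add: cnorm_square_self_adjoint[OF a] abs_square_less_1)
  then obtain c where c: "self_adjoint A c" "c \<otimes> c = \<one> \<ominus> a \<otimes> a"
    and cc: "!!z. z \<in> carrier A ==> z \<otimes> (a \<otimes> a) = (a \<otimes> a) \<otimes> z ==> z \<otimes> c = c \<otimes> z"
    using sqrt_one_minus[OF sa] by metis
  have c' [simp]: "c \<in> carrier A" "star A c = c" using c by (auto simp: self_adjoint_def)
  have ccomm: "z \<otimes> c = c \<otimes> z" if "z \<in> carrier A" "z \<otimes> a = a \<otimes> z" for z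
    using that by (intro cc) (auto simp: m_assoc[symmetric], simp add: m_assoc)
  have ac_ca: "a \<otimes> c = c \<otimes> a" by (rule ccomm) auto
  define u where "u = a \<oplus> \<i> \<odot> c"
  show thesis
  proof (rule that[of u])
    show "u \<in> carrier A" by (simp add: u_def)
    show "star A u \<otimes> u = \<one>" "u \<otimes> star A u = \<one>"
      by (simp_all add: u_def cs ac_ca c(2) scal_uminus as)
    have "u \<oplus> star A u = a \<oplus> a" by (simp add: u_def cs as scal_uminus)
    then show "a = (1/2) \<odot> (u \<oplus> star A u)"
      by (simp add: scal_add_right scal_add_left[symmetric])
    show "z \<otimes> u = u \<otimes> z" if "z \<in> carrier A" "z \<otimes> a = a \<otimes> z" for z
      using that ccomm[OF that] by (simp add: u_def cs)
  qed
qed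

lemma unitary_cnorm_le:
  assumes "u \<in> carrier A" "star A u \<otimes> u = \<one>"
  shows "cnorm A u \<le> 1"
proof -
  have "(cnorm A u)\<^sup>2 \<le> 1" using cstar_identity[OF assms(1)] assms cnorm_one_le by simp
  then show ?thesis using cnorm_nonneg[OF assms(1)] by (simp add: abs_square_le_1)
qed

lemma unitary_mult_cnorm:
  assumes "u \<in> carrier A" "star A u \<otimes> u = \<one>" "z \<in> carrier A"
  shows "cnorm A (u \<otimes> z) = cnorm A z"
proof -
  have "star A (u \<otimes> z) \<otimes> (u \<otimes> z) = star A z \<otimes> (star A u \<otimes> u) \<otimes> z"
    using assms(1,3) by (simp add: star_mult m_assoc)
  then have "(cnorm A (u \<otimes> z))\<^sup>2 = (cnorm A z)\<^sup>2"
    using assms cstar_identity[of "u \<otimes> z"] cstar_identity[of z] by simp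
  then show ?thesis using assms cnorm_nonneg by (simp add: power2_eq_iff_nonneg)
qed

end

section \<open>Continuous functional calculus\<close>

text \<open>A coefficient is a mean of values at roots of unity.\<close>

lemma coeff_le_circle_bound:
  fixes q :: "complex poly"
  assumes B: "!!z. cmod z = 1 ==> cmod (poly q z) \<le> B"
  shows "cmod (coeff q k) \<le> B"
proof -
  define M where "M = degree q + k + 1"
  define w where "w = (\<lambda>j::nat. cis (2 * pi * real j / real M))"
  have M: "M > 0" "k < M" "degree q < M" by (auto simp: M_def)
  have w1: "cmod (w j) = 1" for j by (simp add: w_def)
  have wM: "w j ^ M = 1" for j
  proof -
    have "w j ^ M = cis (real M * (2 * pi * real j / real M))" unfolding w_def by (rule Complex.DeMoivre)
    also have "real M * (2 * pi * real j / real M) = 2 * pi * real j" using M(1) by simp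
    also have "cis (2 * pi * real j) = 1" by (rule cis_multiple_2pi) simp
    finally show ?thesis .
  qed
  have winj: "inj_on w {..<M}" using Complex.bij_betw_roots_unity[of M] M(1) by (simp add: w_def bij_betw_def)
  have swap: "w j ^ l = w l ^ j" for j l
    unfolding w_def Complex.DeMoivre by (simp add: mult_ac)
  have orth: "(\<Sum>j<M. w j ^ l * cnj (w j) ^ k) = (if l = k then of_nat M else 0)" if l: "l < M" for l
  proof -
    have eq: "w j ^ l * cnj (w j) ^ k = (w l * cnj (w k)) ^ j" for j
      by (metis swap complex_cnj_power power_mult_distrib)
    show ?thesis
    proof (cases "l = k")
      case True
      have "w k * cnj (w k) = 1" using w1[of k] by (simp add: complex_norm_square[symmetric])
      then show ?thesis unfolding eq using True by simp
    next
      case False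
      have "w l \<noteq> w k" using False l M winj by (auto dest: inj_onD)
      moreover have "w k * cnj (w k) = 1" using w1[of k] by (simp add: complex_norm_square[symmetric])
      ultimately have ne: "w l * cnj (w k) \<noteq> 1"
        by (metis mult.assoc mult.commute mult.right_neutral)
      have "(w l * cnj (w k)) ^ M = 1"
        by (metis wM complex_cnj_power complex_cnj_one power_mult_distrib mult_1)
      then have "(\<Sum>j<M. (w l * cnj (w k)) ^ j) = 0" using ne by (simp add: geometric_sum)
      then show ?thesis unfolding eq using False by simp
    qed
  qed
  have "(\<Sum>j<M. poly q (w j) * cnj (w j) ^ k)
      = (\<Sum>j<M. \<Sum>l\<le>degree q. coeff q l * (w j ^ l * cnj (w j) ^ k))"
    by (simp add: poly_altdef sum_distrib_right mult.assoc)
  also have "\<dots> = (\<Sum>l\<le>degree q. \<Sum>j<M. coeff q l * (w j ^ l * cnj (w j) ^ k))"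
    by (rule sum.swap)
  also have "\<dots> = (\<Sum>l\<le>degree q. coeff q l * (if l = k then of_nat M else 0))"
    using M(3) by (intro sum.cong refl) (simp add: sum_distrib_left[symmetric] orth)
  also have "\<dots> = coeff q k * of_nat M"
    by (cases "k \<le> degree q") (auto simp: if_distrib[of "\<lambda>x. _ * x"] sum.delta coeff_eq_0 cong: if_cong)
  finally have "cmod (coeff q k) * real M = cmod (\<Sum>j<M. poly q (w j) * cnj (w j) ^ k)"
    by (simp add: norm_mult)
  also have "\<dots> \<le> (\<Sum>j<M. B)"
  proof (rule sum_norm_le)
    fix j show "cmod (poly q (w j) * cnj (w j) ^ k) \<le> B"
      using B[OF w1[of j]] by (simp add: norm_mult norm_power w1)
  qed
  finally have "cmod (coeff q k) * real M \<le> B * real M" by (simp add: mult.commute)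
  then show ?thesis using M(1) by simp
qed

context unital_cstar_algebra
begin

text \<open>Polynomials in a unitary \<open>u\<close> are controlled coefficientwise by their values on the unit
  circle. This replaces spectral theory in the construction of the functional calculus below.\<close>

definition poly_at :: "'a => complex poly => 'a"
  where "poly_at u q = fold_coeffs (\<lambda>c z. c \<odot> \<one> \<oplus> u \<otimes> z) q \<zero>"

lemma poly_at_0 [simp]: "poly_at u 0 = \<zero>"
  by (simp add: poly_at_def)

lemma poly_at_pCons:
  assumes "u \<in> carrier A" shows "poly_at u (pCons c q) = c \<odot> \<one> \<oplus> u \<otimes> poly_at u q"
proof (cases "c = 0 \<and> q = 0")
  case False
  have "fold_coeffs (\<lambda>c z. c \<odot> \<one> \<oplus> u \<otimes> z) (pCons c q)
      = (\<lambda>c z. c \<odot> \<one> \<oplus> u \<otimes> z) c \<circ> fold_coeffs (\<lambda>c z. c \<odot> \<one> \<oplus> u \<otimes> z) q"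
    using fold_coeffs_pCons_coeff_not_0_eq[of c] fold_coeffs_pCons_not_0_0_eq[of q] False
    by (cases "c = 0") blast+
  then show ?thesis by (simp add: poly_at_def)
qed (use assms in auto)

lemma poly_at_closed [simp, intro]:
  assumes u: "u \<in> carrier A" shows "poly_at u q \<in> carrier A"
proof (induction q)
  case (pCons c q)
  show ?case unfolding poly_at_pCons[OF u] by (intro a_closed m_closed scal_closed one_closed u pCons.IH)
qed simp

lemma poly_at_add:
  assumes [simp]: "u \<in> carrier A" shows "poly_at u (p + q) = poly_at u p \<oplus> poly_at u q"
proof (induction p arbitrary: q)
  case (pCons a p)
  obtain b r where q: "q = pCons b r" by (cases q)
  show ?case by (simp add: q poly_at_pCons pCons.IH scal_add_left cs)
qed auto

lemma poly_at_smult: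
  assumes [simp]: "u \<in> carrier A" shows "poly_at u (Polynomial.smult c p) = c \<odot> poly_at u p"
  by (induction p) (auto simp: poly_at_pCons cs)

lemma poly_at_mult:
  assumes [simp]: "u \<in> carrier A" shows "poly_at u (p * q) = poly_at u p \<otimes> poly_at u q"
  by (induction p) (auto simp: poly_at_pCons poly_at_add poly_at_smult cs)

lemma poly_at_cnorm_le:
  assumes [simp]: "u \<in> carrier A" and nu: "cnorm A u \<le> 1" and n: "Polynomial.degree q \<le> n"
  shows "cnorm A (poly_at u q) \<le> (\<Sum>i\<le>n. cmod (Polynomial.coeff q i))"
  using n
proof (induction q arbitrary: n)
  case (pCons a q)
  have "cnorm A (poly_at u (pCons a q)) \<le> cmod a + cnorm A u * cnorm A (poly_at u q)"
    using cnorm_triangle[of "a \<odot> \<one>" "u \<otimes> poly_at u q"] cnorm_scal_one_le[of a]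
      cnorm_mult[of u "poly_at u q"] by (simp add: poly_at_pCons)
  also have "\<dots> \<le> cmod a + cnorm A (poly_at u q)"
    using nu cnorm_nonneg[of "poly_at u q"] by (simp add: mult_left_le_one_le cnorm_nonneg)
  finally have le: "cnorm A (poly_at u (pCons a q)) \<le> cmod a + cnorm A (poly_at u q)" .
  show ?case
  proof (cases "q = 0")
    case True
    have "cmod a \<le> (\<Sum>i\<le>n. cmod (Polynomial.coeff (pCons a q) i))"
      using member_le_sum[of 0 "{..n}" "\<lambda>i. cmod (Polynomial.coeff (pCons a q) i)"] by simp
    then show ?thesis using le True by simp
  next
    case False
    then obtain m where m: "n = Suc m" "Polynomial.degree q \<le> m" using pCons.prems by (cases n) auto
    show ?thesis using le pCons.IH[OF m(2)]
      unfolding m(1) by (subst sum.atMost_Suc_shift) simp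
  qed
qed (auto intro: sum_nonneg)

text \<open>The natural number bounds the degree of the polynomial.\<close>

inductive real_poly :: "'a => nat => (real => real) => 'a => bool" for a
  where
    rp_const: "real_poly a 0 (\<lambda>x. c) (of_real c \<odot> \<one>)"
  | rp_id: "real_poly a 1 (\<lambda>x. x) a"
  | rp_add: "real_poly a n f z ==> real_poly a m g w ==> real_poly a (n + m) (\<lambda>x. f x + g x) (z \<oplus> w)"
  | rp_mult: "real_poly a n f z ==> real_poly a m g w ==> real_poly a (n + m) (\<lambda>x. f x * g x) (z \<otimes> w)"

lemma real_poly_closed:
  assumes "a \<in> carrier A" "real_poly a n f z" shows "z \<in> carrier A"
  using assms(2,1) by induction auto

lemma real_poly_commute:
  assumes "a \<in> carrier A" "v \<in> carrier A" "v \<otimes> a = a \<otimes> v" "real_poly a n f z"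
  shows "v \<otimes> z = z \<otimes> v"
  using assms(4)
proof induction
  case (rp_const c) then show ?case using assms by (simp add: cs)
next
  case (rp_add n f z m g w)
  then show ?case using assms real_poly_closed[OF assms(1)] by (simp add: l_distr r_distr)
next
  case (rp_mult n f z m g w)
  then have "z \<in> carrier A" "w \<in> carrier A" using assms real_poly_closed by auto
  then show ?case using rp_mult assms by (metis m_assoc)
qed (use assms in auto)

lemma real_poly_commute':
  assumes "a \<in> carrier A" "real_poly a n f z" "real_poly a m g w"
  shows "z \<otimes> w = w \<otimes> z"
  using assms real_poly_commute[OF assms(1) assms(1) refl assms(2)]
    real_poly_commute[OF assms(1) real_poly_closed[OF assms(1,2)] _ assms(3)] by auto

lemma real_poly_self_adjoint:
  assumes "self_adjoint A a" "real_poly a n f z" shows "self_adjoint A z"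
  using assms(2)
proof induction
  case (rp_mult n f z m g w)
  then have "z \<otimes> w = w \<otimes> z" using assms by (auto simp: self_adjoint_def intro: real_poly_commute')
  then show ?case using rp_mult by (auto simp: self_adjoint_def star_mult)
qed (use assms in \<open>auto simp: self_adjoint_def star_simps\<close>)

text \<open>Repeated squaring: for self-adjoint elements the C*-identity turns it into repeated squaring of
  the norm, as in the spectral radius formula.\<close>

definition squares :: "nat => 'a => 'a"
  where "squares k z = ((\<lambda>y. y \<otimes> y) ^^ k) z"

lemma squares_real_poly:
  "real_poly a n f z ==> real_poly a (2 ^ k * n) (\<lambda>x. f x ^ (2 ^ k)) (squares k z)"
proof (induction k)
  case (Suc k)
  show ?case using rp_mult[OF Suc.IH Suc.IH] Suc.prems
    by (simp add: squares_def mult_2 power_add algebra_simps)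
qed (simp add: squares_def)

lemma squares_cnorm:
  "self_adjoint A z ==> self_adjoint A (squares k z) \<and> cnorm A (squares k z) = cnorm A z ^ (2 ^ k)"
proof (induction k)
  case (Suc k)
  then have s: "self_adjoint A (squares k z)" by simp
  have "squares (Suc k) z = squares k z \<otimes> squares k z" by (simp add: squares_def)
  then show ?case using s Suc cnorm_square_self_adjoint[OF s]
    by (auto simp: self_adjoint_def star_mult power_even_eq)
qed (simp add: squares_def)

text \<open>Since \<open>a = (R/2) (u + u\<^sup>*)\<close>, multiplication by \<open>u\<^sup>n\<close> clears the negative powers of \<open>u\<close> in a
  polynomial of degree \<open>n\<close> in \<open>a\<close>; on the circle \<open>R cos t\<close> takes the place of \<open>a\<close>.\<close>

lemma real_poly_unitary:
  assumes u [simp]: "u \<in> carrier A" "star A u \<otimes> u = \<one>" "u \<otimes> star A u = \<one>"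
    and a: "a = of_real (R/2) \<odot> (u \<oplus> star A u)"
    and z: "real_poly a n f z"
  shows "\<exists>q. Polynomial.degree q \<le> 2 * n \<and> poly_at u (Polynomial.monom 1 n) \<otimes> z = poly_at u q \<and>
    (\<forall>t. cis t ^ n * complex_of_real (f (R * cos t)) = poly q (cis t))"
  using z
proof induction
  case (rp_const c)
  have "poly_at u (Polynomial.monom 1 0) \<otimes> (of_real c \<odot> \<one>) = poly_at u [:complex_of_real c:]"
    by (simp add: poly_at_pCons monom_0)
  then show ?case by (intro exI[of _ "[:complex_of_real c:]"]) simp
next
  case rp_id
  have "poly_at u (Polynomial.monom 1 1) \<otimes> a = poly_at u [:R/2, 0, R/2:]"
    unfolding a One_nat_def by (simp add: poly_at_pCons monom_0 monom_Suc cs)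
  moreover have "cis t * complex_of_real (R * cos t) = poly [:R/2, 0, R/2:] (cis t)" for t
  proof -
    have "complex_of_real (cos t) = (cis t + cis (- t)) / 2" by (simp add: complex_eq_iff)
    moreover have "cis t * cis (- t) = 1" by (simp add: cis_mult)
    ultimately show ?thesis by (simp add: field_simps)
  qed
  ultimately show ?case
    by (intro exI[of _ "[:complex_of_real (R/2), 0, complex_of_real (R/2):]"]) simp
next
  case (rp_add n f z m g w)
  have ac: "a \<in> carrier A" by (simp add: a)
  have zw [simp]: "z \<in> carrier A" "w \<in> carrier A" using rp_add.hyps ac real_poly_closed by auto
  obtain p where p: "Polynomial.degree p \<le> 2 * n" "poly_at u (Polynomial.monom 1 n) \<otimes> z = poly_at u p"
    "\<forall>t. cis t ^ n * complex_of_real (f (R * cos t)) = poly p (cis t)" using rp_add.IH by blast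
  obtain q where q: "Polynomial.degree q \<le> 2 * m" "poly_at u (Polynomial.monom 1 m) \<otimes> w = poly_at u q"
    "\<forall>t. cis t ^ m * complex_of_real (g (R * cos t)) = poly q (cis t)" using rp_add.IH by blast
  have mm: "Polynomial.monom 1 (n + m) = (Polynomial.monom 1 m * Polynomial.monom 1 n :: complex poly)"
    "Polynomial.monom 1 (n + m) = (Polynomial.monom 1 n * Polynomial.monom 1 m :: complex poly)"
    by (simp_all add: mult_monom add.commute)
  have "poly_at u (Polynomial.monom 1 (n + m)) \<otimes> (z \<oplus> w)
      = (poly_at u (Polynomial.monom 1 m) \<otimes> poly_at u (Polynomial.monom 1 n)) \<otimes> z \<oplus>
        (poly_at u (Polynomial.monom 1 n) \<otimes> poly_at u (Polynomial.monom 1 m)) \<otimes> w"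
    by (simp add: r_distr poly_at_mult[symmetric] mm(1)[symmetric] mm(2)[symmetric])
  also have "\<dots> = poly_at u (Polynomial.monom 1 m * p + Polynomial.monom 1 n * q)"
    by (simp add: m_assoc p q poly_at_add poly_at_mult)
  finally have 1: "poly_at u (Polynomial.monom 1 (n + m)) \<otimes> (z \<oplus> w) = poly_at u (Polynomial.monom 1 m * p + Polynomial.monom 1 n * q)" .
  have "Polynomial.degree (Polynomial.monom 1 m * p + Polynomial.monom 1 n * q) \<le> 2 * (n + m)"
    using p(1) q(1) degree_mult_le[of "Polynomial.monom 1 m" p] degree_mult_le[of "Polynomial.monom 1 n" q]
    by (intro degree_add_le) (auto simp: degree_monom_eq)
  moreover have "cis t ^ (n + m) * complex_of_real (f (R * cos t) + g (R * cos t))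
      = poly (Polynomial.monom 1 m * p + Polynomial.monom 1 n * q) (cis t)" for t
    using p(3)[rule_format, of t, symmetric] q(3)[rule_format, of t, symmetric]
    by (simp add: poly_monom power_add algebra_simps)
  ultimately show ?case using 1 by blast
next
  case (rp_mult n f z m g w)
  have ac: "a \<in> carrier A" by (simp add: a)
  have zw [simp]: "z \<in> carrier A" "w \<in> carrier A" using rp_mult.hyps ac real_poly_closed by auto
  obtain p where p: "Polynomial.degree p \<le> 2 * n" "poly_at u (Polynomial.monom 1 n) \<otimes> z = poly_at u p"
    "\<forall>t. cis t ^ n * complex_of_real (f (R * cos t)) = poly p (cis t)" using rp_mult.IH by blast
  obtain q where q: "Polynomial.degree q \<le> 2 * m" "poly_at u (Polynomial.monom 1 m) \<otimes> w = poly_at u q"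
    "\<forall>t. cis t ^ m * complex_of_real (g (R * cos t)) = poly q (cis t)" using rp_mult.IH by blast
  have mm: "Polynomial.monom 1 (n + m) = (Polynomial.monom 1 m * Polynomial.monom 1 n :: complex poly)"
    by (simp add: mult_monom add.commute)
  have "poly_at u (Polynomial.monom 1 (n + m)) \<otimes> (z \<otimes> w)
      = poly_at u (Polynomial.monom 1 m) \<otimes> ((poly_at u (Polynomial.monom 1 n) \<otimes> z) \<otimes> w)"
    by (simp add: mm poly_at_mult m_assoc)
  also have "\<dots> = (poly_at u (Polynomial.monom 1 m) \<otimes> poly_at u p) \<otimes> w" by (simp add: p m_assoc)
  also have "poly_at u (Polynomial.monom 1 m) \<otimes> poly_at u p = poly_at u p \<otimes> poly_at u (Polynomial.monom 1 m)"
    by (simp add: poly_at_mult[symmetric] mult.commute)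
  also have "\<dots> \<otimes> w = poly_at u (p * q)" by (simp add: m_assoc q poly_at_mult)
  finally have 1: "poly_at u (Polynomial.monom 1 (n + m)) \<otimes> (z \<otimes> w) = poly_at u (p * q)" .
  have "Polynomial.degree (p * q) \<le> 2 * (n + m)" using p(1) q(1) degree_mult_le[of p q] by simp
  moreover have "cis t ^ (n + m) * complex_of_real (f (R * cos t) * g (R * cos t))
      = poly (p * q) (cis t)" for t
    using p(3)[rule_format, of t, symmetric] q(3)[rule_format, of t, symmetric]
    by (simp add: power_add algebra_simps)
  ultimately show ?case using 1 by blast
qed

lemma unitary_power_cnorm:
  assumes "u \<in> carrier A" "star A u \<otimes> u = \<one>" "z \<in> carrier A"
  shows "cnorm A (poly_at u (Polynomial.monom 1 n) \<otimes> z) = cnorm A z"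
proof (induction n)
  case 0 show ?case using assms by (simp add: monom_0 poly_at_pCons)
next
  case (Suc n)
  have "poly_at u (Polynomial.monom 1 (Suc n)) \<otimes> z = u \<otimes> (poly_at u (Polynomial.monom 1 n) \<otimes> z)"
    using assms by (simp add: monom_Suc poly_at_pCons m_assoc)
  then show ?case using Suc assms by (simp add: unitary_mult_cnorm)
qed

lemma real_poly_crude_bound:
  assumes a: "self_adjoint A a" "cnorm A a < R" and z: "real_poly a n f z"
    and B: "!!x. x \<in> {-R..R} ==> \<bar>f x\<bar> \<le> B"
  shows "cnorm A z \<le> (2 * real n + 1) * B"
proof -
  have ac [simp]: "a \<in> carrier A" "star A a = a" using a by (auto simp: self_adjoint_def)
  have R: "R > 0" using a cnorm_nonneg[OF ac(1)] by linarith
  define b where "b = of_real (1/R) \<odot> a"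
  have "self_adjoint A b" "cnorm A b < 1"
    using a R by (auto simp: b_def self_adjoint_def star_smult cnorm_smult field_simps norm_divide)
  then obtain u where u: "u \<in> carrier A" "star A u \<otimes> u = \<one>" "u \<otimes> star A u = \<one>"
    "b = (1/2) \<odot> (u \<oplus> star A u)" using unitary_dilation by metis
  have "a = of_real R \<odot> b" using R by (simp add: b_def)
  then have au: "a = of_real (R/2) \<odot> (u \<oplus> star A u)" using u by simp
  obtain q where q: "Polynomial.degree q \<le> 2 * n" "poly_at u (Polynomial.monom 1 n) \<otimes> z = poly_at u q"
    "\<forall>t. cis t ^ n * complex_of_real (f (R * cos t)) = poly q (cis t)"
    using real_poly_unitary[OF u(1-3) au z] by blast
  have circ: "cmod (poly q w) \<le> B" if "cmod w = 1" for w
  proof -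
    have "w = cis (Arg w)" using rcis_cmod_Arg[of w] that by (simp add: rcis_def)
    then obtain t where t: "w = cis t" ..
    have "R * cos t \<in> {-R..R}" 
      using R mult_left_mono[of "cos t" 1 R] mult_left_mono[of "-1" "cos t" R] by simp
    then show ?thesis
      using B q(3)[rule_format, of t, symmetric] t by (simp add: norm_mult norm_power)
  qed
  have "cnorm A z = cnorm A (poly_at u q)"
    using unitary_power_cnorm[OF u(1,2), of z n] z q(2) real_poly_closed[OF ac(1)] by simp
  also have "\<dots> \<le> (\<Sum>i\<le>2*n. cmod (Polynomial.coeff q i))"
    using u q by (intro poly_at_cnorm_le unitary_cnorm_le) auto
  also have "\<dots> \<le> (\<Sum>i\<le>2*n. B)" by (intro sum_mono coeff_le_circle_bound circ)
  finally show ?thesis by (simp add: algebra_simps)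
qed

text \<open>The crude bound for \<open>z\<close> to the power \<open>2 ^ k\<close> is a bound on the norm of \<open>z\<close> to that power;
  the linear factor disappears as \<open>k\<close> grows.\<close>

lemma real_poly_bound:
  assumes a: "self_adjoint A a" "cnorm A a < R" and z: "real_poly a n f z"
    and B: "!!x. x \<in> {-R..R} ==> \<bar>f x\<bar> \<le> B"
  shows "cnorm A z \<le> B"
proof (rule ccontr)
  assume "\<not> cnorm A z \<le> B"
  then have less: "B < cnorm A z" by simp
  have "a \<in> carrier A" using a by (auto simp: self_adjoint_def)
  then have "R > 0" using a cnorm_nonneg[of a] by linarith
  then have B0: "0 \<le> B" using B[of 0] by simp
  have zs: "self_adjoint A z" using real_poly_self_adjoint[OF a(1) z] .
  have pow: "cnorm A z ^ (2 ^ k) \<le> (2 * real (2 ^ k * n) + 1) * B ^ (2 ^ k)" for k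
  proof -
    have "cnorm A (squares k z) \<le> (2 * real (2 ^ k * n) + 1) * B ^ (2 ^ k)"
      by (rule real_poly_crude_bound[OF a squares_real_poly[OF z]])
        (unfold power_abs, intro power_mono B abs_ge_zero)
    then show ?thesis using squares_cnorm[OF zs] by simp
  qed
  show False
  proof (cases "B = 0")
    case True then show False using pow[of 0] less by simp
  next
    case False
    define r where "r = sqrt (cnorm A z / B)"
    have Bp: "B > 0" using B0 False by simp
    have r1: "r > 1" using less Bp by (auto simp: r_def)
    define e where "e = r - 1"
    have e: "e > 0" using r1 by (simp add: e_def)
    have up: "(1 + real (2 ^ k) * e)\<^sup>2 \<le> 2 * real (2 ^ k * n) + 1" for k
    proof -
      have "1 + real (2 ^ k) * e \<le> r ^ (2 ^ k)"
        using Bernoulli_inequality[of e "2 ^ k"] e by (simp add: e_def)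
      then have "(1 + real (2 ^ k) * e)\<^sup>2 \<le> (r ^ (2 ^ k))\<^sup>2" using e by (intro power_mono) auto
      also have "\<dots> = (r\<^sup>2) ^ (2 ^ k)" by (simp add: power_mult[symmetric] mult.commute)
      also have "r\<^sup>2 = cnorm A z / B" using less Bp by (simp add: r_def)
      also have "(cnorm A z / B) ^ (2 ^ k) \<le> 2 * real (2 ^ k * n) + 1"
        using pow[of k] Bp by (simp add: power_divide divide_le_eq)
      finally show ?thesis .
    qed
    obtain N where N: "real N > (2 * real n + 1) / e\<^sup>2" using reals_Archimedean2 by blast
    have "real N < 2 ^ N" by (metis of_nat_less_two_power)
    have "2 * real n + 1 < real N * e\<^sup>2" using N e by (simp add: divide_less_eq)
    also have "\<dots> \<le> real (2 ^ N) * e\<^sup>2" using \<open>real N < 2 ^ N\<close> by (intro mult_right_mono) auto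
    finally have big: "real (2 ^ N) * e\<^sup>2 > 2 * real n + 1" .
    have "(real (2 ^ N))\<^sup>2 * e\<^sup>2 \<le> (1 + real (2 ^ N) * e)\<^sup>2"
      using e by (simp add: power2_sum power_mult_distrib)
    also have "\<dots> \<le> 2 * real (2 ^ N * n) + 1" by (rule up)
    also have "\<dots> \<le> real (2 ^ N) * (2 * real n + 1)" by (simp add: algebra_simps)
    also have "\<dots> < real (2 ^ N) * (real (2 ^ N) * e\<^sup>2)" using big by (intro mult_strict_left_mono) auto
    finally show False by (simp add: power2_eq_square)
  qed
qed

end

text \<open>Polynomials are bounded by their supremum on \<open>[-R, R]\<close>, so they extend to all continuous
  functions on this interval by the Weierstrass theorem. The interval is not the spectrum, hence the
  calculus is in general not injective; it is multiplicative, contractive and real.\<close>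

locale functional_calculus = unital_cstar_algebra A for A :: "'a cstar_algebra" (structure) +
  fixes a :: 'a and R :: real
  assumes sa: "self_adjoint A a" and norm_less: "cnorm A a < R"
begin

lemma a_closed [simp, intro]: "a \<in> carrier A" and star_a [simp]: "star A a = a"
  using sa by (auto simp: self_adjoint_def)

lemma R_pos: "R > 0"
  using norm_less cnorm_nonneg[OF a_closed] by linarith

abbreviation "spdom \<equiv> {-R..R}"

lemma real_poly_diff_bound:
  assumes "real_poly a n f z" "real_poly a m g w" "!!x. x \<in> spdom ==> \<bar>f x - g x\<bar> \<le> B"
  shows "cnorm A (z \<ominus> w) \<le> B"
proof -
  have [simp]: "z \<in> carrier A" "w \<in> carrier A"
    using real_poly_closed[OF a_closed] assms(1,2) by blast+
  have "real_poly a (n + (0 + m)) (\<lambda>x. f x + (-1) * g x) (z \<oplus> (of_real (-1) \<odot> \<one>) \<otimes> w)"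
    by (intro rp_add rp_mult rp_const assms)
  moreover have "z \<oplus> (of_real (-1) \<odot> \<one>) \<otimes> w = z \<ominus> w"
    by (simp add: scal_uminus cs)
  ultimately show ?thesis using real_poly_bound[OF sa norm_less] assms(3) by simp
qed

definition is_fc :: "(real => real) => 'a => bool"
  where "is_fc f z \<longleftrightarrow> z \<in> carrier A \<and>
    (\<forall>e>0. \<exists>n g w. real_poly a n g w \<and> (\<forall>x\<in>spdom. \<bar>f x - g x\<bar> \<le> e) \<and> cnorm A (z \<ominus> w) \<le> e)"

definition fc :: "(real => real) => 'a"
  where "fc f = (THE z. is_fc f z)"

lemma is_fcD:
  assumes "is_fc f z" "e > 0"
  obtains n g w where "real_poly a n g w" "w \<in> carrier A"
    "!!x. x \<in> spdom ==> \<bar>f x - g x\<bar> \<le> e" "cnorm A (z \<ominus> w) \<le> e"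
  using assms real_poly_closed[OF a_closed] unfolding is_fc_def by meson

lemma is_fc_diff_bound:
  assumes "is_fc f z" "is_fc g w" "!!x. x \<in> spdom ==> \<bar>f x - g x\<bar> \<le> B"
  shows "cnorm A (z \<ominus> w) \<le> B"
proof (rule field_le_epsilon)
  fix e :: real assume "e > 0"
  then have e: "e / 4 > 0" by simp
  have [simp]: "z \<in> carrier A" "w \<in> carrier A" using assms by (auto simp: is_fc_def)
  obtain n f' z' where f': "real_poly a n f' z'" and [simp]: "z' \<in> carrier A"
    and f'': "!!x. x \<in> spdom ==> \<bar>f x - f' x\<bar> \<le> e / 4" "cnorm A (z \<ominus> z') \<le> e / 4"
    using is_fcD[OF assms(1) e] by metis
  obtain m g' w' where g': "real_poly a m g' w'" and [simp]: "w' \<in> carrier A"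
    and g'': "!!x. x \<in> spdom ==> \<bar>g x - g' x\<bar> \<le> e / 4" "cnorm A (w \<ominus> w') \<le> e / 4"
    using is_fcD[OF assms(2) e] by metis
  have "cnorm A (z' \<ominus> w') \<le> B + e / 2"
  proof (rule real_poly_diff_bound[OF f' g'])
    fix x assume x: "x \<in> spdom"
    show "\<bar>f' x - g' x\<bar> \<le> B + e / 2" using f''(1)[OF x] g''(1)[OF x] assms(3)[OF x] by linarith
  qed
  then show "cnorm A (z \<ominus> w) \<le> B + e"
    using cnorm_diff_triangle[of z z' w] cnorm_diff_triangle[of z' w' w] f''(2) g''(2)
    by (simp add: cnorm_diff_commute[of w' w])
qed

lemma is_fc_unique: "is_fc f z ==> is_fc f w ==> z = w"
  using is_fc_diff_bound[of f z f w 0] cnorm_nonneg[of "z \<ominus> w"]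
  by (auto simp: is_fc_def cnorm_eq_zero_iff diff_eq_zero)

lemma real_poly_exists: "real_polynomial_function g ==> \<exists>n z. real_poly a n g z"
proof (induction rule: real_polynomial_function.induct)
  case (linear f)
  then have eq: "f = (\<lambda>x. f 1 * x)"
    by (metis (no_types, lifting) bounded_linear.linear linear_cmul mult.commute mult.right_neutral real_scaleR_def)
  show ?case by (subst eq) (use rp_mult[OF rp_const rp_id] in blast)
qed (use rp_const rp_add rp_mult in blast)+

lemma is_fc_exists:
  assumes f: "continuous_on spdom f" shows "\<exists>z. is_fc f z"
proof -
  have "\<exists>n g w. real_poly a n g w \<and> (\<forall>x\<in>spdom. \<bar>f x - g x\<bar> \<le> 1 / real (Suc k))" for k
  proof -
    obtain g where g: "real_polynomial_function g" "!!x. x \<in> spdom ==> \<bar>f x - g x\<bar> < 1 / real (Suc k)"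
      using Stone_Weierstrass_real_polynomial_function[OF _ f, of "1 / real (Suc k)"] by auto
    then show ?thesis using real_poly_exists[OF g(1)] by (meson less_imp_le)
  qed
  then obtain N g w where w: "!!k. real_poly a (N k) (g k) (w k)"
    and g: "!!k x. x \<in> spdom ==> \<bar>f x - g k x\<bar> \<le> 1 / real (Suc k)" by metis
  have [simp]: "w k \<in> carrier A" for k using w real_poly_closed by blast
  have wdiff: "cnorm A (w m \<ominus> w k) \<le> 1 / real (Suc m) + 1 / real (Suc k)" for m k
    using g by (intro real_poly_diff_bound[OF w w]) (smt (verit, best))
  have lim: "(\<lambda>k. 1 / real (Suc k)) \<longlonglongrightarrow> 0" using LIMSEQ_inverse_real_of_nat by (simp add: divide_inverse)
  have cau: "\<exists>N. \<forall>m\<ge>N. \<forall>n\<ge>N. cnorm A (w m \<ominus> w n) < e" if e: "e > 0" for e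
  proof -
    obtain N where N: "!!n. n \<ge> N ==> 1 / real (Suc n) < e / 2"
      using order_tendstoD(2)[OF lim, of "e/2"] e by (auto simp: eventually_sequentially)
    then show ?thesis using wdiff by (intro exI[of _ N]) (smt (verit) field_sum_of_halves)
  qed
  obtain z where z [simp]: "z \<in> carrier A" and zlim: "(\<lambda>k. cnorm A (w k \<ominus> z)) \<longlonglongrightarrow> 0"
    using Cauchy_limit[OF _ cau] by auto
  have "is_fc f z" unfolding is_fc_def
  proof (intro conjI allI impI)
    fix e :: real assume e: "e > 0"
    have "\<forall>\<^sub>F k in sequentially. 1 / real (Suc k) < e \<and> cnorm A (w k \<ominus> z) < e"
      using order_tendstoD(2)[OF lim e] order_tendstoD(2)[OF zlim e] by (rule eventually_conj)
    then obtain k where "1 / real (Suc k) < e" "cnorm A (w k \<ominus> z) < e"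
      by (auto simp: eventually_sequentially)
    then have "\<forall>x\<in>spdom. \<bar>f x - g k x\<bar> \<le> e" "cnorm A (z \<ominus> w k) \<le> e"
      using order_trans[OF g[of _ k] less_imp_le] by (auto simp: cnorm_diff_commute[of z])
    then show "\<exists>n g w. real_poly a n g w \<and> (\<forall>x\<in>spdom. \<bar>f x - g x\<bar> \<le> e) \<and> cnorm A (z \<ominus> w) \<le> e"
      using w[of k] by blast
  qed simp
  then show ?thesis ..
qed

lemma is_fc_fc: "continuous_on spdom f ==> is_fc f (fc f)"
  unfolding fc_def using is_fc_exists is_fc_unique by (metis the_equality)

lemma fc_eqI: "is_fc f z ==> fc f = z"
  unfolding fc_def using is_fc_unique by blast

lemma fc_real_poly: "real_poly a n f z ==> fc f = z"
  using real_poly_closed[OF a_closed, of n f z]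
  by (intro fc_eqI) (auto simp: is_fc_def intro!: exI[of _ n] exI[of _ f] exI[of _ z])

lemma fc_closed [simp, intro]: "continuous_on spdom f ==> fc f \<in> carrier A"
  using is_fc_fc by (auto simp: is_fc_def)

lemma fc_const: "fc (\<lambda>x. c) = of_real c \<odot> \<one>"
  by (rule fc_real_poly[OF rp_const])

lemma fc_id: "fc (\<lambda>x. x) = a"
  by (rule fc_real_poly[OF rp_id])

lemma fc_cong: "(!!x. x \<in> spdom ==> f x = g x) ==> fc f = fc g"
  unfolding fc_def is_fc_def by simp

lemma fc_bound:
  assumes "continuous_on spdom f" "!!x. x \<in> spdom ==> \<bar>f x\<bar> \<le> B"
  shows "cnorm A (fc f) \<le> B"
  using is_fc_diff_bound[OF is_fc_fc[OF assms(1)] is_fc_fc[of "\<lambda>x. 0"]] assms by (simp add: fc_const)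

lemma fc_add:
  assumes f: "continuous_on spdom f" and g: "continuous_on spdom g"
  shows "fc (\<lambda>x. f x + g x) = fc f \<oplus> fc g"
proof (rule fc_eqI)
  show "is_fc (\<lambda>x. f x + g x) (fc f \<oplus> fc g)" unfolding is_fc_def
  proof (intro conjI allI impI)
    fix e :: real assume "e > 0"
    then have e: "e / 2 > 0" by simp
    obtain n f' z' where f': "real_poly a n f' z'" and [simp]: "z' \<in> carrier A"
      and f'': "!!x. x \<in> spdom ==> \<bar>f x - f' x\<bar> \<le> e / 2" "cnorm A (fc f \<ominus> z') \<le> e / 2"
      using is_fcD[OF is_fc_fc[OF f] e] by metis
    obtain m g' w' where g': "real_poly a m g' w'" and [simp]: "w' \<in> carrier A"
      and g'': "!!x. x \<in> spdom ==> \<bar>g x - g' x\<bar> \<le> e / 2" "cnorm A (fc g \<ominus> w') \<le> e / 2"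
      using is_fcD[OF is_fc_fc[OF g] e] by metis
    have "cnorm A ((fc f \<oplus> fc g) \<ominus> (z' \<oplus> w')) \<le> e"
      using cnorm_triangle[of "fc f \<ominus> z'" "fc g \<ominus> w'"] f'' g'' f g by (simp add: add_diff_add)
    moreover have "\<forall>x\<in>spdom. \<bar>f x + g x - (f' x + g' x)\<bar> \<le> e"
    proof
      fix x assume x: "x \<in> spdom"
      show "\<bar>f x + g x - (f' x + g' x)\<bar> \<le> e" using f''(1)[OF x] g''(1)[OF x] by linarith
    qed
    ultimately show "\<exists>n h w. real_poly a n h w \<and> (\<forall>x\<in>spdom. \<bar>f x + g x - h x\<bar> \<le> e) \<and>
        cnorm A (fc f \<oplus> fc g \<ominus> w) \<le> e"
      using rp_add[OF f' g'] by blast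
  qed (use f g in auto)
qed

lemma fc_mult:
  assumes f: "continuous_on spdom f" and g: "continuous_on spdom g"
  shows "fc (\<lambda>x. f x * g x) = fc f \<otimes> fc g"
proof (rule fc_eqI)
  obtain F where F: "!!x. x \<in> spdom ==> \<bar>f x\<bar> \<le> F"
    using compact_continuous_image[OF f] compact_imp_bounded[of "f ` spdom"]
    by (metis bounded_real compact_Icc image_eqI)
  obtain G where G: "!!x. x \<in> spdom ==> \<bar>g x\<bar> \<le> G"
    using compact_continuous_image[OF g] compact_imp_bounded[of "g ` spdom"]
    by (metis bounded_real compact_Icc image_eqI)
  have F0: "0 \<le> F" and G0: "0 \<le> G" using F[of 0] G[of 0] R_pos by auto
  show "is_fc (\<lambda>x. f x * g x) (fc f \<otimes> fc g)" unfolding is_fc_def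
  proof (intro conjI allI impI)
    fix e :: real assume e0: "e > 0"
    define d where "d = min 1 (e / (F + G + 1))"
    have FG: "F + G + 1 > 0" using F0 G0 by simp
    have d: "d > 0" "d \<le> 1" using e0 FG by (auto simp: d_def)
    have "d \<le> e / (F + G + 1)" by (simp add: d_def)
    then have d: "d > 0" "d \<le> 1" "d * (F + G + 1) \<le> e"
      using d FG by (auto simp: pos_le_divide_eq)
    obtain n f' z' where f': "real_poly a n f' z'" and [simp]: "z' \<in> carrier A"
      and f'': "!!x. x \<in> spdom ==> \<bar>f x - f' x\<bar> \<le> d" "cnorm A (fc f \<ominus> z') \<le> d"
      using is_fcD[OF is_fc_fc[OF f] d(1)] by metis
    obtain m g' w' where g': "real_poly a m g' w'" and [simp]: "w' \<in> carrier A"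
      and g'': "!!x. x \<in> spdom ==> \<bar>g x - g' x\<bar> \<le> d" "cnorm A (fc g \<ominus> w') \<le> d"
      using is_fcD[OF is_fc_fc[OF g] d(1)] by metis
    have alg: "(fc f \<otimes> fc g) \<ominus> (z' \<otimes> w') = fc f \<otimes> (fc g \<ominus> w') \<oplus> (fc f \<ominus> z') \<otimes> w'"
      using f g by (simp add: cs)
    have nf: "cnorm A (fc f) \<le> F" using fc_bound[OF f F] .
    have nw: "cnorm A w' \<le> G + 1"
      using fc_bound[OF g G] cnorm_le_diff[of w' "fc g"] g''(2) d(2) g by (simp add: cnorm_diff_commute[of w'])
    have "cnorm A ((fc f \<otimes> fc g) \<ominus> (z' \<otimes> w'))
        \<le> cnorm A (fc f) * cnorm A (fc g \<ominus> w') + cnorm A (fc f \<ominus> z') * cnorm A w'"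
      unfolding alg using cnorm_triangle[of "fc f \<otimes> (fc g \<ominus> w')" "(fc f \<ominus> z') \<otimes> w'"]
        cnorm_mult[of "fc f" "fc g \<ominus> w'"] cnorm_mult[of "fc f \<ominus> z'" w'] f g by simp
    also have "\<dots> \<le> F * d + d * (G + 1)"
      using nf nw f'' g'' d F0 G0 f g by (intro add_mono mult_mono) (auto intro: cnorm_nonneg)
    also have "\<dots> \<le> e" using d(3) by (simp add: algebra_simps)
    finally have 1: "cnorm A ((fc f \<otimes> fc g) \<ominus> (z' \<otimes> w')) \<le> e" .
    have 2: "\<bar>f x * g x - f' x * g' x\<bar> \<le> e" if x: "x \<in> spdom" for x
    proof -
      have "\<bar>g' x\<bar> \<le> G + 1" using G[OF x] g''(1)[OF x] d(2) by linarith
      have "f x * g x - f' x * g' x = f x * (g x - g' x) + (f x - f' x) * g' x" by (simp add: algebra_simps)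
      also have "\<bar>\<dots>\<bar> \<le> \<bar>f x\<bar> * \<bar>g x - g' x\<bar> + \<bar>f x - f' x\<bar> * \<bar>g' x\<bar>"
        by (metis abs_mult abs_triangle_ineq)
      also have "\<dots> \<le> F * d + d * (G + 1)"
        using F[OF x] f''(1)[OF x] g''(1)[OF x] \<open>\<bar>g' x\<bar> \<le> G + 1\<close> d F0 G0 by (intro add_mono mult_mono) auto
      also have "\<dots> \<le> e" using d(3) by (simp add: algebra_simps)
      finally show ?thesis .
    qed
    show "\<exists>n h w. real_poly a n h w \<and> (\<forall>x\<in>spdom. \<bar>f x * g x - h x\<bar> \<le> e) \<and>
        cnorm A (fc f \<otimes> fc g \<ominus> w) \<le> e"
      using rp_mult[OF f' g'] 1 2 by blast
  qed (use f g in auto)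
qed

lemma fc_scale:
  "continuous_on spdom f ==> fc (\<lambda>x. c * f x) = of_real c \<odot> fc f"
  using fc_mult[of "\<lambda>x. c" f] by (simp add: fc_const smult_mult_left)

lemma fc_diff:
  assumes "continuous_on spdom f" "continuous_on spdom g"
  shows "fc (\<lambda>x. f x - g x) = fc f \<ominus> fc g"
  using fc_add[OF assms(1), of "\<lambda>x. (-1) * g x"] fc_scale[OF assms(2), of "-1"] assms
  by (simp add: continuous_on_minus scal_uminus minus_eq)

lemma fc_self_adjoint: assumes "continuous_on spdom f" shows "self_adjoint A (fc f)"
proof -
  have "is_fc f (star A (fc f))" unfolding is_fc_def
  proof (intro conjI allI impI)
    fix e :: real assume "e > 0"
    then obtain n f' z' where f': "real_poly a n f' z'" and [simp]: "z' \<in> carrier A"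
      and f'': "!!x. x \<in> spdom ==> \<bar>f x - f' x\<bar> \<le> e" "cnorm A (fc f \<ominus> z') \<le> e"
      using is_fcD[OF is_fc_fc[OF assms]] by metis
    have "star A z' = z'" using real_poly_self_adjoint[OF sa f'] by (simp add: self_adjoint_def)
    then have "cnorm A (star A (fc f) \<ominus> z') = cnorm A (star A (fc f \<ominus> z'))"
      using assms by (simp add: star_diff del: cnorm_star)
    also have "\<dots> = cnorm A (fc f \<ominus> z')" using assms by (intro cnorm_star) auto
    finally have "cnorm A (star A (fc f) \<ominus> z') = cnorm A (fc f \<ominus> z')" .
    then show "\<exists>n g w. real_poly a n g w \<and> (\<forall>x\<in>spdom. \<bar>f x - g x\<bar> \<le> e) \<and> cnorm A (star A (fc f) \<ominus> w) \<le> e"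
      using f' f''(1) order_trans[OF eq_refl f''(2)] by blast
  qed (use assms in auto)
  from fc_eqI[OF this] have "star A (fc f) = fc f" by simp
  then show ?thesis using fc_closed[OF assms] by (simp add: self_adjoint_def)
qed

lemma fc_sum:
  assumes "finite S" "!!k. k \<in> S ==> continuous_on spdom (f k)"
  shows "fc (\<lambda>x. \<Sum>k\<in>S. f k x) = (\<Oplus>k\<in>S. fc (f k))"
  using assms
proof (induction S rule: finite_induct)
  case empty show ?case using fc_const[of 0] by simp
next
  case (insert k S)
  then have "fc (\<lambda>x. f k x + (\<Sum>k\<in>S. f k x)) = fc (f k) \<oplus> fc (\<lambda>x. \<Sum>k\<in>S. f k x)"
    by (intro fc_add continuous_on_sum) auto
  then show ?case using insert by (simp add: finsum_insert Pi_def)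
qed

end

section \<open>Homomorphisms and seminorms\<close>

lemma unital_star_homD:
  assumes "h \<in> unital_star_hom A B"
  shows "x \<in> carrier A ==> h x \<in> carrier B"
    and "x \<in> carrier A ==> y \<in> carrier A ==> h (x \<oplus>\<^bsub>A\<^esub> y) = h x \<oplus>\<^bsub>B\<^esub> h y"
    and "x \<in> carrier A ==> y \<in> carrier A ==> h (x \<otimes>\<^bsub>A\<^esub> y) = h x \<otimes>\<^bsub>B\<^esub> h y"
    and "h \<one>\<^bsub>A\<^esub> = \<one>\<^bsub>B\<^esub>"
    and "x \<in> carrier A ==> h (c \<odot>\<^bsub>A\<^esub> x) = c \<odot>\<^bsub>B\<^esub> h x"
    and "x \<in> carrier A ==> h (star A x) = star B (h x)"
  using assms by (auto simp: unital_star_hom_def ring_hom_def)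

lemma unital_star_homI:
  assumes "!!x. x \<in> carrier A ==> h x \<in> carrier B"
    and "!!x y. x \<in> carrier A ==> y \<in> carrier A ==> h (x \<oplus>\<^bsub>A\<^esub> y) = h x \<oplus>\<^bsub>B\<^esub> h y"
    and "!!x y. x \<in> carrier A ==> y \<in> carrier A ==> h (x \<otimes>\<^bsub>A\<^esub> y) = h x \<otimes>\<^bsub>B\<^esub> h y"
    and "h \<one>\<^bsub>A\<^esub> = \<one>\<^bsub>B\<^esub>"
    and "!!x c. x \<in> carrier A ==> h (c \<odot>\<^bsub>A\<^esub> x) = c \<odot>\<^bsub>B\<^esub> h x"
    and "!!x. x \<in> carrier A ==> h (star A x) = star B (h x)"
  shows "h \<in> unital_star_hom A B"
  using assms by (auto simp: unital_star_hom_def ring_hom_def)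

lemma unital_star_hom_diff:
  assumes A: "unital_cstar_algebra A" and B: "unital_cstar_algebra B" and h: "h \<in> unital_star_hom A B"
    and x: "x \<in> carrier A" "y \<in> carrier A"
  shows "h (x \<ominus>\<^bsub>A\<^esub> y) = h x \<ominus>\<^bsub>B\<^esub> h y"
proof -
  interpret A: unital_cstar_algebra A by fact
  interpret B: unital_cstar_algebra B by fact
  have e: "x \<ominus>\<^bsub>A\<^esub> y = x \<oplus>\<^bsub>A\<^esub> (-1) \<odot>\<^bsub>A\<^esub> y" using x by (simp add: A.scal_uminus A.minus_eq)
  show ?thesis unfolding e using x unital_star_homD[OF h]
    by (simp add: B.scal_uminus B.minus_eq)
qed

text \<open>A self-adjoint contraction is a mean of two unitaries, whose images have norm at most \<open>1\<close>; the
  C*-identity gives the general case.\<close>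

lemma unital_star_hom_contractive:
  assumes A: "unital_cstar_algebra A" and B: "unital_cstar_algebra B"
    and h: "h \<in> unital_star_hom A B" and x: "x \<in> carrier A"
  shows "cnorm B (h x) \<le> cnorm A x"
proof -
  interpret A: unital_cstar_algebra A by fact
  interpret B: unital_cstar_algebra B by fact
  note hs [simp] = unital_star_homD[OF h]
  have *: "cnorm B (h a) \<le> 1" if a: "self_adjoint A a" "cnorm A a < 1" for a
  proof -
    obtain u where u: "u \<in> carrier A" "star A u \<otimes>\<^bsub>A\<^esub> u = \<one>\<^bsub>A\<^esub>" "a = (1/2) \<odot>\<^bsub>A\<^esub> (u \<oplus>\<^bsub>A\<^esub> star A u)"
      using A.unitary_dilation[OF a] by metis
    have "star B (h u) \<otimes>\<^bsub>B\<^esub> h u = h (star A u \<otimes>\<^bsub>A\<^esub> u)" using u(1) by simp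
    then have "cnorm B (h u) \<le> 1" using u by (intro B.unitary_cnorm_le) auto
    moreover have "h a = (1/2) \<odot>\<^bsub>B\<^esub> (h u \<oplus>\<^bsub>B\<^esub> star B (h u))" using u by simp
    ultimately show ?thesis
      using B.cnorm_triangle[of "h u" "star B (h u)"] u(1) by (simp add: B.cnorm_smult)
  qed
  have sa: "cnorm B (h a) \<le> cnorm A a" if a: "self_adjoint A a" for a
  proof (rule field_le_epsilon)
    fix e :: real assume e: "e > 0"
    have ac: "a \<in> carrier A" using a by (simp add: self_adjoint_def)
    define r where "r = cnorm A a + e"
    have r: "r > 0" "cnorm A a < r" using e A.cnorm_nonneg[OF ac] by (auto simp: r_def)
    have "cnorm B (h (of_real (1/r) \<odot>\<^bsub>A\<^esub> a)) \<le> 1"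
      using a r by (intro *) (auto simp: self_adjoint_def A.star_smult A.cnorm_smult norm_divide)
    then show "cnorm B (h a) \<le> cnorm A a + e"
      using r ac by (simp add: B.cnorm_smult norm_divide r_def[symmetric] divide_simps)
  qed
  have "(cnorm B (h x))\<^sup>2 = cnorm B (h (star A x \<otimes>\<^bsub>A\<^esub> x))" using x by (simp add: B.cstar_identity)
  also have "\<dots> \<le> cnorm A (star A x \<otimes>\<^bsub>A\<^esub> x)"
    using x by (intro sa) (auto simp: self_adjoint_def A.star_simps)
  also have "\<dots> = (cnorm A x)\<^sup>2" using x by (simp add: A.cstar_identity)
  finally show ?thesis using A.cnorm_nonneg[OF x] by (rule power2_le_imp_le)
qed

context unital_cstar_algebra
begin

text \<open>If \<open>M a < norm a\<close>, functional calculus yields a nonzero element on which \<open>M\<close> vanishes: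
  a function of \<open>a\<close> supported where the spectral parameter exceeds \<open>M a\<close> is divisible by every
  power of \<open>a\<close>.\<close>

lemma cstar_seminorm_eq_norm:
  assumes M0: "!!x. x \<in> carrier A ==> 0 \<le> M x"
    and Mm: "!!x y. [|x \<in> carrier A; y \<in> carrier A|] ==> M (x \<otimes> y) \<le> M x * M y"
    and Mle: "!!x. x \<in> carrier A ==> M x \<le> cnorm A x"
    and Mc: "!!x. x \<in> carrier A ==> (M x)\<^sup>2 \<le> M (star A x \<otimes> x)"
    and Mz: "!!x. [|x \<in> carrier A; M x = 0|] ==> x = \<zero>"
    and x: "x \<in> carrier A"
  shows "M x = cnorm A x"
proof -
  have Mstar: "M y \<le> M (star A y)" if y: "y \<in> carrier A" for y
  proof (cases "M y = 0")
    case False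
    have "(M y)\<^sup>2 \<le> M (star A y) * M y" using Mc[OF y] Mm[of "star A y" y] y by auto
    then show ?thesis using False M0[OF y] by (simp add: power2_eq_square)
  qed (use M0 y in auto)
  have sa: "cnorm A a \<le> M a" if a: "self_adjoint A a" for a
  proof (rule ccontr)
    assume "\<not> cnorm A a \<le> M a"
    then have less: "M a < cnorm A a" by simp
    have ac: "a \<in> carrier A" using a by (simp add: self_adjoint_def)
    obtain s where s: "M a < s" "s < cnorm A a" using less dense by blast
    obtain t where t: "s < t" "t < cnorm A a" using s dense by blast
    have s0: "s > 0" using s M0[OF ac] by simp
    interpret functional_calculus A a "cnorm A a + 1" by unfold_locales (use a in auto)
    define f where "f = (\<lambda>x::real. max 0 (min 1 ((\<bar>x\<bar> - s) / (t - s))))"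
    have f01: "0 \<le> f x" "f x \<le> 1" and f0: "\<bar>x\<bar> \<le> s ==> f x = 0" and f1: "\<bar>x\<bar> \<ge> t ==> f x = 1" for x
      using t by (auto simp: f_def min_def max_def divide_simps)
    have fcont: "continuous_on UNIV f" unfolding f_def by (intro continuous_intros) (use t in auto)
    define k where "k = (\<lambda>n x. f x / (max s \<bar>x\<bar>) ^ n * sgn x ^ n)"
    define k' where "k' = (\<lambda>(n::nat) x::real. f x / (max s \<bar>x\<bar>) ^ (2*n))"
    have kcont: "continuous_on S (k' n)" for S n
      unfolding k'_def using s0 by (intro continuous_intros continuous_on_subset[OF fcont]) auto
    have kx: "x ^ (2*n) * k' n x = f x" for n x
    proof (cases "\<bar>x\<bar> \<le> s")
      case False
      then have "max s \<bar>x\<bar> = \<bar>x\<bar>" "x \<noteq> 0" using s0 by auto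
      then show ?thesis by (simp add: k'_def power_even_abs)
    qed (simp add: f0 k'_def)
    have kb: "\<bar>k' n x\<bar> \<le> 1 / s ^ (2*n)" for n x
    proof -
      have "s ^ (2*n) \<le> max s \<bar>x\<bar> ^ (2*n)" using s0 by (intro power_mono) auto
      then show ?thesis unfolding k'_def using f01[of x] s0
        by (simp add: abs_mult power_abs[symmetric]) (intro frac_le, auto)
    qed
    have pcont: "continuous_on S (\<lambda>x::real. x ^ n)" for S n by (intro continuous_intros)
    have fcpow: "fc (\<lambda>x. x ^ n) \<in> carrier A \<and> M (fc (\<lambda>x. x ^ Suc n)) \<le> M a ^ Suc n" for n
    proof (induction n)
      case 0 show ?case using pcont[of _ 0] by (simp add: fc_id fc_const)
    next
      case (Suc n)
      have "fc (\<lambda>x. x * x ^ Suc n) = a \<otimes> fc (\<lambda>x. x ^ Suc n)"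
        using fc_mult[of "\<lambda>x. x" "\<lambda>x. x ^ Suc n"] pcont by (simp add: fc_id del: power_Suc)
      then have "M (fc (\<lambda>x. x ^ Suc (Suc n))) \<le> M a * M (fc (\<lambda>x. x ^ Suc n))"
        using Mm[OF ac fc_closed[OF pcont[of _ "Suc n"]]] by simp
      also have "\<dots> \<le> M a * M a ^ Suc n" using Suc M0[OF ac] by (intro mult_left_mono) auto
      finally show ?case using fc_closed[OF pcont, of "Suc n"] by simp
    qed
    have Mf: "M (fc f) \<le> (M a / s) ^ (2 * Suc n)" for n
    proof -
      have "fc f = fc (\<lambda>x. x ^ (2 * Suc n)) \<otimes> fc (k' (Suc n))"
        using fc_mult[OF pcont kcont, of "2 * Suc n" "Suc n"] by (simp only: kx)
      then have "M (fc f) = M (fc (\<lambda>x. x ^ (2 * Suc n)) \<otimes> fc (k' (Suc n)))" by (rule arg_cong)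
      also have "\<dots> \<le> M (fc (\<lambda>x. x ^ (2 * Suc n))) * M (fc (k' (Suc n)))"
        by (intro Mm fc_closed pcont kcont)
      also have "\<dots> \<le> M a ^ (2 * Suc n) * (1 / s ^ (2 * Suc n))"
      proof (rule mult_mono)
        show "M (fc (\<lambda>x. x ^ (2 * Suc n))) \<le> M a ^ (2 * Suc n)" using fcpow[of "2 * n + 1"] by simp
        show "M (fc (k' (Suc n))) \<le> 1 / s ^ (2 * Suc n)"
          using Mle[OF fc_closed[OF kcont]] fc_bound[OF kcont kb] by (rule order_trans)
      qed (use M0[OF ac] M0[OF fc_closed[OF kcont]] in auto)
      finally show ?thesis by (simp add: power_divide)
    qed
    have q: "0 \<le> M a / s" "M a / s < 1" using s s0 M0[OF ac] by auto
    have "(\<lambda>n. (M a / s) ^ (2 * Suc n)) \<longlonglongrightarrow> 0"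
      using LIMSEQ_subseq_LIMSEQ[OF LIMSEQ_realpow_zero[OF q], of "\<lambda>n. 2 * Suc n"]
      by (simp add: o_def strict_mono_def)
    then have "M (fc f) \<le> 0" using Mf by (intro LIMSEQ_le_const) auto
    moreover have fcl: "fc f \<in> carrier A" using fcont by (intro fc_closed continuous_on_subset[OF fcont]) auto
    ultimately have fz: "fc f = \<zero>" using Mz M0 by (metis order_antisym)
    have "a \<otimes> a = fc (\<lambda>x. x * x)" using fc_mult[of "\<lambda>x. x" "\<lambda>x. x"] by (simp add: fc_id)
    also have "\<dots> = fc (\<lambda>x. x * x - f x * (x * x))"
    proof -
      have fc': "continuous_on spdom f" by (rule continuous_on_subset[OF fcont]) simp
      have c2: "continuous_on spdom (\<lambda>x. x * x)" by (intro continuous_intros)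
      show ?thesis using fc_diff[OF c2 continuous_on_mult[OF fc' c2]] fc_mult[OF fc' c2] fz c2
        by simp
    qed
    finally have aa: "a \<otimes> a = fc (\<lambda>x. x * x - f x * (x * x))" .
    have "cnorm A (a \<otimes> a) \<le> t\<^sup>2" unfolding aa
    proof (rule fc_bound)
      show "continuous_on spdom (\<lambda>x. x * x - f x * (x * x))"
        by (intro continuous_intros continuous_on_subset[OF fcont]) auto
      fix x
      have "x * x - f x * (x * x) = (1 - f x) * x\<^sup>2" by (simp add: power2_eq_square algebra_simps)
      moreover have "\<bar>(1 - f x) * x\<^sup>2\<bar> \<le> t\<^sup>2"
      proof (cases "\<bar>x\<bar> \<ge> t")
        case False
        then have "x\<^sup>2 \<le> t\<^sup>2" by (intro power2_le_iff_abs_le[THEN iffD2]) (use t s0 in auto)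
        then show ?thesis using f01[of x] by (simp add: abs_mult mult_left_le_one_le order_trans[OF mult_left_le_one_le])
      qed (simp add: f1)
      ultimately show "\<bar>x * x - f x * (x * x)\<bar> \<le> t\<^sup>2" by simp
    qed
    then have "(cnorm A a)\<^sup>2 \<le> t\<^sup>2" by (simp add: cnorm_square_self_adjoint[OF a])
    then show False using t s0 by (simp add: power2_le_iff_abs_le)
  qed
  have "(cnorm A x)\<^sup>2 = cnorm A (star A x \<otimes> x)" using x by (simp add: cstar_identity)
  also have "\<dots> \<le> M (star A x \<otimes> x)" using x by (intro sa) (auto simp: self_adjoint_def star_simps)
  also have "\<dots> \<le> M (star A x) * M x" using x by (intro Mm) auto
  also have "\<dots> \<le> M x * M x"
    using Mstar[of "star A x"] x by (intro mult_right_mono M0) (auto simp: star_star)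
  finally have "(cnorm A x)\<^sup>2 \<le> (M x)\<^sup>2" by (simp only: power2_eq_square)
  then have "cnorm A x \<le> M x" using M0[OF x] by (rule power2_le_imp_le)
  then show ?thesis using Mle[OF x] by simp
qed

end

section \<open>States and traces\<close>

definition state :: "'a cstar_algebra => ('a => complex) => bool"
  where "state A w \<longleftrightarrow>
    (\<forall>x \<in> carrier A. \<forall>y \<in> carrier A. w (x \<oplus>\<^bsub>A\<^esub> y) = w x + w y) \<and>
    (\<forall>c. \<forall>x \<in> carrier A. w (c \<odot>\<^bsub>A\<^esub> x) = c * w x) \<and>
    (\<forall>x \<in> carrier A. w (star A x \<otimes>\<^bsub>A\<^esub> x) \<in> \<real>\<^sub>\<ge>\<^sub>0) \<and>
    w \<one>\<^bsub>A\<^esub> = 1"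

locale cstar_state = unital_cstar_algebra A for A :: "'a cstar_algebra" (structure) +
  fixes w :: "'a => complex"
  assumes state: "state A w"
begin

lemma st_add: "[|x \<in> carrier A; y \<in> carrier A|] ==> w (x \<oplus> y) = w x + w y"
  and st_scal: "x \<in> carrier A ==> w (c \<odot> x) = c * w x"
  and st_one: "w \<one> = 1"
  using state by (auto simp: state_def)

lemma st_pos: "x \<in> carrier A ==> 0 \<le> Re (w (star A x \<otimes> x))"
  and st_real: "x \<in> carrier A ==> Im (w (star A x \<otimes> x)) = 0"
  using state by (auto simp: state_def complex_nonneg_Reals_iff)

lemma st_minus: "x \<in> carrier A ==> w (\<ominus> x) = - w x"
  using st_scal[of x "-1"] by (simp add: scal_uminus)

lemma st_diff: "[|x \<in> carrier A; y \<in> carrier A|] ==> w (x \<ominus> y) = w x - w y"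
  by (simp add: minus_eq st_add st_minus)

lemma st_zero: "w \<zero> = 0"
  using st_scal[of \<zero> 0] by simp

lemmas st = st_add st_scal st_one st_minus st_diff st_zero

lemma st_expand:
  assumes [simp]: "x \<in> carrier A" "y \<in> carrier A"
  shows "w (star A (x \<oplus> c \<odot> y) \<otimes> (x \<oplus> c \<odot> y)) =
    w (star A x \<otimes> x) + c * w (star A x \<otimes> y) + cnj c * w (star A y \<otimes> x) + cnj c * c * w (star A y \<otimes> y)"
  by (simp add: cs st)

lemma st_star: assumes [simp]: "x \<in> carrier A" shows "w (star A x) = cnj (w x)"
proof -
  have "Im (w (star A (\<one> \<oplus> c \<odot> x) \<otimes> (\<one> \<oplus> c \<odot> x))) = 0" for c by (intro st_real) auto
  then have *: "Im (c * w x + cnj c * w (star A x)) = 0" for c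
    using st_real[of x] st_real[of \<one>] unfolding st_expand[OF one_closed assms]
    by (simp add: st)
  show ?thesis using *[of 1] *[of \<i>] by (simp add: complex_eq_iff)
qed

lemma norm2_sq: "x \<in> carrier A ==> (norm2 A w x)\<^sup>2 = Re (w (star A x \<otimes> x))"
  by (simp add: norm2_def st_pos)

lemma norm2_nonneg [simp]: "x \<in> carrier A ==> 0 \<le> norm2 A w x"
  by (simp add: norm2_def st_pos)

lemma Cauchy_Schwarz:
  assumes x [simp]: "x \<in> carrier A" and y [simp]: "y \<in> carrier A"
  shows "cmod (w (star A x \<otimes> y)) \<le> norm2 A w x * norm2 A w y"
proof -
  define s where "s = w (star A x \<otimes> y)"
  define P where "P = Re (w (star A x \<otimes> x))"
  define Q where "Q = Re (w (star A y \<otimes> y))"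
  have P0: "0 \<le> P" and Q0: "0 \<le> Q" by (auto simp: P_def Q_def st_pos)
  have yx: "w (star A y \<otimes> x) = cnj s"
    using st_star[of "star A x \<otimes> y"] by (simp add: s_def star_simps)
  have quad: "0 \<le> P - 2 * t * (cmod s)\<^sup>2 + t\<^sup>2 * (cmod s)\<^sup>2 * Q" for t :: real
  proof -
    let ?c = "- complex_of_real t * cnj s"
    have cc: "complex_of_real ((cmod s)\<^sup>2) = s * cnj s" by (rule complex_norm_square)
    then have cc: "(complex_of_real (cmod s))\<^sup>2 = s * cnj s" by simp
    have e1: "?c * s = - complex_of_real (t * (cmod s)\<^sup>2)"
      by (simp add: cc mult_ac)
    have e2: "cnj ?c * cnj s = - complex_of_real (t * (cmod s)\<^sup>2)"
      by (simp add: cc mult_ac)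
    have e3: "cnj ?c * ?c = complex_of_real (t\<^sup>2 * (cmod s)\<^sup>2)"
      by (simp add: cc[unfolded of_real_power power2_eq_square] power2_eq_square mult_ac)
    have "0 \<le> Re (w (star A (x \<oplus> ?c \<odot> y) \<otimes> (x \<oplus> ?c \<odot> y)))" by (intro st_pos) auto
    also have "\<dots> = P + Re (?c * s) + Re (cnj ?c * cnj s) + Re (cnj ?c * ?c * w (star A y \<otimes> y))"
      by (subst st_expand) (simp_all add: P_def s_def[symmetric] yx)
    also have "\<dots> = P - 2 * t * (cmod s)\<^sup>2 + t\<^sup>2 * (cmod s)\<^sup>2 * Q"
      unfolding e1 e2 e3 by (simp add: Q_def)
    finally show ?thesis .
  qed
  have "(cmod s)\<^sup>2 \<le> P * Q"
  proof (cases "Q = 0")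
    case True
    then have "2 * ((P + 1) / (cmod s)\<^sup>2) * (cmod s)\<^sup>2 \<le> P" using quad[of "(P + 1) / (cmod s)\<^sup>2"] by simp
    then have "cmod s = 0" using P0 by (cases "cmod s = 0") auto
    then show ?thesis using P0 Q0 by simp
  next
    case False
    then have "Q > 0" using Q0 by simp
    have "0 \<le> P - 2 * (1/Q) * (cmod s)\<^sup>2 + (1/Q)\<^sup>2 * (cmod s)\<^sup>2 * Q" by (rule quad)
    also have "\<dots> = P - (cmod s)\<^sup>2 / Q" using \<open>Q > 0\<close> by (simp add: field_simps power2_eq_square)
    finally show ?thesis using \<open>Q > 0\<close> by (simp add: field_simps)
  qed
  then have "sqrt ((cmod s)\<^sup>2) \<le> sqrt (P * Q)" by (rule real_sqrt_le_mono)
  then show ?thesis by (simp add: real_sqrt_mult norm2_def P_def Q_def s_def)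
qed

lemma norm2_triangle:
  assumes [simp]: "x \<in> carrier A" "y \<in> carrier A"
  shows "norm2 A w (x \<oplus> y) \<le> norm2 A w x + norm2 A w y"
proof -
  have "(norm2 A w (x \<oplus> y))\<^sup>2 = Re (w (star A x \<otimes> x)) + Re (w (star A x \<otimes> y)) + Re (w (star A y \<otimes> x)) + Re (w (star A y \<otimes> y))"
    using st_expand[of x y 1] by (simp add: norm2_sq)
  also have "\<dots> \<le> (norm2 A w x)\<^sup>2 + norm2 A w x * norm2 A w y + norm2 A w y * norm2 A w x + (norm2 A w y)\<^sup>2"
    using order_trans[OF complex_Re_le_cmod Cauchy_Schwarz[OF assms]]
      order_trans[OF complex_Re_le_cmod Cauchy_Schwarz[OF assms(2,1)]] by (simp only: norm2_sq assms)
  also have "\<dots> = (norm2 A w x + norm2 A w y)\<^sup>2" by (simp add: power2_eq_square algebra_simps)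
  finally show ?thesis by (rule power2_le_imp_le) simp
qed

lemma norm2_scal: "x \<in> carrier A ==> norm2 A w (c \<odot> x) = cmod c * norm2 A w x"
proof -
  assume [simp]: "x \<in> carrier A"
  have "w (star A (c \<odot> x) \<otimes> (c \<odot> x)) = complex_of_real ((cmod c)\<^sup>2) * w (star A x \<otimes> x)"
    by (simp add: cs st complex_norm_square mult_ac del: of_real_power)
  then show ?thesis by (simp add: norm2_def real_sqrt_mult)
qed

lemma norm2_zero [simp]: "norm2 A w \<zero> = 0"
  by (simp add: norm2_def st)

lemma norm2_minus [simp]: "x \<in> carrier A ==> norm2 A w (\<ominus> x) = norm2 A w x"
  using norm2_scal[of x "-1"] by (simp add: scal_uminus)

lemma norm2_diff_le:
  "[|x \<in> carrier A; y \<in> carrier A|] ==> norm2 A w (x \<ominus> y) \<le> norm2 A w x + norm2 A w y"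
  using norm2_triangle[of x "\<ominus> y"] by (simp add: minus_eq)

lemma norm2_diff_triangle:
  "[|x \<in> carrier A; y \<in> carrier A; z \<in> carrier A|]
    ==> norm2 A w (x \<ominus> z) \<le> norm2 A w (x \<ominus> y) + norm2 A w (y \<ominus> z)"
  using norm2_triangle[of "x \<ominus> y" "y \<ominus> z"] by (simp add: diff_add_diff)

lemma norm2_diff_commute:
  "[|x \<in> carrier A; y \<in> carrier A|] ==> norm2 A w (x \<ominus> y) = norm2 A w (y \<ominus> x)"
  using norm2_minus[of "x \<ominus> y"] by (simp add: diff_commute)

lemma norm2_le_diff:
  "[|x \<in> carrier A; y \<in> carrier A|] ==> norm2 A w x \<le> norm2 A w y + norm2 A w (x \<ominus> y)"
  using norm2_diff_triangle[of x y \<zero>] by simp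

text \<open>\<open>r\<^sup>2 - x\<^sup>*x\<close> is a square for \<open>r\<close> above the norm of \<open>x\<close>.\<close>

lemma norm2_mult_le:
  assumes [simp]: "x \<in> carrier A" "y \<in> carrier A"
  shows "norm2 A w (x \<otimes> y) \<le> cnorm A x * norm2 A w y"
proof -
  have *: "norm2 A w (x \<otimes> y) \<le> r * norm2 A w y" if r: "r > cnorm A x" for r
  proof -
    have r0: "r > 0" using r cnorm_nonneg[of x] by simp
    define h where "h = of_real (1/r\<^sup>2) \<odot> (star A x \<otimes> x)"
    have "cnorm A h = (cnorm A x / r)\<^sup>2"
      by (simp add: h_def cnorm_smult cstar_identity norm_divide norm_power power_divide)
    also have "\<dots> < 1" using r r0 cnorm_nonneg[of x] by (simp add: abs_square_less_1)
    finally have "cnorm A h < 1" .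
    moreover have "self_adjoint A h" by (simp add: h_def self_adjoint_def star_simps)
    ultimately obtain c where c: "self_adjoint A c" "c \<otimes> c = \<one> \<ominus> h"
      using sqrt_one_minus[of h thesis] by blast
    have [simp]: "c \<in> carrier A" "star A c = c" using c by (auto simp: self_adjoint_def)
    have hc: "h \<in> carrier A" by (simp add: h_def)
    have "star A (c \<otimes> y) \<otimes> (c \<otimes> y) = star A y \<otimes> (c \<otimes> c) \<otimes> y" by (simp add: star_mult m_assoc)
    also have "\<dots> = star A y \<otimes> y \<ominus> of_real (1/r\<^sup>2) \<odot> (star A (x \<otimes> y) \<otimes> (x \<otimes> y))"
      unfolding c(2) h_def by (simp add: cs)
    finally have "0 \<le> Re (w (star A y \<otimes> y)) - Re (w (star A (x \<otimes> y) \<otimes> (x \<otimes> y))) / r\<^sup>2"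
      using st_pos[of "c \<otimes> y"] by (simp add: st Re_divide_of_real flip: of_real_power)
    then have "(norm2 A w (x \<otimes> y))\<^sup>2 \<le> (r * norm2 A w y)\<^sup>2"
      using r0 by (simp add: norm2_sq power_mult_distrib field_simps)
    then show ?thesis by (rule power2_le_imp_le) (use r0 in auto)
  qed
  show ?thesis
  proof (rule field_le_epsilon)
    fix e :: real assume e: "e > 0"
    define d where "d = e / (norm2 A w y + 1)"
    have p: "norm2 A w y + 1 > 0" by (simp add: add_nonneg_pos)
    have "d > 0" using e p by (simp add: d_def)
    moreover have "d * norm2 A w y \<le> d * (norm2 A w y + 1)" using \<open>d > 0\<close> by simp
    moreover have "d * (norm2 A w y + 1) = e" using p by (simp add: d_def)
    ultimately show "norm2 A w (x \<otimes> y) \<le> cnorm A x * norm2 A w y + e"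
      using *[of "cnorm A x + d"] by (simp add: distrib_right)
  qed
qed

lemma norm2_one [simp]: "norm2 A w \<one> = 1"
  by (simp add: norm2_def st)

lemma norm2_le_cnorm: "x \<in> carrier A ==> norm2 A w x \<le> cnorm A x"
  using norm2_mult_le[of x \<one>] by simp

lemma cmod_le_norm2: "x \<in> carrier A ==> cmod (w x) \<le> norm2 A w x"
  using Cauchy_Schwarz[of \<one> x] by simp

end

lemma tracial_state_imp_state: "tracial_state A r ==> state A r"
  by (auto simp: tracial_state_def state_def)

locale tracial_algebra = unital_cstar_algebra A for A :: "'a cstar_algebra" (structure) +
  fixes w :: "'a => complex"
  assumes tracial: "tracial_state A w"

sublocale tracial_algebra \<subseteq> cstar_state A w
  by unfold_locales (rule tracial_state_imp_state[OF tracial])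

context tracial_algebra
begin

lemma trace: "[|x \<in> carrier A; y \<in> carrier A|] ==> w (x \<otimes> y) = w (y \<otimes> x)"
  using tracial by (auto simp: tracial_state_def)

lemma norm2_star [simp]: "x \<in> carrier A ==> norm2 A w (star A x) = norm2 A w x"
  by (simp add: norm2_def star_star trace[of x])

lemma norm2_mult_le':
  "[|x \<in> carrier A; y \<in> carrier A|] ==> norm2 A w (x \<otimes> y) \<le> norm2 A w x * cnorm A y"
  using norm2_mult_le[of "star A y" "star A x"] norm2_star[of "x \<otimes> y"]
  by (simp add: star_mult mult.commute)

end

section \<open>Almost central projections\<close>

text \<open>A continuous substitute for the characteristic function of \<open>(l, \<infinity>)\<close>.\<close>

definition ramp :: "real => real => real => real"
  where "ramp l h = (\<lambda>x. max 0 (min 1 ((x - l) / h)))"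

lemma ramp_range: "0 \<le> ramp l h x" "ramp l h x \<le> 1"
  by (auto simp: ramp_def)

lemma ramp_eq_0: "h > 0 ==> x \<le> l ==> ramp l h x = 0"
  by (simp add: ramp_def divide_nonpos_pos)

lemma ramp_eq_1: "h > 0 ==> l + h \<le> x ==> ramp l h x = 1"
  by (auto simp: ramp_def max_def min_def divide_simps)

lemma ramp_continuous: "h > 0 ==> continuous_on S (ramp l h)"
  unfolding ramp_def by (intro continuous_intros) auto

context functional_calculus
begin

text \<open>Where the resolvent of \<open>a\<close> exists at \<open>l\<close> with norm \<open>C\<close>, a function \<open>g\<close> supported within
  distance \<open>h < 1/C\<close> of \<open>l\<close> satisfies \<open>g(a) = c\<^sup>n (l - a)\<^sup>n g(a)\<close>, which tends to zero.\<close>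

lemma gap_projection:
  assumes U: "of_real l \<odot> \<one> \<ominus> a \<in> Units A"
  obtains e where "e > 0" "!!h. 0 < h ==> h \<le> e ==> projection A (fc (ramp l h))"
proof -
  obtain c where c [simp]: "c \<in> carrier A" and cy: "c \<otimes> (of_real l \<odot> \<one> \<ominus> a) = \<one>"
    using U by (auto simp: Units_def)
  define C where "C = cnorm A c"
  have C0: "0 \<le> C" by (simp add: C_def cnorm_nonneg)
  define e where "e = 1 / (2 * (C + 1))"
  have e0: "e > 0" using C0 by (simp add: e_def)
  have "C * e \<le> 1 / 2" using C0 by (simp add: e_def field_simps)
  show thesis
  proof (rule that[OF e0])
    fix h assume h: "0 < h" "h \<le> e"
    define g where "g = (\<lambda>x. ramp l h x * ramp l h x - ramp l h x)"
    have rc: "continuous_on spdom (ramp l h)" using h by (intro ramp_continuous)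
    have gc: "continuous_on spdom g" unfolding g_def by (intro continuous_intros rc)
    define G where "G = (\<lambda>n. fc (\<lambda>x. (l - x) ^ n * g x))"
    have pc: "continuous_on spdom (\<lambda>x. (l - x) ^ n * g x)" for n by (intro continuous_intros gc)
    have Gc [simp]: "G n \<in> carrier A" for n unfolding G_def by (intro fc_closed pc)
    have lx: "fc (\<lambda>x. l - x) = of_real l \<odot> \<one> \<ominus> a"
      using fc_diff[of "\<lambda>x. l" "\<lambda>x. x"] by (simp add: fc_const fc_id)
    have GS: "G (Suc n) = (of_real l \<odot> \<one> \<ominus> a) \<otimes> G n" for n
    proof -
      have "continuous_on spdom (\<lambda>x. l - x)" by (intro continuous_intros)
      from fc_mult[OF this pc, of n] show ?thesis by (simp add: G_def lx mult.assoc)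
    qed
    have GG: "G n = c \<otimes> G (Suc n)" for n
      unfolding GS by (subst m_assoc[symmetric]) (simp_all add: cy)
    have G0: "cnorm A (G 0) \<le> C ^ n * cnorm A (G n)" for n
    proof (induction n)
      case (Suc n)
      have "cnorm A (G n) \<le> C * cnorm A (G (Suc n))"
        using cnorm_mult[OF c Gc[of "Suc n"]] by (simp only: GG[symmetric] C_def)
      then have "C ^ n * cnorm A (G n) \<le> C ^ n * (C * cnorm A (G (Suc n)))"
        using C0 by (intro mult_left_mono) auto
      then show ?case using Suc by (simp add: mult_ac)
    qed simp
    have Gn: "cnorm A (G n) \<le> h ^ n" for n
      unfolding G_def
    proof (rule fc_bound[OF pc])
      fix x
      have g1: "\<bar>g x\<bar> \<le> 1"
      proof -
        have "0 \<le> ramp l h x * ramp l h x" "ramp l h x * ramp l h x \<le> 1"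
          using ramp_range[of l h x] by (auto intro: mult_le_one)
        then show ?thesis using ramp_range[of l h x] unfolding g_def by linarith
      qed
      show "\<bar>(l - x) ^ n * g x\<bar> \<le> h ^ n"
      proof (cases "l \<le> x \<and> x \<le> l + h")
        case True
        then have "\<bar>l - x\<bar> ^ n \<le> h ^ n" by (intro power_mono) auto
        then show ?thesis using mult_mono[OF _ g1, of "\<bar>l - x\<bar> ^ n" "h ^ n"] h
          by (simp add: abs_mult power_abs)
      next
        case False
        then have "g x = 0" using ramp_eq_0[OF h(1), of x l] ramp_eq_1[OF h(1), of l x] by (auto simp: g_def)
        then show ?thesis using h by simp
      qed
    qed
    have "cnorm A (G 0) \<le> (1/2) ^ n" for n
    proof -
      have "cnorm A (G 0) \<le> C ^ n * h ^ n"
        using G0[of n] mult_left_mono[OF Gn[of n], of "C ^ n"] C0 by simp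
      also have "\<dots> = (C * h) ^ n" by (simp add: power_mult_distrib)
      also have "\<dots> \<le> (1/2) ^ n"
        using \<open>C * e \<le> 1 / 2\<close> mult_left_mono[OF h(2) C0] C0 h by (intro power_mono) auto
      finally show ?thesis .
    qed
    moreover have "(\<lambda>n. (1/2::real) ^ n) \<longlonglongrightarrow> 0" by (rule LIMSEQ_realpow_zero) auto
    ultimately have "cnorm A (G 0) \<le> 0" by (intro LIMSEQ_le_const) auto
    then have "G 0 = \<zero>" using cnorm_nonneg[OF Gc[of 0]] by (simp add: cnorm_eq_zero_iff)
    moreover have "G 0 = fc (ramp l h) \<otimes> fc (ramp l h) \<ominus> fc (ramp l h)"
      using fc_diff[OF continuous_on_mult[OF rc rc] rc] fc_mult[OF rc rc] by (simp add: G_def g_def)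
    ultimately have "fc (ramp l h) \<otimes> fc (ramp l h) = fc (ramp l h)"
      using diff_eq_zero[of "fc (ramp l h) \<otimes> fc (ramp l h)" "fc (ramp l h)"] rc by simp
    then show "projection A (fc (ramp l h))" using fc_self_adjoint[OF rc] by (simp add: projection_def)
  qed
qed

end

lemma sum_step_lower:
  fixes g :: "nat => real"
  assumes "!!k. 0 \<le> g k" "!!k. real k + 1 \<le> v ==> g k = 1" "0 \<le> v"
  shows "min (v - 2) (real n - 1) \<le> (\<Sum>k\<in>{1..<n}. g k)"
proof (induction n)
  case (Suc n)
  show ?case
  proof (cases "n = 0")
    case False
    then have "(\<Sum>k\<in>{1..<Suc n}. g k) = (\<Sum>k\<in>{1..<n}. g k) + g n" by simp
    then show ?thesis using Suc assms(1)[of n] assms(2)[of n] by (cases "real n + 1 \<le> v") auto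
  qed (use assms in auto)
qed auto

lemma sum_step_upper:
  fixes g :: "nat => real"
  assumes "!!k. g k \<le> 1" "!!k. v \<le> real k ==> g k = 0" "0 \<le> v"
  shows "(\<Sum>k\<in>{1..<n}. g k) \<le> max 0 (min v (real n - 1))"
proof (induction n)
  case (Suc n)
  show ?case
  proof (cases "n = 0")
    case False
    then have "(\<Sum>k\<in>{1..<Suc n}. g k) = (\<Sum>k\<in>{1..<n}. g k) + g n" by simp
    then show ?thesis using Suc assms(1)[of n] assms(2)[of n] assms(3) False
      by (cases "v \<le> real n") auto
  qed (use assms in auto)
qed auto

context unital_cstar_algebra
begin

text \<open>In real rank zero the element may be taken to have finite spectrum, so that almost every real
  number lies in a gap of the spectrum and is the threshold of a spectral projection.\<close>

lemma real_rank_zero_staircase: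
  assumes rr: "real_rank_zero A" and w: "self_adjoint A w" "cnorm A w < r" and l: "(4::nat) \<le> l"
  obtains q :: "nat => 'a" where "!!k. projection A (q k)"
    "!!k k'. k < k' ==> q k \<otimes> q k' = q k' \<and> q k' \<otimes> q k = q k'"
    "cnorm A (w \<oplus> of_real r \<odot> \<one> \<ominus> of_real (r / (4 * l)) \<odot> (\<Oplus>k\<in>{1..<8*l}. q k))
      \<le> 3 * (r / (4 * l))"
    "!!k. k \<in> {3*l..<5*l} ==>
      cnorm A ((\<one> \<ominus> q k) \<otimes> (w \<oplus> of_real (r/2) \<odot> \<one>) \<otimes> (\<one> \<ominus> q k)) \<le> 7/8 * r"
    "!!k. k \<in> {3*l..<5*l} ==>
      cnorm A (q k \<otimes> (w \<oplus> of_real (-r/2) \<odot> \<one>) \<otimes> q k) \<le> 7/8 * r"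
proof -
  have wc [simp]: "w \<in> carrier A" using w by (simp add: self_adjoint_def)
  have r0: "r > 0" using w(2) cnorm_nonneg[OF wc] by linarith
  define s where "s = r / (4 * l)"
  have s0: "s > 0" using r0 l by (simp add: s_def)
  have s16: "s \<le> r / 16" unfolding s_def using r0 l by (intro divide_left_mono) auto
  have sl: "4 * real l * s = r" using l by (simp add: s_def)
  have "min s (r - cnorm A w) > 0" using s0 w by simp
  then obtain y where y: "self_adjoint A y" "finite (spectrum A y)" "cnorm A (w \<ominus> y) < min s (r - cnorm A w)"
    using rr w(1) unfolding real_rank_zero_def by blast
  have yc [simp]: "y \<in> carrier A" using y by (simp add: self_adjoint_def)
  have "cnorm A y < r" using y(3) cnorm_le_diff[of y w] by (simp add: cnorm_diff_commute[of y w])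
  then interpret Y: functional_calculus A y r by unfold_locales (use y in auto)
  define \<theta> where "\<theta> = (\<lambda>k::nat. - r + real k * s)"
  have "\<exists>l. \<theta> k < l \<and> l < \<theta> k + s/4 \<and> complex_of_real l \<notin> spectrum A y" for k
  proof -
    have "finite (complex_of_real -` spectrum A y)"
      by (intro finite_vimageI y) (auto simp: inj_def)
    moreover have "infinite {\<theta> k<..<\<theta> k + s/4}" using s0 by (intro infinite_Ioo) simp
    ultimately have "infinite ({\<theta> k<..<\<theta> k + s/4} - complex_of_real -` spectrum A y)" by (rule Diff_infinite_finite)
    then have "{\<theta> k<..<\<theta> k + s/4} - complex_of_real -` spectrum A y \<noteq> {}" by (metis finite.emptyI)
    then show ?thesis by auto
  qed
  then obtain lam where lam: "!!k. \<theta> k < lam k" "!!k. lam k < \<theta> k + s/4"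
    "!!k. complex_of_real (lam k) \<notin> spectrum A y" by metis
  have "\<exists>e>0. \<forall>h. 0 < h --> h \<le> e --> projection A (Y.fc (ramp (lam k) h))" for k
  proof -
    have "of_real (lam k) \<odot> \<one> \<ominus> y \<in> Units A" using lam(3)[of k] by (simp add: spectrum_def)
    then show ?thesis by (rule Y.gap_projection) blast
  qed
  then obtain e where e: "!!k. e k > 0"
    "!!k h. 0 < h ==> h \<le> e k ==> projection A (Y.fc (ramp (lam k) h))" by metis
  define eta where "eta = (\<lambda>k. min (e k) (s/4))"
  have eta: "eta k > 0" "eta k \<le> s/4" "eta k \<le> e k" for k using e(1)[of k] s0 by (auto simp: eta_def)
  define rho where "rho = (\<lambda>k. ramp (lam k) (eta k))"
  have rc: "continuous_on S (rho k)" for S k unfolding rho_def using eta by (intro ramp_continuous)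
  define q where "q = (\<lambda>k. Y.fc (rho k))"
  have pq: "projection A (q k)" for k unfolding q_def rho_def using eta by (intro e)
  have qc [simp]: "q k \<in> carrier A" for k using pq by (simp add: projection_def self_adjoint_def)
  have r01: "0 \<le> rho k x" "rho k x \<le> 1" for k x by (auto simp: rho_def ramp_range)
  have rz: "rho k x = 0" if "x \<le> \<theta> k" for k x
    unfolding rho_def using that lam(1)[of k] eta[of k] by (intro ramp_eq_0) auto
  have r1: "rho k x = 1" if "\<theta> k + s/2 \<le> x" for k x
    unfolding rho_def using that lam(2)[of k] eta[of k] by (intro ramp_eq_1) auto
  have chain: "q k \<otimes> q k' = q k' \<and> q k' \<otimes> q k = q k'" if "k < k'" for k k'
  proof -
    have "\<theta> k + s \<le> \<theta> k'"
    proof -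
      have "(real k + 1) * s \<le> real k' * s" using that s0 by (intro mult_right_mono) auto
      then show ?thesis by (simp add: \<theta>_def algebra_simps)
    qed
    then have eq: "rho k x * rho k' x = rho k' x" for x
      using rz[of x k'] r1[of k x] s0 by (cases "x \<le> \<theta> k'") auto
    have "q k \<otimes> q k' = q k'" unfolding q_def Y.fc_mult[OF rc rc, symmetric] eq ..
    moreover have "q k' \<otimes> q k = q k'"
      unfolding q_def Y.fc_mult[OF rc rc, symmetric] mult.commute[of "rho k' _"] eq ..
    ultimately show ?thesis ..
  qed
  define f where "f = (\<lambda>x. x + r - s * (\<Sum>k\<in>{1..<8*l}. rho k x))"
  have fb: "\<bar>f x\<bar> \<le> 2 * s" if x: "x \<in> {-r..r}" for x
  proof -
    define v where "v = (x + r) / s"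
    have v0: "0 \<le> v" using x s0 by (simp add: v_def)
    have vs: "v * s = x + r" using s0 by (simp add: v_def)
    have v8: "v \<le> 8 * real l"
    proof -
      have "v * s \<le> (8 * real l) * s" using x sl vs by simp
      then show ?thesis using s0 by simp
    qed
    have a1: "rho k x = 1" if "real k + 1 \<le> v" for k
    proof -
      have "(real k + 1) * s \<le> x + r" using mult_right_mono[OF that, of s] s0 vs by simp
      then show ?thesis using s0 by (intro r1) (simp add: \<theta>_def algebra_simps)
    qed
    have a0: "rho k x = 0" if "v \<le> real k" for k
    proof -
      have "x + r \<le> real k * s" using mult_right_mono[OF that, of s] s0 vs by simp
      then show ?thesis by (intro rz) (simp add: \<theta>_def)
    qed
    have lo: "v - 2 \<le> (\<Sum>k\<in>{1..<8*l}. rho k x)"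
      using sum_step_lower[of "\<lambda>k. rho k x" v "8*l", OF r01(1) a1 v0] v8 by simp
    have up: "(\<Sum>k\<in>{1..<8*l}. rho k x) \<le> v"
      using sum_step_upper[of "\<lambda>k. rho k x" v "8*l", OF r01(2) a0 v0] v0 by simp
    have "s * (v - 2) \<le> s * (\<Sum>k\<in>{1..<8*l}. rho k x)" using lo s0 by (intro mult_left_mono) auto
    then have "v * s - 2 * s \<le> s * (\<Sum>k\<in>{1..<8*l}. rho k x)" by (simp only: algebra_simps)
    moreover have "s * (\<Sum>k\<in>{1..<8*l}. rho k x) \<le> v * s"
      using mult_left_mono[OF up, of s] s0 by (simp only: mult.commute[of v])
    ultimately show ?thesis unfolding f_def vs by linarith
  qed
  have sumc: "continuous_on {-r..r} (\<lambda>x. \<Sum>k\<in>{1..<8*l}. rho k x)" by (intro continuous_intros rc)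
  have fcf: "continuous_on {-r..r} f" unfolding f_def by (intro continuous_intros rc)
  have Qc: "(\<Oplus>k\<in>{1..<8*l}. q k) \<in> carrier A" by (intro finsum_closed) auto
  have ff: "Y.fc f = y \<oplus> of_real r \<odot> \<one> \<ominus> of_real s \<odot> (\<Oplus>k\<in>{1..<8*l}. q k)"
  proof -
    have "Y.fc (\<lambda>x. \<Sum>k\<in>{1..<8*l}. rho k x) = (\<Oplus>k\<in>{1..<8*l}. q k)"
      unfolding q_def by (rule Y.fc_sum) (auto intro: rc)
    then have 1: "Y.fc (\<lambda>x. s * (\<Sum>k\<in>{1..<8*l}. rho k x)) = of_real s \<odot> (\<Oplus>k\<in>{1..<8*l}. q k)"
      using Y.fc_scale[OF sumc] by simp
    have 2: "Y.fc (\<lambda>x. x + r) = y \<oplus> of_real r \<odot> \<one>"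
      using Y.fc_add[of "\<lambda>x. x" "\<lambda>x. r"] by (simp add: Y.fc_id Y.fc_const)
    have c1: "continuous_on {-r..r} (\<lambda>x. x + r)" by (intro continuous_intros)
    have c2: "continuous_on {-r..r} (\<lambda>x. s * (\<Sum>k\<in>{1..<8*l}. rho k x))" by (intro continuous_intros rc)
    show ?thesis unfolding f_def Y.fc_diff[OF c1 c2] 1 2 ..
  qed
  have dec: "w \<oplus> of_real r \<odot> \<one> \<ominus> of_real s \<odot> (\<Oplus>k\<in>{1..<8*l}. q k) = (w \<ominus> y) \<oplus> Y.fc f"
    unfolding ff using Qc by (simp add: cs)
  have b1: "cnorm A (w \<oplus> of_real r \<odot> \<one> \<ominus> of_real s \<odot> (\<Oplus>k\<in>{1..<8*l}. q k)) \<le> 3 * s"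
    unfolding dec using cnorm_triangle[of "w \<ominus> y" "Y.fc f"] Y.fc_bound[OF fcf fb] y(3) fcf by simp
  have compress: "cnorm A (p \<otimes> (w \<oplus> of_real c \<odot> \<one>) \<otimes> p) \<le> s + B"
    if g: "continuous_on {-r..r} g" "p = Y.fc g" "!!x. x \<in> {-r..r} ==> \<bar>g x\<bar> \<le> 1"
      "!!x. x \<in> {-r..r} ==> \<bar>g x * (x + c) * g x\<bar> \<le> B" for p g c B
  proof -
    have pc [simp]: "p \<in> carrier A" using g by simp
    have pn: "cnorm A p \<le> 1" unfolding g(2) by (rule Y.fc_bound[OF g(1,3)])
    have xc: "continuous_on {-r..r} (\<lambda>x. x + c)" by (intro continuous_intros)
    have gxc: "continuous_on {-r..r} (\<lambda>x. g x * (x + c))" by (intro continuous_intros g)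
    have xx: "Y.fc (\<lambda>x. x + c) = y \<oplus> of_real c \<odot> \<one>"
      using Y.fc_add[of "\<lambda>x. x" "\<lambda>x. c"] by (simp add: Y.fc_id Y.fc_const)
    have 1: "Y.fc (\<lambda>x. g x * (x + c) * g x) = p \<otimes> (y \<oplus> of_real c \<odot> \<one>) \<otimes> p"
      using Y.fc_mult[OF gxc g(1)] Y.fc_mult[OF g(1) xc] by (simp add: xx g(2))
    have 2: "p \<otimes> (w \<oplus> of_real c \<odot> \<one>) \<otimes> p
        = p \<otimes> (w \<ominus> y) \<otimes> p \<oplus> p \<otimes> (y \<oplus> of_real c \<odot> \<one>) \<otimes> p"
    proof -
      have "w \<oplus> of_real c \<odot> \<one> = (w \<ominus> y) \<oplus> (y \<oplus> of_real c \<odot> \<one>)"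
        by (simp add: cs)
      then show ?thesis by (simp only:) (simp add: r_distr l_distr)
    qed
    have "cnorm A (p \<otimes> (w \<ominus> y) \<otimes> p) \<le> cnorm A (p \<otimes> (w \<ominus> y)) * cnorm A p" by (intro cnorm_mult) auto
    also have "\<dots> \<le> cnorm A (p \<otimes> (w \<ominus> y))" using pn by (intro mult_left_le cnorm_nonneg) auto
    also have "\<dots> \<le> cnorm A p * cnorm A (w \<ominus> y)" by (intro cnorm_mult) auto
    also have "\<dots> \<le> cnorm A (w \<ominus> y)" using pn by (intro mult_left_le_one_le cnorm_nonneg) auto
    also have "\<dots> \<le> s" using y(3) by simp
    finally have 3: "cnorm A (p \<otimes> (w \<ominus> y) \<otimes> p) \<le> s" .
    have "continuous_on {-r..r} (\<lambda>x. g x * (x + c) * g x)" by (intro continuous_intros g)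
    from Y.fc_bound[OF this g(4)] have "cnorm A (p \<otimes> (y \<oplus> of_real c \<odot> \<one>) \<otimes> p) \<le> B"
      unfolding 1 .
    then show ?thesis unfolding 2
      using cnorm_triangle[of "p \<otimes> (w \<ominus> y) \<otimes> p" "p \<otimes> (y \<oplus> of_real c \<odot> \<one>) \<otimes> p"] 3 by simp
  qed
  have thl: "- r/4 \<le> \<theta> k" "\<theta> k \<le> r/4 - s" if k: "k \<in> {3*l..<5*l}" for k
  proof -
    have "(3 * real l) * s \<le> real k * s" using k s0 by (intro mult_right_mono) auto
    then show "- r/4 \<le> \<theta> k" using sl by (simp add: \<theta>_def)
    have "real k + 1 \<le> 5 * real l" using k by auto
    then have "(real k + 1) * s \<le> (5 * real l) * s" using s0 by (intro mult_right_mono) auto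
    then show "\<theta> k \<le> r/4 - s" using sl by (simp add: \<theta>_def algebra_simps)
  qed
  have square_bound: "\<bar>g * z * g\<bar> \<le> B" if "\<bar>g\<bar> \<le> 1" "\<bar>z\<bar> \<le> B" for g z B :: real
  proof -
    have "\<bar>g\<bar> * \<bar>z\<bar> * \<bar>g\<bar> \<le> 1 * B * 1" using that by (intro mult_mono) auto
    then show ?thesis by (simp add: abs_mult)
  qed
  have b2: "cnorm A ((\<one> \<ominus> q k) \<otimes> (w \<oplus> of_real (r/2) \<odot> \<one>) \<otimes> (\<one> \<ominus> q k)) \<le> 7/8 * r"
    if k: "k \<in> {3*l..<5*l}" for k
  proof -
    have "cnorm A ((\<one> \<ominus> q k) \<otimes> (w \<oplus> of_real (r/2) \<odot> \<one>) \<otimes> (\<one> \<ominus> q k)) \<le> s + 3/4 * r"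
    proof (rule compress[of "\<lambda>x. 1 - rho k x"])
      show "continuous_on {-r..r} (\<lambda>x. 1 - rho k x)" by (intro continuous_intros rc)
      show "\<one> \<ominus> q k = Y.fc (\<lambda>x. 1 - rho k x)"
        using Y.fc_diff[OF _ rc, of "\<lambda>x. 1" k] by (simp add: Y.fc_const q_def)
      fix x assume x: "x \<in> {-r..r}"
      show 1: "\<bar>1 - rho k x\<bar> \<le> 1" using r01[of k x] by simp
      show "\<bar>(1 - rho k x) * (x + r/2) * (1 - rho k x)\<bar> \<le> 3/4 * r"
      proof (cases "\<theta> k + s/2 \<le> x")
        case False
        then have "\<bar>x + r/2\<bar> \<le> 3/4 * r" using x thl(2)[OF k] s0 r0 unfolding atLeastAtMost_iff by linarith
        then show ?thesis by (rule square_bound[OF 1])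
      qed (use r1 r0 in auto)
    qed
    then show ?thesis using s16 r0 by linarith
  qed
  have b3: "cnorm A (q k \<otimes> (w \<oplus> of_real (-r/2) \<odot> \<one>) \<otimes> q k) \<le> 7/8 * r"
    if k: "k \<in> {3*l..<5*l}" for k
  proof -
    have "cnorm A (q k \<otimes> (w \<oplus> of_real (-r/2) \<odot> \<one>) \<otimes> q k) \<le> s + 3/4 * r"
    proof (rule compress[of "rho k"])
      show "continuous_on {-r..r} (rho k)" by (rule rc)
      show "q k = Y.fc (rho k)" by (simp add: q_def)
      fix x assume x: "x \<in> {-r..r}"
      show 1: "\<bar>rho k x\<bar> \<le> 1" using r01[of k x] by simp
      show "\<bar>rho k x * (x + -r/2) * rho k x\<bar> \<le> 3/4 * r"
      proof (cases "x \<le> \<theta> k")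
        case False
        then have "\<bar>x + -r/2\<bar> \<le> 3/4 * r" using x thl(1)[OF k] r0 unfolding atLeastAtMost_iff by linarith
        then show ?thesis by (rule square_bound[OF 1])
      qed (use rz r0 in auto)
    qed
    then show ?thesis using s16 r0 by linarith
  qed
  show thesis using that[of q] pq chain b1 b2 b3 unfolding s_def by blast
qed

definition comm :: "'a => 'a => 'a"
  where "comm p b = p \<otimes> b \<ominus> b \<otimes> p"

lemma comm_closed [simp, intro]: "p \<in> carrier A ==> b \<in> carrier A ==> comm p b \<in> carrier A"
  by (simp add: comm_def)

lemma comm_add: "[|p \<in> carrier A; q \<in> carrier A; b \<in> carrier A|] ==> comm (p \<oplus> q) b = comm p b \<oplus> comm q b"
  by (simp add: comm_def cs)

end

context tracial_algebra
begin

lemma norm2_sq_add: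
  assumes "x \<in> carrier A" "y \<in> carrier A"
  shows "(norm2 A w (x \<oplus> y))\<^sup>2 = (norm2 A w x)\<^sup>2 + (norm2 A w y)\<^sup>2 + 2 * Re (w (star A x \<otimes> y))"
proof -
  have "w (star A y \<otimes> x) = cnj (w (star A x \<otimes> y))"
    using st_star[of "star A x \<otimes> y"] assms by (simp add: star_simps)
  then show ?thesis using st_expand[of x y 1] assms by (simp add: norm2_sq)
qed

text \<open>The inner product is \<open>\<parallel>q b (1 - p)\<parallel>\<^sup>2 + \<parallel>(1 - p) b q\<parallel>\<^sup>2\<close>.\<close>

lemma commutator_inner_nonneg:
  assumes p: "projection A p" and q: "projection A q" and pq: "p \<otimes> q = q" "q \<otimes> p = q"
    and b [simp]: "b \<in> carrier A"
  shows "0 \<le> Re (w (star A (comm p b) \<otimes> comm q b))"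
proof -
  have [simp]: "p \<in> carrier A" "q \<in> carrier A" "star A p = p" "star A q = q" "p \<otimes> p = p" "q \<otimes> q = q"
    using p q by (auto simp: projection_def self_adjoint_def)
  have as: "p \<otimes> (p \<otimes> z) = p \<otimes> z" "q \<otimes> (q \<otimes> z) = q \<otimes> z" "p \<otimes> (q \<otimes> z) = q \<otimes> z" "q \<otimes> (p \<otimes> z) = q \<otimes> z"
    if "z \<in> carrier A" for z using that by (simp_all add: m_assoc[symmetric] pq)
  define r where "r = \<one> \<ominus> p"
  have r [simp]: "r \<in> carrier A" "star A r = r" "r \<otimes> r = r"
    by (simp_all add: r_def cs)
  have ra: "r \<otimes> (r \<otimes> z) = r \<otimes> z" if "z \<in> carrier A" for z using that by (simp add: m_assoc[symmetric])
  let ?x = "star A b \<otimes> q \<otimes> b" and ?u = "star A b \<otimes> p \<otimes> b \<otimes> q" and ?v = "star A b \<otimes> b \<otimes> q"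
  define z1 where "z1 = q \<otimes> b \<otimes> r"
  define z2 where "z2 = r \<otimes> b \<otimes> q"
  have "star A z1 \<otimes> z1 = r \<otimes> (?x \<otimes> r)" by (simp add: z1_def star_mult m_assoc as)
  then have "w (star A z1 \<otimes> z1) = w (?x \<otimes> r)" using trace[of r "?x \<otimes> r"] by (simp add: m_assoc)
  also have "?x \<otimes> r = ?x \<ominus> ?x \<otimes> p" by (simp add: r_def diff_distr_right)
  finally have 1: "w (star A z1 \<otimes> z1) = w ?x - w (p \<otimes> ?x)" using trace[of ?x p] by (simp add: st)
  have "star A z2 \<otimes> z2 = q \<otimes> (star A b \<otimes> r \<otimes> b \<otimes> q)" by (simp add: z2_def star_mult m_assoc ra)
  then have "w (star A z2 \<otimes> z2) = w (star A b \<otimes> r \<otimes> b \<otimes> q)"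
    using trace[of q "star A b \<otimes> r \<otimes> b \<otimes> q"] by (simp add: m_assoc)
  also have "star A b \<otimes> r \<otimes> b \<otimes> q = ?v \<ominus> ?u" by (simp add: r_def cs)
  finally have 2: "w (star A z2 \<otimes> z2) = w ?v - w ?u" by (simp add: st)
  have "star A (comm p b) \<otimes> comm q b = ?x \<ominus> ?u \<ominus> p \<otimes> ?x \<oplus> p \<otimes> ?v"
    by (simp add: comm_def cs as)
  moreover have "w (p \<otimes> ?v) = w ?v" using trace[of p ?v] by (simp add: m_assoc pq)
  ultimately have "w (star A (comm p b) \<otimes> comm q b) = w (star A z1 \<otimes> z1) + w (star A z2 \<otimes> z2)"
    by (simp add: st 1 2)
  then show ?thesis using st_pos[of z1] st_pos[of z2] by (simp add: z1_def z2_def)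
qed

text \<open>For a decreasing chain of projections the mixed terms in the square are nonnegative by the
  preceding lemma. This is the source of the gain: the commutator of the sum, which is close to an
  affine function of the given element, bounds the sum of squares of all commutators at once, so among many
  thresholds at least one has a small commutator.\<close>

lemma chain_commutators:
  fixes q :: "nat => 'a"
  assumes q: "!!k. projection A (q k)"
    and chain: "!!k k'. k < k' ==> q k \<otimes> q k' = q k' \<and> q k' \<otimes> q k = q k'"
    and b [simp]: "b \<in> carrier A"
  shows "(\<Sum>k\<in>{1..<n}. (norm2 A w (comm (q k) b))\<^sup>2) \<le> (norm2 A w (comm (\<Oplus>k\<in>{1..<n}. q k) b))\<^sup>2"
proof (induction n)
  case (Suc n)
  have qc [simp]: "q k \<in> carrier A" for k using q by (simp add: projection_def self_adjoint_def)
  have Qc [simp]: "(\<Oplus>k\<in>S. q k) \<in> carrier A" for S :: "nat set" by (intro finsum_closed) auto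
  show ?case
  proof (cases "n = 0")
    case False
    then have ins: "{1..<Suc n} = insert n {1..<n}" by auto
    have Q: "(\<Oplus>k\<in>{1..<Suc m}. q k) = q m \<oplus> (\<Oplus>k\<in>{1..<m}. q k)" if "m \<noteq> 0" for m
    proof -
      have "{1..<Suc m} = insert m {1..<m}" using that by auto
      then show ?thesis by (simp add: finsum_insert)
    qed
    have inner: "0 \<le> Re (w (star A (comm (\<Oplus>k\<in>{1..<m}. q k) b) \<otimes> comm (q n) b))" if "m \<le> n" for m
      using that
    proof (induction m)
      case (Suc m)
      show ?case
      proof (cases "m = 0")
        case False
        have "0 \<le> Re (w (star A (comm (q m) b) \<otimes> comm (q n) b))"
          using chain[of m n] Suc.prems by (intro commutator_inner_nonneg q) auto
        then show ?thesis using Suc unfolding Q[OF False]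
          by (simp add: comm_add star_add l_distr st)
      qed (simp add: comm_def st)
    qed (simp add: comm_def st)
    have "comm (\<Oplus>k\<in>{1..<Suc n}. q k) b = comm (\<Oplus>k\<in>{1..<n}. q k) b \<oplus> comm (q n) b"
      unfolding Q[OF False] by (simp add: comm_add a_comm)
    then have "(norm2 A w (comm (\<Oplus>k\<in>{1..<Suc n}. q k) b))\<^sup>2
        \<ge> (norm2 A w (comm (\<Oplus>k\<in>{1..<n}. q k) b))\<^sup>2 + (norm2 A w (comm (q n) b))\<^sup>2"
      using inner[of n] by (simp add: norm2_sq_add)
    then show ?thesis using Suc unfolding ins by simp
  qed (simp)
qed simp

lemma norm2_comm_le: "p \<in> carrier A ==> b \<in> carrier A ==> norm2 A w (comm p b) \<le> 2 * cnorm A p * norm2 A w b"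
  using norm2_diff_le[of "p \<otimes> b" "b \<otimes> p"] norm2_mult_le[of p b] norm2_mult_le'[of b p]
  by (simp add: comm_def mult_ac)

text \<open>Among the projections with threshold in the middle window, one commutes well on average.\<close>

lemma almost_central_cut:
  fixes b :: "'t => 'a"
  assumes rr: "real_rank_zero A" and h: "self_adjoint A h" "cnorm A h < r" and l: "(4::nat) \<le> l"
    and F: "finite F" "!!t. t \<in> F ==> b t \<in> carrier A"
  obtains q where "projection A q"
    "cnorm A ((\<one> \<ominus> q) \<otimes> (h \<oplus> of_real (r/2) \<odot> \<one>) \<otimes> (\<one> \<ominus> q)) \<le> 7/8 * r"
    "cnorm A (q \<otimes> (h \<oplus> of_real (-r/2) \<odot> \<one>) \<otimes> q) \<le> 7/8 * r"
    "(\<Sum>t\<in>F. (norm2 A w (comm q (b t)))\<^sup>2) \<le>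
      (\<Sum>t\<in>F. (norm2 A w (comm h (b t)) * (4 * l) / r + 6 * norm2 A w (b t))\<^sup>2) / (2 * l)"
proof -
  have hc [simp]: "h \<in> carrier A" using h by (simp add: self_adjoint_def)
  have r0: "r > 0" using h(2) cnorm_nonneg[OF hc] by linarith
  define s where "s = r / (4 * l)"
  have s0: "s > 0" using r0 l by (simp add: s_def)
  obtain q :: "nat => 'a" where q: "!!k. projection A (q k)"
    and chain: "!!k k'. k < k' ==> q k \<otimes> q k' = q k' \<and> q k' \<otimes> q k = q k'"
    and app: "cnorm A (h \<oplus> of_real r \<odot> \<one> \<ominus> of_real s \<odot> (\<Oplus>k\<in>{1..<8*l}. q k)) \<le> 3 * s"
    and lo: "!!k. k \<in> {3*l..<5*l} ==>
      cnorm A ((\<one> \<ominus> q k) \<otimes> (h \<oplus> of_real (r/2) \<odot> \<one>) \<otimes> (\<one> \<ominus> q k)) \<le> 7/8 * r"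
    and hi: "!!k. k \<in> {3*l..<5*l} ==>
      cnorm A (q k \<otimes> (h \<oplus> of_real (-r/2) \<odot> \<one>) \<otimes> q k) \<le> 7/8 * r"
    using real_rank_zero_staircase[OF rr h l] unfolding s_def by blast
  have qc [simp]: "q k \<in> carrier A" for k using q by (simp add: projection_def self_adjoint_def)
  define Q where "Q = (\<Oplus>k\<in>{1..<8*l}. q k)"
  have Qc [simp]: "Q \<in> carrier A" unfolding Q_def by (intro finsum_closed) auto
  define d where "d = h \<oplus> of_real r \<odot> \<one> \<ominus> of_real s \<odot> Q"
  have dc [simp]: "d \<in> carrier A" by (simp add: d_def)
  have dn: "cnorm A d \<le> 3 * s" using app by (simp add: d_def Q_def)
  have Qb: "norm2 A w (comm Q z) \<le> norm2 A w (comm h z) * (4 * l) / r + 6 * norm2 A w z"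
    if z [simp]: "z \<in> carrier A" for z
  proof -
    have "of_real s \<odot> comm Q z = comm h z \<ominus> comm d z"
      unfolding comm_def d_def by (simp add: cs)
    then have "s * norm2 A w (comm Q z) = norm2 A w (comm h z \<ominus> comm d z)"
      using norm2_scal[of "comm Q z" "complex_of_real s"] s0 by simp
    also have "\<dots> \<le> norm2 A w (comm h z) + norm2 A w (comm d z)" by (intro norm2_diff_le) auto
    also have "\<dots> \<le> norm2 A w (comm h z) + 2 * cnorm A d * norm2 A w z"
      by (intro add_left_mono norm2_comm_le) auto
    also have "\<dots> \<le> norm2 A w (comm h z) + 2 * (3 * s) * norm2 A w z"
      using dn by (intro add_left_mono mult_right_mono mult_left_mono) auto
    finally have "norm2 A w (comm Q z) \<le> (norm2 A w (comm h z) + 2 * (3 * s) * norm2 A w z) / s"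
      using s0 by (simp add: pos_le_divide_eq mult.commute)
    also have "\<dots> = norm2 A w (comm h z) * (4 * l) / r + 6 * norm2 A w z"
    proof -
      have "x / s = x * (4 * l) / r" for x using l by (simp add: s_def)
      from this[of "norm2 A w (comm h z)"] show ?thesis using s0 by (simp add: add_divide_distrib)
    qed
    finally show ?thesis .
  qed
  define S where "S = (\<lambda>k. \<Sum>t\<in>F. (norm2 A w (comm (q k) (b t)))\<^sup>2)"
  define T where "T = (\<Sum>t\<in>F. (norm2 A w (comm h (b t)) * (4 * l) / r + 6 * norm2 A w (b t))\<^sup>2)"
  have "(\<Sum>k\<in>{3*l..<5*l}. S k) \<le> (\<Sum>k\<in>{1..<8*l}. S k)"
    using l by (intro sum_mono2) (auto simp: S_def intro: sum_nonneg)
  also have "\<dots> = (\<Sum>t\<in>F. \<Sum>k\<in>{1..<8*l}. (norm2 A w (comm (q k) (b t)))\<^sup>2)"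
    unfolding S_def by (rule sum.swap)
  also have "\<dots> \<le> (\<Sum>t\<in>F. (norm2 A w (comm Q (b t)))\<^sup>2)"
    unfolding Q_def by (intro sum_mono chain_commutators[OF q chain] F)
  also have "\<dots> \<le> T"
    unfolding T_def using F by (intro sum_mono power_mono Qb) auto
  finally have tot: "(\<Sum>k\<in>{3*l..<5*l}. S k) \<le> T" .
  have "\<exists>k\<in>{3*l..<5*l}. S k \<le> T / (2 * l)"
  proof (rule ccontr)
    assume "\<not> ?thesis"
    then have less: "!!k. k \<in> {3*l..<5*l} ==> T / (2 * l) < S k" by (meson not_le)
    have "(\<Sum>k\<in>{3*l..<5*l}. T / (2 * l)) < (\<Sum>k\<in>{3*l..<5*l}. S k)"
      by (rule sum_strict_mono[OF _ _ less]) (use l in auto)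
    moreover have "(\<Sum>k\<in>{3*l..<5*l}. T / (2 * l)) = T" using l by simp
    ultimately show False using tot by simp
  qed
  then obtain k where k: "k \<in> {3*l..<5*l}" "S k \<le> T / (2 * l)" by blast
  show thesis
    by (rule that[OF q lo[OF k(1)] hi[OF k(1)]]) (use k(2) in \<open>simp add: S_def T_def\<close>)
qed

end

section \<open>Bounded families modulo the trace norm\<close>

definition bdd_fam :: "'i set => ('i => 'a cstar_algebra) => ('i => 'a) => bool"
  where "bdd_fam I A z \<longleftrightarrow> (\<forall>i\<in>I. z i \<in> carrier (A i)) \<and> (\<exists>C. \<forall>i\<in>I. cnorm (A i) (z i) \<le> C)"

definition eqv ::
    "'i filter => ('i => 'a cstar_algebra) => ('i => 'a => complex) => ('i => 'a) => ('i => 'a) => bool"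
  where "eqv \<alpha> A \<rho> z z' \<longleftrightarrow> ((\<lambda>i. norm2 (A i) (\<rho> i) (z i \<ominus>\<^bsub>A i\<^esub> z' i)) \<longlongrightarrow> 0) \<alpha>"

text \<open>A choice of representatives for the values of a unital *-homomorphism into the tracial
  ultraproduct.\<close>

definition asym_hom ::
    "'i set => 'i filter => ('i => 'a cstar_algebra) => ('i => 'a => complex) =>
      't cstar_algebra => ('t => 'i => 'a) => bool"
  where "asym_hom I \<alpha> A \<rho> T x \<longleftrightarrow>
    (\<forall>t\<in>carrier T. bdd_fam I A (x t)) \<and>
    (\<forall>s\<in>carrier T. \<forall>t\<in>carrier T. eqv \<alpha> A \<rho> (x (s \<oplus>\<^bsub>T\<^esub> t)) (\<lambda>i. x s i \<oplus>\<^bsub>A i\<^esub> x t i)) \<and>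
    (\<forall>s\<in>carrier T. \<forall>t\<in>carrier T. eqv \<alpha> A \<rho> (x (s \<otimes>\<^bsub>T\<^esub> t)) (\<lambda>i. x s i \<otimes>\<^bsub>A i\<^esub> x t i)) \<and>
    (\<forall>c. \<forall>t\<in>carrier T. eqv \<alpha> A \<rho> (x (c \<odot>\<^bsub>T\<^esub> t)) (\<lambda>i. c \<odot>\<^bsub>A i\<^esub> x t i)) \<and>
    (\<forall>t\<in>carrier T. eqv \<alpha> A \<rho> (x (star T t)) (\<lambda>i. star (A i) (x t i))) \<and>
    eqv \<alpha> A \<rho> (x \<one>\<^bsub>T\<^esub>) (\<lambda>i. \<one>\<^bsub>A i\<^esub>)"

locale family =
  fixes I :: "'i set" and \<alpha> :: "'i filter" and A :: "'i => 'a cstar_algebra" and \<rho> :: "'i => 'a => complex"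
  assumes nontrivial: "nontrivial_ultrafilter_on I \<alpha>"
    and fam: "!!i. i \<in> I ==> tracial_algebra (A i) (\<rho> i)"
begin

abbreviation mult_at :: "'a => 'i => 'a => 'a"  (\<open>_ \<otimes>\<^sub>_ _\<close> [70, 1000, 71] 70)
  where "u \<otimes>\<^sub>i v \<equiv> u \<otimes>\<^bsub>A i\<^esub> v"
abbreviation add_at :: "'a => 'i => 'a => 'a"  (\<open>_ \<oplus>\<^sub>_ _\<close> [65, 1000, 66] 65)
  where "u \<oplus>\<^sub>i v \<equiv> u \<oplus>\<^bsub>A i\<^esub> v"
abbreviation diff_at :: "'a => 'i => 'a => 'a"  (\<open>_ \<ominus>\<^sub>_ _\<close> [65, 1000, 66] 65)
  where "u \<ominus>\<^sub>i v \<equiv> u \<ominus>\<^bsub>A i\<^esub> v"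
abbreviation scal_at :: "complex => 'i => 'a => 'a"  (\<open>_ \<odot>\<^sub>_ _\<close> [70, 1000, 71] 70)
  where "c \<odot>\<^sub>i u \<equiv> c \<odot>\<^bsub>A i\<^esub> u"
abbreviation one_at :: "'i => 'a"  (\<open>\<one>\<^sub>_\<close> [1000] 1000)
  where "\<one>\<^sub>i \<equiv> \<one>\<^bsub>A i\<^esub>"
abbreviation zero_at :: "'i => 'a"  (\<open>\<zero>\<^sub>_\<close> [1000] 1000)
  where "\<zero>\<^sub>i \<equiv> \<zero>\<^bsub>A i\<^esub>"
abbreviation nrm :: "'i => 'a => real"
  where "nrm i \<equiv> norm2 (A i) (\<rho> i)"

lemma not_bot: "\<alpha> \<noteq> bot"
  and in_I: "\<forall>\<^sub>F i in \<alpha>. i \<in> I"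
  and ultra: "(\<forall>\<^sub>F i in \<alpha>. P i) \<or> (\<forall>\<^sub>F i in \<alpha>. \<not> P i)"
  using nontrivial by (auto simp: nontrivial_ultrafilter_on_def ultrafilter_on_def)

text \<open>Countable incompleteness of the ultrafilter lets a countable family of properties be
  satisfied along an index that tends to infinity.\<close>

lemma diagonal:
  assumes "!!n::nat. \<forall>\<^sub>F i in \<alpha>. P n i"
  obtains N where "\<forall>\<^sub>F i in \<alpha>. P (N i) i" "!!n. \<forall>\<^sub>F i in \<alpha>. n \<le> N i"
proof -
  obtain E :: "nat => 'i set" where E: "!!n. \<forall>\<^sub>F i in \<alpha>. i \<in> E n" "(\<Inter>n. E n) = {}"
    using nontrivial unfolding nontrivial_ultrafilter_on_def by blast
  define G where "G = (\<lambda>n. {i. \<forall>m\<le>n. P m i \<and> i \<in> E m})"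
  have Gev: "\<forall>\<^sub>F i in \<alpha>. i \<in> G n" for n
  proof -
    have "\<forall>\<^sub>F i in \<alpha>. \<forall>m\<in>{..n}. P m i \<and> i \<in> E m"
      using assms E by (intro eventually_ball_finite) (auto intro: eventually_conj)
    then show ?thesis by (rule eventually_mono) (auto simp: G_def)
  qed
  define N where "N = (\<lambda>i. Max {n. i \<in> G n})"
  have fin: "finite {n. i \<in> G n}" for i
  proof -
    obtain m where "i \<notin> E m" using E(2) by blast
    then have "{n. i \<in> G n} \<subseteq> {..<m}" by (auto simp: G_def) (meson not_le)
    then show ?thesis by (rule finite_subset) simp
  qed
  have "P (N i) i" if "i \<in> G 0" for i
  proof -
    have "N i \<in> {n. i \<in> G n}" unfolding N_def using fin[of i] that by (intro Max_in) auto
    then show ?thesis by (auto simp: G_def)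
  qed
  then have "\<forall>\<^sub>F i in \<alpha>. P (N i) i" using Gev[of 0] by (rule eventually_mono[rotated])
  moreover have "n \<le> N i" if "i \<in> G n" for n i
    unfolding N_def using fin[of i] that by (intro Max_ge) auto
  then have "\<forall>\<^sub>F i in \<alpha>. n \<le> N i" for n using Gev[of n] by (rule eventually_mono[rotated])
  ultimately show thesis by (rule that)
qed

lemma ultralimit:
  fixes f :: "'i => complex"
  assumes "\<forall>\<^sub>F i in \<alpha>. cmod (f i) \<le> C"
  obtains l where "(f \<longlongrightarrow> l) \<alpha>"
proof -
  have "compact (cball (0::complex) C)" by simp
  moreover have "filtermap f \<alpha> \<noteq> bot" using not_bot by (simp add: filtermap_bot_iff)
  moreover have "eventually (\<lambda>z. z \<in> cball 0 C) (filtermap f \<alpha>)"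
    using assms by (simp add: eventually_filtermap)
  ultimately obtain l where l: "inf (nhds l) (filtermap f \<alpha>) \<noteq> bot"
    unfolding compact_filter by blast
  have "(f \<longlongrightarrow> l) \<alpha>"
  proof (rule topological_tendstoI, rule ccontr)
    fix S assume S: "open S" "l \<in> S" "\<not> (\<forall>\<^sub>F i in \<alpha>. f i \<in> S)"
    then have "\<forall>\<^sub>F i in \<alpha>. f i \<notin> S" using ultra by blast
    then have "eventually (\<lambda>z. z \<notin> S) (filtermap f \<alpha>)" by (simp add: eventually_filtermap)
    moreover have "eventually (\<lambda>z. z \<in> S) (nhds l)" using S by (metis eventually_nhds)
    ultimately have "eventually (\<lambda>z. False) (inf (nhds l) (filtermap f \<alpha>))"
      unfolding eventually_inf by blast
    then show False using l by (simp add: trivial_limit_def)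
  qed
  then show thesis by (rule that)
qed

abbreviation fam_in :: "('i => 'a) => bool"
  where "fam_in z \<equiv> \<forall>i\<in>I. z i \<in> carrier (A i)"

abbreviation bounded_fam :: "('i => 'a) => bool"
  where "bounded_fam \<equiv> bdd_fam I A"

abbreviation equiv_fam :: "('i => 'a) => ('i => 'a) => bool"  (infix \<open>\<asymp>\<close> 50)
  where "z \<asymp> z' \<equiv> eqv \<alpha> A \<rho> z z'"

abbreviation n2 :: "('i => 'a) => 'i => real"
  where "n2 z i \<equiv> nrm i (z i)"

lemma bddD: "bounded_fam z ==> i \<in> I ==> z i \<in> carrier (A i)"
  by (simp add: bdd_fam_def)

lemma bdd_bound:
  assumes "bounded_fam z" obtains C where "C \<ge> 0" "!!i. i \<in> I ==> cnorm (A i) (z i) \<le> C"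
proof -
  obtain C where "\<forall>i\<in>I. cnorm (A i) (z i) \<le> C" using assms by (auto simp: bdd_fam_def)
  then show thesis by (intro that[of "max 0 C"]) (auto intro: max.coboundedI2)
qed

lemma bdd_add: assumes "bounded_fam z" "bounded_fam y" shows "bounded_fam (\<lambda>i. z i \<oplus>\<^sub>i y i)"
proof -
  obtain C D where "!!i. i \<in> I ==> cnorm (A i) (z i) \<le> C" "!!i. i \<in> I ==> cnorm (A i) (y i) \<le> D"
    using assms bdd_bound by metis
  moreover have "z i \<oplus>\<^sub>i y i \<in> carrier (A i) \<and>
      cnorm (A i) (z i \<oplus>\<^sub>i y i) \<le> cnorm (A i) (z i) + cnorm (A i) (y i)" if "i \<in> I" for i
  proof -
    interpret tracial_algebra "A i" "\<rho> i" by (rule fam[OF that])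
    show ?thesis using cnorm_triangle bddD[OF assms(1) that] bddD[OF assms(2) that] by simp
  qed
  ultimately show ?thesis unfolding bdd_fam_def by (meson add_mono order_trans)
qed

lemma bdd_mult: assumes "bounded_fam z" "bounded_fam y" shows "bounded_fam (\<lambda>i. z i \<otimes>\<^sub>i y i)"
proof -
  obtain C D where C: "C \<ge> 0" "!!i. i \<in> I ==> cnorm (A i) (z i) \<le> C" "!!i. i \<in> I ==> cnorm (A i) (y i) \<le> D"
    using assms bdd_bound by metis
  have "z i \<otimes>\<^sub>i y i \<in> carrier (A i) \<and> cnorm (A i) (z i \<otimes>\<^sub>i y i) \<le> C * D" if "i \<in> I" for i
  proof -
    interpret tracial_algebra "A i" "\<rho> i" by (rule fam[OF that])
    have [simp]: "z i \<in> carrier (A i)" "y i \<in> carrier (A i)" using assms that by (auto simp: bdd_fam_def)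
    have "cnorm (A i) (z i \<otimes>\<^sub>i y i) \<le> cnorm (A i) (z i) * cnorm (A i) (y i)" by (rule cnorm_mult) auto
    also have "\<dots> \<le> C * D" using C that by (intro mult_mono cnorm_nonneg) auto
    finally show ?thesis by simp
  qed
  then show ?thesis unfolding bdd_fam_def by blast
qed

lemma bdd_scal: assumes "bounded_fam z" shows "bounded_fam (\<lambda>i. c \<odot>\<^sub>i z i)"
proof -
  obtain C where C: "!!i. i \<in> I ==> cnorm (A i) (z i) \<le> C" using assms bdd_bound by metis
  have "c \<odot>\<^sub>i z i \<in> carrier (A i) \<and> cnorm (A i) (c \<odot>\<^sub>i z i) \<le> cmod c * C" if "i \<in> I" for i
  proof -
    interpret tracial_algebra "A i" "\<rho> i" by (rule fam[OF that])
    show ?thesis using C[OF that] bddD[OF assms that] by (simp add: cnorm_smult mult_left_mono)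
  qed
  then show ?thesis unfolding bdd_fam_def by blast
qed

lemma bdd_star: assumes "bounded_fam z" shows "bounded_fam (\<lambda>i. star (A i) (z i))"
proof -
  obtain C where C: "!!i. i \<in> I ==> cnorm (A i) (z i) \<le> C" using assms bdd_bound by metis
  have "star (A i) (z i) \<in> carrier (A i) \<and> cnorm (A i) (star (A i) (z i)) \<le> C" if "i \<in> I" for i
  proof -
    interpret tracial_algebra "A i" "\<rho> i" by (rule fam[OF that])
    show ?thesis using C[OF that] bddD[OF assms that] by simp
  qed
  then show ?thesis unfolding bdd_fam_def by blast
qed

lemma bdd_one: "bounded_fam (\<lambda>i. \<one>\<^sub>i)"
proof -
  have "\<one>\<^sub>i \<in> carrier (A i) \<and> cnorm (A i) (\<one>\<^sub>i) \<le> 1" if "i \<in> I" for i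
  proof -
    interpret tracial_algebra "A i" "\<rho> i" by (rule fam[OF that])
    show ?thesis using cnorm_one_le by simp
  qed
  then show ?thesis unfolding bdd_fam_def by blast
qed

lemma bdd_diff: assumes "bounded_fam z" "bounded_fam y" shows "bounded_fam (\<lambda>i. z i \<ominus>\<^sub>i y i)"
proof -
  have "z i \<ominus>\<^sub>i y i = z i \<oplus>\<^sub>i (-1) \<odot>\<^sub>i y i" if "i \<in> I" for i
  proof -
    interpret tracial_algebra "A i" "\<rho> i" by (rule fam[OF that])
    show ?thesis using bddD[OF assms(2) that] by (simp add: minus_eq scal_uminus)
  qed
  then show ?thesis using bdd_add[OF assms(1) bdd_scal[OF assms(2), of "-1"]] by (simp add: bdd_fam_def)
qed

lemma bdd_projection: assumes "!!i. i \<in> I ==> projection (A i) (q i)" shows "bounded_fam q"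
proof -
  have "q i \<in> carrier (A i) \<and> cnorm (A i) (q i) \<le> 1" if "i \<in> I" for i
  proof -
    interpret tracial_algebra "A i" "\<rho> i" by (rule fam[OF that])
    have q: "q i \<in> carrier (A i)" "star (A i) (q i) = q i" "q i \<otimes>\<^sub>i q i = q i"
      using assms[OF that] by (auto simp: projection_def self_adjoint_def)
    have "cnorm (A i) (q i) = (cnorm (A i) (q i))\<^sup>2" using cstar_identity[OF q(1)] q by simp
    then have "cnorm (A i) (q i) = 0 \<or> cnorm (A i) (q i) = 1" by (simp add: power2_eq_square)
    then show ?thesis using q by auto
  qed
  then show ?thesis unfolding bdd_fam_def by blast
qed

lemma n2_nonneg: "fam_in z ==> i \<in> I ==> 0 \<le> n2 z i"
proof -
  assume "fam_in z" and i: "i \<in> I"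
  interpret tracial_algebra "A i" "\<rho> i" by (rule fam[OF i])
  show ?thesis using \<open>fam_in z\<close> i by simp
qed

lemma n2_null_sandwich:
  assumes "fam_in z" "(f \<longlongrightarrow> 0) \<alpha>" "!!i. i \<in> I ==> n2 z i \<le> f i"
  shows "(n2 z \<longlongrightarrow> 0) \<alpha>"
proof (rule tendsto_sandwich[OF _ _ tendsto_const assms(2)])
  show "\<forall>\<^sub>F i in \<alpha>. 0 \<le> n2 z i" using in_I by (rule eventually_mono) (rule n2_nonneg[OF assms(1)])
  show "\<forall>\<^sub>F i in \<alpha>. n2 z i \<le> f i" using in_I by (rule eventually_mono) (rule assms(3))
qed

lemma fam_diff: assumes "fam_in z" "fam_in y" shows "fam_in (\<lambda>i. z i \<ominus>\<^sub>i y i)"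
proof
  fix i assume i: "i \<in> I"
  interpret tracial_algebra "A i" "\<rho> i" by (rule fam[OF i])
  show "z i \<ominus>\<^sub>i y i \<in> carrier (A i)" using assms i by simp
qed

lemma eqvI:
  assumes "fam_in z" "fam_in z'" "(f \<longlongrightarrow> 0) \<alpha>"
    "!!i. i \<in> I ==> nrm i (z i \<ominus>\<^sub>i z' i) \<le> f i"
  shows "z \<asymp> z'"
  unfolding eqv_def by (rule n2_null_sandwich[OF fam_diff[OF assms(1,2)] assms(3,4)])

lemma eqv_eventually: assumes "\<forall>\<^sub>F i in \<alpha>. z i = z' i" "fam_in z" shows "z \<asymp> z'"
proof -
  have "\<forall>\<^sub>F i in \<alpha>. nrm i (z i \<ominus>\<^sub>i z' i) = 0"
    using in_I assms(1)
  proof eventually_elim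
    case (elim i)
    interpret tracial_algebra "A i" "\<rho> i" by (rule fam[OF elim(1)])
    have "z' i \<in> carrier (A i)" using elim assms(2) by metis
    then show ?case using elim by simp
  qed
  then show ?thesis unfolding eqv_def by (rule tendsto_eventually)
qed

lemma eqv_same: "[|!!i. i \<in> I ==> z i = z' i; fam_in z|] ==> z \<asymp> z'"
  using in_I by (intro eqv_eventually) (auto elim: eventually_mono)

lemma eqv_sym: assumes "z \<asymp> z'" "fam_in z" "fam_in z'" shows "z' \<asymp> z"
proof (rule eqvI[OF assms(3,2) assms(1)[unfolded eqv_def]])
  fix i assume i: "i \<in> I"
  interpret tracial_algebra "A i" "\<rho> i" by (rule fam[OF i])
  show "nrm i (z' i \<ominus>\<^sub>i z i) \<le> nrm i (z i \<ominus>\<^sub>i z' i)"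
    using assms i by (simp add: norm2_diff_commute)
qed

lemma eqv_trans: assumes "x \<asymp> y" "y \<asymp> z" "fam_in x" "fam_in y" "fam_in z" shows "x \<asymp> z"
proof (rule eqvI[OF assms(3,5)])
  show "((\<lambda>i. nrm i (x i \<ominus>\<^sub>i y i) + nrm i (y i \<ominus>\<^sub>i z i)) \<longlongrightarrow> 0) \<alpha>"
    using tendsto_add[OF assms(1,2)[unfolded eqv_def]] by simp
  fix i assume i: "i \<in> I"
  interpret tracial_algebra "A i" "\<rho> i" by (rule fam[OF i])
  show "nrm i (x i \<ominus>\<^sub>i z i)
      \<le> nrm i (x i \<ominus>\<^sub>i y i) + nrm i (y i \<ominus>\<^sub>i z i)"
    using assms i by (intro norm2_diff_triangle) auto
qed

lemma eqv_add:
  assumes "z \<asymp> z'" "y \<asymp> y'" "fam_in z" "fam_in z'" "fam_in y" "fam_in y'"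
  shows "(\<lambda>i. z i \<oplus>\<^sub>i y i) \<asymp> (\<lambda>i. z' i \<oplus>\<^sub>i y' i)"
  unfolding eqv_def
proof (rule n2_null_sandwich)
  show "((\<lambda>i. nrm i (z i \<ominus>\<^sub>i z' i) + nrm i (y i \<ominus>\<^sub>i y' i)) \<longlongrightarrow> 0) \<alpha>"
    using tendsto_add[OF assms(1,2)[unfolded eqv_def]] by simp
  have *: "(z i \<oplus>\<^sub>i y i) \<ominus>\<^sub>i (z' i \<oplus>\<^sub>i y' i) \<in> carrier (A i) \<and>
      nrm i ((z i \<oplus>\<^sub>i y i) \<ominus>\<^sub>i (z' i \<oplus>\<^sub>i y' i))
      \<le> nrm i (z i \<ominus>\<^sub>i z' i) + nrm i (y i \<ominus>\<^sub>i y' i)" if i: "i \<in> I" for i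
  proof -
    interpret tracial_algebra "A i" "\<rho> i" by (rule fam[OF i])
    show ?thesis using assms(3-6) i norm2_triangle[of "z i \<ominus>\<^sub>i z' i" "y i \<ominus>\<^sub>i y' i"]
      by (simp add: add_diff_add)
  qed
  then show "\<forall>i\<in>I. (z i \<oplus>\<^sub>i y i) \<ominus>\<^sub>i (z' i \<oplus>\<^sub>i y' i) \<in> carrier (A i)" by blast
  show "nrm i ((z i \<oplus>\<^sub>i y i) \<ominus>\<^sub>i (z' i \<oplus>\<^sub>i y' i))
      \<le> nrm i (z i \<ominus>\<^sub>i z' i) + nrm i (y i \<ominus>\<^sub>i y' i)" if "i \<in> I" for i
    using * that by blast
qed

lemma eqv_mult:
  assumes "z \<asymp> z'" "y \<asymp> y'" "bounded_fam z" "bounded_fam z'" "bounded_fam y" "bounded_fam y'"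
  shows "(\<lambda>i. z i \<otimes>\<^sub>i y i) \<asymp> (\<lambda>i. z' i \<otimes>\<^sub>i y' i)"
proof -
  obtain C where C: "C \<ge> 0" "!!i. i \<in> I ==> cnorm (A i) (z' i) \<le> C" using bdd_bound[OF assms(4)] by metis
  obtain D where D: "D \<ge> 0" "!!i. i \<in> I ==> cnorm (A i) (y i) \<le> D" using bdd_bound[OF assms(5)] by metis
  show ?thesis unfolding eqv_def
  proof (rule n2_null_sandwich)
  show "((\<lambda>i. nrm i (z i \<ominus>\<^sub>i z' i) * D + C * nrm i (y i \<ominus>\<^sub>i y' i)) \<longlongrightarrow> 0) \<alpha>"
    using tendsto_add[OF tendsto_mult_left_zero[OF assms(1)[unfolded eqv_def], of D]
      tendsto_mult_right_zero[OF assms(2)[unfolded eqv_def], of C]] by simp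
  have *: "z i \<otimes>\<^sub>i y i \<ominus>\<^sub>i z' i \<otimes>\<^sub>i y' i \<in> carrier (A i) \<and>
      nrm i (z i \<otimes>\<^sub>i y i \<ominus>\<^sub>i z' i \<otimes>\<^sub>i y' i)
      \<le> nrm i (z i \<ominus>\<^sub>i z' i) * D + C * nrm i (y i \<ominus>\<^sub>i y' i)"
    if i: "i \<in> I" for i
  proof -
    interpret tracial_algebra "A i" "\<rho> i" by (rule fam[OF i])
    have [simp]: "z i \<in> carrier (A i)" "z' i \<in> carrier (A i)" "y i \<in> carrier (A i)" "y' i \<in> carrier (A i)"
      using assms(3-6) i by (auto simp: bdd_fam_def)
    have "z i \<otimes>\<^sub>i y i \<ominus>\<^sub>i z' i \<otimes>\<^sub>i y' i
        = (z i \<ominus>\<^sub>i z' i) \<otimes>\<^sub>i y i \<oplus>\<^sub>i z' i \<otimes>\<^sub>i (y i \<ominus>\<^sub>i y' i)"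
      by (simp add: cs)
    then have "nrm i (z i \<otimes>\<^sub>i y i \<ominus>\<^sub>i z' i \<otimes>\<^sub>i y' i)
        \<le> nrm i (z i \<ominus>\<^sub>i z' i) * cnorm (A i) (y i)
          + cnorm (A i) (z' i) * nrm i (y i \<ominus>\<^sub>i y' i)"
      using norm2_triangle[of "(z i \<ominus>\<^sub>i z' i) \<otimes>\<^sub>i y i" "z' i \<otimes>\<^sub>i (y i \<ominus>\<^sub>i y' i)"]
        norm2_mult_le'[of "z i \<ominus>\<^sub>i z' i" "y i"] norm2_mult_le[of "z' i" "y i \<ominus>\<^sub>i y' i"] by simp
    also have "\<dots> \<le> nrm i (z i \<ominus>\<^sub>i z' i) * D + C * nrm i (y i \<ominus>\<^sub>i y' i)"
      using C D i by (intro add_mono mult_left_mono mult_right_mono norm2_nonneg) auto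
    finally show ?thesis by simp
  qed
  then show "\<forall>i\<in>I. z i \<otimes>\<^sub>i y i \<ominus>\<^sub>i z' i \<otimes>\<^sub>i y' i \<in> carrier (A i)" by blast
  show "nrm i (z i \<otimes>\<^sub>i y i \<ominus>\<^sub>i z' i \<otimes>\<^sub>i y' i)
      \<le> nrm i (z i \<ominus>\<^sub>i z' i) * D + C * nrm i (y i \<ominus>\<^sub>i y' i)"
    if "i \<in> I" for i using * that by blast
  qed
qed

lemma bdd_fam_in: "bounded_fam z ==> fam_in z"
  by (simp add: bdd_fam_def)

lemma eqv_refl: "fam_in z ==> z \<asymp> z"
  by (rule eqv_same) auto

lemma eqv_scal:
  assumes "z \<asymp> z'" "bounded_fam z" "bounded_fam z'"
  shows "(\<lambda>i. c \<odot>\<^sub>i z i) \<asymp> (\<lambda>i. c \<odot>\<^sub>i z' i)"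
proof (rule eqvI)
  show "((\<lambda>i. cmod c * nrm i (z i \<ominus>\<^sub>i z' i)) \<longlongrightarrow> 0) \<alpha>"
    using tendsto_mult_right_zero[OF assms(1)[unfolded eqv_def]] .
  fix i assume i: "i \<in> I"
  interpret tracial_algebra "A i" "\<rho> i" by (rule fam[OF i])
  show "nrm i (c \<odot>\<^sub>i z i \<ominus>\<^sub>i c \<odot>\<^sub>i z' i)
      \<le> cmod c * nrm i (z i \<ominus>\<^sub>i z' i)"
    using bddD[OF assms(2) i] bddD[OF assms(3) i] by (simp add: norm2_scal flip: scal_diff_right)
qed (use bdd_fam_in[OF bdd_scal[OF assms(2)]] bdd_fam_in[OF bdd_scal[OF assms(3)]] in auto)

lemma eqv_star:
  assumes "z \<asymp> z'" "bounded_fam z" "bounded_fam z'"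
  shows "(\<lambda>i. star (A i) (z i)) \<asymp> (\<lambda>i. star (A i) (z' i))"
proof (rule eqvI[OF _ _ assms(1)[unfolded eqv_def]])
  fix i assume i: "i \<in> I"
  interpret tracial_algebra "A i" "\<rho> i" by (rule fam[OF i])
  show "nrm i (star (A i) (z i) \<ominus>\<^sub>i star (A i) (z' i))
      \<le> nrm i (z i \<ominus>\<^sub>i z' i)"
    using bddD[OF assms(2) i] bddD[OF assms(3) i] by (simp flip: star_diff)
qed (use bdd_fam_in[OF bdd_star[OF assms(2)]] bdd_fam_in[OF bdd_star[OF assms(3)]] in auto)

lemma eqv_diff:
  assumes "z \<asymp> z'" "y \<asymp> y'" "bounded_fam z" "bounded_fam z'" "bounded_fam y" "bounded_fam y'"
  shows "(\<lambda>i. z i \<ominus>\<^sub>i y i) \<asymp> (\<lambda>i. z' i \<ominus>\<^sub>i y' i)"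
proof -
  have eq: "u i \<ominus>\<^sub>i v i = u i \<oplus>\<^sub>i (-1) \<odot>\<^sub>i v i"
    if "i \<in> I" "bounded_fam v" for u v i
  proof -
    interpret tracial_algebra "A i" "\<rho> i" by (rule fam[OF that(1)])
    show ?thesis using bddD[OF that(2,1)] by (simp add: minus_eq scal_uminus)
  qed
  note b = bdd_fam_in[OF assms(3)] bdd_fam_in[OF assms(4)]
    bdd_fam_in[OF bdd_scal[OF assms(5), of "-1"]] bdd_fam_in[OF bdd_scal[OF assms(6), of "-1"]]
  have 1: "(\<lambda>i. z i \<oplus>\<^sub>i (-1) \<odot>\<^sub>i y i) \<asymp> (\<lambda>i. z' i \<oplus>\<^sub>i (-1) \<odot>\<^sub>i y' i)"
    by (rule eqv_add[OF assms(1) eqv_scal[OF assms(2,5,6)] b])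
  have 2: "(\<lambda>i. z i \<ominus>\<^sub>i y i) \<asymp> (\<lambda>i. z i \<oplus>\<^sub>i (-1) \<odot>\<^sub>i y i)"
    using eq[OF _ assms(5)] bdd_fam_in[OF bdd_diff[OF assms(3,5)]] by (intro eqv_same) auto
  have 3: "(\<lambda>i. z' i \<oplus>\<^sub>i (-1) \<odot>\<^sub>i y' i) \<asymp> (\<lambda>i. z' i \<ominus>\<^sub>i y' i)"
    using eq[OF _ assms(6)] bdd_fam_in[OF bdd_add[OF assms(4) bdd_scal[OF assms(6)]]]
    by (intro eqv_same) auto
  note f = bdd_fam_in[OF bdd_diff[OF assms(3,5)]] bdd_fam_in[OF bdd_diff[OF assms(4,6)]]
    bdd_fam_in[OF bdd_add[OF assms(3) bdd_scal[OF assms(5)]]] bdd_fam_in[OF bdd_add[OF assms(4) bdd_scal[OF assms(6)]]]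
  show ?thesis by (rule eqv_trans[OF 2 eqv_trans[OF 1 3]]) (rule f)+
qed

lemma eqv_trace: assumes "z \<asymp> z'" "bounded_fam z" "bounded_fam z'"
  shows "((\<lambda>i. \<rho> i (z i) - \<rho> i (z' i)) \<longlongrightarrow> 0) \<alpha>"
proof (rule Lim_null_comparison[OF _ assms(1)[unfolded eqv_def]])
  show "\<forall>\<^sub>F i in \<alpha>. norm (\<rho> i (z i) - \<rho> i (z' i)) \<le> nrm i (z i \<ominus>\<^sub>i z' i)"
    using in_I
  proof eventually_elim
    case (elim i)
    interpret tracial_algebra "A i" "\<rho> i" by (rule fam[OF elim])
    show ?case using cmod_le_norm2[of "z i \<ominus>\<^sub>i z' i"] bddD[OF assms(2) elim] bddD[OF assms(3) elim]
      by (simp add: st)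
  qed
qed

lemma n2_tendsto_cong: assumes "z \<asymp> z'" "fam_in z" "fam_in z'" "(n2 z \<longlongrightarrow> l) \<alpha>" shows "(n2 z' \<longlongrightarrow> l) \<alpha>"
proof -
  have "((\<lambda>i. n2 z' i - n2 z i) \<longlongrightarrow> 0) \<alpha>"
  proof (rule Lim_null_comparison[OF _ assms(1)[unfolded eqv_def]])
    show "\<forall>\<^sub>F i in \<alpha>. norm (n2 z' i - n2 z i) \<le> nrm i (z i \<ominus>\<^sub>i z' i)"
      using in_I
    proof eventually_elim
      case (elim i)
      interpret tracial_algebra "A i" "\<rho> i" by (rule fam[OF elim])
      show ?case using norm2_le_diff[of "z i" "z' i"] norm2_le_diff[of "z' i" "z i"] assms elim
        by (auto simp: norm2_diff_commute)
    qed
  qed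
  from tendsto_add[OF this assms(4)] show ?thesis by simp
qed

end

text \<open>A unital *-homomorphism into the tracial ultraproduct, given by representatives, induces a
  state, and the trace norms of the representatives converge to the corresponding seminorm.\<close>

locale representation = family I \<alpha> A \<rho> + T: unital_cstar_algebra T
  for I :: "'i set" and \<alpha> :: "'i filter" and A :: "'i => 'a cstar_algebra" and \<rho> :: "'i => 'a => complex"
    and T :: "'t cstar_algebra" (structure) +
  fixes x :: "'t => 'i => 'a"
  assumes asym: "asym_hom I \<alpha> A \<rho> T x"
begin

lemma x_bdd: "t \<in> carrier T ==> bounded_fam (x t)"
  and x_add: "s \<in> carrier T ==> t \<in> carrier T ==> x (s \<oplus> t) \<asymp> (\<lambda>i. x s i \<oplus>\<^sub>i x t i)"
  and x_mult: "s \<in> carrier T ==> t \<in> carrier T ==> x (s \<otimes> t) \<asymp> (\<lambda>i. x s i \<otimes>\<^sub>i x t i)"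
  and x_scal: "t \<in> carrier T ==> x (c \<odot> t) \<asymp> (\<lambda>i. c \<odot>\<^sub>i x t i)"
  and x_star: "t \<in> carrier T ==> x (star T t) \<asymp> (\<lambda>i. star (A i) (x t i))"
  and x_one: "x \<one> \<asymp> (\<lambda>i. \<one>\<^sub>i)"
  using asym by (auto simp: asym_hom_def)

lemma x_in: "t \<in> carrier T ==> fam_in (x t)"
  using x_bdd by (simp add: bdd_fam_def)

definition lim_state :: "'t => complex"
  where "lim_state t = Lim \<alpha> (\<lambda>i. \<rho> i (x t i))"

lemma lim_state_lim: assumes t: "t \<in> carrier T" shows "((\<lambda>i. \<rho> i (x t i)) \<longlongrightarrow> lim_state t) \<alpha>"
proof -
  obtain C where C: "!!i. i \<in> I ==> cnorm (A i) (x t i) \<le> C" using bdd_bound[OF x_bdd[OF t]] by metis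
  have "\<forall>\<^sub>F i in \<alpha>. cmod (\<rho> i (x t i)) \<le> C"
    using in_I
  proof eventually_elim
    case (elim i)
    interpret tracial_algebra "A i" "\<rho> i" by (rule fam[OF elim])
    have "x t i \<in> carrier (A i)" using x_in[OF t] elim by simp
    then show ?case using cmod_le_norm2[of "x t i"] norm2_le_cnorm[of "x t i"] C[OF elim] by simp
  qed
  then obtain l where "((\<lambda>i. \<rho> i (x t i)) \<longlongrightarrow> l) \<alpha>" by (rule ultralimit)
  then show ?thesis unfolding lim_state_def using tendsto_Lim[OF not_bot] by blast
qed

lemma lim_state_eqI:
  assumes t: "t \<in> carrier T" and z: "bounded_fam z" "x t \<asymp> z" and l: "((\<lambda>i. \<rho> i (z i)) \<longlongrightarrow> l) \<alpha>"
  shows "lim_state t = l"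
proof -
  have "((\<lambda>i. (\<rho> i (x t i) - \<rho> i (z i)) + \<rho> i (z i)) \<longlongrightarrow> 0 + l) \<alpha>"
    by (intro tendsto_add l eqv_trace z x_bdd t)
  then show ?thesis using tendsto_unique[OF not_bot lim_state_lim[OF t]] by simp
qed

lemma x_star_mult:
  assumes t: "t \<in> carrier T"
  shows "x (star T t \<otimes> t) \<asymp> (\<lambda>i. star (A i) (x t i) \<otimes>\<^sub>i x t i)"
proof (rule eqv_trans[OF x_mult])
  show "(\<lambda>i. x (star T t) i \<otimes>\<^sub>i x t i) \<asymp> (\<lambda>i. star (A i) (x t i) \<otimes>\<^sub>i x t i)"
    using t by (intro eqv_mult x_star eqv_refl bdd_fam_in x_bdd bdd_star) auto
qed (use t x_bdd in \<open>auto intro!: bdd_fam_in[THEN bspec] bdd_mult bdd_star\<close>)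

lemma n2_tendsto_aux:
  assumes t: "t \<in> carrier T"
  shows "((\<lambda>i. \<rho> i (star (A i) (x t i) \<otimes>\<^sub>i x t i)) \<longlongrightarrow> lim_state (star T t \<otimes> t)) \<alpha>"
proof -
  have "((\<lambda>i. \<rho> i (x (star T t \<otimes> t) i) - \<rho> i (star (A i) (x t i) \<otimes>\<^sub>i x t i)) \<longlongrightarrow> 0) \<alpha>"
    using t by (intro eqv_trace x_star_mult x_bdd bdd_mult bdd_star) auto
  from tendsto_diff[OF lim_state_lim[of "star T t \<otimes> t"] this] t show ?thesis by (simp add: T.star_closed)
qed

lemma lim_state: "state T lim_state"
  unfolding state_def
proof (intro conjI ballI allI)
  fix s t assume s: "s \<in> carrier T" and t: "t \<in> carrier T"
  show "lim_state (s \<oplus> t) = lim_state s + lim_state t"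
  proof (rule lim_state_eqI[OF _ bdd_add[OF x_bdd[OF s] x_bdd[OF t]] x_add[OF s t]])
    show "((\<lambda>i. \<rho> i (x s i \<oplus>\<^sub>i x t i)) \<longlongrightarrow> lim_state s + lim_state t) \<alpha>"
    proof (rule Lim_transform_eventually[OF tendsto_add[OF lim_state_lim[OF s] lim_state_lim[OF t]]])
      show "\<forall>\<^sub>F i in \<alpha>. \<rho> i (x s i) + \<rho> i (x t i) = \<rho> i (x s i \<oplus>\<^sub>i x t i)"
        using in_I
      proof eventually_elim
        case (elim i)
        interpret tracial_algebra "A i" "\<rho> i" by (rule fam[OF elim])
        show ?case using x_in[OF s] x_in[OF t] elim by (simp add: st)
      qed
    qed
  qed (use s t in auto)
next
  fix c t assume t: "t \<in> carrier T"
  show "lim_state (c \<odot> t) = c * lim_state t"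
  proof (rule lim_state_eqI[OF _ bdd_scal[OF x_bdd[OF t]] x_scal[OF t]])
    show "((\<lambda>i. \<rho> i (c \<odot>\<^sub>i x t i)) \<longlongrightarrow> c * lim_state t) \<alpha>"
    proof (rule Lim_transform_eventually[OF tendsto_mult[OF tendsto_const lim_state_lim[OF t]]])
      show "\<forall>\<^sub>F i in \<alpha>. c * \<rho> i (x t i) = \<rho> i (c \<odot>\<^sub>i x t i)"
        using in_I
      proof eventually_elim
        case (elim i)
        interpret tracial_algebra "A i" "\<rho> i" by (rule fam[OF elim])
        show ?case using x_in[OF t] elim by (simp add: st)
      qed
    qed
  qed (use t in auto)
next
  fix t assume t: "t \<in> carrier T"
  show "lim_state (star T t \<otimes> t) \<in> \<real>\<^sub>\<ge>\<^sub>0"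
  proof (rule Lim_in_closed_set[OF closed_nonneg_Reals_complex _ not_bot n2_tendsto_aux[OF t]])
    show "\<forall>\<^sub>F i in \<alpha>. \<rho> i (star (A i) (x t i) \<otimes>\<^sub>i x t i) \<in> \<real>\<^sub>\<ge>\<^sub>0"
      using in_I
    proof eventually_elim
      case (elim i)
      interpret tracial_algebra "A i" "\<rho> i" by (rule fam[OF elim])
      show ?case using tracial x_in[OF t] elim unfolding tracial_state_def by blast
    qed
  qed
next
  show "lim_state \<one> = 1"
  proof (rule lim_state_eqI[OF _ bdd_one x_one])
    have "\<forall>\<^sub>F i in \<alpha>. \<rho> i \<one>\<^sub>i = 1"
      using in_I
    proof eventually_elim
      case (elim i)
      interpret tracial_algebra "A i" "\<rho> i" by (rule fam[OF elim])
      show ?case by (simp add: st)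
    qed
    then show "((\<lambda>i. \<rho> i \<one>\<^sub>i) \<longlongrightarrow> 1) \<alpha>" by (rule tendsto_eventually)
  qed auto
qed

sublocale L: cstar_state T lim_state
  by unfold_locales (rule lim_state)

lemma n2_tendsto: "t \<in> carrier T ==> (n2 (x t) \<longlongrightarrow> norm2 T lim_state t) \<alpha>"
  unfolding norm2_def by (intro tendsto_real_sqrt tendsto_Re n2_tendsto_aux)

lemma x_diff:
  assumes s: "s \<in> carrier T" and t: "t \<in> carrier T"
  shows "x (s \<ominus> t) \<asymp> (\<lambda>i. x s i \<ominus>\<^sub>i x t i)"
proof -
  have eq: "s \<ominus> t = s \<oplus> (-1) \<odot> t" using s t by (simp add: T.minus_eq T.scal_uminus)
  have t': "(-1) \<odot> t \<in> carrier T" using t by simp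
  have 1: "x (s \<ominus> t) \<asymp> (\<lambda>i. x s i \<oplus>\<^sub>i x ((-1) \<odot> t) i)"
    unfolding eq by (rule x_add[OF s t'])
  have 2: "(\<lambda>i. x s i \<oplus>\<^sub>i x ((-1) \<odot> t) i) \<asymp> (\<lambda>i. x s i \<oplus>\<^sub>i (-1) \<odot>\<^sub>i x t i)"
    using s t t' by (intro eqv_add eqv_refl x_scal x_in bdd_fam_in bdd_scal x_bdd) auto
  have 3: "(\<lambda>i. x s i \<oplus>\<^sub>i (-1) \<odot>\<^sub>i x t i) \<asymp> (\<lambda>i. x s i \<ominus>\<^sub>i x t i)"
  proof (rule eqv_same)
    fix i assume i: "i \<in> I"
    interpret tracial_algebra "A i" "\<rho> i" by (rule fam[OF i])
    show "x s i \<oplus>\<^sub>i (-1) \<odot>\<^sub>i x t i = x s i \<ominus>\<^sub>i x t i"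
      using x_in[OF s] x_in[OF t] i by (simp add: minus_eq scal_uminus)
  qed (intro bdd_fam_in bdd_add bdd_scal x_bdd s t)
  have f: "fam_in (x (s \<ominus> t))" "fam_in (\<lambda>i. x s i \<oplus>\<^sub>i x ((-1) \<odot> t) i)"
    "fam_in (\<lambda>i. x s i \<oplus>\<^sub>i (-1) \<odot>\<^sub>i x t i)" "fam_in (\<lambda>i. x s i \<ominus>\<^sub>i x t i)"
    using s t t' by (intro bdd_fam_in bdd_add bdd_diff bdd_scal x_bdd; simp)+
  show ?thesis by (rule eqv_trans[OF 1 eqv_trans[OF 2 3]]) (rule f)+
qed

lemma n2_diff_less:
  assumes s: "s \<in> carrier T" and t: "t \<in> carrier T" and d: "cnorm T (s \<ominus> t) < e"
  shows "\<forall>\<^sub>F i in \<alpha>. nrm i (x s i \<ominus>\<^sub>i x t i) < e"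
proof -
  have "(n2 (\<lambda>i. x s i \<ominus>\<^sub>i x t i) \<longlongrightarrow> norm2 T lim_state (s \<ominus> t)) \<alpha>"
    by (rule n2_tendsto_cong[OF x_diff[OF s t] _ _ n2_tendsto])
      (use s t in \<open>auto intro!: x_in[THEN bspec] bdd_fam_in[OF bdd_diff[OF x_bdd x_bdd], THEN bspec]\<close>)
  moreover have "norm2 T lim_state (s \<ominus> t) < e"
    using L.norm2_le_cnorm[of "s \<ominus> t"] d s t by simp
  ultimately show ?thesis by (rule order_tendstoD(2))
qed

end

section \<open>Corners\<close>

text \<open>Arithmetic in a corner is that of the ambient algebra, except for the unit. A tracial state is
  renormalized by the trace of the corner projection.\<close>

lemma unital_corner_simps [simp]:
  "x \<otimes>\<^bsub>unital_corner A p\<^esub> y = x \<otimes>\<^bsub>A\<^esub> y" "x \<oplus>\<^bsub>unital_corner A p\<^esub> y = x \<oplus>\<^bsub>A\<^esub> y"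
  "\<zero>\<^bsub>unital_corner A p\<^esub> = \<zero>\<^bsub>A\<^esub>" "\<one>\<^bsub>unital_corner A p\<^esub> = p"
  "c \<odot>\<^bsub>unital_corner A p\<^esub> x = c \<odot>\<^bsub>A\<^esub> x" "star (unital_corner A p) x = star A x"
  "cnorm (unital_corner A p) x = cnorm A x"
  by (simp_all add: unital_corner_def)

context unital_cstar_algebra
begin

lemma add_diff_diff:
  assumes "u \<in> carrier A" "v \<in> carrier A" "d \<in> carrier A"
  shows "u \<oplus> (d \<ominus> v) \<ominus> d = u \<ominus> v"
proof -
  have "u \<oplus> (d \<ominus> v) \<ominus> d = (u \<ominus> v) \<oplus> (d \<ominus> d)" using assms by (simp add: minus_eq a_ac)
  then show ?thesis using assms by simp
qed

lemma projectionD: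
  assumes "projection A p"
  shows "p \<in> carrier A" "star A p = p" "p \<otimes> p = p" "z \<in> carrier A ==> p \<otimes> (p \<otimes> z) = p \<otimes> z"
proof -
  show *: "p \<in> carrier A" "star A p = p" "p \<otimes> p = p" using assms by (auto simp: projection_def self_adjoint_def)
  show "z \<in> carrier A ==> p \<otimes> (p \<otimes> z) = p \<otimes> z" using * by (simp add: m_assoc[symmetric])
qed

lemma projection_cnorm: assumes "projection A p" shows "cnorm A p \<le> 1"
proof -
  have "cnorm A p = (cnorm A p)\<^sup>2" using cstar_identity[of p] projectionD[OF assms] by simp
  then have "cnorm A p = 0 \<or> cnorm A p = 1" by (simp add: power2_eq_square)
  then show ?thesis by auto
qed

lemma projection_complement: assumes "projection A p" shows "projection A (\<one> \<ominus> p)"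
  using projectionD(1-3)[OF assms] by (simp add: projection_def self_adjoint_def cs)

lemma projection_one: "projection A \<one>"
  by (simp add: projection_def self_adjoint_def)

lemma corner_closed: "p \<in> carrier A ==> x \<in> carrier A ==> p \<otimes> x \<otimes> p \<in> carrier (unital_corner A p)"
  by (auto simp: unital_corner_def)

lemma corner_carrierD:
  assumes p: "projection A p" and z: "z \<in> carrier (unital_corner A p)"
  shows "z \<in> carrier A" "p \<otimes> z = z" "z \<otimes> p = z"
proof -
  note [simp] = projectionD[OF p]
  obtain x where x: "x \<in> carrier A" "z = p \<otimes> x \<otimes> p" using z by (auto simp: unital_corner_def)
  then show "z \<in> carrier A" "p \<otimes> z = z" "z \<otimes> p = z" by (simp_all add: m_assoc)
qed

lemma corner_diff:
  assumes p: "projection A p" and C: "unital_cstar_algebra (unital_corner A p)"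
    and z: "z \<in> carrier (unital_corner A p)" "y \<in> carrier (unital_corner A p)"
  shows "z \<ominus>\<^bsub>unital_corner A p\<^esub> y = z \<ominus> y"
proof -
  interpret C: unital_cstar_algebra "unital_corner A p" by fact
  have y': "\<ominus>\<^bsub>unital_corner A p\<^esub> y \<in> carrier A" "y \<in> carrier A"
    using z corner_carrierD(1)[OF p] by auto
  have "\<ominus>\<^bsub>unital_corner A p\<^esub> y \<oplus> y = \<zero>" using C.l_neg[OF z(2)] by simp
  then have "\<ominus>\<^bsub>unital_corner A p\<^esub> y = \<ominus> y" using minus_equality[of "\<ominus>\<^bsub>unital_corner A p\<^esub> y" y] y' by simp
  then show ?thesis by (simp add: C.minus_eq minus_eq)
qed

lemma corner_shift:
  assumes "projection A p" "h \<in> carrier A"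
  shows "p \<otimes> (h \<ominus> c \<odot> \<one>) \<otimes> p = p \<otimes> h \<otimes> p \<ominus> c \<odot> p"
  using projectionD[OF assms(1)] assms(2) by (simp add: cs)

lemma corner_sum_hom:
  assumes p: "projection A p"
    and f: "f \<in> unital_star_hom T (unital_corner A p)" and g: "g \<in> unital_star_hom T (unital_corner A (\<one> \<ominus> p))"
  shows "(\<lambda>t. f t \<oplus> g t) \<in> unital_star_hom T A"
proof -
  have p': "projection A (\<one> \<ominus> p)" by (rule projection_complement[OF p])
  note [simp] = projectionD[OF p]
  have fD: "f t \<in> carrier A" "p \<otimes> f t = f t" "f t \<otimes> p = f t" if "t \<in> carrier T" for t
    using corner_carrierD[OF p unital_star_homD(1)[OF f that]] by auto
  have gD: "g t \<in> carrier A" "(\<one> \<ominus> p) \<otimes> g t = g t" "g t \<otimes> (\<one> \<ominus> p) = g t" if "t \<in> carrier T" for t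
    using corner_carrierD[OF p' unital_star_homD(1)[OF g that]] by auto
  have fg: "f s \<otimes> g t = \<zero>" "g s \<otimes> f t = \<zero>" if s: "s \<in> carrier T" and t: "t \<in> carrier T" for s t
  proof -
    note [simp] = fD(1)[OF s] fD(1)[OF t] gD(1)[OF s] gD(1)[OF t]
    have "f s \<otimes> g t = (f s \<otimes> p) \<otimes> ((\<one> \<ominus> p) \<otimes> g t)" using fD[OF s] gD[OF t] by simp
    also have "\<dots> = f s \<otimes> ((p \<otimes> (\<one> \<ominus> p)) \<otimes> g t)" by (simp add: m_assoc)
    also have "p \<otimes> (\<one> \<ominus> p) = \<zero>" by (simp add: cs)
    finally show "f s \<otimes> g t = \<zero>" by simp
    have "g s \<otimes> f t = (g s \<otimes> (\<one> \<ominus> p)) \<otimes> (p \<otimes> f t)" using fD[OF t] gD[OF s] by simp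
    also have "\<dots> = g s \<otimes> (((\<one> \<ominus> p) \<otimes> p) \<otimes> f t)" by (simp add: m_assoc)
    also have "(\<one> \<ominus> p) \<otimes> p = \<zero>" by (simp add: cs)
    finally show "g s \<otimes> f t = \<zero>" by simp
  qed
  show ?thesis
  proof (rule unital_star_homI)
    show "f \<one>\<^bsub>T\<^esub> \<oplus> g \<one>\<^bsub>T\<^esub> = \<one>"
      using unital_star_homD(4)[OF f] unital_star_homD(4)[OF g] a_lcomm[of p \<one> "\<ominus> p"]
      by (simp add: minus_eq r_neg)
    fix s t assume s: "s \<in> carrier T" and t: "t \<in> carrier T"
    show "f (s \<otimes>\<^bsub>T\<^esub> t) \<oplus> g (s \<otimes>\<^bsub>T\<^esub> t) = (f s \<oplus> g s) \<otimes> (f t \<oplus> g t)"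
      using unital_star_homD(3)[OF f s t] unital_star_homD(3)[OF g s t] fD(1)[OF s] fD(1)[OF t] gD(1)[OF s] gD(1)[OF t]
        fg[OF s t] by (simp add: l_distr r_distr)
    show "f (s \<oplus>\<^bsub>T\<^esub> t) \<oplus> g (s \<oplus>\<^bsub>T\<^esub> t) = (f s \<oplus> g s) \<oplus> (f t \<oplus> g t)"
      using unital_star_homD(2)[OF f s t] unital_star_homD(2)[OF g s t] fD(1)[OF s] fD(1)[OF t] gD(1)[OF s] gD(1)[OF t]
      by (simp add: a_ac)
  next
    fix t assume t: "t \<in> carrier T"
    show "f t \<oplus> g t \<in> carrier A" using fD(1)[OF t] gD(1)[OF t] by simp
    show "f (star T t) \<oplus> g (star T t) = star A (f t \<oplus> g t)"
      using unital_star_homD(6)[OF f t] unital_star_homD(6)[OF g t] fD(1)[OF t] gD(1)[OF t] by (simp add: star_add)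
    show "f (c \<odot>\<^bsub>T\<^esub> t) \<oplus> g (c \<odot>\<^bsub>T\<^esub> t) = c \<odot> (f t \<oplus> g t)" for c
      using unital_star_homD(5)[OF f t, of c] unital_star_homD(5)[OF g t, of c] fD(1)[OF t] gD(1)[OF t]
      by (simp add: scal_add_right)
  qed
qed

end

context tracial_algebra
begin

lemma st_projection:
  assumes "projection A p" shows "w p = complex_of_real (Re (w p))" "Re (w p) = (norm2 A w p)\<^sup>2"
proof -
  note p = projectionD[OF assms]
  show "w p = complex_of_real (Re (w p))" using st_real[OF p(1)] p by (simp add: complex_eq_iff)
  show "Re (w p) = (norm2 A w p)\<^sup>2" using norm2_sq[OF p(1)] p by simp
qed

lemma corner_tracial:
  assumes p: "projection A p" "0 < Re (w p)" and C: "unital_cstar_algebra (unital_corner A p)"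
  shows "tracial_algebra (unital_corner A p) (\<lambda>z. w z / w p)"
proof -
  have wp: "w p = complex_of_real (Re (w p))" by (rule st_projection[OF p(1)])
  have wp0: "w p \<noteq> 0" using p(2) by auto
  note D = corner_carrierD[OF p(1)]
  have "w (star A x \<otimes> x) / w p \<in> \<real>\<^sub>\<ge>\<^sub>0" if "x \<in> carrier A" for x
    using st_pos[OF that] st_real[OF that] p(2) by (subst wp) (simp add: complex_nonneg_Reals_iff)
  then have "tracial_state (unital_corner A p) (\<lambda>z. w z / w p)"
    unfolding tracial_state_def using D(1) wp0 trace
    by (auto simp: st add_divide_distrib)
  with C show ?thesis unfolding tracial_algebra_def tracial_algebra_axioms_def by simp
qed

lemma corner_norm2:
  assumes p: "projection A p" "0 < Re (w p)" and z: "z \<in> carrier A"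
  shows "norm2 (unital_corner A p) (\<lambda>z. w z / w p) z = norm2 A w z / sqrt (Re (w p))"
proof -
  have wp: "w p = complex_of_real (Re (w p))" by (rule st_projection[OF p(1)])
  have "Re (w (star A z \<otimes> z) / w p) = Re (w (star A z \<otimes> z)) / Re (w p)"
    by (subst wp) (rule Re_divide_of_real)
  then show ?thesis by (simp add: norm2_def real_sqrt_divide)
qed

text \<open>Elements of complementary corners are orthogonal, and
  \<open>x - p x p - (1 - p) x (1 - p) = [p, x] (1 - p) - (1 - p) [p, x]\<close>.\<close>

lemma corner_sum_error:
  assumes p: "projection A p" "0 < Re (w p)" and p': "0 < Re (w (\<one> \<ominus> p))"
    and C: "unital_cstar_algebra (unital_corner A p)" "unital_cstar_algebra (unital_corner A (\<one> \<ominus> p))"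
    and f: "f \<in> carrier (unital_corner A p)" and g: "g \<in> carrier (unital_corner A (\<one> \<ominus> p))"
    and x [simp]: "x \<in> carrier A"
    and ef: "norm2 (unital_corner A p) (\<lambda>z. w z / w p) (f \<ominus>\<^bsub>unital_corner A p\<^esub> p \<otimes> x \<otimes> p) < e"
    and eg: "norm2 (unital_corner A (\<one> \<ominus> p)) (\<lambda>z. w z / w (\<one> \<ominus> p))
      (g \<ominus>\<^bsub>unital_corner A (\<one> \<ominus> p)\<^esub> (\<one> \<ominus> p) \<otimes> x \<otimes> (\<one> \<ominus> p)) < e"
  shows "norm2 A w ((f \<oplus> g) \<ominus> x) \<le> e + 2 * norm2 A w (comm p x)"
proof -
  define r where "r = \<one> \<ominus> p"
  have r: "projection A r" unfolding r_def by (rule projection_complement[OF p(1)])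
  note [simp] = projectionD[OF p(1)] projectionD[OF r]
  define u where "u = f \<ominus> p \<otimes> x \<otimes> p"
  define v where "v = g \<ominus> r \<otimes> x \<otimes> r"
  have fc: "f \<in> carrier A" "p \<otimes> f = f" "f \<otimes> p = f" using corner_carrierD[OF p(1) f] by auto
  have gc: "g \<in> carrier A" "r \<otimes> g = g" "g \<otimes> r = g"
    using corner_carrierD[OF r] g unfolding r_def by auto
  note [simp] = fc gc
  have uv [simp]: "u \<in> carrier A" "v \<in> carrier A" by (simp_all add: u_def v_def)
  have up: "u \<otimes> p = u" "p \<otimes> u = u" by (simp_all add: u_def diff_distr_left diff_distr_right m_assoc)
  have vr: "v \<otimes> r = v" "r \<otimes> v = v" by (simp_all add: v_def diff_distr_left diff_distr_right m_assoc)
  have e0: "0 \<le> e"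
  proof -
    interpret C: tracial_algebra "unital_corner A p" "\<lambda>z. w z / w p" by (rule corner_tracial[OF p C(1)])
    have "p \<otimes> x \<otimes> p \<in> carrier (unital_corner A p)" by (rule corner_closed) auto
    then show ?thesis using ef C.norm2_nonneg[OF C.minus_closed[OF f]] by fastforce
  qed
  have "norm2 A w u / sqrt (Re (w p)) < e"
    using ef corner_norm2[OF p uv(1)] corner_diff[OF p(1) C(1) f corner_closed[of p x]] by (simp add: u_def)
  then have u: "norm2 A w u \<le> e * sqrt (Re (w p))" using p(2) by (simp add: divide_less_eq less_imp_le)
  have "norm2 A w v / sqrt (Re (w r)) < e"
    using eg corner_norm2[OF r _ uv(2)] corner_diff[OF r _ _ corner_closed[of r x], of g] C(2) g p'
    by (simp add: v_def r_def)
  then have v: "norm2 A w v \<le> e * sqrt (Re (w r))" using p' by (simp add: r_def divide_less_eq less_imp_le)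
  have "star A u \<otimes> v = (star A u \<otimes> p) \<otimes> (r \<otimes> v)"
    using up vr by (metis star_mult projectionD(1,2)[OF p(1)] uv(1))
  also have "\<dots> = star A u \<otimes> ((p \<otimes> r) \<otimes> v)" by (simp add: m_assoc)
  also have "p \<otimes> r = \<zero>" by (simp add: r_def cs)
  finally have "(norm2 A w (u \<oplus> v))\<^sup>2 = (norm2 A w u)\<^sup>2 + (norm2 A w v)\<^sup>2" by (simp add: norm2_sq_add st)
  also have "\<dots> \<le> (e * sqrt (Re (w p)))\<^sup>2 + (e * sqrt (Re (w r)))\<^sup>2"
    using u v by (intro add_mono power_mono) auto
  also have "\<dots> = e\<^sup>2 * (Re (w p) + Re (w r))"
    using p(2) p' by (simp add: power_mult_distrib r_def distrib_left)
  also have "Re (w p) + Re (w r) = 1" by (simp add: r_def st)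
  finally have "(norm2 A w (u \<oplus> v))\<^sup>2 \<le> e\<^sup>2" by simp
  then have uvn: "norm2 A w (u \<oplus> v) \<le> e" using e0 by (rule power2_le_imp_le)
  define d where "d = comm p x \<otimes> r \<ominus> r \<otimes> comm p x"
  have dc [simp]: "d \<in> carrier A" by (simp add: d_def)
  have "norm2 A w d \<le> norm2 A w (comm p x) * cnorm A r + cnorm A r * norm2 A w (comm p x)"
    unfolding d_def using norm2_diff_le[of "comm p x \<otimes> r" "r \<otimes> comm p x"] norm2_mult_le'[of "comm p x" r]
      norm2_mult_le[of r "comm p x"] by (simp add: mult.commute)
  also have "\<dots> \<le> norm2 A w (comm p x) * 1 + 1 * norm2 A w (comm p x)"
    using projection_cnorm[OF r] by (intro add_mono mult_left_mono mult_right_mono) auto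
  finally have dn: "norm2 A w d \<le> 2 * norm2 A w (comm p x)" by simp
  have "(f \<oplus> g) \<ominus> x = (u \<oplus> v) \<ominus> d"
  proof -
    have 1: "comm p x \<otimes> r = p \<otimes> x \<otimes> r" and 2: "r \<otimes> comm p x = \<ominus> (r \<otimes> x \<otimes> p)"
    proof -
      have "p \<otimes> r = \<zero>" "r \<otimes> p = \<zero>" by (simp_all add: r_def cs)
      moreover have "comm p x \<otimes> r = p \<otimes> x \<otimes> r \<ominus> x \<otimes> (p \<otimes> r)"
        "r \<otimes> comm p x = (r \<otimes> p) \<otimes> x \<ominus> r \<otimes> x \<otimes> p"
        by (simp_all add: comm_def diff_distr_left diff_distr_right m_assoc)
      ultimately show "comm p x \<otimes> r = p \<otimes> x \<otimes> r" "r \<otimes> comm p x = \<ominus> (r \<otimes> x \<otimes> p)"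
        by (simp_all add: minus_eq)
    qed
    have 3: "x = (p \<otimes> x \<otimes> p \<oplus> r \<otimes> x \<otimes> r) \<oplus> (p \<otimes> x \<otimes> r \<oplus> r \<otimes> x \<otimes> p)"
    proof -
      have "x = (p \<oplus> r) \<otimes> x \<otimes> (p \<oplus> r)" by (simp add: r_def cs)
      also have "\<dots> = (p \<otimes> x \<otimes> p \<oplus> r \<otimes> x \<otimes> r) \<oplus> (p \<otimes> x \<otimes> r \<oplus> r \<otimes> x \<otimes> p)"
        by (simp add: l_distr r_distr a_ac m_assoc)
      finally show ?thesis .
    qed
    have "(f \<oplus> g) \<ominus> ((p \<otimes> x \<otimes> p \<oplus> r \<otimes> x \<otimes> r) \<oplus> (p \<otimes> x \<otimes> r \<oplus> r \<otimes> x \<otimes> p)) = (u \<oplus> v) \<ominus> d"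
      unfolding u_def v_def d_def 1 2 by (simp add: minus_eq minus_add a_ac)
    then show ?thesis by (subst 3)
  qed
  then show ?thesis using norm2_diff_le[of "u \<oplus> v" d] uvn dn by simp
qed

end

text \<open>The representative is equivalent to a self-adjoint family with spectrum within \<open>r\<close> of \<open>c\<close>.\<close>

definition loc ::
    "'i set => 'i filter => ('i => 'a cstar_algebra) => ('i => 'a => complex) =>
      ('i => 'a) => real => real => bool"
  where "loc I \<alpha> A \<rho> z c r \<longleftrightarrow> (\<exists>h.
    (\<forall>i\<in>I. self_adjoint (A i) (h i) \<and> cnorm (A i) (h i \<ominus>\<^bsub>A i\<^esub> of_real c \<odot>\<^bsub>A i\<^esub> \<one>\<^bsub>A i\<^esub>) \<le> r) \<and>
    eqv \<alpha> A \<rho> z h)"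

text \<open>Honest homomorphisms match the representatives on \<open>F\<close> up to \<open>\<epsilon>\<close>. The strict inequality with all
  \<open>\<epsilon>' > \<epsilon>\<close> makes the property stable under the small losses in each cut, without tracking them.\<close>

definition good ::
    "'i filter => ('i => 'a cstar_algebra) => ('i => 'a => complex) =>
      't cstar_algebra => ('t => 'i => 'a) => 't set => real => bool"
  where "good \<alpha> A \<rho> T x F \<epsilon> \<longleftrightarrow> (\<forall>\<epsilon>'>\<epsilon>. \<forall>\<^sub>F i in \<alpha>. \<exists>\<psi>\<in>unital_star_hom T (A i). \<forall>t\<in>F.
    norm2 (A i) (\<rho> i) (\<psi> t \<ominus>\<^bsub>A i\<^esub> x t i) < \<epsilon>')"

context family
begin

lemma loc_bdd:
  assumes "!!i. i \<in> I ==> self_adjoint (A i) (h i) \<and>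
    cnorm (A i) (h i \<ominus>\<^sub>i of_real c \<odot>\<^sub>i \<one>\<^sub>i) \<le> r"
  shows "bounded_fam h"
proof -
  have "h i \<in> carrier (A i) \<and> cnorm (A i) (h i) \<le> \<bar>c\<bar> + r" if i: "i \<in> I" for i
  proof -
    interpret tracial_algebra "A i" "\<rho> i" by (rule fam[OF i])
    have h: "h i \<in> carrier (A i)" using assms[OF i] by (simp add: self_adjoint_def)
    then show ?thesis
      using cnorm_le_diff[of "h i" "of_real c \<odot>\<^sub>i \<one>\<^sub>i"] cnorm_scal_one_le[of "complex_of_real c"] assms[OF i]
      by simp
  qed
  then show ?thesis unfolding bdd_fam_def by blast
qed

text \<open>A projection of full trace in the limit may be used to change the family on a null set.\<close>

lemma loc_compress:
  assumes p: "!!i. i \<in> I ==> projection (A i) (p i)" "p \<asymp> (\<lambda>i. \<one>\<^sub>i)"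
    and h: "!!i. i \<in> I ==> self_adjoint (A i) (h i)" "bounded_fam h" "z \<asymp> h" "fam_in z"
    and bound: "!!i. i \<in> I ==>
      cnorm (A i) (p i \<otimes>\<^sub>i (h i \<ominus>\<^sub>i of_real c \<odot>\<^sub>i \<one>\<^sub>i) \<otimes>\<^sub>i p i) \<le> r"
  shows "loc I \<alpha> A \<rho> z c r"
proof -
  define k where "k = (\<lambda>i. p i \<otimes>\<^sub>i h i \<otimes>\<^sub>i p i \<oplus>\<^sub>i of_real c \<odot>\<^sub>i (\<one>\<^sub>i \<ominus>\<^sub>i p i))"
  have pb: "bounded_fam p" by (rule bdd_projection[OF p(1)])
  have kb: "bounded_fam k" unfolding k_def by (intro bdd_add bdd_mult bdd_scal bdd_diff bdd_one pb h)
  have 1: "k \<asymp> (\<lambda>i. \<one>\<^sub>i \<otimes>\<^sub>i h i \<otimes>\<^sub>i \<one>\<^sub>i \<oplus>\<^sub>i of_real c \<odot>\<^sub>i (\<one>\<^sub>i \<ominus>\<^sub>i \<one>\<^sub>i))"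
    unfolding k_def
    by (intro eqv_add eqv_mult eqv_scal eqv_diff p(2) eqv_refl bdd_add bdd_mult bdd_scal bdd_diff bdd_one pb h bdd_fam_in)
  have eqh: "\<one>\<^sub>i \<otimes>\<^sub>i h i \<otimes>\<^sub>i \<one>\<^sub>i \<oplus>\<^sub>i of_real c \<odot>\<^sub>i (\<one>\<^sub>i \<ominus>\<^sub>i \<one>\<^sub>i) = h i"
    if i: "i \<in> I" for i
  proof -
    interpret tracial_algebra "A i" "\<rho> i" by (rule fam[OF i])
    show ?thesis using bddD[OF h(2) i] by simp
  qed
  have fh: "fam_in h" by (rule bdd_fam_in[OF h(2)])
  have b3: "bounded_fam (\<lambda>i. \<one>\<^sub>i \<otimes>\<^sub>i h i \<otimes>\<^sub>i \<one>\<^sub>i \<oplus>\<^sub>i of_real c \<odot>\<^sub>i (\<one>\<^sub>i \<ominus>\<^sub>i \<one>\<^sub>i))"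
    by (intro bdd_add bdd_mult bdd_scal bdd_diff bdd_one h)
  have kh: "k \<asymp> h"
    by (rule eqv_trans[OF 1 eqv_same[OF eqh] bdd_fam_in[OF kb] bdd_fam_in[OF b3] fh])
      (assumption | rule bdd_fam_in[OF b3])+
  have zk: "z \<asymp> k"
    by (rule eqv_trans[OF h(3) eqv_sym[OF kh bdd_fam_in[OF kb] fh] h(4) fh bdd_fam_in[OF kb]])
  have "self_adjoint (A i) (k i) \<and> cnorm (A i) (k i \<ominus>\<^sub>i of_real c \<odot>\<^sub>i \<one>\<^sub>i) \<le> r"
    if i: "i \<in> I" for i
  proof -
    interpret tracial_algebra "A i" "\<rho> i" by (rule fam[OF i])
    note pi = projectionD[OF p(1)[OF i]]
    have hi: "h i \<in> carrier (A i)" "star (A i) (h i) = h i" using h(1)[OF i] by (auto simp: self_adjoint_def)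
    have "k i \<ominus>\<^sub>i of_real c \<odot>\<^sub>i \<one>\<^sub>i
        = p i \<otimes>\<^sub>i (h i \<ominus>\<^sub>i of_real c \<odot>\<^sub>i \<one>\<^sub>i) \<otimes>\<^sub>i p i"
      unfolding corner_shift[OF p(1)[OF i] hi(1)] unfolding k_def using pi(1) hi(1)
      by (simp add: scal_diff_right add_diff_diff)
    moreover have "star (A i) (k i) = k i" using pi hi by (simp add: k_def star_simps m_assoc)
    ultimately show ?thesis using bound[OF i] bddD[OF kb i] by (simp add: self_adjoint_def)
  qed
  with zk show ?thesis unfolding loc_def by blast
qed

end

text \<open>Cutting a representation by projections that commute asymptotically with it gives again a
  representation, now in the corners. The trace of the projections has to stay away from zero, as
  the normalization of the trace divides by it.\<close>

locale corner_family = representation I \<alpha> A \<rho> T x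
  for I :: "'i set" and \<alpha> :: "'i filter" and A :: "'i => 'a cstar_algebra" and \<rho> :: "'i => 'a => complex"
    and T :: "'t cstar_algebra" (structure) and x :: "'t => 'i => 'a" +
  fixes q :: "'i => 'a" and \<tau> :: real
  assumes q: "!!i. i \<in> I ==> projection (A i) (q i)"
    and q_pos: "!!i. i \<in> I ==> 0 < Re (\<rho> i (q i))"
    and q_lim: "((\<lambda>i. Re (\<rho> i (q i))) \<longlongrightarrow> \<tau>) \<alpha>" and \<tau>: "0 < \<tau>"
    and q_comm: "!!t. t \<in> carrier T ==> (\<lambda>i. q i \<otimes>\<^bsub>A i\<^esub> x t i) \<asymp> (\<lambda>i. x t i \<otimes>\<^bsub>A i\<^esub> q i)"
    and C_cstar: "!!i. i \<in> I ==> unital_cstar_algebra (unital_corner (A i) (q i))"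
begin

definition C :: "'i => 'a cstar_algebra" where "C i = unital_corner (A i) (q i)"
definition \<kappa> :: "'i => 'a => complex" where "\<kappa> i = (\<lambda>z. \<rho> i z / \<rho> i (q i))"
definition cp :: "('i => 'a) => 'i => 'a" where "cp z i = q i \<otimes>\<^sub>i z i \<otimes>\<^sub>i q i"

lemma C_tracial: "i \<in> I ==> tracial_algebra (C i) (\<kappa> i)"
  unfolding C_def \<kappa>_def
  by (intro tracial_algebra.corner_tracial fam q q_pos C_cstar)

lemma q_bdd: "bounded_fam q"
  by (rule bdd_projection[OF q])

lemma cp_bdd: "bounded_fam z ==> bounded_fam (cp z)"
  unfolding cp_def by (intro bdd_mult q_bdd)

lemma cp_eqv: "z \<asymp> z' ==> bounded_fam z ==> bounded_fam z' ==> cp z \<asymp> cp z'"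
  unfolding cp_def by (intro eqv_mult eqv_refl bdd_mult q_bdd bdd_fam_in)

lemma cp_C: "fam_in z ==> i \<in> I ==> cp z i \<in> carrier (C i)"
proof -
  assume z: "fam_in z" and i: "i \<in> I"
  interpret tracial_algebra "A i" "\<rho> i" by (rule fam[OF i])
  show ?thesis unfolding cp_def C_def using z i projectionD(1)[OF q[OF i]] by (intro corner_closed) auto
qed

lemma C_A: "i \<in> I ==> z \<in> carrier (C i) ==> z \<in> carrier (A i)"
proof -
  assume i: "i \<in> I" and z: "z \<in> carrier (C i)"
  interpret tracial_algebra "A i" "\<rho> i" by (rule fam[OF i])
  show ?thesis using corner_carrierD(1)[OF q[OF i]] z by (simp add: C_def)
qed

lemma C_diff: "i \<in> I ==> z \<in> carrier (C i) ==> y \<in> carrier (C i) ==> z \<ominus>\<^bsub>C i\<^esub> y = z \<ominus>\<^sub>i y"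
proof -
  assume i: "i \<in> I" and z: "z \<in> carrier (C i)" "y \<in> carrier (C i)"
  interpret tracial_algebra "A i" "\<rho> i" by (rule fam[OF i])
  show ?thesis using corner_diff[OF q[OF i] C_cstar[OF i]] z by (simp add: C_def)
qed

lemma C_simps [simp]:
  "u \<otimes>\<^bsub>C i\<^esub> v = u \<otimes>\<^sub>i v" "u \<oplus>\<^bsub>C i\<^esub> v = u \<oplus>\<^sub>i v" "\<one>\<^bsub>C i\<^esub> = q i"
  "c \<odot>\<^bsub>C i\<^esub> u = c \<odot>\<^sub>i u" "star (C i) u = star (A i) u" "cnorm (C i) u = cnorm (A i) u"
  by (simp_all add: C_def)

lemma eqv_C:
  assumes "z \<asymp> y" "!!i. i \<in> I ==> z i \<in> carrier (C i)" "!!i. i \<in> I ==> y i \<in> carrier (C i)"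
  shows "eqv \<alpha> C \<kappa> z y"
  unfolding eqv_def
proof (rule Lim_transform_eventually)
  show "((\<lambda>i. nrm i (z i \<ominus>\<^sub>i y i) / sqrt (Re (\<rho> i (q i)))) \<longlongrightarrow> 0) \<alpha>"
    using tendsto_divide[OF assms(1)[unfolded eqv_def] tendsto_real_sqrt[OF q_lim]] \<tau> by simp
  show "\<forall>\<^sub>F i in \<alpha>. nrm i (z i \<ominus>\<^sub>i y i) / sqrt (Re (\<rho> i (q i)))
      = norm2 (C i) (\<kappa> i) (z i \<ominus>\<^bsub>C i\<^esub> y i)"
    using in_I
  proof eventually_elim
    case (elim i)
    interpret tracial_algebra "A i" "\<rho> i" by (rule fam[OF elim])
    have "z i \<ominus>\<^sub>i y i \<in> carrier (A i)" using C_A[OF elim] assms(2,3) elim by simp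
    then show ?case using corner_norm2[OF q[OF elim] q_pos[OF elim]] C_diff[OF elim assms(2,3)[OF elim]]
      by (simp add: C_def \<kappa>_def)
  qed
qed

definition y :: "'t => 'i => 'a" where "y t = cp (x t)"

lemma bdd_C: "bounded_fam z ==> (!!i. i \<in> I ==> z i \<in> carrier (C i)) ==> bdd_fam I C z"
  unfolding bdd_fam_def by (simp add: C_def)

lemma y_in: "t \<in> carrier T ==> i \<in> I ==> y t i \<in> carrier (C i)"
  unfolding y_def by (rule cp_C[OF x_in])

lemma y_bdd: "t \<in> carrier T ==> bounded_fam (y t)"
  unfolding y_def by (intro cp_bdd x_bdd)

lemma eqv_cp:
  assumes "x t \<asymp> z" "t \<in> carrier T" "bounded_fam z" "cp z \<asymp> u" "bounded_fam u"
    "!!i. i \<in> I ==> u i \<in> carrier (C i)"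
  shows "eqv \<alpha> C \<kappa> (y t) u"
proof (rule eqv_C)
  show "y t \<asymp> u" unfolding y_def using assms
    by (intro eqv_trans[OF cp_eqv[OF assms(1) x_bdd[OF assms(2)] assms(3)] assms(4)] bdd_fam_in cp_bdd x_bdd)
qed (use assms y_in in auto)

lemma C_asym_hom: "asym_hom I \<alpha> C \<kappa> T y"
  unfolding asym_hom_def
proof (intro conjI ballI allI)
  fix t assume t: "t \<in> carrier T"
  show "bdd_fam I C (y t)" using y_bdd[OF t] y_in[OF t] by (rule bdd_C)
  have xt: "!!i. i \<in> I ==> x t i \<in> carrier (A i)" using x_in[OF t] by simp
  show "eqv \<alpha> C \<kappa> (y (star T t)) (\<lambda>i. star (C i) (y t i))"
  proof (rule eqv_cp[OF x_star[OF t]])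
    show "cp (\<lambda>i. star (A i) (x t i)) \<asymp> (\<lambda>i. star (C i) (y t i))"
    proof (rule eqv_same)
      fix i assume i: "i \<in> I"
      interpret tracial_algebra "A i" "\<rho> i" by (rule fam[OF i])
      show "cp (\<lambda>i. star (A i) (x t i)) i = star (C i) (y t i)"
        using projectionD[OF q[OF i]] xt[OF i] by (simp add: cp_def y_def star_mult m_assoc)
    qed (intro bdd_fam_in cp_bdd bdd_star x_bdd t)
    show "bounded_fam (\<lambda>i. star (C i) (y t i))" using bdd_star[OF y_bdd[OF t]] by simp
    fix i assume i: "i \<in> I"
    interpret C: tracial_algebra "C i" "\<kappa> i" by (rule C_tracial[OF i])
    show "star (C i) (y t i) \<in> carrier (C i)" using y_in[OF t i] by (rule C.star_closed)
  qed (use t bdd_star x_bdd in auto)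
  show "eqv \<alpha> C \<kappa> (y (c \<odot> t)) (\<lambda>i. c \<odot>\<^bsub>C i\<^esub> y t i)" for c
  proof (rule eqv_cp[OF x_scal[OF t]])
    show "cp (\<lambda>i. c \<odot>\<^sub>i x t i) \<asymp> (\<lambda>i. c \<odot>\<^bsub>C i\<^esub> y t i)"
    proof (rule eqv_same)
      fix i assume i: "i \<in> I"
      interpret tracial_algebra "A i" "\<rho> i" by (rule fam[OF i])
      show "cp (\<lambda>i. c \<odot>\<^sub>i x t i) i = c \<odot>\<^bsub>C i\<^esub> y t i"
        using projectionD[OF q[OF i]] xt[OF i] by (simp add: cp_def y_def smult_mult_left smult_mult_right)
    qed (intro bdd_fam_in cp_bdd bdd_scal x_bdd t)
    show "bounded_fam (\<lambda>i. c \<odot>\<^bsub>C i\<^esub> y t i)" using bdd_scal[OF y_bdd[OF t]] by simp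
    fix i assume i: "i \<in> I"
    interpret C: tracial_algebra "C i" "\<kappa> i" by (rule C_tracial[OF i])
    show "c \<odot>\<^bsub>C i\<^esub> y t i \<in> carrier (C i)" using y_in[OF t i] by (rule C.scal_closed)
  qed (use t bdd_scal x_bdd in auto)
next
  fix s t assume s: "s \<in> carrier T" and t: "t \<in> carrier T"
  have xt: "!!i. i \<in> I ==> x t i \<in> carrier (A i)" using x_in[OF t] by simp
  have xs: "!!i. i \<in> I ==> x s i \<in> carrier (A i)" using x_in[OF s] by simp
  show "eqv \<alpha> C \<kappa> (y (s \<oplus> t)) (\<lambda>i. y s i \<oplus>\<^bsub>C i\<^esub> y t i)"
  proof (rule eqv_cp[OF x_add[OF s t]])
    show "cp (\<lambda>i. x s i \<oplus>\<^sub>i x t i) \<asymp> (\<lambda>i. y s i \<oplus>\<^bsub>C i\<^esub> y t i)"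
    proof (rule eqv_same)
      fix i assume i: "i \<in> I"
      interpret tracial_algebra "A i" "\<rho> i" by (rule fam[OF i])
      show "cp (\<lambda>i. x s i \<oplus>\<^sub>i x t i) i = y s i \<oplus>\<^bsub>C i\<^esub> y t i"
        using projectionD[OF q[OF i]] xt[OF i] xs[OF i] by (simp add: cp_def y_def l_distr r_distr)
    qed (intro bdd_fam_in cp_bdd bdd_add x_bdd s t)
    show "bounded_fam (\<lambda>i. y s i \<oplus>\<^bsub>C i\<^esub> y t i)" using bdd_add[OF y_bdd[OF s] y_bdd[OF t]] by simp
    fix i assume i: "i \<in> I"
    interpret C: tracial_algebra "C i" "\<kappa> i" by (rule C_tracial[OF i])
    show "y s i \<oplus>\<^bsub>C i\<^esub> y t i \<in> carrier (C i)" using y_in[OF s i] y_in[OF t i] by (rule C.a_closed)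
  qed (use s t bdd_add x_bdd in auto)
  show "eqv \<alpha> C \<kappa> (y (s \<otimes> t)) (\<lambda>i. y s i \<otimes>\<^bsub>C i\<^esub> y t i)"
  proof (rule eqv_cp[OF x_mult[OF s t]])
    have a: "cp (\<lambda>i. x s i \<otimes>\<^sub>i x t i) \<asymp> (\<lambda>i. q i \<otimes>\<^sub>i (q i \<otimes>\<^sub>i x s i) \<otimes>\<^sub>i (x t i \<otimes>\<^sub>i q i))"
    proof (rule eqv_same)
      fix i assume i: "i \<in> I"
      interpret tracial_algebra "A i" "\<rho> i" by (rule fam[OF i])
      show "cp (\<lambda>i. x s i \<otimes>\<^sub>i x t i) i = q i \<otimes>\<^sub>i (q i \<otimes>\<^sub>i x s i) \<otimes>\<^sub>i (x t i \<otimes>\<^sub>i q i)"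
        using projectionD[OF q[OF i]] xt[OF i] xs[OF i] by (simp add: cp_def m_assoc)
    qed (intro bdd_fam_in cp_bdd bdd_mult x_bdd s t)
    have b: "(\<lambda>i. q i \<otimes>\<^sub>i (q i \<otimes>\<^sub>i x s i) \<otimes>\<^sub>i (x t i \<otimes>\<^sub>i q i))
        \<asymp> (\<lambda>i. q i \<otimes>\<^sub>i (x s i \<otimes>\<^sub>i q i) \<otimes>\<^sub>i (x t i \<otimes>\<^sub>i q i))"
      by (intro eqv_mult eqv_refl q_comm bdd_mult q_bdd x_bdd bdd_fam_in s t)
    have c: "(\<lambda>i. q i \<otimes>\<^sub>i (x s i \<otimes>\<^sub>i q i) \<otimes>\<^sub>i (x t i \<otimes>\<^sub>i q i)) \<asymp> (\<lambda>i. y s i \<otimes>\<^bsub>C i\<^esub> y t i)"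
    proof (rule eqv_same)
      fix i assume i: "i \<in> I"
      interpret tracial_algebra "A i" "\<rho> i" by (rule fam[OF i])
      show "q i \<otimes>\<^sub>i (x s i \<otimes>\<^sub>i q i) \<otimes>\<^sub>i (x t i \<otimes>\<^sub>i q i) = y s i \<otimes>\<^bsub>C i\<^esub> y t i"
        using projectionD[OF q[OF i]] xt[OF i] xs[OF i] by (simp add: cp_def y_def m_assoc)
    qed (intro bdd_fam_in bdd_mult q_bdd x_bdd s t)
    have yy: "bounded_fam (\<lambda>i. y s i \<otimes>\<^bsub>C i\<^esub> y t i)" using bdd_mult[OF y_bdd[OF s] y_bdd[OF t]] by simp
    show "cp (\<lambda>i. x s i \<otimes>\<^sub>i x t i) \<asymp> (\<lambda>i. y s i \<otimes>\<^bsub>C i\<^esub> y t i)"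
      by (rule eqv_trans[OF a eqv_trans[OF b c]])
        (intro bdd_fam_in cp_bdd bdd_mult q_bdd x_bdd s t yy)+
    show "bounded_fam (\<lambda>i. y s i \<otimes>\<^bsub>C i\<^esub> y t i)" by (rule yy)
    fix i assume i: "i \<in> I"
    interpret C: tracial_algebra "C i" "\<kappa> i" by (rule C_tracial[OF i])
    show "y s i \<otimes>\<^bsub>C i\<^esub> y t i \<in> carrier (C i)" using y_in[OF s i] y_in[OF t i] by (rule C.m_closed)
  qed (use s t bdd_mult x_bdd in auto)
next
  show "eqv \<alpha> C \<kappa> (y \<one>) (\<lambda>i. \<one>\<^bsub>C i\<^esub>)"
  proof (rule eqv_cp[OF x_one])
    show "cp (\<lambda>i. \<one>\<^sub>i) \<asymp> (\<lambda>i. \<one>\<^bsub>C i\<^esub>)"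
    proof (rule eqv_same)
      fix i assume i: "i \<in> I"
      interpret tracial_algebra "A i" "\<rho> i" by (rule fam[OF i])
      show "cp (\<lambda>i. \<one>\<^sub>i) i = \<one>\<^bsub>C i\<^esub>" using projectionD[OF q[OF i]] by (simp add: cp_def)
    qed (intro bdd_fam_in cp_bdd bdd_one)
    fix i assume i: "i \<in> I"
    interpret C: tracial_algebra "C i" "\<kappa> i" by (rule C_tracial[OF i])
    show "\<one>\<^bsub>C i\<^esub> \<in> carrier (C i)" by (rule C.one_closed)
  qed (use bdd_one q_bdd in auto)
qed

lemma C_loc:
  assumes a: "a \<in> carrier T" and h: "!!i. i \<in> I ==> self_adjoint (A i) (h i)" "bounded_fam h" "x a \<asymp> h"
    and r: "0 \<le> r"
    and bound: "\<forall>\<^sub>F i in \<alpha>.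
      cnorm (A i) (q i \<otimes>\<^sub>i (h i \<ominus>\<^sub>i of_real c \<odot>\<^sub>i \<one>\<^sub>i) \<otimes>\<^sub>i q i) \<le> r"
  shows "loc I \<alpha> C \<kappa> (y a) c r"
proof -
  define k where "k = (\<lambda>i. if cnorm (A i) (q i \<otimes>\<^sub>i (h i \<ominus>\<^sub>i of_real c \<odot>\<^sub>i \<one>\<^sub>i) \<otimes>\<^sub>i q i) \<le> r
    then cp h i else of_real c \<odot>\<^sub>i q i)"
  have *: "self_adjoint (C i) (k i) \<and> cnorm (C i) (k i \<ominus>\<^bsub>C i\<^esub> of_real c \<odot>\<^bsub>C i\<^esub> \<one>\<^bsub>C i\<^esub>) \<le> r"
    if i: "i \<in> I" for i
  proof -
    interpret tracial_algebra "A i" "\<rho> i" by (rule fam[OF i])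
    interpret C: tracial_algebra "C i" "\<kappa> i" by (rule C_tracial[OF i])
    note qi = projectionD[OF q[OF i]]
    have hi: "h i \<in> carrier (A i)" "star (A i) (h i) = h i" using h(1)[OF i] by (auto simp: self_adjoint_def)
    have c1: "cp h i \<in> carrier (C i)" using bdd_fam_in[OF h(2)] i by (rule cp_C)
    have "\<one>\<^bsub>C i\<^esub> \<in> carrier (C i)" by (rule C.one_closed)
    then have qC: "q i \<in> carrier (C i)" by (simp only: C_simps)
    have c2: "of_real c \<odot>\<^sub>i q i \<in> carrier (C i)" using C.scal_closed[OF qC] by simp
    have kC: "k i \<in> carrier (C i)" using c1 c2 by (simp add: k_def)
    have ks: "star (A i) (k i) = k i" using qi hi by (simp add: k_def cp_def star_simps m_assoc)
    have "cnorm (A i) (k i \<ominus>\<^sub>i of_real c \<odot>\<^sub>i q i) \<le> r"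
      using r qi corner_shift[OF q[OF i] hi(1), of "complex_of_real c"] by (simp add: k_def cp_def)
    then show ?thesis using kC ks C_diff[OF i kC c2] by (simp add: self_adjoint_def)
  qed
  have kin: "!!i. i \<in> I ==> k i \<in> carrier (C i)" using * by (simp add: self_adjoint_def)
  have kA: "fam_in k" using kin C_A by blast
  have 1: "y a \<asymp> cp h" unfolding y_def by (intro cp_eqv h x_bdd a)
  have 2: "cp h \<asymp> k"
    by (rule eqv_eventually[OF eventually_mono[OF bound]]) (use cp_bdd[OF h(2)] in \<open>auto simp: k_def bdd_fam_def\<close>)
  have "y a \<asymp> k" by (rule eqv_trans[OF 1 2]) (intro bdd_fam_in y_bdd a cp_bdd h kA)+
  then have "eqv \<alpha> C \<kappa> (y a) k" using y_in[OF a] kin by (rule eqv_C)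
  with * show ?thesis unfolding loc_def by blast
qed

end

section \<open>Cutting the spectrum of a central element\<close>

lemma (in unital_cstar_algebra) diff_diff_cancel:
  assumes "u \<in> carrier A" "v \<in> carrier A" "d \<in> carrier A"
  shows "(u \<ominus> d) \<ominus> (v \<ominus> d) = u \<ominus> v"
proof -
  have "(u \<ominus> d) \<ominus> (v \<ominus> d) = (u \<ominus> v) \<oplus> (d \<ominus> d)" using assms by (simp add: minus_eq minus_add a_ac)
  then show ?thesis using assms by simp
qed

context representation
begin

text \<open>The cut at index \<open>i\<close> has to commute with the first \<open>N i\<close> members of a dense sequence, where \<open>N i\<close>
  tends to infinity. The number \<open>l n\<close> of thresholds to choose from is so large that the average
  squared commutator is below \<open>1 / (n + 1)\<close>.\<close>

lemma almost_central_projections: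
  fixes d :: "nat => 't"
  assumes rr: "!!i. i \<in> I ==> real_rank_zero (A i)"
    and d: "!!k. d k \<in> carrier T"
    and dense: "!!t e. t \<in> carrier T ==> e > 0 ==> \<exists>k. cnorm T (t \<ominus> d k) < e"
    and h: "!!i. i \<in> I ==> self_adjoint (A i) (h i)" "!!i. i \<in> I ==> cnorm (A i) (h i) < r" and r: "0 < r"
    and hc: "!!t. t \<in> carrier T ==> (\<lambda>i. h i \<otimes>\<^sub>i x t i) \<asymp> (\<lambda>i. x t i \<otimes>\<^sub>i h i)"
  obtains q where "!!i. i \<in> I ==> projection (A i) (q i)"
    "!!i. i \<in> I ==> cnorm (A i) ((\<one>\<^sub>i \<ominus>\<^sub>i q i) \<otimes>\<^sub>i
      (h i \<oplus>\<^sub>i of_real (r/2) \<odot>\<^sub>i \<one>\<^sub>i) \<otimes>\<^sub>i (\<one>\<^sub>i \<ominus>\<^sub>i q i)) \<le> 7/8 * r"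
    "!!i. i \<in> I ==> cnorm (A i) (q i \<otimes>\<^sub>i
      (h i \<oplus>\<^sub>i of_real (-r/2) \<odot>\<^sub>i \<one>\<^sub>i) \<otimes>\<^sub>i q i) \<le> 7/8 * r"
    "!!t. t \<in> carrier T ==> (\<lambda>i. q i \<otimes>\<^sub>i x t i) \<asymp> (\<lambda>i. x t i \<otimes>\<^sub>i q i)"
proof -
  have "\<exists>C\<ge>0. \<forall>i\<in>I. cnorm (A i) (x (d k) i) \<le> C" for k
    using bdd_bound[OF x_bdd[OF d[of k]]] by metis
  then obtain M where M: "!!k. 0 \<le> M k" "!!k i. i \<in> I ==> cnorm (A i) (x (d k) i) \<le> M k" by metis
  have "\<exists>l::nat. (4::nat) \<le> l \<and> (\<Sum>k\<le>n. (1 + 6 * M k)\<^sup>2) / (2 * l) < 1 / real (Suc n)" for n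
  proof -
    define V where "V = (\<Sum>k\<le>n. (1 + 6 * M k)\<^sup>2)"
    have V0: "0 \<le> V" unfolding V_def by (intro sum_nonneg) auto
    obtain l0 where l0: "real l0 > V * real (Suc n)" using reals_Archimedean2 by blast
    define l where "l = max 4 l0"
    have "V * real (Suc n) < 2 * real l" using l0 by (simp add: l_def)
    then have "V < 2 * real l / real (Suc n)" by (simp only: pos_less_divide_eq of_nat_0_less_iff zero_less_Suc)
    moreover have l2: "0 < 2 * real l" by (simp add: l_def)
    ultimately have "V / (2 * real l) < (2 * real l / real (Suc n)) / (2 * real l)" by (rule divide_strict_right_mono)
    also have "\<dots> = 1 / real (Suc n)" using l2 by simp
    finally have "V / (2 * real l) < 1 / real (Suc n)" .
    moreover have "(4::nat) \<le> l" by (simp add: l_def)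
    ultimately show ?thesis unfolding V_def by (intro exI[of _ l] conjI) (simp_all only: of_nat_mult of_nat_numeral)
  qed
  then obtain l :: "nat => nat" where l: "!!n. (4::nat) \<le> l n"
    "!!n. (\<Sum>k\<le>n. (1 + 6 * M k)\<^sup>2) / (2 * l n) < 1 / real (Suc n)" by metis
  define cm where "cm = (\<lambda>u t i. nrm i (u i \<otimes>\<^sub>i x t i \<ominus>\<^sub>i x t i \<otimes>\<^sub>i u i))"
  define P where "P = (\<lambda>n i. i \<in> I \<and> (\<forall>k\<in>{..n}. cm h (d k) i * (4 * l n) / r \<le> 1))"
  have "\<forall>\<^sub>F i in \<alpha>. P n i" for n
  proof -
    have "\<forall>\<^sub>F i in \<alpha>. cm h (d k) i * (4 * l n) / r \<le> 1" for k
    proof -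
      have "(cm h (d k) \<longlongrightarrow> 0) \<alpha>" using hc[OF d[of k]] by (simp add: cm_def eqv_def)
      moreover have "r / (4 * l n) > 0" using r l(1)[of n] by simp
      ultimately have "\<forall>\<^sub>F i in \<alpha>. cm h (d k) i < r / (4 * l n)" by (rule order_tendstoD(2))
      then show ?thesis
      proof (rule eventually_mono)
        fix i assume "cm h (d k) i < r / (4 * l n)"
        then show "cm h (d k) i * (4 * l n) / r \<le> 1" using r l(1)[of n] by (simp add: field_simps)
      qed
    qed
    then show ?thesis unfolding P_def by (intro eventually_conj in_I eventually_ball_finite) auto
  qed
  then obtain N where N: "\<forall>\<^sub>F i in \<alpha>. P (N i) i" "!!n. \<forall>\<^sub>F i in \<alpha>. n \<le> N i" using diagonal by blast
  define Qp where "Qp = (\<lambda>i q. projection (A i) q \<and>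
      cnorm (A i) ((\<one>\<^sub>i \<ominus>\<^sub>i q) \<otimes>\<^sub>i
        (h i \<oplus>\<^sub>i of_real (r/2) \<odot>\<^sub>i \<one>\<^sub>i) \<otimes>\<^sub>i (\<one>\<^sub>i \<ominus>\<^sub>i q)) \<le> 7/8 * r \<and>
      cnorm (A i) (q \<otimes>\<^sub>i (h i \<oplus>\<^sub>i of_real (-r/2) \<odot>\<^sub>i \<one>\<^sub>i) \<otimes>\<^sub>i q) \<le> 7/8 * r \<and>
      (\<Sum>k\<le>N i. (nrm i (q \<otimes>\<^sub>i x (d k) i \<ominus>\<^sub>i x (d k) i \<otimes>\<^sub>i q))\<^sup>2) \<le>
      (\<Sum>k\<le>N i. (cm h (d k) i * (4 * l (N i)) / r + 6 * n2 (x (d k)) i)\<^sup>2) / (2 * l (N i)))"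
  have ex: "\<exists>q. Qp i q" if i: "i \<in> I" for i
  proof -
    interpret tracial_algebra "A i" "\<rho> i" by (rule fam[OF i])
    have xi: "!!k. k \<in> {..N i} ==> x (d k) i \<in> carrier (A i)" using x_in[OF d] i by blast
    show ?thesis unfolding Qp_def
      by (rule almost_central_cut[where F = "{..N i}" and b = "\<lambda>k. x (d k) i", OF rr[OF i] h(1)[OF i] h(2)[OF i] l(1)[of "N i"] finite_atMost xi])
        (assumption, unfold comm_def cm_def, intro exI conjI, assumption+)
  qed
  define q where "q = (\<lambda>i. SOME z. Qp i z)"
  have "Qp i (q i)" if "i \<in> I" for i
    unfolding q_def by (rule someI_ex[OF ex[OF that]])
  then have q: "!!i. i \<in> I ==> projection (A i) (q i)"
    and lo: "!!i. i \<in> I ==> cnorm (A i) ((\<one>\<^sub>i \<ominus>\<^sub>i q i) \<otimes>\<^sub>i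
        (h i \<oplus>\<^sub>i of_real (r/2) \<odot>\<^sub>i \<one>\<^sub>i) \<otimes>\<^sub>i (\<one>\<^sub>i \<ominus>\<^sub>i q i)) \<le> 7/8 * r"
    and hi: "!!i. i \<in> I ==> cnorm (A i) (q i \<otimes>\<^sub>i
        (h i \<oplus>\<^sub>i of_real (-r/2) \<odot>\<^sub>i \<one>\<^sub>i) \<otimes>\<^sub>i q i) \<le> 7/8 * r"
    and sm: "!!i. i \<in> I ==> (\<Sum>k\<le>N i. (cm q (d k) i)\<^sup>2) \<le>
      (\<Sum>k\<le>N i. (cm h (d k) i * (4 * l (N i)) / r + 6 * n2 (x (d k)) i)\<^sup>2) / (2 * l (N i))"
    unfolding cm_def Qp_def by blast+
  have small: "(cm q (d k) i)\<^sup>2 \<le> 1 / real (Suc (N i))" if i: "P (N i) i" and k: "k \<le> N i" for i k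
  proof -
    have iI: "i \<in> I" using i by (simp add: P_def)
    interpret tracial_algebra "A i" "\<rho> i" by (rule fam[OF iI])
    have xi [simp]: "x (d k) i \<in> carrier (A i)" for k using x_in[OF d] iI by blast
    have hi [simp]: "h i \<in> carrier (A i)" using h(1)[OF iI] by (simp add: self_adjoint_def)
    have "(cm q (d k) i)\<^sup>2 \<le> (\<Sum>k\<le>N i. (cm q (d k) i)\<^sup>2)"
      using k by (intro member_le_sum) auto
    also have "\<dots> \<le> (\<Sum>k\<le>N i. (cm h (d k) i * (4 * l (N i)) / r + 6 * n2 (x (d k)) i)\<^sup>2) / (2 * l (N i))"
      by (rule sm[OF iI])
    also have "\<dots> \<le> (\<Sum>k\<le>N i. (1 + 6 * M k)\<^sup>2) / (2 * l (N i))"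
    proof (intro divide_right_mono sum_mono power_mono add_mono mult_left_mono)
      fix j assume "j \<in> {..N i}"
      then show "cm h (d j) i * (4 * l (N i)) / r \<le> 1" using i by (simp add: P_def)
      show "n2 (x (d j)) i \<le> M j" using norm2_le_cnorm[OF xi] M(2)[OF iI] by (rule order_trans)
      have "0 \<le> cm h (d j) i" unfolding cm_def by (intro norm2_nonneg) auto
      then show "0 \<le> cm h (d j) i * (4 * l (N i)) / r + 6 * n2 (x (d j)) i" using r by simp
    qed auto
    also have "\<dots> \<le> 1 / real (Suc (N i))" using l(2)[of "N i"] by (rule less_imp_le)
    finally show ?thesis .
  qed
  have ev_d: "\<forall>\<^sub>F i in \<alpha>. cm q (d k) i < e" if e: "e > 0" for k e
  proof -
    obtain m :: nat where m: "1 / real (Suc m) < e\<^sup>2" using e nat_approx_posE[of "e\<^sup>2"] by auto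
    show ?thesis using N(1) N(2)[of k] N(2)[of m]
    proof eventually_elim
      case (elim i)
      have "(cm q (d k) i)\<^sup>2 \<le> 1 / real (Suc (N i))" using elim by (intro small)
      also have "\<dots> \<le> 1 / real (Suc m)" using elim(3) by (intro divide_left_mono) auto
      also have "\<dots> < e\<^sup>2" by (rule m)
      finally show ?case using less_imp_le[OF e] by (rule power2_less_imp_less)
    qed
  qed
  have ev_t: "\<forall>\<^sub>F i in \<alpha>. cm q t i < e" if e: "e > 0" and t: "t \<in> carrier T" for t e
  proof -
    obtain k where k: "cnorm T (t \<ominus> d k) < e / 4" using dense[OF t, of "e/4"] e by auto
    have "e / 2 > 0" using e by simp
    show ?thesis using n2_diff_less[OF t d k] ev_d[OF \<open>e / 2 > 0\<close>, of k] in_I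
    proof eventually_elim
      case (elim i)
      interpret tracial_algebra "A i" "\<rho> i" by (rule fam[OF elim(3)])
      have [simp]: "x t i \<in> carrier (A i)" "x (d k) i \<in> carrier (A i)" "q i \<in> carrier (A i)"
        using x_in[OF d] x_in[OF t] elim projectionD(1)[OF q] by auto
      have "q i \<otimes>\<^sub>i x t i \<ominus>\<^sub>i x t i \<otimes>\<^sub>i q i
          = comm (q i) (x t i \<ominus>\<^sub>i x (d k) i) \<oplus>\<^sub>i comm (q i) (x (d k) i)"
      proof -
        have "comm (q i) (z \<oplus>\<^sub>i u) = comm (q i) z \<oplus>\<^sub>i comm (q i) u"
          if "z \<in> carrier (A i)" "u \<in> carrier (A i)" for z u
          using that by (simp add: comm_def r_distr l_distr add_diff_add)
        moreover have "x t i = (x t i \<ominus>\<^sub>i x (d k) i) \<oplus>\<^sub>i x (d k) i"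
          using diff_add_diff[of "x t i" "x (d k) i" "\<zero>\<^sub>i"] by simp
        ultimately have "comm (q i) (x t i)
            = comm (q i) (x t i \<ominus>\<^sub>i x (d k) i) \<oplus>\<^sub>i comm (q i) (x (d k) i)"
          by (metis minus_closed \<open>x t i \<in> carrier (A i)\<close> \<open>x (d k) i \<in> carrier (A i)\<close>)
        then show ?thesis by (simp only: comm_def)
      qed
      then have "cm q t i \<le> nrm i (comm (q i) (x t i \<ominus>\<^sub>i x (d k) i))
          + nrm i (comm (q i) (x (d k) i))"
        unfolding cm_def by (simp only:) (intro norm2_triangle, auto)
      also have "\<dots> \<le> 2 * cnorm (A i) (q i) * nrm i (x t i \<ominus>\<^sub>i x (d k) i) + cm q (d k) i"
        using norm2_comm_le[of "q i" "x t i \<ominus>\<^sub>i x (d k) i"] by (simp add: cm_def comm_def)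
      also have "\<dots> \<le> 2 * 1 * nrm i (x t i \<ominus>\<^sub>i x (d k) i) + cm q (d k) i"
        using projection_cnorm[OF q[OF elim(3)]] by (intro add_mono mult_right_mono mult_left_mono) auto
      finally show ?case using elim by simp
    qed
  qed
  show thesis
  proof (rule that[OF q lo hi])
    fix t assume t: "t \<in> carrier T"
    show "(\<lambda>i. q i \<otimes>\<^sub>i x t i) \<asymp> (\<lambda>i. x t i \<otimes>\<^sub>i q i)"
      unfolding eqv_def
    proof (rule order_tendstoI)
      fix e :: real assume "e < 0"
      show "\<forall>\<^sub>F i in \<alpha>. e < nrm i (q i \<otimes>\<^sub>i x t i \<ominus>\<^sub>i x t i \<otimes>\<^sub>i q i)"
        using in_I
      proof eventually_elim
        case (elim i)
        interpret tracial_algebra "A i" "\<rho> i" by (rule fam[OF elim])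
        have "0 \<le> nrm i (q i \<otimes>\<^sub>i x t i \<ominus>\<^sub>i x t i \<otimes>\<^sub>i q i)"
          using x_in[OF t] elim projectionD(1)[OF q[OF elim]] by (intro norm2_nonneg) auto
        then show ?case using \<open>e < 0\<close> by linarith
      qed
    qed (use ev_t[OF _ t] in \<open>simp add: cm_def\<close>)
  qed auto
qed

text \<open>A central element has representatives that commute asymptotically with all others, so its
  spectrum can be cut by almost central projections. The cut gains the factor \<open>7/8\<close> on a radius
  slightly above \<open>r\<close>; the strict bound is bought by enlarging \<open>r\<close> to \<open>36/35 r\<close>, and
  \<open>7/8 \<cdot> 36/35 = 9/10\<close>.\<close>

lemma central_cut:
  fixes d :: "nat => 't"
  assumes rr: "!!i. i \<in> I ==> real_rank_zero (A i)"
    and d: "!!k. d k \<in> carrier T"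
    and dense: "!!t e. t \<in> carrier T ==> e > 0 ==> \<exists>k. cnorm T (t \<ominus> d k) < e"
    and a: "a \<in> carrier T" "!!t. t \<in> carrier T ==> a \<otimes> t = t \<otimes> a"
    and l: "loc I \<alpha> A \<rho> (x a) c r" and r: "0 < r"
  obtains h q c1 c2 where "!!i. i \<in> I ==> self_adjoint (A i) (h i)" "bounded_fam h" "x a \<asymp> h"
    "!!i. i \<in> I ==> projection (A i) (q i)"
    "!!i. i \<in> I ==> cnorm (A i) ((\<one>\<^sub>i \<ominus>\<^sub>i q i) \<otimes>\<^sub>i
      (h i \<ominus>\<^sub>i of_real c1 \<odot>\<^sub>i \<one>\<^sub>i) \<otimes>\<^sub>i (\<one>\<^sub>i \<ominus>\<^sub>i q i)) \<le> 9/10 * r"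
    "!!i. i \<in> I ==> cnorm (A i) (q i \<otimes>\<^sub>i
      (h i \<ominus>\<^sub>i of_real c2 \<odot>\<^sub>i \<one>\<^sub>i) \<otimes>\<^sub>i q i) \<le> 9/10 * r"
    "!!t. t \<in> carrier T ==> (\<lambda>i. q i \<otimes>\<^sub>i x t i) \<asymp> (\<lambda>i. x t i \<otimes>\<^sub>i q i)"
proof -
  obtain h where h: "!!i. i \<in> I ==> self_adjoint (A i) (h i) \<and>
      cnorm (A i) (h i \<ominus>\<^sub>i of_real c \<odot>\<^sub>i \<one>\<^sub>i) \<le> r" and xh: "x a \<asymp> h"
    using l unfolding loc_def by blast
  have hb: "bounded_fam h" by (rule loc_bdd[OF h])
  define g where "g = (\<lambda>i. h i \<ominus>\<^sub>i of_real c \<odot>\<^sub>i \<one>\<^sub>i)"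
  define r' where "r' = 36/35 * r"
  have gs: "self_adjoint (A i) (g i) \<and> cnorm (A i) (g i) < r'" if i: "i \<in> I" for i
  proof -
    interpret tracial_algebra "A i" "\<rho> i" by (rule fam[OF i])
    show ?thesis using h[OF i] r by (auto simp: g_def r'_def self_adjoint_def star_simps)
  qed
  have hc: "(\<lambda>i. h i \<otimes>\<^sub>i x t i) \<asymp> (\<lambda>i. x t i \<otimes>\<^sub>i h i)" if t: "t \<in> carrier T" for t
  proof -
    note fi = bdd_fam_in[OF bdd_mult[OF hb x_bdd[OF t]]] bdd_fam_in[OF bdd_mult[OF x_bdd[OF t] hb]]
      bdd_fam_in[OF bdd_mult[OF x_bdd[OF a(1)] x_bdd[OF t]]] bdd_fam_in[OF bdd_mult[OF x_bdd[OF t] x_bdd[OF a(1)]]]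
    have at: "a \<otimes> t \<in> carrier T" using a t by simp
    have 1: "(\<lambda>i. x a i \<otimes>\<^sub>i x t i) \<asymp> (\<lambda>i. h i \<otimes>\<^sub>i x t i)"
      by (intro eqv_mult xh eqv_refl x_in x_bdd a t hb)
    have 2: "(\<lambda>i. x t i \<otimes>\<^sub>i x a i) \<asymp> (\<lambda>i. x t i \<otimes>\<^sub>i h i)"
      by (intro eqv_mult xh eqv_refl x_in x_bdd a t hb)
    have 3: "x (a \<otimes> t) \<asymp> (\<lambda>i. x a i \<otimes>\<^sub>i x t i)" by (rule x_mult[OF a(1) t])
    have 4: "x (a \<otimes> t) \<asymp> (\<lambda>i. x t i \<otimes>\<^sub>i x a i)" unfolding a(2)[OF t] by (rule x_mult[OF t a(1)])
    have 5: "x (a \<otimes> t) \<asymp> (\<lambda>i. h i \<otimes>\<^sub>i x t i)" by (rule eqv_trans[OF 3 1 x_in[OF at] fi(3,1)])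
    have 6: "x (a \<otimes> t) \<asymp> (\<lambda>i. x t i \<otimes>\<^sub>i h i)" by (rule eqv_trans[OF 4 2 x_in[OF at] fi(4,2)])
    show ?thesis by (rule eqv_trans[OF eqv_sym[OF 5 x_in[OF at] fi(1)] 6 fi(1) x_in[OF at] fi(2)])
  qed
  have gc: "(\<lambda>i. g i \<otimes>\<^sub>i x t i) \<asymp> (\<lambda>i. x t i \<otimes>\<^sub>i g i)" if t: "t \<in> carrier T" for t
    unfolding eqv_def
  proof (rule Lim_transform_eventually[OF hc[OF t, unfolded eqv_def]])
    show "\<forall>\<^sub>F i in \<alpha>. nrm i (h i \<otimes>\<^sub>i x t i \<ominus>\<^sub>i x t i \<otimes>\<^sub>i h i)
        = nrm i (g i \<otimes>\<^sub>i x t i \<ominus>\<^sub>i x t i \<otimes>\<^sub>i g i)"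
      using in_I
    proof eventually_elim
      case (elim i)
      interpret tracial_algebra "A i" "\<rho> i" by (rule fam[OF elim])
      have [simp]: "x t i \<in> carrier (A i)" "h i \<in> carrier (A i)"
        using x_in[OF t] elim bddD[OF hb elim] by auto
      have "g i \<otimes>\<^sub>i x t i \<ominus>\<^sub>i x t i \<otimes>\<^sub>i g i = h i \<otimes>\<^sub>i x t i \<ominus>\<^sub>i x t i \<otimes>\<^sub>i h i"
        by (simp add: g_def diff_distr_left diff_distr_right smult_mult_left smult_mult_right diff_diff_cancel)
      then show ?case by simp
    qed
  qed
  obtain q where q: "!!i. i \<in> I ==> projection (A i) (q i)"
    and lo: "!!i. i \<in> I ==> cnorm (A i) ((\<one>\<^sub>i \<ominus>\<^sub>i q i) \<otimes>\<^sub>i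
      (g i \<oplus>\<^sub>i of_real (r'/2) \<odot>\<^sub>i \<one>\<^sub>i) \<otimes>\<^sub>i (\<one>\<^sub>i \<ominus>\<^sub>i q i)) \<le> 7/8 * r'"
    and hi: "!!i. i \<in> I ==> cnorm (A i) (q i \<otimes>\<^sub>i
      (g i \<oplus>\<^sub>i of_real (-r'/2) \<odot>\<^sub>i \<one>\<^sub>i) \<otimes>\<^sub>i q i) \<le> 7/8 * r'"
    and qc: "!!t. t \<in> carrier T ==> (\<lambda>i. q i \<otimes>\<^sub>i x t i) \<asymp> (\<lambda>i. x t i \<otimes>\<^sub>i q i)"
    by (rule almost_central_projections[OF rr d dense, of g r'])
      (use gs gc r in \<open>auto simp: r'_def\<close>)
  have shift: "g i \<oplus>\<^sub>i of_real s \<odot>\<^sub>i \<one>\<^sub>i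
      = h i \<ominus>\<^sub>i of_real (c - s) \<odot>\<^sub>i \<one>\<^sub>i" if i: "i \<in> I" for i s
  proof -
    interpret tracial_algebra "A i" "\<rho> i" by (rule fam[OF i])
    show ?thesis using bddD[OF hb i] by (simp add: g_def scal_diff_left cs)
  qed
  have r'r: "7/8 * r' = 9/10 * r" by (simp add: r'_def)
  have hs: "self_adjoint (A i) (h i)" if "i \<in> I" for i using h[OF that] by blast
  show thesis
  proof (rule that[of h q "c - r'/2" "c - (-r'/2)", OF hs hb xh q _ _ qc])
    fix i assume i: "i \<in> I"
    show "cnorm (A i) ((\<one>\<^sub>i \<ominus>\<^sub>i q i) \<otimes>\<^sub>i
        (h i \<ominus>\<^sub>i of_real (c - r'/2) \<odot>\<^sub>i \<one>\<^sub>i) \<otimes>\<^sub>i (\<one>\<^sub>i \<ominus>\<^sub>i q i)) \<le> 9/10 * r"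
      using lo[OF i] unfolding shift[OF i] r'r .
    show "cnorm (A i) (q i \<otimes>\<^sub>i
        (h i \<ominus>\<^sub>i of_real (c - (-r'/2)) \<odot>\<^sub>i \<one>\<^sub>i) \<otimes>\<^sub>i q i) \<le> 9/10 * r"
      using hi[OF i] unfolding shift[OF i] r'r .
  qed auto
qed

end

text \<open>For a projection the trace is the square of the 2-norm.\<close>

lemma (in family) projection_of_null_trace:
  assumes q: "!!i. i \<in> I ==> projection (A i) (q i)" and l: "((\<lambda>i. Re (\<rho> i (q i))) \<longlongrightarrow> 0) \<alpha>"
  shows "(\<lambda>i. \<one>\<^sub>i \<ominus>\<^sub>i q i) \<asymp> (\<lambda>i. \<one>\<^sub>i)"
  unfolding eqv_def
proof (rule Lim_transform_eventually)
  show "((\<lambda>i. sqrt (Re (\<rho> i (q i)))) \<longlongrightarrow> 0) \<alpha>" using tendsto_real_sqrt[OF l] by simp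
  show "\<forall>\<^sub>F i in \<alpha>. sqrt (Re (\<rho> i (q i))) = nrm i ((\<one>\<^sub>i \<ominus>\<^sub>i q i) \<ominus>\<^sub>i \<one>\<^sub>i)"
  proof (rule eventually_mono[OF in_I])
    fix i assume i: "i \<in> I"
    interpret tracial_algebra "A i" "\<rho> i" by (rule fam[OF i])
    note qi = projectionD(1)[OF q[OF i]]
    have "(\<one>\<^sub>i \<ominus>\<^sub>i q i) \<ominus>\<^sub>i \<one>\<^sub>i = \<ominus>\<^bsub>A i\<^esub> q i \<oplus>\<^sub>i (\<one>\<^sub>i \<ominus>\<^sub>i \<one>\<^sub>i)"
      using qi by (simp add: minus_eq a_ac)
    also have "\<dots> = \<zero>\<^sub>i \<ominus>\<^sub>i q i" using qi by (simp add: minus_eq r_neg)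
    finally have "nrm i ((\<one>\<^sub>i \<ominus>\<^sub>i q i) \<ominus>\<^sub>i \<one>\<^sub>i) = nrm i (q i)"
      using norm2_diff_commute[of "\<zero>\<^sub>i" "q i"] qi by simp
    then show "sqrt (Re (\<rho> i (q i))) = nrm i ((\<one>\<^sub>i \<ominus>\<^sub>i q i) \<ominus>\<^sub>i \<one>\<^sub>i)"
      using st_projection(2)[OF q[OF i]] qi by simp
  qed
qed

context representation
begin

text \<open>Compression to a corner of positive trace keeps the bounds on the other elements of \<open>S\<close> and
  improves the one on \<open>a\<close>. At the negligible set of indices where the projection has trace zero,
  the unit replaces it.\<close>

lemma good_on_corner:
  fixes \<C> :: "'a cstar_algebra set"
  assumes cls: "!!B. B \<in> \<C> ==> unital_cstar_algebra B" and corner: "corner_closed \<C>"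
    and A: "!!i. i \<in> I ==> A i \<in> \<C>"
    and S: "S \<subseteq> carrier T" and R: "!!b. b \<in> S ==> 0 < R b" and r: "0 < r"
    and l: "!!b. b \<in> S ==> loc I \<alpha> A \<rho> (x b) (c b) (R b)"
    and h: "!!i. i \<in> I ==> self_adjoint (A i) (h i)" "bounded_fam h" "x a \<asymp> h"
    and u: "!!i. i \<in> I ==> projection (A i) (u i)"
    and hu: "!!i. i \<in> I ==> cnorm (A i) (u i \<otimes>\<^sub>i (h i \<ominus>\<^sub>i of_real c' \<odot>\<^sub>i \<one>\<^sub>i) \<otimes>\<^sub>i u i) \<le> r"
    and lim: "((\<lambda>i. Re (\<rho> i (u i))) \<longlongrightarrow> \<sigma>) \<alpha>" and \<sigma>: "0 < \<sigma>"
    and comm: "!!t. t \<in> carrier T ==> (\<lambda>i. u i \<otimes>\<^sub>i x t i) \<asymp> (\<lambda>i. x t i \<otimes>\<^sub>i u i)"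
    and base: "!!A \<rho> x. \<forall>i\<in>I. A i \<in> \<C> \<and> tracial_state (A i) (\<rho> i) ==> asym_hom I \<alpha> A \<rho> T x ==>
      \<forall>b\<in>S. loc I \<alpha> A \<rho> (x b) ((c(a := c')) b) ((R(a := r)) b) ==> good \<alpha> A \<rho> T x F \<epsilon>"
    and e: "\<epsilon> < e"
  shows "\<forall>\<^sub>F i in \<alpha>. 0 < Re (\<rho> i (u i)) \<and> unital_cstar_algebra (unital_corner (A i) (u i)) \<and>
    (\<exists>f\<in>unital_star_hom T (unital_corner (A i) (u i)). \<forall>t\<in>F.
      norm2 (unital_corner (A i) (u i)) (\<lambda>z. \<rho> i z / \<rho> i (u i))
        (f t \<ominus>\<^bsub>unital_corner (A i) (u i)\<^esub> u i \<otimes>\<^sub>i x t i \<otimes>\<^sub>i u i) < e)"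
proof -
  \<comment> \<open>the unit is a default value that keeps the corner nonzero at every index\<close>
  define v where "v = (\<lambda>i. if 0 < Re (\<rho> i (u i)) then u i else \<one>\<^sub>i)"
  have ev: "\<forall>\<^sub>F i in \<alpha>. 0 < Re (\<rho> i (u i))" by (rule order_tendstoD(1)[OF lim \<sigma>])
  have v: "projection (A i) (v i) \<and> 0 < Re (\<rho> i (v i)) \<and> unital_corner (A i) (v i) \<in> \<C>" if i: "i \<in> I" for i
  proof -
    interpret tracial_algebra "A i" "\<rho> i" by (rule fam[OF i])
    have "projection (A i) (v i) \<and> 0 < Re (\<rho> i (v i))" using u[OF i] projection_one by (simp add: v_def st)
    then show ?thesis using corner A[OF i] unfolding Defs.corner_closed_def by blast
  qed
  interpret V: corner_family I \<alpha> A \<rho> T x v \<sigma>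
  proof (intro corner_family.intro representation_axioms corner_family_axioms.intro)
    show "((\<lambda>i. Re (\<rho> i (v i))) \<longlongrightarrow> \<sigma>) \<alpha>"
      by (rule Lim_transform_eventually[OF lim]) (rule eventually_mono[OF ev], simp add: v_def)
    show "eqv \<alpha> A \<rho> (\<lambda>i. v i \<otimes>\<^sub>i x t i) (\<lambda>i. x t i \<otimes>\<^sub>i v i)" if "t \<in> carrier T" for t
      unfolding eqv_def
      by (rule Lim_transform_eventually[OF comm[OF that, unfolded eqv_def]])
        (rule eventually_mono[OF ev], simp add: v_def)
  qed (use v cls \<sigma> in auto)
  have "good \<alpha> V.C V.\<kappa> T V.y F \<epsilon>"
  proof (rule base)
    show "\<forall>i\<in>I. V.C i \<in> \<C> \<and> tracial_state (V.C i) (V.\<kappa> i)"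
      using V.C_tracial v unfolding V.C_def by (auto simp: tracial_algebra_def tracial_algebra_axioms_def)
    show "asym_hom I \<alpha> V.C V.\<kappa> T V.y" by (rule V.C_asym_hom)
    show "\<forall>b\<in>S. loc I \<alpha> V.C V.\<kappa> (V.y b) ((c(a := c')) b) ((R(a := r)) b)"
    proof
      fix b assume b: "b \<in> S"
      then have bT: "b \<in> carrier T" using S by blast
      show "loc I \<alpha> V.C V.\<kappa> (V.y b) ((c(a := c')) b) ((R(a := r)) b)"
      proof (cases "b = a")
        case True
        have "loc I \<alpha> V.C V.\<kappa> (V.y b) c' r"
        proof (rule V.C_loc[OF bT h(1,2)])
          show "\<forall>\<^sub>F i in \<alpha>. cnorm (A i) (v i \<otimes>\<^sub>i (h i \<ominus>\<^sub>i of_real c' \<odot>\<^sub>i \<one>\<^sub>i) \<otimes>\<^sub>i v i) \<le> r"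
            using ev in_I by eventually_elim (use hu in \<open>simp add: v_def\<close>)
        qed (use True r h(3) in auto)
        then show ?thesis using True by simp
      next
        case False
        obtain g where g: "!!i. i \<in> I ==> self_adjoint (A i) (g i) \<and>
            cnorm (A i) (g i \<ominus>\<^sub>i of_real (c b) \<odot>\<^sub>i \<one>\<^sub>i) \<le> R b" and xg: "x b \<asymp> g"
          using l[OF b] unfolding loc_def by blast
        have "loc I \<alpha> V.C V.\<kappa> (V.y b) (c b) (R b)"
        proof (rule V.C_loc[OF bT _ loc_bdd[OF g] xg])
          show "\<forall>\<^sub>F i in \<alpha>. cnorm (A i) (v i \<otimes>\<^sub>i (g i \<ominus>\<^sub>i of_real (c b) \<odot>\<^sub>i \<one>\<^sub>i) \<otimes>\<^sub>i v i) \<le> R b"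
            using in_I
          proof eventually_elim
            case (elim i)
            interpret tracial_algebra "A i" "\<rho> i" by (rule fam[OF elim])
            define z where "z = g i \<ominus>\<^sub>i of_real (c b) \<odot>\<^sub>i \<one>\<^sub>i"
            have p: "projection (A i) (v i)" using v[OF elim] by blast
            have z: "z \<in> carrier (A i)" "cnorm (A i) z \<le> R b" using g[OF elim] by (auto simp: z_def self_adjoint_def)
            note [simp] = projectionD(1)[OF p] z(1)
            have "cnorm (A i) (v i \<otimes>\<^sub>i z \<otimes>\<^sub>i v i) \<le> cnorm (A i) (v i) * cnorm (A i) z * cnorm (A i) (v i)"
              by (intro order_trans[OF cnorm_mult] mult_right_mono cnorm_mult cnorm_nonneg) auto
            also have "\<dots> \<le> 1 * R b * 1"
              using projection_cnorm[OF p] z(2) R[OF b] by (intro mult_mono cnorm_nonneg mult_nonneg_nonneg) auto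
            finally show ?case by (simp add: z_def)
          qed
        qed (use g R[OF b] in auto)
        then show ?thesis using False by simp
      qed
    qed
  qed
  from this[unfolded good_def, rule_format, OF e] show ?thesis using ev in_I
  proof eventually_elim
    case (elim i)
    have vu: "v i = u i" using elim(2) by (simp add: v_def)
    show ?case using elim(1,2) V.C_cstar[OF elim(3)]
      unfolding V.C_def V.\<kappa>_def V.y_def V.cp_def vu by blast
  qed
qed

text \<open>One cut. If one of the two projections has trace tending to zero, the other one is equivalent
  to the unit and no corner is needed; otherwise models on the two corners are added.\<close>

lemma good_by_cutting:
  fixes \<C> :: "'a cstar_algebra set" and d :: "nat => 't"
  assumes cls: "!!B. B \<in> \<C> ==> unital_cstar_algebra B \<and> real_rank_zero B" and corner: "corner_closed \<C>"
    and A: "\<forall>i\<in>I. A i \<in> \<C> \<and> tracial_state (A i) (\<rho> i)"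
    and d: "!!k. d k \<in> carrier T"
    and dense: "!!t e. t \<in> carrier T ==> e > 0 ==> \<exists>k. cnorm T (t \<ominus> d k) < e"
    and S: "S \<subseteq> carrier T" "!!a t. a \<in> S ==> t \<in> carrier T ==> a \<otimes> t = t \<otimes> a"
    and F: "finite F" "F \<subseteq> carrier T" and R: "!!b. b \<in> S ==> 0 < R b" and a: "a \<in> S"
    and l: "!!b. b \<in> S ==> loc I \<alpha> A \<rho> (x b) (c b) (R b)"
    and base: "!!A \<rho> x c. \<forall>i\<in>I. A i \<in> \<C> \<and> tracial_state (A i) (\<rho> i) ==> asym_hom I \<alpha> A \<rho> T x ==>
      \<forall>b\<in>S. loc I \<alpha> A \<rho> (x b) (c b) ((R(a := 9/10 * R a)) b) ==> good \<alpha> A \<rho> T x F \<epsilon>"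
  shows "good \<alpha> A \<rho> T x F \<epsilon>"
proof -
  define r where "r = 9/10 * R a"
  have r: "0 < r" and aT: "a \<in> carrier T" and rr: "!!i. i \<in> I ==> real_rank_zero (A i)"
    using R[OF a] S(1) a A cls by (auto simp: r_def)
  obtain h q c1 c2 where h: "!!i. i \<in> I ==> self_adjoint (A i) (h i)" "bounded_fam h" "x a \<asymp> h"
    and q: "!!i. i \<in> I ==> projection (A i) (q i)"
    and lo: "!!i. i \<in> I ==> cnorm (A i) ((\<one>\<^sub>i \<ominus>\<^sub>i q i) \<otimes>\<^sub>i
      (h i \<ominus>\<^sub>i of_real c1 \<odot>\<^sub>i \<one>\<^sub>i) \<otimes>\<^sub>i (\<one>\<^sub>i \<ominus>\<^sub>i q i)) \<le> r"
    and hi: "!!i. i \<in> I ==> cnorm (A i) (q i \<otimes>\<^sub>i (h i \<ominus>\<^sub>i of_real c2 \<odot>\<^sub>i \<one>\<^sub>i) \<otimes>\<^sub>i q i) \<le> r"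
    and qc: "!!t. t \<in> carrier T ==> (\<lambda>i. q i \<otimes>\<^sub>i x t i) \<asymp> (\<lambda>i. x t i \<otimes>\<^sub>i q i)"
    unfolding r_def by (rule central_cut[OF rr d dense aT S(2)[OF a] l[OF a] R[OF a]]) blast+
  define p where "p = (\<lambda>i. \<one>\<^sub>i \<ominus>\<^sub>i q i)"
  have info: "projection (A i) (p i) \<and> \<one>\<^sub>i \<ominus>\<^sub>i p i = q i \<and> Re (\<rho> i (p i)) = 1 - Re (\<rho> i (q i)) \<and>
      0 \<le> Re (\<rho> i (q i)) \<and> 0 \<le> Re (\<rho> i (p i)) \<and> cmod (\<rho> i (q i)) \<le> 1" if i: "i \<in> I" for i
  proof -
    interpret tracial_algebra "A i" "\<rho> i" by (rule fam[OF i])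
    note qi = projectionD(1)[OF q[OF i]]
    have p: "projection (A i) (p i)" unfolding p_def by (rule projection_complement[OF q[OF i]])
    have "cmod (\<rho> i (q i)) \<le> 1"
      using cmod_le_norm2[OF qi] norm2_le_cnorm[OF qi] projection_cnorm[OF q[OF i]] by linarith
    moreover have "\<one>\<^sub>i \<ominus>\<^sub>i p i = q i" unfolding p_def using qi by (simp add: cs)
    ultimately show ?thesis
      using p st_projection(2)[OF q[OF i]] st_projection(2)[OF p] qi by (simp add: p_def st)
  qed
  have pc: "(\<lambda>i. p i \<otimes>\<^sub>i x t i) \<asymp> (\<lambda>i. x t i \<otimes>\<^sub>i p i)" if t: "t \<in> carrier T" for t
    unfolding eqv_def
  proof (rule Lim_transform_eventually[OF qc[OF t, unfolded eqv_def]], rule eventually_mono[OF in_I])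
    fix i assume i: "i \<in> I"
    interpret tracial_algebra "A i" "\<rho> i" by (rule fam[OF i])
    have [simp]: "x t i \<in> carrier (A i)" "q i \<in> carrier (A i)" using x_in[OF t] projectionD(1)[OF q] i by auto
    have "p i \<otimes>\<^sub>i x t i \<ominus>\<^sub>i x t i \<otimes>\<^sub>i p i = x t i \<otimes>\<^sub>i q i \<ominus>\<^sub>i q i \<otimes>\<^sub>i x t i" by (simp add: p_def cs)
    then show "nrm i (q i \<otimes>\<^sub>i x t i \<ominus>\<^sub>i x t i \<otimes>\<^sub>i q i) = nrm i (p i \<otimes>\<^sub>i x t i \<ominus>\<^sub>i x t i \<otimes>\<^sub>i p i)"
      using norm2_diff_commute[of "q i \<otimes>\<^sub>i x t i" "x t i \<otimes>\<^sub>i q i"] by simp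
  qed
  have "\<forall>\<^sub>F i in \<alpha>. cmod (\<rho> i (q i)) \<le> 1" using in_I by (rule eventually_mono) (use info in blast)
  then obtain m where m: "((\<lambda>i. \<rho> i (q i)) \<longlongrightarrow> m) \<alpha>" by (rule ultralimit)
  define \<tau> where "\<tau> = Re m"
  have t1: "((\<lambda>i. Re (\<rho> i (q i))) \<longlongrightarrow> \<tau>) \<alpha>" unfolding \<tau>_def by (intro tendsto_Re m)
  have t2: "((\<lambda>i. Re (\<rho> i (p i))) \<longlongrightarrow> 1 - \<tau>) \<alpha>"
    by (rule Lim_transform_eventually[OF tendsto_diff[OF tendsto_const t1]], rule eventually_mono[OF in_I])
      (use info in simp)
  have "0 \<le> \<tau>" by (rule tendsto_lowerbound[OF t1 _ not_bot], rule eventually_mono[OF in_I]) (use info in blast)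
  have "0 \<le> 1 - \<tau>" by (rule tendsto_lowerbound[OF t2 _ not_bot], rule eventually_mono[OF in_I]) (use info in blast)
  have pj: "!!i. i \<in> I ==> projection (A i) (p i)" using info by blast
  have whole: "good \<alpha> A \<rho> T x F \<epsilon>" if l': "loc I \<alpha> A \<rho> (x a) c' r" for c'
  proof -
    have "\<forall>b\<in>S. loc I \<alpha> A \<rho> (x b) ((c(a := c')) b) ((R(a := 9/10 * R a)) b)"
      using l' l by (auto simp: r_def)
    then show ?thesis by (rule base[OF A asym])
  qed
  have lo': "!!i. i \<in> I ==> cnorm (A i) (p i \<otimes>\<^sub>i (h i \<ominus>\<^sub>i of_real c1 \<odot>\<^sub>i \<one>\<^sub>i) \<otimes>\<^sub>i p i) \<le> r"
    using lo by (simp add: p_def)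
  consider "\<tau> = 0" | "1 - \<tau> = 0" | "0 < \<tau>" "0 < 1 - \<tau>" using \<open>0 \<le> \<tau>\<close> \<open>0 \<le> 1 - \<tau>\<close> by linarith
  then show ?thesis
  proof cases
    case 1
    have e: "p \<asymp> (\<lambda>i. \<one>\<^sub>i)" unfolding p_def using projection_of_null_trace[OF q] t1 1 by simp
    show ?thesis by (rule whole[OF loc_compress[OF pj e h x_in[OF aT] lo']])
  next
    case 2
    have 1: "(\<lambda>i. \<one>\<^sub>i \<ominus>\<^sub>i p i) \<asymp> (\<lambda>i. \<one>\<^sub>i)" using projection_of_null_trace[OF pj] t2 2 by simp
    have 2: "q \<asymp> (\<lambda>i. \<one>\<^sub>i \<ominus>\<^sub>i p i)"
      by (rule eqv_same) (use info bdd_fam_in[OF bdd_projection[OF q]] in auto)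
    have e: "q \<asymp> (\<lambda>i. \<one>\<^sub>i)"
      by (rule eqv_trans[OF 2 1]) (intro fam_diff bdd_fam_in[OF bdd_one] bdd_fam_in[OF bdd_projection[OF q]]
        bdd_fam_in[OF bdd_projection[OF pj]], assumption?)+
    show ?thesis by (rule whole[OF loc_compress[OF q e h x_in[OF aT] hi]])
  next
    case 3
    show ?thesis unfolding good_def
    proof (intro allI impI)
      fix \<epsilon>' assume "\<epsilon> < \<epsilon>'"
      \<comment> \<open>half of the slack goes to the models on the corners, half to the commutators\<close>
      define e where "e = (\<epsilon> + \<epsilon>') / 2"
      have e: "\<epsilon> < e" and e': "0 < (\<epsilon>' - e) / 2" using \<open>\<epsilon> < \<epsilon>'\<close> by (auto simp: e_def)
      have base': "good \<alpha> A \<rho> T x F \<epsilon>" if "\<forall>i\<in>I. A i \<in> \<C> \<and> tracial_state (A i) (\<rho> i)" "asym_hom I \<alpha> A \<rho> T x"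
          "\<forall>b\<in>S. loc I \<alpha> A \<rho> (x b) ((c(a := c')) b) ((R(a := r)) b)" for A \<rho> x c'
        using base[OF that(1,2)] that(3) unfolding r_def by blast
      have cls': "!!B. B \<in> \<C> ==> unital_cstar_algebra B" and A': "!!i. i \<in> I ==> A i \<in> \<C>" using cls A by auto
      define M where "M = (\<lambda>u i. 0 < Re (\<rho> i (u i)) \<and> unital_cstar_algebra (unital_corner (A i) (u i)) \<and>
        (\<exists>f\<in>unital_star_hom T (unital_corner (A i) (u i)). \<forall>t\<in>F.
          norm2 (unital_corner (A i) (u i)) (\<lambda>z. \<rho> i z / \<rho> i (u i))
            (f t \<ominus>\<^bsub>unital_corner (A i) (u i)\<^esub> u i \<otimes>\<^sub>i x t i \<otimes>\<^sub>i u i) < e))"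
      have mq: "\<forall>\<^sub>F i in \<alpha>. M q i" unfolding M_def
        by (rule good_on_corner[OF cls' corner A' S(1) R r l h q hi t1 3(1) qc base' e])
      have mp: "\<forall>\<^sub>F i in \<alpha>. M p i" unfolding M_def
        by (rule good_on_corner[OF cls' corner A' S(1) R r l h pj lo' t2 3(2) pc base' e])
      have "\<forall>\<^sub>F i in \<alpha>. \<forall>t\<in>F. nrm i (q i \<otimes>\<^sub>i x t i \<ominus>\<^sub>i x t i \<otimes>\<^sub>i q i) < (\<epsilon>' - e) / 2"
        by (rule eventually_ball_finite[OF F(1)], rule ballI, rule order_tendstoD(2)[OF qc[unfolded eqv_def] e'])
          (use F(2) in blast)
      then show "\<forall>\<^sub>F i in \<alpha>. \<exists>\<psi>\<in>unital_star_hom T (A i). \<forall>t\<in>F. nrm i (\<psi> t \<ominus>\<^sub>i x t i) < \<epsilon>'"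
        using mq mp in_I
      proof eventually_elim
        case (elim i)
        interpret tracial_algebra "A i" "\<rho> i" by (rule fam[OF elim(4)])
        obtain f where f: "f \<in> unital_star_hom T (unital_corner (A i) (q i))"
          "\<forall>t\<in>F. norm2 (unital_corner (A i) (q i)) (\<lambda>z. \<rho> i z / \<rho> i (q i))
            (f t \<ominus>\<^bsub>unital_corner (A i) (q i)\<^esub> q i \<otimes>\<^sub>i x t i \<otimes>\<^sub>i q i) < e"
          using elim(2) unfolding M_def by blast
        obtain g where g: "g \<in> unital_star_hom T (unital_corner (A i) (p i))"
          "\<forall>t\<in>F. norm2 (unital_corner (A i) (p i)) (\<lambda>z. \<rho> i z / \<rho> i (p i))
            (g t \<ominus>\<^bsub>unital_corner (A i) (p i)\<^esub> p i \<otimes>\<^sub>i x t i \<otimes>\<^sub>i p i) < e"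
          using elim(3) unfolding M_def by blast
        have pos: "0 < Re (\<rho> i (q i))" "0 < Re (\<rho> i (p i))"
          and cst: "unital_cstar_algebra (unital_corner (A i) (q i))" "unital_cstar_algebra (unital_corner (A i) (p i))"
          using elim(2,3) unfolding M_def by blast+
        have fin: "nrm i ((f t \<oplus>\<^sub>i g t) \<ominus>\<^sub>i x t i) < \<epsilon>'" if t: "t \<in> F" for t
        proof -
          have tT: "t \<in> carrier T" using t F by blast
          have xt: "x t i \<in> carrier (A i)" using x_in[OF tT] elim(4) by blast
          have "nrm i ((f t \<oplus>\<^sub>i g t) \<ominus>\<^sub>i x t i) \<le> e + 2 * nrm i (comm (q i) (x t i))"
            by (rule corner_sum_error[OF q[OF elim(4)] pos(1) pos(2)[unfolded p_def] cst(1) cst(2)[unfolded p_def]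
                  unital_star_homD(1)[OF f(1) tT] unital_star_homD(1)[OF g(1)[unfolded p_def] tT] xt
                  bspec[OF f(2) t] bspec[OF g(2)[unfolded p_def] t]])
          also have "\<dots> < e + 2 * ((\<epsilon>' - e) / 2)" using bspec[OF elim(1) t] unfolding comm_def by linarith
          also have "e + 2 * ((\<epsilon>' - e) / 2) = \<epsilon>'" by (simp add: field_simps)
          finally show ?thesis .
        qed
        show ?case by (rule bexI[OF ballI corner_sum_hom[OF q[OF elim(4)] f(1) g(1)[unfolded p_def]]]) (rule fin)
      qed
    qed
  qed
qed

end

text \<open>Repeated cutting brings the spectra of the finitely many central elements down to any prescribed
  diameter. The induction is on the total number of cuts that are still needed.\<close>

theorem good_by_localization:
  fixes \<C> :: "'u cstar_algebra set" and T :: "'t cstar_algebra" and d :: "nat => 't"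
    and A :: "'i => 'u cstar_algebra"
  assumes cls: "!!A. A \<in> \<C> ==> unital_cstar_algebra A \<and> real_rank_zero A"
    and corner: "corner_closed \<C>"
    and nontriv: "nontrivial_ultrafilter_on I \<alpha>"
    and T: "unital_cstar_algebra T"
    and d: "!!k. d k \<in> carrier T"
    and dense: "!!t e. t \<in> carrier T ==> e > 0 ==> \<exists>k. cnorm T (t \<ominus>\<^bsub>T\<^esub> d k) < e"
    and S: "finite S" "S \<subseteq> carrier T" "!!a t. a \<in> S ==> t \<in> carrier T ==> a \<otimes>\<^bsub>T\<^esub> t = t \<otimes>\<^bsub>T\<^esub> a"
    and \<delta>: "0 < \<delta>" and F: "finite F" "F \<subseteq> carrier T"
    and base: "!!A \<rho> x c. \<forall>i\<in>I. A i \<in> \<C> \<and> tracial_state (A i) (\<rho> i) ==>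
      asym_hom I \<alpha> A \<rho> T x ==> \<forall>a\<in>S. loc I \<alpha> A \<rho> (x a) (c a) \<delta> ==> good \<alpha> A \<rho> T x F \<epsilon>"
    and A: "\<forall>i\<in>I. A i \<in> \<C> \<and> tracial_state (A i) (\<rho> i)"
    and x: "asym_hom I \<alpha> A \<rho> T x"
    and loc: "\<forall>a\<in>S. loc I \<alpha> A \<rho> (x a) (c a) (\<delta> * (10/9) ^ k a)"
  shows "good \<alpha> A \<rho> T x F \<epsilon>"
  using A x loc
proof (induction "\<Sum>a\<in>S. k a" arbitrary: A \<rho> x c k)
  case 0
  then have "k a = 0" if "a \<in> S" for a using that S(1) by simp
  then show ?case using 0 by (intro base[of A \<rho> x c]) auto
next
  case (Suc n)
  have fam: "tracial_algebra (A i) (\<rho> i)" if "i \<in> I" for i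
    using that Suc.prems(1) cls by (simp add: tracial_algebra_def tracial_algebra_axioms_def)
  have rep: "representation I \<alpha> A \<rho> T x"
    by (intro representation.intro family.intro representation_axioms.intro nontriv fam T Suc.prems)
  have "\<exists>a\<in>S. k a \<noteq> 0" using Suc.hyps(2) by (metis sum.neutral nat.distinct(1))
  then obtain a where a: "a \<in> S" "k a \<noteq> 0" by blast
  define k' where "k' = k(a := k a - 1)"
  have sumk: "n = (\<Sum>a\<in>S. k' a)"
  proof -
    have "(\<Sum>a\<in>S. k a) = k a + (\<Sum>b\<in>S - {a}. k b)" using S(1) a(1) by (rule sum.remove)
    moreover have "(\<Sum>a\<in>S. k' a) = k' a + (\<Sum>b\<in>S - {a}. k' b)" using S(1) a(1) by (rule sum.remove)
    moreover have "(\<Sum>b\<in>S - {a}. k' b) = (\<Sum>b\<in>S - {a}. k b)" by (rule sum.cong) (auto simp: k'_def)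
    ultimately show ?thesis using Suc.hyps(2) a(2) by (simp add: k'_def)
  qed
  let ?R = "\<lambda>b. \<delta> * (10/9) ^ k b"
  have R: "(?R(a := 9/10 * ?R a)) b = \<delta> * (10/9) ^ k' b" for b
    using a(2) by (cases "k a") (auto simp: k'_def)
  show ?case
  proof (rule representation.good_by_cutting[OF rep cls corner Suc.prems(1) d dense S(2,3) F _ a(1)])
    show "0 < ?R b" for b using \<delta> by simp
    show "loc I \<alpha> A \<rho> (x b) (c b) (?R b)" if "b \<in> S" for b using Suc.prems(3) that by blast
    show "good \<alpha> A \<rho> T x F \<epsilon>" if "\<forall>i\<in>I. A i \<in> \<C> \<and> tracial_state (A i) (\<rho> i)" "asym_hom I \<alpha> A \<rho> T x"
        "\<forall>b\<in>S. loc I \<alpha> A \<rho> (x b) (c b) ((?R(a := 9/10 * ?R a)) b)" for A \<rho> x c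
      using Suc.hyps(1)[OF sumk that(1,2)] that(3) unfolding R by blast
  qed
qed

section \<open>Representatives in the tracial ultraproduct\<close>

context family
begin

abbreviation P :: "('i => 'a) cstar_algebra" where "P \<equiv> cstar_product I A"
abbreviation J :: "('i => 'a) set" where "J \<equiv> trace_ideal I \<alpha> A \<rho>"
abbreviation U :: "('i => 'a) set cstar_algebra" where "U \<equiv> tracial_ultraproduct I \<alpha> A \<rho>"
abbreviation cos :: "('i => 'a) => ('i => 'a) set" where "cos \<equiv> coset_of I \<alpha> A \<rho>"

lemma P_carrier_iff: "z \<in> carrier P \<longleftrightarrow> z \<in> extensional I \<and> bounded_fam z"
  by (auto simp: cstar_product_def bdd_fam_def PiE_def Pi_def bdd_above_def)

lemma P_restrict: "bounded_fam z ==> restrict z I \<in> carrier P"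
  by (auto simp: P_carrier_iff bdd_fam_def)

lemma P_ops:
  "z \<otimes>\<^bsub>P\<^esub> y = (\<lambda>i\<in>I. z i \<otimes>\<^sub>i y i)" "z \<oplus>\<^bsub>P\<^esub> y = (\<lambda>i\<in>I. z i \<oplus>\<^sub>i y i)"
  "\<one>\<^bsub>P\<^esub> = (\<lambda>i\<in>I. \<one>\<^sub>i)" "\<zero>\<^bsub>P\<^esub> = (\<lambda>i\<in>I. \<zero>\<^sub>i)" "c \<odot>\<^bsub>P\<^esub> z = (\<lambda>i\<in>I. c \<odot>\<^sub>i z i)"
  "star P z = (\<lambda>i\<in>I. star (A i) (z i))"
  by (simp_all add: cstar_product_def)

lemma bdd_zero: "bounded_fam (\<lambda>i. \<zero>\<^sub>i)"
proof -
  have "\<zero>\<^sub>i \<in> carrier (A i) \<and> cnorm (A i) \<zero>\<^sub>i \<le> 0" if "i \<in> I" for i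
  proof -
    interpret tracial_algebra "A i" "\<rho> i" by (rule fam[OF that])
    show ?thesis by simp
  qed
  then show ?thesis unfolding bdd_fam_def by blast
qed

lemma ring_A: "i \<in> I ==> ring (A i)"
  using fam by (simp add: tracial_algebra_def unital_cstar_algebra_def)

lemma P_closed:
  assumes "z \<in> carrier P" "y \<in> carrier P"
  shows "z \<otimes>\<^bsub>P\<^esub> y \<in> carrier P" "z \<oplus>\<^bsub>P\<^esub> y \<in> carrier P"
  using assms unfolding P_ops
  by (intro P_restrict bdd_mult bdd_add; simp add: P_carrier_iff)+

lemma P_closed':
  assumes "z \<in> carrier P"
  shows "c \<odot>\<^bsub>P\<^esub> z \<in> carrier P" "star P z \<in> carrier P"
  using assms unfolding P_ops
  by (intro P_restrict bdd_scal bdd_star; simp add: P_carrier_iff)+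

lemma P_one: "\<one>\<^bsub>P\<^esub> \<in> carrier P" and P_zero: "\<zero>\<^bsub>P\<^esub> \<in> carrier P"
  unfolding P_ops by (intro P_restrict bdd_one bdd_zero)+

lemma P_eqI:
  assumes "z \<in> carrier P" "y \<in> carrier P" "!!i. i \<in> I ==> z i = y i"
  shows "z = y"
  using assms by (intro extensionalityI[of z I y]) (auto simp: P_carrier_iff)

lemma P_at: "z \<in> carrier P ==> i \<in> I ==> z i \<in> carrier (A i)"
  by (simp add: P_carrier_iff bdd_fam_def)

lemma P_ring: "ring P"
proof (rule ringI)
  show "abelian_group P"
  proof (rule abelian_groupI)
    fix z assume z: "z \<in> carrier P"
    show "\<exists>y\<in>carrier P. y \<oplus>\<^bsub>P\<^esub> z = \<zero>\<^bsub>P\<^esub>"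
    proof
      have "(-1) \<odot>\<^bsub>P\<^esub> z \<in> carrier P" by (rule P_closed'(1)[OF z])
      then show "(-1) \<odot>\<^bsub>P\<^esub> z \<oplus>\<^bsub>P\<^esub> z = \<zero>\<^bsub>P\<^esub>"
      proof (intro P_eqI P_closed P_closed' z P_zero)
        fix i assume i: "i \<in> I"
        interpret tracial_algebra "A i" "\<rho> i" by (rule fam[OF i])
        show "((-1) \<odot>\<^bsub>P\<^esub> z \<oplus>\<^bsub>P\<^esub> z) i = \<zero>\<^bsub>P\<^esub> i"
          using i P_at[OF z i] by (simp add: P_ops scal_uminus l_neg)
      qed
    qed (rule P_closed'(1)[OF z])
    show "\<zero>\<^bsub>P\<^esub> \<oplus>\<^bsub>P\<^esub> z = z"
    proof (intro P_eqI P_closed P_closed' z P_zero)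
      fix i assume i: "i \<in> I"
      interpret ring "A i" by (rule ring_A[OF i])
      show "(\<zero>\<^bsub>P\<^esub> \<oplus>\<^bsub>P\<^esub> z) i = z i" using i P_at[OF z i] by (simp add: P_ops)
    qed
    fix y assume y: "y \<in> carrier P"
    show "z \<oplus>\<^bsub>P\<^esub> y \<in> carrier P" by (rule P_closed(2)[OF z y])
    show "z \<oplus>\<^bsub>P\<^esub> y = y \<oplus>\<^bsub>P\<^esub> z"
    proof (intro P_eqI P_closed P_closed' z y)
      fix i assume i: "i \<in> I"
      interpret ring "A i" by (rule ring_A[OF i])
      show "(z \<oplus>\<^bsub>P\<^esub> y) i = (y \<oplus>\<^bsub>P\<^esub> z) i" using i P_at[OF z i] P_at[OF y i] by (simp add: P_ops a_comm)
    qed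
    fix u assume u: "u \<in> carrier P"
    show "(z \<oplus>\<^bsub>P\<^esub> y) \<oplus>\<^bsub>P\<^esub> u = z \<oplus>\<^bsub>P\<^esub> (y \<oplus>\<^bsub>P\<^esub> u)"
    proof (intro P_eqI P_closed P_closed' z y u)
      fix i assume i: "i \<in> I"
      interpret ring "A i" by (rule ring_A[OF i])
      show "((z \<oplus>\<^bsub>P\<^esub> y) \<oplus>\<^bsub>P\<^esub> u) i = (z \<oplus>\<^bsub>P\<^esub> (y \<oplus>\<^bsub>P\<^esub> u)) i"
        using i P_at[OF z i] P_at[OF y i] P_at[OF u i] by (simp add: P_ops a_assoc)
    qed
  qed (rule P_zero)
  show "Group.monoid P"
  proof (rule monoidI)
    fix z assume z: "z \<in> carrier P"
    show "\<one>\<^bsub>P\<^esub> \<otimes>\<^bsub>P\<^esub> z = z"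
    proof (intro P_eqI P_closed P_closed' z P_one)
      fix i assume i: "i \<in> I"
      interpret ring "A i" by (rule ring_A[OF i])
      show "(\<one>\<^bsub>P\<^esub> \<otimes>\<^bsub>P\<^esub> z) i = z i" using i P_at[OF z i] by (simp add: P_ops)
    qed
    show "z \<otimes>\<^bsub>P\<^esub> \<one>\<^bsub>P\<^esub> = z"
    proof (intro P_eqI P_closed P_closed' z P_one)
      fix i assume i: "i \<in> I"
      interpret ring "A i" by (rule ring_A[OF i])
      show "(z \<otimes>\<^bsub>P\<^esub> \<one>\<^bsub>P\<^esub>) i = z i" using i P_at[OF z i] by (simp add: P_ops)
    qed
    fix y u assume y: "y \<in> carrier P" and u: "u \<in> carrier P"
    show "(z \<otimes>\<^bsub>P\<^esub> y) \<otimes>\<^bsub>P\<^esub> u = z \<otimes>\<^bsub>P\<^esub> (y \<otimes>\<^bsub>P\<^esub> u)"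
    proof (intro P_eqI P_closed P_closed' z y u)
      fix i assume i: "i \<in> I"
      interpret ring "A i" by (rule ring_A[OF i])
      show "((z \<otimes>\<^bsub>P\<^esub> y) \<otimes>\<^bsub>P\<^esub> u) i = (z \<otimes>\<^bsub>P\<^esub> (y \<otimes>\<^bsub>P\<^esub> u)) i"
        using i P_at[OF z i] P_at[OF y i] P_at[OF u i] by (simp add: P_ops m_assoc)
    qed
  qed (auto intro: P_closed P_one)
  fix z y u assume z: "z \<in> carrier P" and y: "y \<in> carrier P" and u: "u \<in> carrier P"
  show "(z \<oplus>\<^bsub>P\<^esub> y) \<otimes>\<^bsub>P\<^esub> u = z \<otimes>\<^bsub>P\<^esub> u \<oplus>\<^bsub>P\<^esub> y \<otimes>\<^bsub>P\<^esub> u"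
  proof (intro P_eqI P_closed P_closed' z y u)
    fix i assume i: "i \<in> I"
    interpret ring "A i" by (rule ring_A[OF i])
    show "((z \<oplus>\<^bsub>P\<^esub> y) \<otimes>\<^bsub>P\<^esub> u) i = (z \<otimes>\<^bsub>P\<^esub> u \<oplus>\<^bsub>P\<^esub> y \<otimes>\<^bsub>P\<^esub> u) i"
      using i P_at[OF z i] P_at[OF y i] P_at[OF u i] by (simp add: P_ops l_distr)
  qed
  show "u \<otimes>\<^bsub>P\<^esub> (z \<oplus>\<^bsub>P\<^esub> y) = u \<otimes>\<^bsub>P\<^esub> z \<oplus>\<^bsub>P\<^esub> u \<otimes>\<^bsub>P\<^esub> y"
  proof (intro P_eqI P_closed P_closed' z y u)
    fix i assume i: "i \<in> I"
    interpret ring "A i" by (rule ring_A[OF i])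
    show "(u \<otimes>\<^bsub>P\<^esub> (z \<oplus>\<^bsub>P\<^esub> y)) i = (u \<otimes>\<^bsub>P\<^esub> z \<oplus>\<^bsub>P\<^esub> u \<otimes>\<^bsub>P\<^esub> y) i"
      using i P_at[OF z i] P_at[OF y i] P_at[OF u i] by (simp add: P_ops r_distr)
  qed
qed

lemma P_minus: assumes z: "z \<in> carrier P" shows "\<ominus>\<^bsub>P\<^esub> z = (-1) \<odot>\<^bsub>P\<^esub> z"
proof -
  interpret P: ring P by (rule P_ring)
  have "(-1) \<odot>\<^bsub>P\<^esub> z \<oplus>\<^bsub>P\<^esub> z = \<zero>\<^bsub>P\<^esub>"
  proof (intro P_eqI P_closed P_closed' z P_zero)
    fix i assume i: "i \<in> I"
    interpret tracial_algebra "A i" "\<rho> i" by (rule fam[OF i])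
    show "((-1) \<odot>\<^bsub>P\<^esub> z \<oplus>\<^bsub>P\<^esub> z) i = \<zero>\<^bsub>P\<^esub> i"
      using i P_at[OF z i] by (simp add: P_ops scal_uminus l_neg)
  qed
  then show ?thesis using P.minus_equality[of "(-1) \<odot>\<^bsub>P\<^esub> z" z] z P_closed'(1)[OF z] by simp
qed

lemma P_diff_at:
  assumes z: "z \<in> carrier P" and y: "y \<in> carrier P" and i: "i \<in> I"
  shows "(z \<ominus>\<^bsub>P\<^esub> y) i = z i \<ominus>\<^sub>i y i"
proof -
  interpret P: ring P by (rule P_ring)
  interpret tracial_algebra "A i" "\<rho> i" by (rule fam[OF i])
  show ?thesis using i P_at[OF z i] P_at[OF y i]
    by (simp add: P.minus_eq P_minus[OF y] P_ops scal_uminus minus_eq)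
qed

lemma J_iff: "z \<in> J \<longleftrightarrow> z \<in> carrier P \<and> (n2 z \<longlongrightarrow> 0) \<alpha>"
  by (simp add: trace_ideal_def)

lemma J_iff': "z \<in> J \<longleftrightarrow> z \<in> carrier P \<and> z \<asymp> (\<lambda>i. \<zero>\<^sub>i)"
proof -
  have "n2 z i = nrm i (z i \<ominus>\<^sub>i \<zero>\<^sub>i)" if "z \<in> carrier P" "i \<in> I" for i
  proof -
    interpret tracial_algebra "A i" "\<rho> i" by (rule fam[OF that(2)])
    show ?thesis using P_at[OF that] by simp
  qed
  then have "\<forall>\<^sub>F i in \<alpha>. n2 z i = nrm i (z i \<ominus>\<^sub>i \<zero>\<^sub>i)" if "z \<in> carrier P"
    by (rule eventually_mono[OF in_I]) (rule that)
  from tendsto_cong[OF this] show ?thesis unfolding J_iff eqv_def by blast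
qed

lemma P_bdd: "z \<in> carrier P ==> bounded_fam z"
  by (simp add: P_carrier_iff)

lemma bdd_cong: "bounded_fam y ==> (!!i. i \<in> I ==> z i = y i) ==> bounded_fam z"
  by (simp add: bdd_fam_def)

lemma eqv_zero_op:
  assumes "u \<asymp> (\<lambda>i. f i)" "bounded_fam u" "bounded_fam f" "!!i. i \<in> I ==> f i = \<zero>\<^sub>i"
  shows "u \<asymp> (\<lambda>i. \<zero>\<^sub>i)"
  by (rule eqv_trans[OF assms(1) eqv_same])
    (use assms bdd_zero in \<open>auto intro: bdd_fam_in[THEN bspec]\<close>)

lemma J_ideal: "ideal J P"
proof -
  interpret P: ring P by (rule P_ring)
  have zero: "\<zero>\<^sub>i \<oplus>\<^sub>i \<zero>\<^sub>i = \<zero>\<^sub>i" if "i \<in> I" for i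
    using ring.ring_simprules[OF ring_A[OF that]] by simp
  have scal0: "c \<odot>\<^sub>i \<zero>\<^sub>i = \<zero>\<^sub>i" if "i \<in> I" for i c
  proof -
    interpret tracial_algebra "A i" "\<rho> i" by (rule fam[OF that])
    show ?thesis by simp
  qed
  have restr: "restrict f I \<asymp> g" if "f \<asymp> g" "bounded_fam f" "bounded_fam g" for f g
    using that bdd_fam_in[OF that(2)] bdd_fam_in[OF that(3)] bdd_cong[OF that(2), of "restrict f I"]
    by (intro eqv_trans[OF eqv_same that(1)]) auto
  have restrJ: "restrict f I \<in> J" if "f \<asymp> (\<lambda>i. \<zero>\<^sub>i)" "bounded_fam f" for f
    unfolding J_iff' using P_restrict[OF that(2)] restr[OF that bdd_zero] by simp
  show ?thesis
  proof (rule idealI[OF P_ring])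
    show "subgroup J (add_monoid P)"
    proof (rule P.add.subgroupI)
      show "J \<subseteq> carrier P" by (auto simp: J_iff)
      have "restrict (\<lambda>i. \<zero>\<^sub>i) I \<asymp> (\<lambda>i. \<zero>\<^sub>i)"
        using bdd_zero by (intro restr eqv_refl bdd_fam_in)
      then have "\<zero>\<^bsub>P\<^esub> \<in> J" unfolding J_iff' using P_zero by (simp add: P_ops)
      then show "J \<noteq> {}" by blast
      fix z assume z: "z \<in> J"
      then have zP: "z \<in> carrier P" and z0: "z \<asymp> (\<lambda>i. \<zero>\<^sub>i)" by (auto simp: J_iff')
      have "(\<lambda>i. (-1) \<odot>\<^sub>i z i) \<asymp> (\<lambda>i. \<zero>\<^sub>i)"
        by (rule eqv_zero_op[OF eqv_scal[OF z0 P_bdd[OF zP] bdd_zero]])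
          (use scal0 in \<open>auto intro: bdd_scal P_bdd zP bdd_zero\<close>)
      then have "(-1) \<odot>\<^bsub>P\<^esub> z \<in> J"
        unfolding P_ops by (rule restrJ) (intro bdd_scal P_bdd zP)
      then show "\<ominus>\<^bsub>P\<^esub> z \<in> J" using P_minus[OF zP] by simp
      fix y assume y: "y \<in> J"
      then have yP: "y \<in> carrier P" and y0: "y \<asymp> (\<lambda>i. \<zero>\<^sub>i)" by (auto simp: J_iff')
      have "(\<lambda>i. z i \<oplus>\<^sub>i y i) \<asymp> (\<lambda>i. \<zero>\<^sub>i)"
        by (rule eqv_zero_op[OF eqv_add[OF z0 y0]])
          (use zero P_bdd[OF zP] P_bdd[OF yP] bdd_zero in
            \<open>auto intro: bdd_add bdd_zero P_bdd zP yP bdd_fam_in[THEN bspec]\<close>)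
      then show "z \<oplus>\<^bsub>P\<^esub> y \<in> J"
        unfolding P_ops by (rule restrJ) (intro bdd_add P_bdd zP yP)
    qed
  next
    fix z y assume z: "z \<in> J" and yP: "y \<in> carrier P"
    then have zP: "z \<in> carrier P" and z0: "z \<asymp> (\<lambda>i. \<zero>\<^sub>i)" by (auto simp: J_iff')
    have null: "y i \<otimes>\<^sub>i \<zero>\<^sub>i = \<zero>\<^sub>i" "\<zero>\<^sub>i \<otimes>\<^sub>i y i = \<zero>\<^sub>i" if i: "i \<in> I" for i
    proof -
      interpret ring "A i" by (rule ring_A[OF i])
      show "y i \<otimes>\<^sub>i \<zero>\<^sub>i = \<zero>\<^sub>i" "\<zero>\<^sub>i \<otimes>\<^sub>i y i = \<zero>\<^sub>i" using P_at[OF yP i] by simp_all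
    qed
    note b = P_bdd[OF zP] P_bdd[OF yP] bdd_zero
    have "(\<lambda>i. y i \<otimes>\<^sub>i z i) \<asymp> (\<lambda>i. \<zero>\<^sub>i)"
      by (rule eqv_zero_op[OF eqv_mult[OF eqv_refl z0]])
        (use null b in \<open>auto intro: bdd_mult bdd_fam_in[THEN bspec]\<close>)
    then show "y \<otimes>\<^bsub>P\<^esub> z \<in> J"
      unfolding P_ops by (rule restrJ) (intro bdd_mult b)
    have "(\<lambda>i. z i \<otimes>\<^sub>i y i) \<asymp> (\<lambda>i. \<zero>\<^sub>i)"
      by (rule eqv_zero_op[OF eqv_mult[OF z0 eqv_refl]])
        (use null b in \<open>auto intro: bdd_mult bdd_fam_in[THEN bspec]\<close>)
    then show "z \<otimes>\<^bsub>P\<^esub> y \<in> J"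
      unfolding P_ops by (rule restrJ) (intro bdd_mult b)
  qed
qed

lemma cos_eq_iff:
  assumes z: "z \<in> carrier P" and y: "y \<in> carrier P"
  shows "cos z = cos y \<longleftrightarrow> z \<asymp> y"
proof -
  interpret P: ring P by (rule P_ring)
  have "cos z = cos y \<longleftrightarrow> z \<ominus>\<^bsub>P\<^esub> y \<in> J"
    unfolding coset_of_def using P.quotient_eq_iff_same_a_r_cos[OF J_ideal z y] by simp
  also have "\<dots> \<longleftrightarrow> (n2 (z \<ominus>\<^bsub>P\<^esub> y) \<longlongrightarrow> 0) \<alpha>" using z y by (simp add: J_iff)
  also have "\<dots> \<longleftrightarrow> z \<asymp> y" unfolding eqv_def
    by (rule tendsto_cong, rule eventually_mono[OF in_I]) (simp add: P_diff_at[OF z y])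
  finally show ?thesis .
qed

lemma U_ops:
  "carrier U = a_rcosets\<^bsub>P\<^esub> J" "S \<otimes>\<^bsub>U\<^esub> S' = [mod J:] S \<Otimes>\<^bsub>P\<^esub> S'" "S \<oplus>\<^bsub>U\<^esub> S' = S <+>\<^bsub>P\<^esub> S'"
  "\<one>\<^bsub>U\<^esub> = cos \<one>\<^bsub>P\<^esub>" "c \<odot>\<^bsub>U\<^esub> S = (\<Union>z\<in>S. cos (c \<odot>\<^bsub>P\<^esub> z))" "star U S = (\<Union>z\<in>S. cos (star P z))"
  by (simp_all add: tracial_ultraproduct_def cstar_quotient_def FactRing_def coset_of_def)

lemma U_carrier: "S \<in> carrier U \<longleftrightarrow> (\<exists>z\<in>carrier P. S = cos z)"
  by (auto simp: U_ops A_RCOSETS_def' coset_of_def)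

lemma cos_member: assumes z: "z \<in> carrier P" and y: "y \<in> cos z"
  shows "y \<in> carrier P \<and> cos y = cos z"
proof -
  interpret P: ring P by (rule P_ring)
  interpret J: ideal J P by (rule J_ideal)
  have y': "y \<in> J +>\<^bsub>P\<^esub> z" using y by (simp add: coset_of_def)
  have "y \<in> carrier P" using P.a_r_coset_subset_G[OF J.a_subset z] y' by blast
  moreover have "cos y = cos z"
    unfolding coset_of_def using P.a_repr_independence[OF y' z J.a_subgroup] by simp
  ultimately show ?thesis ..
qed

lemma cos_self: "z \<in> carrier P ==> z \<in> cos z"
proof -
  assume z: "z \<in> carrier P"
  interpret J: ideal J P by (rule J_ideal)
  show ?thesis unfolding coset_of_def by (rule J.a_rcos_self[OF z])
qed

lemma U_cos:
  assumes z: "z \<in> carrier P" and y: "y \<in> carrier P"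
  shows "cos z \<otimes>\<^bsub>U\<^esub> cos y = cos (z \<otimes>\<^bsub>P\<^esub> y)" "cos z \<oplus>\<^bsub>U\<^esub> cos y = cos (z \<oplus>\<^bsub>P\<^esub> y)"
    "c \<odot>\<^bsub>U\<^esub> cos z = cos (c \<odot>\<^bsub>P\<^esub> z)" "star U (cos z) = cos (star P z)"
proof -
  interpret J: ideal J P by (rule J_ideal)
  show "cos z \<otimes>\<^bsub>U\<^esub> cos y = cos (z \<otimes>\<^bsub>P\<^esub> y)" unfolding U_ops coset_of_def
    by (rule J.rcoset_mult_add[OF z y])
  show "cos z \<oplus>\<^bsub>U\<^esub> cos y = cos (z \<oplus>\<^bsub>P\<^esub> y)" unfolding U_ops coset_of_def
    by (rule J.a_rcos_sum[OF z y])
  have eq: "u \<asymp> z \<and> u \<in> carrier P" if "u \<in> cos z" for u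
    using cos_member[OF z that] cos_eq_iff[OF _ z, of u] by simp
  have union: "(\<Union>u\<in>cos z. f u) = f z" if "!!u. u \<in> cos z ==> f u = f z" for f :: "('i => 'a) => ('i => 'a) set"
  proof -
    have "(\<Union>u\<in>cos z. f u) = (\<Union>u\<in>cos z. f z)" by (rule SUP_cong) (use that in auto)
    also have "\<dots> = f z" using cos_self[OF z] by blast
    finally show ?thesis .
  qed
  have restr: "restrict f I \<asymp> restrict g I" if "f \<asymp> g" "bounded_fam f" "bounded_fam g" for f g
  proof -
    have 1: "restrict f I \<asymp> f" by (rule eqv_same) (use bdd_fam_in[OF that(2)] in auto)
    have 2: "g \<asymp> restrict g I" by (rule eqv_same) (use bdd_fam_in[OF that(3)] in auto)
    show ?thesis by (rule eqv_trans[OF 1 eqv_trans[OF that(1) 2]])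
      (use bdd_fam_in[OF that(2)] bdd_fam_in[OF that(3)] in auto)
  qed
  show "c \<odot>\<^bsub>U\<^esub> cos z = cos (c \<odot>\<^bsub>P\<^esub> z)" unfolding U_ops(5)
  proof (rule union)
    fix u assume "u \<in> cos z"
    then have u: "u \<asymp> z" "u \<in> carrier P" using eq by auto
    show "cos (c \<odot>\<^bsub>P\<^esub> u) = cos (c \<odot>\<^bsub>P\<^esub> z)"
      unfolding cos_eq_iff[OF P_closed'(1)[OF u(2)] P_closed'(1)[OF z]]
      unfolding P_ops using u z by (intro restr eqv_scal bdd_scal P_bdd)
  qed
  show "star U (cos z) = cos (star P z)" unfolding U_ops(6)
  proof (rule union)
    fix u assume "u \<in> cos z"
    then have u: "u \<asymp> z" "u \<in> carrier P" using eq by auto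
    show "cos (star P u) = cos (star P z)"
      unfolding cos_eq_iff[OF P_closed'(2)[OF u(2)] P_closed'(2)[OF z]]
      unfolding P_ops using u z by (intro restr eqv_star bdd_star P_bdd)
  qed
qed

lemma restrict_eqv: "bounded_fam f ==> restrict f I \<asymp> f"
  by (rule eqv_same) (use bdd_fam_in in auto)

lemma cos_restrict_eq_iff:
  assumes "bounded_fam f" "bounded_fam g"
  shows "cos (restrict f I) = cos (restrict g I) \<longleftrightarrow> f \<asymp> g"
proof -
  note b = bdd_fam_in[OF assms(1)] bdd_fam_in[OF assms(2)]
    bdd_fam_in[OF P_bdd[OF P_restrict[OF assms(1)]]] bdd_fam_in[OF P_bdd[OF P_restrict[OF assms(2)]]]
  note f = restrict_eqv[OF assms(1)] and g = restrict_eqv[OF assms(2)]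
  have "restrict f I \<asymp> restrict g I \<longleftrightarrow> f \<asymp> g"
  proof
    assume "restrict f I \<asymp> restrict g I"
    from eqv_trans[OF eqv_trans[OF eqv_sym[OF f b(3,1)] this b(1,3,4)] g b(1,4,2)] show "f \<asymp> g" .
  next
    assume "f \<asymp> g"
    from eqv_trans[OF eqv_trans[OF f this b(3,1,2)] eqv_sym[OF g b(4,2)] b(3,2,4)]
    show "restrict f I \<asymp> restrict g I" .
  qed
  then show ?thesis using cos_eq_iff[OF P_restrict[OF assms(1)] P_restrict[OF assms(2)]] by simp
qed

text \<open>Values of the homomorphism are cosets; any choice of members satisfies the homomorphism laws up
  to families that are null in 2-norm.\<close>

lemma hom_representatives:
  assumes T: "unital_cstar_algebra T" and \<pi>: "\<pi> \<in> unital_star_hom T U"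
  obtains x where "asym_hom I \<alpha> A \<rho> T x" "!!t. t \<in> carrier T ==> \<pi> t = cos (restrict (x t) I)"
proof -
  interpret T: unital_cstar_algebra T by (rule T)
  have "\<forall>t. \<exists>z. t \<in> carrier T --> z \<in> carrier P \<and> \<pi> t = cos z"
    using unital_star_homD(1)[OF \<pi>] U_carrier by blast
  then obtain x where x: "!!t. t \<in> carrier T ==> x t \<in> carrier P" "!!t. t \<in> carrier T ==> \<pi> t = cos (x t)"
    by metis
  have to_eqv: "x t \<asymp> f" if t: "t \<in> carrier T" and f: "bounded_fam f" and e: "\<pi> t = cos (restrict f I)" for t f
  proof -
    have "x t \<asymp> restrict f I" using cos_eq_iff[OF x(1)[OF t] P_restrict[OF f]] e x(2)[OF t] by simp
    from eqv_trans[OF this restrict_eqv[OF f]] show ?thesis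
      using x(1)[OF t] f P_restrict[OF f] by (simp add: P_bdd bdd_fam_in)
  qed
  have xb: "!!t. t \<in> carrier T ==> bounded_fam (x t)" using x(1) P_bdd by blast
  have "asym_hom I \<alpha> A \<rho> T x" unfolding asym_hom_def
  proof (intro conjI ballI allI)
    fix t assume t: "t \<in> carrier T"
    show "bounded_fam (x t)" by (rule xb[OF t])
    show "x (star T t) \<asymp> (\<lambda>i. star (A i) (x t i))"
      using U_cos(4)[OF x(1)[OF t] x(1)[OF t]] unital_star_homD(6)[OF \<pi> t] x(2)[OF t]
      by (intro to_eqv T.star_closed t bdd_star xb) (simp add: P_ops)
    show "x (c \<odot>\<^bsub>T\<^esub> t) \<asymp> (\<lambda>i. c \<odot>\<^sub>i x t i)" for c
      using U_cos(3)[OF x(1)[OF t] x(1)[OF t], of c] unital_star_homD(5)[OF \<pi> t, of c] x(2)[OF t]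
      by (intro to_eqv T.scal_closed t bdd_scal xb) (simp add: P_ops)
    fix s assume s: "s \<in> carrier T"
    show "x (t \<oplus>\<^bsub>T\<^esub> s) \<asymp> (\<lambda>i. x t i \<oplus>\<^sub>i x s i)"
      using U_cos(2)[OF x(1)[OF t] x(1)[OF s]] unital_star_homD(2)[OF \<pi> t s] x(2)[OF t] x(2)[OF s]
      by (intro to_eqv T.a_closed s t bdd_add xb) (simp add: P_ops)
    show "x (t \<otimes>\<^bsub>T\<^esub> s) \<asymp> (\<lambda>i. x t i \<otimes>\<^sub>i x s i)"
      using U_cos(1)[OF x(1)[OF t] x(1)[OF s]] unital_star_homD(3)[OF \<pi> t s] x(2)[OF t] x(2)[OF s]
      by (intro to_eqv T.m_closed s t bdd_mult xb) (simp add: P_ops)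
  next
    show "x \<one>\<^bsub>T\<^esub> \<asymp> (\<lambda>i. \<one>\<^sub>i)"
      using unital_star_homD(4)[OF \<pi>] by (intro to_eqv T.one_closed bdd_one) (simp add: U_ops P_ops)
  qed
  moreover have "\<pi> t = cos (restrict (x t) I)" if t: "t \<in> carrier T" for t
  proof -
    have "restrict (x t) I = x t" using x(1)[OF t] by (simp add: P_carrier_iff extensional_restrict)
    then show ?thesis using x(2)[OF t] by simp
  qed
  ultimately show thesis by (rule that)
qed

lemma representatives_hom:
  assumes T: "unital_cstar_algebra T" and x: "asym_hom I \<alpha> A \<rho> T x"
  shows "(\<lambda>t. cos (restrict (x t) I)) \<in> unital_star_hom T U"
proof -
  interpret T: unital_cstar_algebra T by (rule T)
  have xb: "!!t. t \<in> carrier T ==> bounded_fam (x t)" using x by (simp add: asym_hom_def)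
  note xP = P_restrict[OF xb]
  show ?thesis
  proof (rule unital_star_homI)
    fix t assume t: "t \<in> carrier T"
    show "cos (restrict (x t) I) \<in> carrier U" using U_carrier xP[OF t] by blast
    have "x (star T t) \<asymp> (\<lambda>i. star (A i) (x t i))" using x t by (simp add: asym_hom_def)
    then show "cos (restrict (x (star T t)) I) = star U (cos (restrict (x t) I))"
      unfolding U_cos(4)[OF xP[OF t] xP[OF t]] P_ops(6)
      using cos_restrict_eq_iff[OF xb[OF T.star_closed[OF t]] bdd_star[OF xb[OF t]]] by (simp cong: restrict_cong)
    fix c
    have "x (c \<odot>\<^bsub>T\<^esub> t) \<asymp> (\<lambda>i. c \<odot>\<^sub>i x t i)" using x t by (simp add: asym_hom_def)
    then show "cos (restrict (x (c \<odot>\<^bsub>T\<^esub> t)) I) = c \<odot>\<^bsub>U\<^esub> cos (restrict (x t) I)"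
      unfolding U_cos(3)[OF xP[OF t] xP[OF t]] P_ops(5)
      using cos_restrict_eq_iff[OF xb[OF T.scal_closed[OF t]] bdd_scal[OF xb[OF t]]] by (simp cong: restrict_cong)
  next
    fix s t assume s: "s \<in> carrier T" and t: "t \<in> carrier T"
    have "x (s \<oplus>\<^bsub>T\<^esub> t) \<asymp> (\<lambda>i. x s i \<oplus>\<^sub>i x t i)" using x s t by (simp add: asym_hom_def)
    then show "cos (restrict (x (s \<oplus>\<^bsub>T\<^esub> t)) I) = cos (restrict (x s) I) \<oplus>\<^bsub>U\<^esub> cos (restrict (x t) I)"
      unfolding U_cos(2)[OF xP[OF s] xP[OF t]] P_ops(2)
      using cos_restrict_eq_iff[OF xb[OF T.a_closed[OF s t]] bdd_add[OF xb[OF s] xb[OF t]]] by (simp cong: restrict_cong)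
    have "x (s \<otimes>\<^bsub>T\<^esub> t) \<asymp> (\<lambda>i. x s i \<otimes>\<^sub>i x t i)" using x s t by (simp add: asym_hom_def)
    then show "cos (restrict (x (s \<otimes>\<^bsub>T\<^esub> t)) I) = cos (restrict (x s) I) \<otimes>\<^bsub>U\<^esub> cos (restrict (x t) I)"
      unfolding U_cos(1)[OF xP[OF s] xP[OF t]] P_ops(1)
      using cos_restrict_eq_iff[OF xb[OF T.m_closed[OF s t]] bdd_mult[OF xb[OF s] xb[OF t]]] by (simp cong: restrict_cong)
  next
    have "x \<one>\<^bsub>T\<^esub> \<asymp> (\<lambda>i. \<one>\<^sub>i)" using x by (simp add: asym_hom_def)
    then show "cos (restrict (x \<one>\<^bsub>T\<^esub>) I) = \<one>\<^bsub>U\<^esub>"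
      unfolding U_ops(4) P_ops(3) using cos_restrict_eq_iff[OF xb[OF T.one_closed] bdd_one] by simp
  qed
qed

end

lemma separable_sequence:
  assumes T: "unital_cstar_algebra T" and sep: "separable_cstar T"
  obtains d :: "nat => 't" where "!!k. d k \<in> carrier T"
    "!!t e. t \<in> carrier (T :: 't cstar_algebra) ==> e > 0 ==> \<exists>k. cnorm T (t \<ominus>\<^bsub>T\<^esub> d k) < e"
proof -
  interpret T: unital_cstar_algebra T by (rule T)
  obtain D where D: "D \<subseteq> carrier T" "countable D" "norm_topology T closure_of D = carrier T"
    using sep by (auto simp: separable_cstar_def)
  have app: "\<exists>y\<in>D. cnorm T (t \<ominus>\<^bsub>T\<^esub> y) < e" if "t \<in> carrier T" "e > 0" for t e
    using T.in_closure_iff[OF D(1)] D(3) that by blast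
  have ne: "D \<noteq> {}" using app[of "\<zero>\<^bsub>T\<^esub>" 1] by auto
  show thesis
  proof (rule that[of "from_nat_into D"])
    show "from_nat_into D k \<in> carrier T" for k using from_nat_into[OF ne] D(1) by blast
    fix t and e :: real assume "t \<in> carrier T" "e > 0"
    then obtain y where "y \<in> D" "cnorm T (t \<ominus>\<^bsub>T\<^esub> y) < e" using app by blast
    then show "\<exists>k. cnorm T (t \<ominus>\<^bsub>T\<^esub> from_nat_into D k) < e"
      using from_nat_into_surj[OF D(2)] by metis
  qed
qed

lemma power_exceeds: "0 < \<delta> ==> \<exists>k::nat. C \<le> \<delta> * (10/9) ^ k" for C \<delta> :: real
proof -
  assume d: "0 < \<delta>"
  obtain k where "C / \<delta> < (10/9) ^ k" using real_arch_pow[of "10/9" "C / \<delta>"] by auto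
  then show ?thesis using d by (intro exI[of _ k]) (simp add: divide_less_eq mult.commute)
qed

lemma (in family) lift_bounded:
  assumes T: "unital_cstar_algebra T" and \<phi>: "!!i. i \<in> E ==> \<phi> i \<in> unital_star_hom T (A i)" and b: "b \<in> carrier T"
  shows "bounded_fam (\<lambda>i. if i \<in> E then \<phi> i b else \<zero>\<^sub>i)"
proof -
  have "(if i \<in> E then \<phi> i b else \<zero>\<^sub>i) \<in> carrier (A i) \<and>
      cnorm (A i) (if i \<in> E then \<phi> i b else \<zero>\<^sub>i) \<le> cnorm T b" if i: "i \<in> I" for i
  proof -
    interpret tracial_algebra "A i" "\<rho> i" by (rule fam[OF i])
    show ?thesis
      using \<phi>[of i] unital_star_homD(1)[of "\<phi> i" T "A i" b] b unital_cstar_algebra.cnorm_nonneg[OF T b]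
        unital_star_hom_contractive[OF T unital_cstar_algebra_axioms, of "\<phi> i" b] by auto
  qed
  then show ?thesis unfolding bdd_fam_def by blast
qed

context representation
begin

lemma self_adjoint_loc:
  assumes a: "self_adjoint T a" obtains r where "loc I \<alpha> A \<rho> (x a) 0 r"
proof -
  have aT: "a \<in> carrier T" and as: "star T a = a" using a by (auto simp: self_adjoint_def)
  define h where "h = (\<lambda>i. (1/2) \<odot>\<^sub>i (x a i \<oplus>\<^sub>i star (A i) (x a i)))"
  have hb: "bounded_fam h" unfolding h_def by (intro bdd_scal bdd_add bdd_star x_bdd aT)
  then obtain C where C: "!!i. i \<in> I ==> cnorm (A i) (h i) \<le> C" using bdd_bound by metis
  have "self_adjoint (A i) (h i) \<and> cnorm (A i) (h i \<ominus>\<^sub>i of_real 0 \<odot>\<^sub>i \<one>\<^sub>i) \<le> C" if i: "i \<in> I" for i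
  proof -
    interpret tracial_algebra "A i" "\<rho> i" by (rule fam[OF i])
    have [simp]: "x a i \<in> carrier (A i)" using x_in[OF aT] i by simp
    have "self_adjoint (A i) (h i)" by (simp add: h_def self_adjoint_def star_simps a_comm)
    then show ?thesis using C[OF i] by (auto simp: self_adjoint_def)
  qed
  moreover have "x a \<asymp> h"
  proof -
    have s: "x a \<asymp> (\<lambda>i. star (A i) (x a i))" using x_star[OF aT] as by simp
    have 1: "(\<lambda>i. (1/2) \<odot>\<^sub>i (x a i \<oplus>\<^sub>i x a i)) \<asymp> h" unfolding h_def
      by (intro eqv_scal eqv_add eqv_refl s x_in aT bdd_add bdd_star x_bdd bdd_fam_in)
    have 2: "x a \<asymp> (\<lambda>i. (1/2) \<odot>\<^sub>i (x a i \<oplus>\<^sub>i x a i))"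
    proof (rule eqv_same)
      fix i assume i: "i \<in> I"
      interpret tracial_algebra "A i" "\<rho> i" by (rule fam[OF i])
      have "x a i \<in> carrier (A i)" using x_in[OF aT] i by simp
      then show "x a i = (1/2) \<odot>\<^sub>i (x a i \<oplus>\<^sub>i x a i)" by (simp add: scal_add_right scal_add_left[symmetric])
    qed (intro x_in aT)
    show ?thesis by (rule eqv_trans[OF 2 1]) (intro x_in aT bdd_fam_in bdd_scal bdd_add x_bdd hb)+
  qed
  ultimately show thesis using that unfolding loc_def by blast
qed

text \<open>A diagonal argument along a dense sequence turns approximate models on finite sets into a
  lift.\<close>

lemma liftable_if_good:
  assumes good: "!!F \<epsilon>. finite F ==> F \<subseteq> carrier T ==> 0 < \<epsilon> ==> good \<alpha> A \<rho> T x F \<epsilon>"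
    and d: "!!k :: nat. d k \<in> carrier T"
    and dense: "!!t e. t \<in> carrier T ==> e > 0 ==> \<exists>k. cnorm T (t \<ominus> d k) < e"
    and \<pi>x: "!!t. t \<in> carrier T ==> \<pi> t = coset_of I \<alpha> A \<rho> (restrict (x t) I)"
  shows "approximately_liftable T I \<alpha> A \<rho> \<pi>"
proof -
  define Q where "Q = (\<lambda>n i. i \<in> I \<and> (\<exists>\<psi>\<in>unital_star_hom T (A i). \<forall>t\<in>d ` {..n}.
    nrm i (\<psi> t \<ominus>\<^sub>i x t i) < 2 / real (Suc n)))"
  have "\<forall>\<^sub>F i in \<alpha>. Q n i" for n
  proof -
    have "good \<alpha> A \<rho> T x (d ` {..n}) (1 / real (Suc n))" using d by (intro good) auto
    moreover have "1 / real (Suc n) < 2 / real (Suc n)" by (intro divide_strict_right_mono) auto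
    ultimately have "\<forall>\<^sub>F i in \<alpha>. \<exists>\<psi>\<in>unital_star_hom T (A i). \<forall>t\<in>d ` {..n}.
        nrm i (\<psi> t \<ominus>\<^sub>i x t i) < 2 / real (Suc n)" unfolding good_def by blast
    then show ?thesis unfolding Q_def by (intro eventually_conj in_I)
  qed
  then obtain N where N: "\<forall>\<^sub>F i in \<alpha>. Q (N i) i" "!!n. \<forall>\<^sub>F i in \<alpha>. n \<le> N i" using diagonal by blast
  define E where "E = {i \<in> I. Q (N i) i}"
  have "\<forall>i\<in>E. \<exists>\<psi>. \<psi> \<in> unital_star_hom T (A i) \<and> (\<forall>t\<in>d ` {..N i}. nrm i (\<psi> t \<ominus>\<^sub>i x t i) < 2 / real (Suc (N i)))"
    unfolding E_def Q_def by blast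
  from bchoice[OF this] obtain \<phi> where \<phi>: "\<forall>i\<in>E. \<phi> i \<in> unital_star_hom T (A i) \<and>
    (\<forall>t\<in>d ` {..N i}. nrm i (\<phi> i t \<ominus>\<^sub>i x t i) < 2 / real (Suc (N i)))" by blast
  have evE: "\<forall>\<^sub>F i in \<alpha>. i \<in> E" unfolding E_def using N(1) in_I by eventually_elim simp
  show ?thesis unfolding approximately_liftable_def
  proof (intro exI[of _ E] exI[of _ \<phi>] conjI ballI)
    show "E \<subseteq> I" by (auto simp: E_def)
    show "\<forall>\<^sub>F i in \<alpha>. i \<in> E" by (rule evE)
    show ph: "\<phi> i \<in> unital_star_hom T (A i)" if "i \<in> E" for i using \<phi> that by blast
    fix b assume b: "b \<in> carrier T"
    define f where "f = (\<lambda>i. if i \<in> E then \<phi> i b else \<zero>\<^sub>i)"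
    have fb: "bounded_fam f" unfolding f_def by (rule lift_bounded[OF T.unital_cstar_algebra_axioms ph b])
    have "x b \<asymp> f" unfolding eqv_def
    proof (rule order_tendstoI)
      fix e :: real assume "e < 0"
      have "fam_in (\<lambda>i. x b i \<ominus>\<^sub>i f i)" by (intro fam_diff x_in b bdd_fam_in fb)
      then show "\<forall>\<^sub>F i in \<alpha>. e < nrm i (x b i \<ominus>\<^sub>i f i)"
        using \<open>e < 0\<close> by (intro eventually_mono[OF in_I]) (meson n2_nonneg order_less_le_trans)
    next
      fix e :: real assume e: "e > 0"
      then have "e/3 > 0" by simp
      then obtain k where k: "cnorm T (b \<ominus> d k) < e/3" using dense[OF b] by blast
      obtain m :: nat where m: "1 / real (Suc m) < e/6" using nat_approx_posE[of "e/6"] e by auto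
      show "\<forall>\<^sub>F i in \<alpha>. nrm i (x b i \<ominus>\<^sub>i f i) < e"
        using n2_diff_less[OF b d k] N(2)[of k] N(2)[of m] evE
      proof eventually_elim
        case (elim i)
        have iI: "i \<in> I" using elim(4) by (simp add: E_def)
        interpret tracial_algebra "A i" "\<rho> i" by (rule fam[OF iI])
        note ph = ph[OF elim(4)]
        have [simp]: "x b i \<in> carrier (A i)" "x (d k) i \<in> carrier (A i)" "\<phi> i b \<in> carrier (A i)" "\<phi> i (d k) \<in> carrier (A i)"
          using x_in[OF b] x_in[OF d] iI unital_star_homD(1)[OF ph] b d by auto
        have "nrm i (\<phi> i (d k) \<ominus>\<^sub>i x (d k) i) < 2 / real (Suc (N i))" using \<phi> elim(4,2) by blast
        also have "\<dots> \<le> 2 / real (Suc m)" using elim(3) by (intro divide_left_mono) auto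
        also have "\<dots> = 2 * (1 / real (Suc m))" by simp
        also have "\<dots> < e/3" using m by linarith
        finally have 1: "nrm i (x (d k) i \<ominus>\<^sub>i \<phi> i (d k)) < e/3" by (simp add: norm2_diff_commute[of "x (d k) i"])
        have "nrm i (\<phi> i (d k) \<ominus>\<^sub>i \<phi> i b) \<le> cnorm (A i) (\<phi> i (d k \<ominus> b))"
          using norm2_le_cnorm[of "\<phi> i (d k) \<ominus>\<^sub>i \<phi> i b"]
            unital_star_hom_diff[OF T.unital_cstar_algebra_axioms unital_cstar_algebra_axioms ph d b] by simp
        also have "\<dots> \<le> cnorm T (d k \<ominus> b)"
          using b d by (intro unital_star_hom_contractive[OF T.unital_cstar_algebra_axioms unital_cstar_algebra_axioms ph]) auto
        also have "\<dots> < e/3" using k T.cnorm_diff_commute[OF b d] by simp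
        finally have 2: "nrm i (\<phi> i (d k) \<ominus>\<^sub>i \<phi> i b) < e/3" .
        have "nrm i (x b i \<ominus>\<^sub>i \<phi> i b) \<le> nrm i (x b i \<ominus>\<^sub>i x (d k) i) +
            (nrm i (x (d k) i \<ominus>\<^sub>i \<phi> i (d k)) + nrm i (\<phi> i (d k) \<ominus>\<^sub>i \<phi> i b))"
          by (intro order_trans[OF norm2_diff_triangle[of _ "x (d k) i"]] add_left_mono norm2_diff_triangle) auto
        then have "nrm i (x b i \<ominus>\<^sub>i \<phi> i b) < e" using elim(1) 1 2 by linarith
        then show ?case using elim(4) by (simp add: f_def)
      qed
    qed
    then show "\<pi> b = coset_of I \<alpha> A \<rho> (\<lambda>i\<in>I. if i \<in> E then \<phi> i b else \<zero>\<^sub>i)"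
      using \<pi>x[OF b] cos_restrict_eq_iff[OF x_bdd[OF b] fb] by (simp add: f_def)
  qed
qed

end

text \<open>It suffices to find approximate models for representations in which finitely many chosen central
  elements are almost scalar: cutting leads from an arbitrary representation to such ones.\<close>

theorem tracially_stable_by_local_models:
  fixes \<C> :: "'u cstar_algebra set" and T :: "'t cstar_algebra"
  assumes cls: "!!A. A \<in> \<C> ==> unital_cstar_algebra A \<and> real_rank_zero A"
    and corner: "corner_closed \<C>"
    and T: "unital_cstar_algebra T" and sep: "separable_cstar T"
    and models: "!!F \<epsilon>. finite F ==> F \<subseteq> carrier T ==> 0 < \<epsilon> ==>
      \<exists>S \<delta>. finite S \<and> S \<subseteq> carrier T \<and> (\<forall>a\<in>S. self_adjoint T a) \<and>
        (\<forall>a\<in>S. \<forall>t\<in>carrier T. a \<otimes>\<^bsub>T\<^esub> t = t \<otimes>\<^bsub>T\<^esub> a) \<and> 0 < \<delta> \<and>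
        (\<forall>(I :: 'i set) \<alpha> A \<rho> x c. nontrivial_ultrafilter_on I \<alpha> --> infinite I -->
          (\<forall>i\<in>I. A i \<in> \<C> \<and> tracial_state (A i) (\<rho> i)) --> asym_hom I \<alpha> A \<rho> T x -->
          (\<forall>a\<in>S. loc I \<alpha> A \<rho> (x a) (c a) \<delta>) --> good \<alpha> A \<rho> T x F \<epsilon>)"
  shows "tracially_stable TYPE('i) \<C> T"
  unfolding tracially_stable_def
proof (intro conjI allI impI T sep)
  fix I :: "'i set" and \<alpha> A \<rho> \<pi>
  assume asm: "infinite I \<and> nontrivial_ultrafilter_on I \<alpha> \<and>
    (\<forall>i\<in>I. A i \<in> \<C> \<and> tracial_state (A i) (\<rho> i)) \<and> \<pi> \<in> unital_star_hom T (tracial_ultraproduct I \<alpha> A \<rho>)"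
  then have nontriv: "nontrivial_ultrafilter_on I \<alpha>" and inf: "infinite I"
    and A: "\<forall>i\<in>I. A i \<in> \<C> \<and> tracial_state (A i) (\<rho> i)"
    and \<pi>: "\<pi> \<in> unital_star_hom T (tracial_ultraproduct I \<alpha> A \<rho>)" by auto
  have fam: "tracial_algebra (A i) (\<rho> i)" if "i \<in> I" for i
    using that A cls by (simp add: tracial_algebra_def tracial_algebra_axioms_def)
  have family: "family I \<alpha> A \<rho>" by (intro family.intro nontriv fam)
  obtain x where x: "asym_hom I \<alpha> A \<rho> T x"
    and \<pi>x: "!!t. t \<in> carrier T ==> \<pi> t = coset_of I \<alpha> A \<rho> (restrict (x t) I)"
    using family.hom_representatives[OF family T \<pi>] by blast
  interpret representation I \<alpha> A \<rho> T x
    by (intro representation.intro family representation_axioms.intro T x)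
  obtain d :: "nat => 't" where d: "!!k. d k \<in> carrier T"
    and dense: "!!t e. t \<in> carrier T ==> e > 0 ==> \<exists>k. cnorm T (t \<ominus>\<^bsub>T\<^esub> d k) < e"
    using separable_sequence[OF T sep] by blast
  show "approximately_liftable T I \<alpha> A \<rho> \<pi>"
  proof (rule liftable_if_good[OF _ d dense \<pi>x])
    fix F and \<epsilon> :: real assume F: "finite F" "F \<subseteq> carrier T" and \<epsilon>: "0 < \<epsilon>"
    obtain S \<delta> where S0: "finite S \<and> S \<subseteq> carrier T \<and> (\<forall>a\<in>S. self_adjoint T a) \<and>
        (\<forall>a\<in>S. \<forall>t\<in>carrier T. a \<otimes>\<^bsub>T\<^esub> t = t \<otimes>\<^bsub>T\<^esub> a) \<and> 0 < \<delta> \<and>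
        (\<forall>(I :: 'i set) \<alpha> A \<rho> x c. nontrivial_ultrafilter_on I \<alpha> --> infinite I -->
          (\<forall>i\<in>I. A i \<in> \<C> \<and> tracial_state (A i) (\<rho> i)) --> asym_hom I \<alpha> A \<rho> T x -->
          (\<forall>a\<in>S. loc I \<alpha> A \<rho> (x a) (c a) \<delta>) --> good \<alpha> A \<rho> T x F \<epsilon>)"
      using models[OF F \<epsilon>] by (elim exE) (rule that)
    then have S: "finite S" "S \<subseteq> carrier T" "!!a. a \<in> S ==> self_adjoint T a"
      "!!a t. a \<in> S ==> t \<in> carrier T ==> a \<otimes>\<^bsub>T\<^esub> t = t \<otimes>\<^bsub>T\<^esub> a" and \<delta>: "0 < \<delta>" by auto
    from S0 have base: "good \<alpha> A \<rho> T x F \<epsilon>" if "nontrivial_ultrafilter_on I \<alpha>" "infinite I"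
        "\<forall>i\<in>I. A i \<in> \<C> \<and> tracial_state (A i) (\<rho> i)" "asym_hom I \<alpha> A \<rho> T x"
        "\<forall>a\<in>S. loc I \<alpha> A \<rho> (x a) (c a) \<delta>" for I :: "'i set" and \<alpha> A \<rho> x c
      using that by (elim conjE allE impE) assumption+
    have "\<exists>k. loc I \<alpha> A \<rho> (x a) 0 (\<delta> * (10/9) ^ k)" if a: "a \<in> S" for a
    proof -
      obtain r where r: "loc I \<alpha> A \<rho> (x a) 0 r" using self_adjoint_loc[OF S(3)[OF a]] by blast
      obtain k where "r \<le> \<delta> * (10/9) ^ k" using power_exceeds[OF \<delta>] by blast
      then show ?thesis using r unfolding loc_def by (meson order_trans)
    qed
    then obtain k where k: "!!a. a \<in> S ==> loc I \<alpha> A \<rho> (x a) 0 (\<delta> * (10/9) ^ k a)" by metis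
    show "good \<alpha> A \<rho> T x F \<epsilon>"
      by (rule good_by_localization[where c = "\<lambda>_. 0" and k = k, OF cls corner nontriv T d dense S(1,2,4) \<delta> F
            base[OF nontriv inf] A x]) (use k in auto)
  qed
qed

section \<open>Sums of squared deviations\<close>

lemma (in abelian_monoid) finsum_additive:
  assumes "finite S" and "!!a. a \<in> S ==> g a \<in> carrier G"
    and "\<phi> \<zero> = (0 :: 'c :: comm_monoid_add)"
    and "!!x y. x \<in> carrier G ==> y \<in> carrier G ==> \<phi> (x \<oplus> y) = \<phi> x + \<phi> y"
  shows "\<phi> (finsum G g S) = (\<Sum>a\<in>S. \<phi> (g a))"
  using assms(1,2)
proof (induction S rule: finite_induct)
  case empty show ?case by (simp add: assms(3))
next
  case (insert a S)
  then have "finsum G g (insert a S) = g a \<oplus> finsum G g S" by (intro finsum_insert) auto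
  moreover have "finsum G g S \<in> carrier G" using insert by (intro finsum_closed) auto
  ultimately show ?case using insert assms(4) by simp
qed

context unital_cstar_algebra
begin

text \<open>In a state it measures how far the elements of \<open>S\<close> are from the scalars \<open>c\<close>; a point at which it
  is small is found by comparing with the expectation.\<close>

definition sq_dev :: "('a => real) => 'a set => 'a"
  where "sq_dev c S = (\<Oplus>a\<in>S. (a \<ominus> of_real (c a) \<odot> \<one>) \<otimes> (a \<ominus> of_real (c a) \<odot> \<one>))"

lemma finsum_self_adjoint:
  assumes "finite S" "!!a. a \<in> S ==> self_adjoint A (g a)"
  shows "self_adjoint A (finsum A g S)"
  using assms
proof (induction S rule: finite_induct)
  case (insert a S)
  then have "finsum A g (insert a S) = g a \<oplus> finsum A g S"
    by (intro finsum_insert) (auto simp: self_adjoint_def)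
  then show ?case using insert by (simp add: self_adjoint_def star_add)
qed (simp add: self_adjoint_def)

lemma sq_dev_self_adjoint:
  assumes "finite S" "!!a. a \<in> S ==> self_adjoint A a"
  shows "self_adjoint A (sq_dev c S)"
  unfolding sq_dev_def using assms
  by (intro finsum_self_adjoint) (auto simp: self_adjoint_def star_mult star_diff star_smult)

end

lemma (in representation) x_scalar: "x (c \<odot> \<one>) \<asymp> (\<lambda>i. c \<odot>\<^sub>i \<one>\<^sub>i)"
  by (rule eqv_trans[OF x_scal])
    (auto intro!: eqv_scal x_one x_in x_bdd bdd_one bdd_fam_in[OF bdd_scal[OF x_bdd]] bdd_fam_in[OF bdd_scal[OF bdd_one]])

text \<open>The 2-norm in the limit state is the limit of the 2-norms, so closeness in \<open>T\<close> passes to almost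
  all indices.\<close>

lemma (in representation) good_by_approximate_homs:
  assumes F: "finite F" "!!t. t \<in> F ==> t \<in> carrier T" "!!t. t \<in> F ==> g t \<in> carrier T"
    and close: "!!t. t \<in> F ==> norm2 T lim_state (t \<ominus> g t) \<le> \<epsilon>"
    and \<psi>: "\<forall>\<^sub>F i in \<alpha>. \<psi> i \<in> unital_star_hom T (A i)"
    and lift: "!!t. t \<in> F ==> x (g t) \<asymp> (\<lambda>i. \<psi> i t)"
  shows "good \<alpha> A \<rho> T x F \<epsilon>"
  unfolding good_def
proof (intro allI impI)
  fix \<epsilon>' assume \<epsilon>': "\<epsilon>' > \<epsilon>"
  have "\<forall>\<^sub>F i in \<alpha>. nrm i (\<psi> i t \<ominus>\<^sub>i x t i) < \<epsilon>'" if t: "t \<in> F" for t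
  proof -
    note [simp] = F(2,3)[OF t]
    have "((\<lambda>i. nrm i (x t i \<ominus>\<^sub>i x (g t) i)) \<longlongrightarrow> norm2 T lim_state (t \<ominus> g t)) \<alpha>"
      by (rule n2_tendsto_cong[OF x_diff _ _ n2_tendsto]) (intro fam_diff x_in | simp)+
    from tendsto_add[OF this lift[OF t, unfolded eqv_def]]
    have "\<forall>\<^sub>F i in \<alpha>. nrm i (x t i \<ominus>\<^sub>i x (g t) i) +
        nrm i (x (g t) i \<ominus>\<^sub>i \<psi> i t) < \<epsilon>'"
      by (rule order_tendstoD(2)) (use close[OF t] \<epsilon>' in simp)
    then show ?thesis using in_I \<psi>
    proof eventually_elim
      case (elim i)
      interpret tracial_algebra "A i" "\<rho> i" by (rule fam[OF elim(2)])
      have [simp]: "x t i \<in> carrier (A i)" "x (g t) i \<in> carrier (A i)" "\<psi> i t \<in> carrier (A i)"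
        using x_in elim(2) unital_star_homD(1)[OF elim(3)] by auto
      show ?case
        using norm2_diff_triangle[of "x t i" "x (g t) i" "\<psi> i t"] elim(1)
        by (simp add: norm2_diff_commute[of "\<psi> i t" "x t i"])
    qed
  qed
  then have "\<forall>\<^sub>F i in \<alpha>. \<forall>t\<in>F. nrm i (\<psi> i t \<ominus>\<^sub>i x t i) < \<epsilon>'"
    using F(1) by (simp add: eventually_ball_finite)
  then show "\<forall>\<^sub>F i in \<alpha>. \<exists>\<psi>\<in>unital_star_hom T (A i). \<forall>t\<in>F. nrm i (\<psi> t \<ominus>\<^sub>i x t i) < \<epsilon>'"
    using \<psi> by eventually_elim blast
qed

lemma (in representation) norm2_deviation_le:
  assumes a: "a \<in> carrier T" and l: "loc I \<alpha> A \<rho> (x a) c \<delta>"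
  shows "norm2 T lim_state (a \<ominus> of_real c \<odot> \<one>) \<le> \<delta>"
proof -
  obtain h where h: "!!i. i \<in> I ==> self_adjoint (A i) (h i) \<and>
      cnorm (A i) (h i \<ominus>\<^sub>i of_real c \<odot>\<^sub>i \<one>\<^sub>i) \<le> \<delta>" and eq: "x a \<asymp> h"
    using l unfolding loc_def by blast
  have hb: "bounded_fam h" by (rule loc_bdd[OF h])
  have hin: "fam_in h" using h by (auto simp: self_adjoint_def)
  let ?c = "complex_of_real c" let ?b = "a \<ominus> of_real c \<odot> \<one>"
  have b: "?b \<in> carrier T" "?c \<odot> \<one> \<in> carrier T" using a by auto
  note c1 = x_scalar[of ?c]
  have "x ?b \<asymp> (\<lambda>i. x a i \<ominus>\<^sub>i x (?c \<odot> \<one>) i)" using x_diff[OF a b(2)] .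
  moreover have "(\<lambda>i. x a i \<ominus>\<^sub>i x (?c \<odot> \<one>) i) \<asymp> (\<lambda>i. h i \<ominus>\<^sub>i ?c \<odot>\<^sub>i \<one>\<^sub>i)"
    by (intro eqv_diff eq c1 x_bdd a b hb bdd_scal bdd_one)
  ultimately have e: "x ?b \<asymp> (\<lambda>i. h i \<ominus>\<^sub>i ?c \<odot>\<^sub>i \<one>\<^sub>i)"
    by (rule eqv_trans) (intro fam_diff x_in a b hin bdd_fam_in[OF bdd_scal[OF bdd_one]])+
  have fc: "fam_in (\<lambda>i. h i \<ominus>\<^sub>i ?c \<odot>\<^sub>i \<one>\<^sub>i)" by (intro fam_diff hin bdd_fam_in[OF bdd_scal[OF bdd_one]])
  have "((\<lambda>i. nrm i (x ?b i \<ominus>\<^sub>i (h i \<ominus>\<^sub>i ?c \<odot>\<^sub>i \<one>\<^sub>i)) + \<delta>) \<longlongrightarrow> 0 + \<delta>) \<alpha>"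
    using e unfolding eqv_def by (intro tendsto_add tendsto_const)
  moreover have "\<forall>\<^sub>F i in \<alpha>. n2 (x ?b) i \<le>
      nrm i (x ?b i \<ominus>\<^sub>i (h i \<ominus>\<^sub>i ?c \<odot>\<^sub>i \<one>\<^sub>i)) + \<delta>"
    using in_I
  proof eventually_elim
    case (elim i)
    interpret tracial_algebra "A i" "\<rho> i" by (rule fam[OF elim])
    have [simp]: "x ?b i \<in> carrier (A i)" using x_in[OF b(1)] elim by blast
    have [simp]: "h i \<ominus>\<^sub>i ?c \<odot>\<^sub>i \<one>\<^sub>i \<in> carrier (A i)" using fc elim by blast
    have "nrm i (h i \<ominus>\<^sub>i ?c \<odot>\<^sub>i \<one>\<^sub>i) \<le> \<delta>"
      using norm2_le_cnorm[of "h i \<ominus>\<^sub>i ?c \<odot>\<^sub>i \<one>\<^sub>i"] h[OF elim] by simp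
    then show ?case
      using norm2_le_diff[of "x ?b i" "h i \<ominus>\<^sub>i ?c \<odot>\<^sub>i \<one>\<^sub>i"] by simp
  qed
  ultimately show ?thesis
    using tendsto_le[OF not_bot _ n2_tendsto[OF b(1)]] by fastforce
qed

lemma (in representation) state_sq_dev_le:
  assumes S: "finite S" "!!a. a \<in> S ==> self_adjoint T a"
    and l: "!!a. a \<in> S ==> loc I \<alpha> A \<rho> (x a) (c a) \<delta>"
  shows "Re (lim_state (T.sq_dev c S)) \<le> real (card S) * \<delta>\<^sup>2"
proof -
  let ?g = "\<lambda>a. a \<ominus> of_real (c a) \<odot> \<one>"
  have Sc: "a \<in> carrier T" if "a \<in> S" for a using S(2)[OF that] by (simp add: self_adjoint_def)
  have "Re (lim_state (T.sq_dev c S)) = (\<Sum>a\<in>S. Re (lim_state (?g a \<otimes> ?g a)))"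
    unfolding T.sq_dev_def using S Sc
    by (intro T.finsum_additive) (auto simp: L.st)
  also have "\<dots> \<le> (\<Sum>a\<in>S. \<delta>\<^sup>2)"
  proof (rule sum_mono)
    fix a assume a: "a \<in> S"
    have g: "?g a \<in> carrier T" using Sc[OF a] by simp
    have "star T (?g a) = ?g a" using S(2)[OF a] by (simp add: self_adjoint_def T.star_diff T.star_smult)
    then have "Re (lim_state (?g a \<otimes> ?g a)) = (norm2 T lim_state (?g a))\<^sup>2"
      using L.norm2_sq[OF g] by simp
    also have "\<dots> \<le> \<delta>\<^sup>2"
      by (intro power_mono norm2_deviation_le l a Sc L.norm2_nonneg g)
    finally show "Re (lim_state (?g a \<otimes> ?g a)) \<le> \<delta>\<^sup>2" .
  qed
  finally show ?thesis by simp
qed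

lemma sum_squares_component_bound:
  assumes "finite S" "(\<Sum>a\<in>S. (f a - c a)\<^sup>2) \<le> real (card S) * \<delta>\<^sup>2 + \<delta>\<^sup>2" "a \<in> S" "0 < (\<delta> :: real)"
  shows "\<bar>f a - c a\<bar> \<le> (real (card S) + 1) * \<delta>"
proof (rule power2_le_imp_le)
  have "\<bar>f a - c a\<bar>\<^sup>2 \<le> (\<Sum>a\<in>S. (f a - c a)\<^sup>2)"
    using member_le_sum[of a S "\<lambda>a. (f a - c a)\<^sup>2"] assms by simp
  also have "\<dots> \<le> (real (card S) + 1) * \<delta>\<^sup>2" using assms(2) by (simp add: distrib_right)
  also have "\<dots> \<le> (real (card S) + 1) * ((real (card S) + 1) * \<delta>\<^sup>2)"
    using mult_right_mono[of 1 "real (card S) + 1" "(real (card S) + 1) * \<delta>\<^sup>2"] by simp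
  finally show "\<bar>f a - c a\<bar>\<^sup>2 \<le> ((real (card S) + 1) * \<delta>)\<^sup>2"
    by (simp add: power_mult_distrib power2_eq_square mult_ac)
qed (use assms in simp)

section \<open>Characters of commutative algebras\<close>

lemma (in cring) maximal_ideal_containing_nonunit:
  assumes s: "s \<in> carrier R" and nonunit: "!!t. t \<in> carrier R ==> t \<otimes> s \<noteq> \<one>"
  obtains M where "maximalideal M R" "s \<in> M"
proof -
  define \<A> where "\<A> = {J. ideal J R \<and> s \<in> J \<and> \<one> \<notin> J}"
  have "PIdl s \<in> \<A>"
    unfolding \<A>_def mem_Collect_eq
    using nonunit cgenideal_ideal[OF s] cgenideal_self[OF s] unfolding cgenideal_def by (smt (verit) mem_Collect_eq)
  then have ne: "\<A> \<noteq> {}" by blast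
  have "\<exists>M\<in>\<A>. \<forall>J\<in>\<A>. M \<subseteq> J --> J = M"
  proof (rule subset_Zorn_nonempty[OF ne])
    fix C assume C: "C \<noteq> {}" "subset.chain \<A> C"
    then have "subset.chain {I. ideal I R} C" by (auto simp: pred_on.chain_def \<A>_def)
    from chain_Union_is_ideal[OF this] C show "\<Union>C \<in> \<A>"
      by (auto simp: pred_on.chain_def \<A>_def)
  qed
  then obtain M where M: "M \<in> \<A>" "!!J. J \<in> \<A> ==> M \<subseteq> J ==> J = M" by blast
  have "maximalideal M R"
  proof (rule maximalidealI)
    show "ideal M R" "carrier R \<noteq> M" using M(1) by (auto simp: \<A>_def)
    fix J assume J: "ideal J R" "M \<subseteq> J"
    show "J = M \<or> J = carrier R"
    proof (cases "\<one> \<in> J")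
      case True then show ?thesis using ideal.one_imp_carrier[OF J(1)] by blast
    next
      case False
      then have "J \<in> \<A>" using J M(1) by (auto simp: \<A>_def)
      then show ?thesis using M(2) J(2) by blast
    qed
  qed
  then show thesis using that M(1) by (auto simp: \<A>_def)
qed

lemma (in unital_cstar_algebra) cartesian_decomposition:
  assumes x: "x \<in> carrier A"
  obtains u v where "self_adjoint A u" "self_adjoint A v" "x = u \<oplus> \<i> \<odot> v"
proof -
  define u where "u = (1/2) \<odot> (x \<oplus> star A x)"
  define v where "v = (- \<i> / 2) \<odot> (x \<ominus> star A x)"
  have [simp]: "u \<in> carrier A" "v \<in> carrier A" using x by (auto simp: u_def v_def)
  have su: "star A u = u" unfolding u_def using x by (simp add: star_simps a_comm)
  have "star A v = (\<i>/2) \<odot> (star A x \<ominus> x)" unfolding v_def using x by (simp add: star_simps)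
  also have "\<dots> = (\<i>/2) \<odot> (\<ominus> (x \<ominus> star A x))" using x by (simp add: diff_commute)
  also have "\<dots> = v" using x by (simp add: v_def scal_minus scal_uminus)
  finally have sv: "star A v = v" .
  have "u \<oplus> \<i> \<odot> v = (1/2) \<odot> ((x \<oplus> star A x) \<oplus> (x \<ominus> star A x))"
    unfolding u_def v_def using x by (simp add: scal_add_right)
  also have "(x \<oplus> star A x) \<oplus> (x \<ominus> star A x) = x \<oplus> x" using x by (simp add: cs)
  also have "(1/2) \<odot> (x \<oplus> x) = x" using x by (simp add: scal_add_right scal_add_left[symmetric])
  finally have "x = u \<oplus> \<i> \<odot> v" by simp
  then show thesis using su sv by (intro that[of u v]) (auto simp: self_adjoint_def)
qed

locale maximal_ideal_algebra = unital_cstar_algebra A + maximalideal M A + cring A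
  for A :: "'a cstar_algebra" (structure) and M
begin

lemma one_notin: "\<one> \<notin> M"
  using I_notcarr one_imp_carrier by blast

lemma M_closed [simp]: "m \<in> M ==> m \<in> carrier A"
  using a_subset by blast

lemma M_diff: "m \<in> M ==> n \<in> M ==> m \<ominus> n \<in> M"
  by (simp add: minus_eq)

lemma M_scal: "m \<in> M ==> c \<odot> m \<in> M"
  using I_l_closed[of m "c \<odot> \<one>"] by (simp add: smult_mult_left)

lemma inverse_mod:
  assumes z: "z \<in> carrier A" "z \<notin> M"
  obtains m t where "m \<in> M" "t \<in> carrier A" "\<one> = m \<oplus> t \<otimes> z"
proof -
  let ?J = "M <+>\<^bsub>A\<^esub> PIdl z"
  have J: "ideal ?J A" by (intro add_ideals cgenideal_ideal z is_ideal)
  have zz: "\<zero> \<otimes> z \<in> PIdl z" "z \<in> PIdl z" using cgenideal_self[OF z(1)] by (auto simp: cgenideal_def)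
  have "m \<in> ?J" if m: "m \<in> M" for m
  proof -
    have "m = m \<oplus> \<zero> \<otimes> z" using m z by simp
    then show ?thesis using m zz unfolding set_add_def' by blast
  qed
  moreover have "z \<in> ?J"
  proof -
    have "z = \<zero> \<oplus> z" "\<zero> \<in> M" using z zero_closed by (auto simp: additive_subgroup.zero_closed is_additive_subgroup)
    then show ?thesis using zz unfolding set_add_def' by blast
  qed
  ultimately have "?J = carrier A"
    using I_maximal[OF J] z(2) ideal.Icarr[OF J] by blast
  then have "\<one> \<in> ?J" by simp
  then show thesis using that by (auto simp: set_add_def' cgenideal_def)
qed

text \<open>A proper ideal stays away from \<open>\<one>\<close>: if \<open>norm (1 - n)\<close> is small, then \<open>n\<^sup>*n\<close> is invertible.\<close>

lemma far_from_one: assumes n: "n \<in> M" shows "1/4 \<le> cnorm A (\<one> \<ominus> n)"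
proof (rule ccontr)
  assume "\<not> ?thesis"
  then have y4: "cnorm A (\<one> \<ominus> n) < 1/4" by simp
  have [simp]: "n \<in> carrier A" using n by simp
  define y where "y = \<one> \<ominus> n"
  have [simp]: "y \<in> carrier A" by (simp add: y_def)
  define b where "b = (y \<oplus> star A y) \<ominus> star A y \<otimes> y"
  have ny: "n = \<one> \<ominus> y" by (simp add: y_def cs)
  have nn: "star A n \<otimes> n = \<one> \<ominus> b"
    unfolding ny b_def by (simp add: cs)
  have sab: "self_adjoint A b" unfolding b_def self_adjoint_def by (simp add: cs)
  have "cnorm A b \<le> cnorm A y + cnorm A y + (cnorm A y)\<^sup>2"
    unfolding b_def using cnorm_diff_le[of "y \<oplus> star A y" "star A y \<otimes> y"] cnorm_triangle[of y "star A y"]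
    by (simp add: cstar_identity)
  moreover have "(cnorm A y)\<^sup>2 \<le> 1/4 * 1"
    unfolding power2_eq_square using y4 cnorm_nonneg[of y] by (intro mult_mono) (auto simp: y_def[symmetric])
  \<comment> \<open>any bound below \<open>1\<close> makes \<open>1 / (1 - x)\<close> continuous on the domain of the calculus\<close>
  ultimately have "cnorm A b < 4/5"
    using y4 by (simp add: y_def[symmetric])
  then interpret F: functional_calculus A b "4/5" by unfold_locales (use sab in auto)
  have c1: "continuous_on F.spdom (\<lambda>x. 1 - x)" by (intro continuous_intros)
  have c2: "continuous_on F.spdom (\<lambda>x. 1 / (1 - x))" by (intro continuous_intros) auto
  have "F.fc (\<lambda>x. 1 / (1 - x)) \<otimes> F.fc (\<lambda>x. 1 - x) = F.fc (\<lambda>x. 1)"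
    unfolding F.fc_mult[OF c2 c1, symmetric] by (rule F.fc_cong) auto
  moreover have "F.fc (\<lambda>x. 1 - x) = star A n \<otimes> n"
    using F.fc_diff[of "\<lambda>x. 1" "\<lambda>x. x"] by (simp add: F.fc_const F.fc_id nn)
  ultimately have "\<one> = F.fc (\<lambda>x. 1 / (1 - x)) \<otimes> (star A n \<otimes> n)" by (simp add: F.fc_const)
  moreover have "F.fc (\<lambda>x. 1 / (1 - x)) \<otimes> (star A n \<otimes> n) \<in> M"
    using n F.fc_closed[OF c2] by (intro I_l_closed) auto
  ultimately show False using one_notin by simp
qed

text \<open>An element outside \<open>M\<close> is invertible modulo \<open>M\<close>, which would move a nearby element of \<open>M\<close> close
  to \<open>\<one>\<close>.\<close>

lemma M_topologically_closed:
  assumes z: "z \<in> carrier A" and lim: "!!e. e > 0 ==> \<exists>m\<in>M. cnorm A (z \<ominus> m) \<le> e"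
  shows "z \<in> M"
proof (rule ccontr)
  assume "z \<notin> M"
  then obtain m' t where m': "m' \<in> M" and t: "t \<in> carrier A" and one: "\<one> = m' \<oplus> t \<otimes> z"
    using inverse_mod z by blast
  have t0: "0 \<le> cnorm A t" using t by (rule cnorm_nonneg)
  then have "0 < 1 / (8 * (cnorm A t + 1))" by simp
  then obtain m where m: "m \<in> M" "cnorm A (z \<ominus> m) \<le> 1 / (8 * (cnorm A t + 1))" using lim by blast
  have n: "m' \<oplus> t \<otimes> m \<in> M" using m(1) m' t by (intro a_closed I_l_closed)
  have "\<one> \<ominus> (m' \<oplus> t \<otimes> m) = (m' \<oplus> t \<otimes> z) \<ominus> (m' \<oplus> t \<otimes> m)" using one by simp
  also have "\<dots> = t \<otimes> (z \<ominus> m)"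
    using m' m(1) t z by (simp add: add_diff_add diff_distr_right)
  finally have "cnorm A (\<one> \<ominus> (m' \<oplus> t \<otimes> m)) \<le> cnorm A t * cnorm A (z \<ominus> m)"
    using cnorm_mult[of t "z \<ominus> m"] m t z by simp
  also have "\<dots> \<le> (cnorm A t + 1) * (1 / (8 * (cnorm A t + 1)))"
    using m t0 z by (intro mult_mono cnorm_nonneg) auto
  also have "\<dots> = 1/8" using t0 by (simp add: divide_simps)
  finally show False using far_from_one[OF n] by simp
qed

lemma M_prime: assumes "a \<otimes> b = \<zero>" "a \<in> carrier A" "b \<in> carrier A" shows "a \<in> M \<or> b \<in> M"
proof (rule disjCI)
  assume "b \<notin> M"
  then obtain m t where m: "m \<in> M" and t: "t \<in> carrier A" and one: "\<one> = m \<oplus> t \<otimes> b"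
    using inverse_mod assms by blast
  have "a = a \<otimes> (m \<oplus> t \<otimes> b)" using assms one[symmetric] by simp
  also have "\<dots> = a \<otimes> m \<oplus> a \<otimes> (t \<otimes> b)" using assms(2,3) m t by (simp add: r_distr)
  also have "a \<otimes> (t \<otimes> b) = t \<otimes> (a \<otimes> b)" using assms(2,3) t by (intro m_lcomm)
  also have "a \<otimes> m \<oplus> t \<otimes> (a \<otimes> b) = a \<otimes> m" using assms m t by simp
  finally show "a \<in> M" using I_l_closed[OF m assms(2)] by simp
qed

text \<open>The scalar is the place where the negative part \<open>(\<mu> - a)\<^sup>+\<close> leaves the ideal as \<open>\<mu>\<close> grows.\<close>

lemma self_adjoint_scalar_mod:
  assumes a: "self_adjoint A a" obtains l :: real where "a \<ominus> of_real l \<odot> \<one> \<in> M"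
proof -
  have [simp]: "a \<in> carrier A" using a by (simp add: self_adjoint_def)
  define R where "R = cnorm A a + 1"
  interpret F: functional_calculus A a R by unfold_locales (use a in \<open>auto simp: R_def\<close>)
  define up where "up = (\<lambda>\<mu>. F.fc (\<lambda>x. max 0 (x - \<mu>)))"
  define dn where "dn = (\<lambda>\<mu>. F.fc (\<lambda>x. max 0 (\<mu> - x)))"
  have co: "continuous_on F.spdom (\<lambda>x. max 0 (x - \<mu>))" "continuous_on F.spdom (\<lambda>x. max 0 (\<mu> - x))" for \<mu>
    by (intro continuous_intros)+
  have [simp]: "up \<mu> \<in> carrier A" "dn \<mu> \<in> carrier A" for \<mu> unfolding up_def dn_def by (intro F.fc_closed co)+
  have "up \<mu> \<otimes> dn \<mu> = F.fc (\<lambda>x. 0)" for \<mu>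
    unfolding up_def dn_def F.fc_mult[OF co, symmetric] by (rule F.fc_cong) auto
  then have prime: "up \<mu> \<in> M \<or> dn \<mu> \<in> M" for \<mu> by (intro M_prime) (simp_all add: F.fc_const)
  have zM: "\<zero> \<in> M" by (rule additive_subgroup.zero_closed[OF is_additive_subgroup])
  define \<Lambda> where "\<Lambda> = {\<mu>. -R \<le> \<mu> \<and> \<mu> \<le> R \<and> dn \<mu> \<in> M}"
  have "dn (-R) = F.fc (\<lambda>x. 0)" unfolding dn_def by (rule F.fc_cong) auto
  then have L1: "-R \<in> \<Lambda>" using F.R_pos zM by (simp add: \<Lambda>_def F.fc_const)
  have L2: "bdd_above \<Lambda>" unfolding \<Lambda>_def by (intro bdd_aboveI[of _ R]) simp
  define l where "l = Sup \<Lambda>"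
  have lR: "-R \<le> l" unfolding l_def by (intro cSup_upper L1 L2)
  have "a \<ominus> of_real l \<odot> \<one> \<in> M"
  proof (rule M_topologically_closed)
    fix e :: real assume e: "e > 0"
    have "\<exists>\<mu>\<in>\<Lambda>. l - e < \<mu>" using less_cSup_iff[OF _ L2, of "l - e"] L1 e by (auto simp: l_def)
    then obtain \<mu> where \<mu>: "\<mu> \<in> \<Lambda>" "l - e < \<mu>" by blast
    have \<mu>l: "\<mu> \<le> l" unfolding l_def by (intro cSup_upper \<mu> L2)
    have dM: "dn \<mu> \<in> M" using \<mu> by (simp add: \<Lambda>_def)
    have uM: "up (l + e) \<in> M"
    proof (cases "l + e \<le> R")
      case True
      have "l + e \<notin> \<Lambda>" using cSup_upper[OF _ L2, of "l + e"] e by (auto simp: l_def[symmetric])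
      then show ?thesis using prime[of "l + e"] True lR e by (auto simp: \<Lambda>_def)
    next
      case False
      then have "up (l + e) = F.fc (\<lambda>x. 0)" unfolding up_def by (intro F.fc_cong) auto
      then show ?thesis using zM by (simp add: F.fc_const)
    qed
    let ?f = "\<lambda>x. x - l" let ?m = "\<lambda>x. max 0 (x - (l + e)) - max 0 (\<mu> - x)"
    have "F.fc ?m = up (l + e) \<ominus> dn \<mu>" unfolding up_def dn_def by (intro F.fc_diff co)
    moreover have "F.fc ?f = a \<ominus> of_real l \<odot> \<one>"
      using F.fc_diff[of "\<lambda>x. x" "\<lambda>x. l"] by (simp add: F.fc_const F.fc_id)
    moreover have "cnorm A (F.fc ?f \<ominus> F.fc ?m) \<le> e"
    proof -
      have "F.fc ?f \<ominus> F.fc ?m = F.fc (\<lambda>x. ?f x - ?m x)"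
        by (intro F.fc_diff[symmetric] continuous_intros)
      also have "cnorm A \<dots> \<le> e"
        by (intro F.fc_bound continuous_intros) (use \<mu> \<mu>l e in \<open>auto simp: max_def abs_if\<close>)
      finally show ?thesis .
    qed
    ultimately show "\<exists>m\<in>M. cnorm A (a \<ominus> of_real l \<odot> \<one> \<ominus> m) \<le> e"
      using M_diff[OF uM dM] by auto
  qed simp
  then show thesis by (rule that)
qed

end

definition character :: "'a cstar_algebra => ('a => complex) => bool"
  where "character A \<gamma> \<longleftrightarrow>
    (\<forall>x\<in>carrier A. \<forall>y\<in>carrier A. \<gamma> (x \<oplus>\<^bsub>A\<^esub> y) = \<gamma> x + \<gamma> y) \<and>
    (\<forall>x\<in>carrier A. \<forall>y\<in>carrier A. \<gamma> (x \<otimes>\<^bsub>A\<^esub> y) = \<gamma> x * \<gamma> y) \<and>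
    (\<forall>c. \<forall>x\<in>carrier A. \<gamma> (c \<odot>\<^bsub>A\<^esub> x) = c * \<gamma> x) \<and>
    (\<forall>x\<in>carrier A. \<gamma> (star A x) = cnj (\<gamma> x)) \<and> \<gamma> \<one>\<^bsub>A\<^esub> = 1"

context maximal_ideal_algebra
begin

lemma scalar_unique:
  assumes "x \<ominus> c \<odot> \<one> \<in> M" "x \<ominus> d \<odot> \<one> \<in> M" "x \<in> carrier A" shows "c = d"
proof (rule ccontr)
  assume "c \<noteq> d"
  have "(x \<ominus> d \<odot> \<one>) \<ominus> (x \<ominus> c \<odot> \<one>) = (c - d) \<odot> \<one>"
    using assms(3) by (simp add: scal_diff_left diff_diff_cancel[of x] cs)
  then have "(c - d) \<odot> \<one> \<in> M" using M_diff[OF assms(2,1)] by simp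
  then have "(1 / (c - d)) \<odot> ((c - d) \<odot> \<one>) \<in> M" by (rule M_scal)
  then show False using \<open>c \<noteq> d\<close> one_notin by simp
qed

lemma M_add': "m \<in> M ==> n \<in> M ==> m \<oplus> n \<in> M"
  by (rule a_closed)

text \<open>Every self-adjoint element is a scalar modulo \<open>M\<close>; the cartesian decomposition extends this to all
  elements and shows compatibility with the involution.\<close>

lemma quotient_character:
  obtains \<gamma> where "character A \<gamma>" "!!x. x \<in> carrier A ==> x \<ominus> \<gamma> x \<odot> \<one> \<in> M"
proof -
  have ex: "\<exists>z. x \<ominus> z \<odot> \<one> \<in> M \<and> star A x \<ominus> cnj z \<odot> \<one> \<in> M" if x: "x \<in> carrier A" for x
  proof -
    obtain u v where sa: "self_adjoint A u" "self_adjoint A v" and xe: "x = u \<oplus> \<i> \<odot> v"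
      using cartesian_decomposition[OF x] by metis
    have [simp]: "u \<in> carrier A" "v \<in> carrier A" and su: "star A u = u" and sv: "star A v = v"
      using sa by (auto simp: self_adjoint_def)
    obtain l where l: "u \<ominus> of_real l \<odot> \<one> \<in> M"
      using self_adjoint_scalar_mod[OF sa(1)] by metis
    obtain k where k: "v \<ominus> of_real k \<odot> \<one> \<in> M"
      using self_adjoint_scalar_mod[OF sa(2)] by metis
    have *: "(u \<oplus> c \<odot> v) \<ominus> (complex_of_real l + c * complex_of_real k) \<odot> \<one> \<in> M" for c
    proof -
      have "(u \<oplus> c \<odot> v) \<ominus> (complex_of_real l + c * complex_of_real k) \<odot> \<one> =
          (u \<ominus> of_real l \<odot> \<one>) \<oplus> c \<odot> (v \<ominus> of_real k \<odot> \<one>)"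
        by (simp add: scal_add_left scal_diff_right add_diff_add)
      then show ?thesis using M_add'[OF l M_scal[OF k]] by simp
    qed
    have "star A x = u \<oplus> (- \<i>) \<odot> v" unfolding xe by (simp add: star_simps su sv)
    then show ?thesis
      using *[of \<i>] *[of "- \<i>"] xe by (intro exI[of _ "complex_of_real l + \<i> * complex_of_real k"]) auto
  qed
  have "\<exists>\<gamma>. \<forall>x\<in>carrier A. x \<ominus> \<gamma> x \<odot> \<one> \<in> M \<and> star A x \<ominus> cnj (\<gamma> x) \<odot> \<one> \<in> M"
    by (intro bchoice ballI ex)
  then obtain \<gamma> where \<gamma>: "!!x. x \<in> carrier A ==> x \<ominus> \<gamma> x \<odot> \<one> \<in> M"
    and st: "!!x. x \<in> carrier A ==> star A x \<ominus> cnj (\<gamma> x) \<odot> \<one> \<in> M" by blast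
  have "\<gamma> (x \<oplus> y) = \<gamma> x + \<gamma> y" if [simp]: "x \<in> carrier A" "y \<in> carrier A" for x y
  proof (rule scalar_unique[OF \<gamma>])
    have "(x \<oplus> y) \<ominus> (\<gamma> x + \<gamma> y) \<odot> \<one> = (x \<ominus> \<gamma> x \<odot> \<one>) \<oplus> (y \<ominus> \<gamma> y \<odot> \<one>)"
      by (simp add: scal_add_left add_diff_add)
    then show "(x \<oplus> y) \<ominus> (\<gamma> x + \<gamma> y) \<odot> \<one> \<in> M" by (simp add: M_add' \<gamma>)
  qed auto
  moreover have "\<gamma> (x \<otimes> y) = \<gamma> x * \<gamma> y" if [simp]: "x \<in> carrier A" "y \<in> carrier A" for x y
  proof (rule scalar_unique[OF \<gamma>])
    have "(x \<otimes> y) \<ominus> (\<gamma> x * \<gamma> y) \<odot> \<one> = (x \<otimes> y \<ominus> \<gamma> x \<odot> y) \<oplus> (\<gamma> x \<odot> y \<ominus> (\<gamma> x * \<gamma> y) \<odot> \<one>)"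
      by (simp add: diff_add_diff)
    also have "\<dots> = y \<otimes> (x \<ominus> \<gamma> x \<odot> \<one>) \<oplus> \<gamma> x \<odot> (y \<ominus> \<gamma> y \<odot> \<one>)"
      by (simp add: diff_distr_right smult_mult_right scal_diff_right m_comm[of x y])
    finally show "(x \<otimes> y) \<ominus> (\<gamma> x * \<gamma> y) \<odot> \<one> \<in> M"
      using \<gamma>[of x] \<gamma>[of y] by (simp add: M_add' M_scal I_l_closed)
  qed auto
  moreover have "\<gamma> (c \<odot> x) = c * \<gamma> x" if [simp]: "x \<in> carrier A" for x c
  proof (rule scalar_unique[OF \<gamma>])
    have "c \<odot> x \<ominus> (c * \<gamma> x) \<odot> \<one> = c \<odot> (x \<ominus> \<gamma> x \<odot> \<one>)" by (simp add: scal_diff_right)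
    then show "c \<odot> x \<ominus> (c * \<gamma> x) \<odot> \<one> \<in> M" by (simp add: M_scal \<gamma>)
  qed auto
  moreover have "\<gamma> (star A x) = cnj (\<gamma> x)" if [simp]: "x \<in> carrier A" for x
    by (rule scalar_unique[OF \<gamma> st]) auto
  moreover have "\<gamma> \<one> = 1"
  proof (rule scalar_unique[OF \<gamma>])
    show "\<one> \<ominus> 1 \<odot> \<one> \<in> M" by (simp add: additive_subgroup.zero_closed[OF is_additive_subgroup])
  qed auto
  ultimately have "character A \<gamma>" by (simp add: character_def)
  then show thesis using \<gamma> by (rule that)
qed

end

text \<open>Since \<open>w h < \<kappa>\<close>, the positive part of \<open>h - \<kappa>\<close> is not invertible; a character that kills it
  takes a value at most \<open>\<kappa>\<close> at \<open>h\<close>.\<close>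

lemma (in cstar_state) character_below_state:
  assumes comm: "cring A" and h: "self_adjoint A h" and wh: "Re (w h) < \<kappa>"
  obtains \<gamma> where "character A \<gamma>" "Re (\<gamma> h) \<le> \<kappa>"
proof -
  interpret cring A by (rule comm)
  have [simp]: "h \<in> carrier A" using h by (simp add: self_adjoint_def)
  define R where "R = cnorm A h + 1"
  interpret F: functional_calculus A h R by unfold_locales (use h in \<open>auto simp: R_def\<close>)
  define s where "s = F.fc (\<lambda>x. max 0 (x - \<kappa>))"
  define r where "r = F.fc (\<lambda>x. max 0 (\<kappa> - x))"
  have co: "continuous_on F.spdom (\<lambda>x. max 0 (x - \<kappa>))" "continuous_on F.spdom (\<lambda>x. max 0 (\<kappa> - x))"
    by (intro continuous_intros)+
  have [simp]: "s \<in> carrier A" "r \<in> carrier A" unfolding s_def r_def by (intro F.fc_closed co)+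
  then have sc: "s \<in> carrier A" by blast
  have "s \<ominus> r = F.fc (\<lambda>x. x - \<kappa>)" unfolding s_def r_def F.fc_diff[OF co, symmetric]
    by (rule F.fc_cong) auto
  then have hsr: "s \<ominus> r = h \<ominus> complex_of_real \<kappa> \<odot> \<one>"
    using F.fc_diff[of "\<lambda>x. x" "\<lambda>x. \<kappa>"] by (simp add: F.fc_const F.fc_id)
  have nonunit: "t \<otimes> s \<noteq> \<one>" if t: "t \<in> carrier A" for t
  proof
    assume ts: "t \<otimes> s = \<one>"
    have "s \<otimes> r = F.fc (\<lambda>x. 0)" unfolding s_def r_def F.fc_mult[OF co, symmetric]
      by (rule F.fc_cong) auto
    then have sr: "s \<otimes> r = \<zero>" by (simp add: F.fc_const)
    have "r = (t \<otimes> s) \<otimes> r" by (simp add: ts)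
    also have "\<dots> = t \<otimes> (s \<otimes> r)" using t by (simp add: m_assoc)
    finally have "r = \<zero>" using t by (simp add: sr)
    then have "s = h \<ominus> complex_of_real \<kappa> \<odot> \<one>" using hsr by simp
    then have neg: "Re (w s) < 0" using wh by (simp add: st)
    define q where "q = F.fc (\<lambda>x. sqrt (max 0 (x - \<kappa>)))"
    have cq: "continuous_on F.spdom (\<lambda>x. sqrt (max 0 (x - \<kappa>)))" by (intro continuous_intros)
    have "star A q \<otimes> q = q \<otimes> q" using F.fc_self_adjoint[OF cq] by (simp add: q_def self_adjoint_def)
    also have "\<dots> = s" unfolding q_def s_def F.fc_mult[OF cq cq, symmetric] by (rule F.fc_cong) auto
    finally have "0 \<le> Re (w s)" using st_pos[of q] F.fc_closed[OF cq] by (simp add: q_def)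
    then show False using neg by simp
  qed
  obtain M where M: "maximalideal M A" "s \<in> M"
    by (rule maximal_ideal_containing_nonunit[OF sc nonunit])
  interpret M: maximal_ideal_algebra A M
    by (intro maximal_ideal_algebra.intro unital_cstar_algebra_axioms M comm)
  obtain \<gamma> where \<gamma>: "character A \<gamma>" "!!x. x \<in> carrier A ==> x \<ominus> \<gamma> x \<odot> \<one> \<in> M"
    using M.quotient_character by blast
  have "\<gamma> (star A h) = cnj (\<gamma> h)" using \<gamma>(1) \<open>h \<in> carrier A\<close> unfolding character_def by blast
  then have "\<gamma> h = cnj (\<gamma> h)" using h by (simp add: self_adjoint_def)
  then have real: "\<gamma> h = complex_of_real (Re (\<gamma> h))" by (simp add: complex_eq_iff)
  have "Re (\<gamma> h) \<le> \<kappa>"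
  proof (rule ccontr)
    assume "\<not> Re (\<gamma> h) \<le> \<kappa>"
    define d where "d = Re (\<gamma> h) - \<kappa>"
    have d: "d > 0" using \<open>\<not> Re (\<gamma> h) \<le> \<kappa>\<close> by (simp add: d_def)
    let ?p = "\<lambda>x. max 0 (\<kappa> - x) + d"
    have cp: "continuous_on F.spdom ?p" by (intro continuous_intros)
    have cp': "continuous_on F.spdom (\<lambda>x. 1 / ?p x)"
      using d by (intro continuous_intros) (auto simp: max_def)
    have "F.fc ?p = r \<oplus> of_real d \<odot> \<one>"
      using F.fc_add[OF co(2) continuous_on_const[of _ d]] by (simp add: F.fc_const r_def)
    also have "\<dots> = s \<ominus> (h \<ominus> \<gamma> h \<odot> \<one>)"
    proof -
      have "r = s \<ominus> (h \<ominus> complex_of_real \<kappa> \<odot> \<one>)" unfolding hsr[symmetric] by (simp add: cs)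
      moreover have "\<gamma> h \<odot> \<one> = complex_of_real \<kappa> \<odot> \<one> \<oplus> of_real d \<odot> \<one>"
        unfolding scal_add_left[symmetric, OF one_closed] using real by (simp add: d_def)
      ultimately show ?thesis by (simp add: cs)
    qed
    also have "\<dots> \<in> M" by (rule M.M_diff[OF M(2) \<gamma>(2)]) simp
    finally have "F.fc (\<lambda>x. 1 / ?p x) \<otimes> F.fc ?p \<in> M"
      using F.fc_closed[OF cp'] by (rule M.I_l_closed)
    moreover have "F.fc (\<lambda>x. 1 / ?p x) \<otimes> F.fc ?p = F.fc (\<lambda>x. 1)"
      unfolding F.fc_mult[OF cp' cp, symmetric] using d by (intro F.fc_cong) (auto simp: max_def)
    ultimately show False using M.one_notin by (simp add: F.fc_const)
  qed
  then show thesis using \<gamma>(1) that by blast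
qed

lemma character_scalars_hom:
  assumes "character A \<gamma>" "unital_cstar_algebra B"
  shows "(\<lambda>t. \<gamma> t \<odot>\<^bsub>B\<^esub> \<one>\<^bsub>B\<^esub>) \<in> unital_star_hom A B"
proof -
  interpret unital_cstar_algebra B by fact
  show ?thesis using assms(1)
    by (intro unital_star_homI) (auto simp: character_def scal_add_left smult_mult_left star_smult)
qed

lemma (in unital_cstar_algebra) character_sq_dev:
  assumes \<gamma>: "character A \<gamma>" and S: "finite S" "!!a. a \<in> S ==> self_adjoint A a"
  shows "Re (\<gamma> (sq_dev c S)) = (\<Sum>a\<in>S. (Re (\<gamma> a) - c a)\<^sup>2)"
    and "a \<in> S ==> \<gamma> a = complex_of_real (Re (\<gamma> a))"
proof -
  have \<gamma>0: "\<gamma> \<zero> = 0" using \<gamma> unfolding character_def by (metis mult_zero_left scal_null zero_closed)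
  have diff: "\<gamma> (x \<ominus> c \<odot> \<one>) = \<gamma> x - c" if x: "x \<in> carrier A" for x c
  proof -
    have "x \<ominus> c \<odot> \<one> = x \<oplus> (- c) \<odot> \<one>" using x by (simp add: minus_eq scal_uminus)
    then show ?thesis using x \<gamma> by (simp add: character_def)
  qed
  have Sc: "a \<in> carrier A" if "a \<in> S" for a using S(2)[OF that] by (simp add: self_adjoint_def)
  show real: "\<gamma> a = complex_of_real (Re (\<gamma> a))" if "a \<in> S" for a
  proof -
    have "\<gamma> (star A a) = cnj (\<gamma> a)" using Sc[OF that] \<gamma> by (simp add: character_def)
    then show ?thesis using S(2)[OF that] by (simp add: self_adjoint_def complex_eq_iff)
  qed
  have "Re (\<gamma> (sq_dev c S)) = (\<Sum>a\<in>S. Re (\<gamma> ((a \<ominus> of_real (c a) \<odot> \<one>) \<otimes> (a \<ominus> of_real (c a) \<odot> \<one>))))"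
    unfolding sq_dev_def using S Sc \<gamma> \<gamma>0 by (intro finsum_additive) (auto simp: character_def)
  also have "\<dots> = (\<Sum>a\<in>S. (Re (\<gamma> a) - c a)\<^sup>2)"
  proof (rule sum.cong[OF refl])
    fix a assume a: "a \<in> S"
    have "Im (\<gamma> a) = 0" using real[OF a] by (metis Im_complex_of_real)
    then show "Re (\<gamma> ((a \<ominus> of_real (c a) \<odot> \<one>) \<otimes> (a \<ominus> of_real (c a) \<odot> \<one>))) = (Re (\<gamma> a) - c a)\<^sup>2"
      using Sc[OF a] \<gamma> by (simp add: character_def diff power2_eq_square)
  qed
  finally show "Re (\<gamma> (sq_dev c S)) = (\<Sum>a\<in>S. (Re (\<gamma> a) - c a)\<^sup>2)" .
qed

lemma (in representation) characters_approximate: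
  assumes comm: "cring T" and S: "finite S" "!!a. a \<in> S ==> self_adjoint T a"
    and l: "!!a. a \<in> S ==> loc I \<alpha> A \<rho> (x a) (c a) \<delta>" and \<delta>: "\<delta> > 0"
    and F: "finite F" "!!t. t \<in> F ==> \<exists>u\<in>S. \<exists>v\<in>S. t = u \<oplus> \<i> \<odot> v"
    and \<epsilon>: "2 * ((real (card S) + 2) * \<delta>) \<le> \<epsilon>"
  shows "good \<alpha> A \<rho> T x F \<epsilon>"
proof -
  have Sc: "a \<in> carrier T" if "a \<in> S" for a using S(2)[OF that] by (simp add: self_adjoint_def)
  have "Re (lim_state (T.sq_dev c S)) < real (card S) * \<delta>\<^sup>2 + \<delta>\<^sup>2"
    using state_sq_dev_le[OF S l] zero_less_power[OF \<delta>, of 2] by linarith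
  then obtain \<gamma> where \<gamma>: "character T \<gamma>" "Re (\<gamma> (T.sq_dev c S)) \<le> real (card S) * \<delta>\<^sup>2 + \<delta>\<^sup>2"
    using L.character_below_state[OF comm T.sq_dev_self_adjoint[OF S]] by blast
  have near: "norm2 T lim_state (a \<ominus> \<gamma> a \<odot> \<one>) \<le> (real (card S) + 2) * \<delta>" if a: "a \<in> S" for a
  proof -
    have [simp]: "a \<in> carrier T" using Sc[OF a] .
    have "\<bar>Re (\<gamma> a) - c a\<bar> \<le> (real (card S) + 1) * \<delta>"
      using \<gamma>(2) T.character_sq_dev(1)[OF \<gamma>(1) S] by (intro sum_squares_component_bound[OF S(1) _ a \<delta>]) simp
    moreover have "cmod (complex_of_real (c a) - \<gamma> a) = \<bar>Re (\<gamma> a) - c a\<bar>"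
    proof -
      obtain r where r: "\<gamma> a = complex_of_real r" using T.character_sq_dev(2)[OF \<gamma>(1) S a] by blast
      show ?thesis unfolding r of_real_diff[symmetric] norm_of_real by simp
    qed
    moreover have "norm2 T lim_state (of_real (c a) \<odot> \<one> \<ominus> \<gamma> a \<odot> \<one>) = cmod (complex_of_real (c a) - \<gamma> a)"
      unfolding T.scal_diff_left[OF T.one_closed, symmetric] by (simp add: L.norm2_scal L.norm2_one)
    moreover have "norm2 T lim_state (a \<ominus> \<gamma> a \<odot> \<one>) \<le>
        norm2 T lim_state (a \<ominus> of_real (c a) \<odot> \<one>)
        + norm2 T lim_state (of_real (c a) \<odot> \<one> \<ominus> \<gamma> a \<odot> \<one>)"
      by (intro L.norm2_diff_triangle) auto
    ultimately show ?thesis using norm2_deviation_le[OF Sc[OF a] l[OF a]] by (simp add: algebra_simps)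
  qed
  have lim: "norm2 T lim_state (t \<ominus> \<gamma> t \<odot> \<one>) \<le> \<epsilon>" and tc: "t \<in> carrier T" if t: "t \<in> F" for t
  proof -
    obtain u v where uv: "u \<in> S" "v \<in> S" and te: "t = u \<oplus> \<i> \<odot> v" using F(2)[OF t] by blast
    have [simp]: "u \<in> carrier T" "v \<in> carrier T" using Sc uv by auto
    show "t \<in> carrier T" by (simp add: te)
    have "\<gamma> t = \<gamma> u + \<i> * \<gamma> v" using \<gamma>(1) by (simp add: te character_def)
    then have "t \<ominus> \<gamma> t \<odot> \<one> = (u \<ominus> \<gamma> u \<odot> \<one>) \<oplus> \<i> \<odot> (v \<ominus> \<gamma> v \<odot> \<one>)"
      by (simp add: te T.scal_add_left T.scal_diff_right T.add_diff_add)
    then show "norm2 T lim_state (t \<ominus> \<gamma> t \<odot> \<one>) \<le> \<epsilon>"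
      using L.norm2_triangle[of "u \<ominus> \<gamma> u \<odot> \<one>" "\<i> \<odot> (v \<ominus> \<gamma> v \<odot> \<one>)"]
        near[OF uv(1)] near[OF uv(2)] \<epsilon> by (simp add: L.norm2_scal)
  qed
  show ?thesis
  proof (rule good_by_approximate_homs[where g = "\<lambda>t. \<gamma> t \<odot> \<one>" and \<psi> = "\<lambda>i t. \<gamma> t \<odot>\<^sub>i \<one>\<^sub>i"])
    show "\<forall>\<^sub>F i in \<alpha>. (\<lambda>t. \<gamma> t \<odot>\<^sub>i \<one>\<^sub>i) \<in> unital_star_hom T (A i)"
      by (rule eventually_mono[OF in_I])
        (intro character_scalars_hom[OF \<gamma>(1)] tracial_algebra.axioms(1)[OF fam])
    show "x (\<gamma> t \<odot> \<one>) \<asymp> (\<lambda>i. \<gamma> t \<odot>\<^sub>i \<one>\<^sub>i)" for t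
      by (rule x_scalar)
  qed (use F(1) tc lim in auto)
qed

text \<open>All elements are central. If the real and imaginary parts of the given elements are almost scalar
  in a representation, a character with almost the same values composed with the unit is a model.\<close>

theorem commutative_tracially_stable:
  fixes \<C> :: "'u cstar_algebra set" and T :: "'t cstar_algebra"
  assumes cls: "!!A. A \<in> \<C> ==> unital_cstar_algebra A \<and> real_rank_zero A"
    and corner: "corner_closed \<C>"
    and T: "unital_cstar_algebra T" and sep: "separable_cstar T" and comm: "cring T"
  shows "tracially_stable TYPE('i) \<C> T"
proof (rule tracially_stable_by_local_models[OF cls corner T sep])
  fix F \<epsilon> assume F: "finite F" "F \<subseteq> carrier T" and \<epsilon>: "0 < (\<epsilon> :: real)"
  interpret T: unital_cstar_algebra T by (rule T)
  interpret cring T by (rule comm)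
  have "\<forall>t\<in>F. \<exists>p. self_adjoint T (fst p) \<and> self_adjoint T (snd p) \<and> t = fst p \<oplus>\<^bsub>T\<^esub> \<i> \<odot>\<^bsub>T\<^esub> snd p"
    using F(2) T.cartesian_decomposition by (metis fst_conv snd_conv subsetD)
  then obtain p where p: "!!t. t \<in> F ==> self_adjoint T (fst (p t)) \<and> self_adjoint T (snd (p t)) \<and>
      t = fst (p t) \<oplus>\<^bsub>T\<^esub> \<i> \<odot>\<^bsub>T\<^esub> snd (p t)" by metis
  define S where "S = (\<lambda>t. fst (p t)) ` F \<union> (\<lambda>t. snd (p t)) ` F"
  define \<delta> where "\<delta> = \<epsilon> / (2 * (real (card S) + 2))"
  have S: "finite S" "!!a. a \<in> S ==> self_adjoint T a" using F(1) p by (auto simp: S_def)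
  have Sc: "S \<subseteq> carrier T" using S(2) by (auto simp: self_adjoint_def)
  have \<delta>: "\<delta> > 0" using \<epsilon> by (simp add: \<delta>_def)
  have \<epsilon>\<delta>: "2 * ((real (card S) + 2) * \<delta>) \<le> \<epsilon>" by (simp add: \<delta>_def field_simps)
  have SF: "\<exists>u\<in>S. \<exists>v\<in>S. t = u \<oplus>\<^bsub>T\<^esub> \<i> \<odot>\<^bsub>T\<^esub> v" if "t \<in> F" for t
    using p[OF that] that unfolding S_def by blast
  have base: "good \<alpha> A \<rho> T x F \<epsilon>" if "nontrivial_ultrafilter_on I \<alpha>"
      "\<forall>i\<in>I. A i \<in> \<C> \<and> tracial_state (A i) (\<rho> i)" "asym_hom I \<alpha> A \<rho> T x"
      "\<forall>a\<in>S. loc I \<alpha> A \<rho> (x a) (c a) \<delta>" for I :: "'i set" and \<alpha> A \<rho> x c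
  proof -
    have "family I \<alpha> A \<rho>" using that cls
      by (intro family.intro) (auto simp: tracial_algebra_def tracial_algebra_axioms_def)
    then interpret representation I \<alpha> A \<rho> T x
      by (intro representation.intro representation_axioms.intro T that)
    show ?thesis using that(4) by (intro characters_approximate[OF comm S _ \<delta> F(1) SF \<epsilon>\<delta>]) auto
  qed
  show "\<exists>S \<delta>. finite S \<and> S \<subseteq> carrier T \<and> (\<forall>a\<in>S. self_adjoint T a) \<and>
        (\<forall>a\<in>S. \<forall>t\<in>carrier T. a \<otimes>\<^bsub>T\<^esub> t = t \<otimes>\<^bsub>T\<^esub> a) \<and> 0 < \<delta> \<and>
        (\<forall>(I :: 'i set) \<alpha> A \<rho> x c. nontrivial_ultrafilter_on I \<alpha> --> infinite I -->
          (\<forall>i\<in>I. A i \<in> \<C> \<and> tracial_state (A i) (\<rho> i)) --> asym_hom I \<alpha> A \<rho> T x -->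
          (\<forall>a\<in>S. loc I \<alpha> A \<rho> (x a) (c a) \<delta>) --> good \<alpha> A \<rho> T x F \<epsilon>)"
    using S Sc \<delta> base m_comm by (intro exI[of _ S] exI[of _ \<delta>]) auto
qed

section \<open>Evaluation at a point of the parameter space\<close>

text \<open>Continuous functions enter through arbitrary representatives that are continuous on \<open>K\<close>;
  \<open>ten b f\<close> depends only on the restriction of \<open>f\<close> to \<open>K\<close>.\<close>

locale tensor_with_functions = unital_cstar_algebra T + B: unital_cstar_algebra B
  for T :: "'t cstar_algebra" (structure) and B :: "'b cstar_algebra" +
  fixes K :: "'x :: metric_space set" and j :: "'b => ('x => complex) => 't"
  assumes compact_K: "compact K"
    and tensor: "is_cstar_tensor_product B (continuous_functions K) T j"
begin

definition ten :: "'b => ('x => complex) => 't" where "ten b f = j b (restrict f K)"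
definition el :: "'b => 't" where "el b = ten b (\<lambda>_. 1)"
definition fn :: "('x => complex) => 't" where "fn f = ten \<one>\<^bsub>B\<^esub> f"

lemma restrict_carrier: "continuous_on K f ==> restrict f K \<in> carrier (continuous_functions K)"
  by (simp add: continuous_functions_def)

lemma restrict_add:
    "restrict f K \<oplus>\<^bsub>continuous_functions K\<^esub> restrict g K = restrict (\<lambda>y. f y + g y) K"
  and restrict_mult:
    "restrict f K \<otimes>\<^bsub>continuous_functions K\<^esub> restrict g K = restrict (\<lambda>y. f y * g y) K"
  and restrict_smult: "c \<odot>\<^bsub>continuous_functions K\<^esub> restrict f K = restrict (\<lambda>y. c * f y) K"
  and restrict_star: "star (continuous_functions K) (restrict f K) = restrict (\<lambda>y. cnj (f y)) K"
  and restrict_one: "\<one>\<^bsub>continuous_functions K\<^esub> = restrict (\<lambda>_. 1) K"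
  and restrict_zero: "\<zero>\<^bsub>continuous_functions K\<^esub> = restrict (\<lambda>_. 0) K"
  by (auto simp: continuous_functions_def restrict_def)

lemma ten_j: "f \<in> carrier (continuous_functions K) ==> j b f = ten b f"
  by (simp add: ten_def continuous_functions_def extensional_restrict)

lemma ten_closed [simp]: "[|b \<in> carrier B; continuous_on K f|] ==> ten b f \<in> carrier T"
  using tensor restrict_carrier[of f] by (simp add: is_cstar_tensor_product_def ten_def)

lemma ten_add_left:
  "[|b \<in> carrier B; b' \<in> carrier B; continuous_on K f|] ==> ten (b \<oplus>\<^bsub>B\<^esub> b') f = ten b f \<oplus> ten b' f"
  using tensor restrict_carrier[of f] by (simp add: is_cstar_tensor_product_def ten_def)

lemma ten_add_right:
  "[|b \<in> carrier B; continuous_on K f; continuous_on K g|] ==> ten b (\<lambda>y. f y + g y) = ten b f \<oplus> ten b g"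
  using tensor restrict_carrier[of f] restrict_carrier[of g]
  by (simp add: is_cstar_tensor_product_def ten_def restrict_add[symmetric])

lemma ten_scal_left: "[|b \<in> carrier B; continuous_on K f|] ==> ten (c \<odot>\<^bsub>B\<^esub> b) f = c \<odot> ten b f"
  using tensor restrict_carrier[of f] by (simp add: is_cstar_tensor_product_def ten_def)

lemma ten_scal_right: "[|b \<in> carrier B; continuous_on K f|] ==> ten b (\<lambda>y. c * f y) = c \<odot> ten b f"
  using tensor restrict_carrier[of f]
  by (simp add: is_cstar_tensor_product_def ten_def restrict_smult[symmetric])

lemma ten_mult:
  "[|b \<in> carrier B; b' \<in> carrier B; continuous_on K f; continuous_on K g|]
    ==> ten b f \<otimes> ten b' g = ten (b \<otimes>\<^bsub>B\<^esub> b') (\<lambda>y. f y * g y)"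
  using tensor restrict_carrier[of f] restrict_carrier[of g]
  by (simp add: is_cstar_tensor_product_def ten_def restrict_mult[symmetric])

lemma ten_star: "[|b \<in> carrier B; continuous_on K f|] ==> star T (ten b f) = ten (star B b) (\<lambda>y. cnj (f y))"
  using tensor restrict_carrier[of f]
  by (simp add: is_cstar_tensor_product_def ten_def restrict_star[symmetric])

lemma ten_one: "ten \<one>\<^bsub>B\<^esub> (\<lambda>_. 1) = \<one>"
  using tensor by (simp add: is_cstar_tensor_product_def ten_def restrict_one[symmetric])

lemma ten_cong: "(!!y. y \<in> K ==> f y = g y) ==> ten b f = ten b g"
  unfolding ten_def by (metis restrict_ext)

lemma ten_sums_dense:
  assumes t: "t \<in> carrier T" and e: "e > 0"
  obtains n :: nat and b f where "!!i. i < n ==> b i \<in> carrier B" "!!i. i < n ==> continuous_on K (f i)"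
    "cnorm T (t \<ominus> (\<Oplus>i\<in>{..<n}. ten (b i) (f i))) < e"
proof -
  let ?D = "{\<Oplus>i\<in>{..<n}. j (a i) (b i) | (n :: nat) a b.
    \<forall>i<n. a i \<in> carrier B \<and> b i \<in> carrier (continuous_functions K)}"
  have cl: "norm_topology T closure_of ?D = carrier T" using tensor by (simp add: is_cstar_tensor_product_def)
  have "?D \<subseteq> carrier T"
    using tensor by (auto simp: is_cstar_tensor_product_def intro!: finsum_closed)
  from in_closure_iff[OF this, of t, unfolded cl] t e have "\<exists>y\<in>?D. cnorm T (t \<ominus> y) < e" by blast
  then obtain n :: nat and b f where nbf: "!!i. i < n ==> b i \<in> carrier B"
    "!!i. i < n ==> f i \<in> carrier (continuous_functions K)"
    "cnorm T (t \<ominus> (\<Oplus>i\<in>{..<n}. j (b i) (f i))) < e" by blast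
  have co: "continuous_on K (f i)" if "i < n" for i
    using nbf(2)[OF that] by (simp add: continuous_functions_def)
  have "(\<Oplus>i\<in>{..<n}. j (b i) (f i)) = (\<Oplus>i\<in>{..<n}. ten (b i) (f i))"
    using nbf(1,2) co by (intro finsum_cong') (auto simp: ten_j)
  then show thesis using nbf co by (intro that[of n b f]) auto
qed

text \<open>A nonzero function is a linearly independent family of length one.\<close>

lemma ten_injective:
  assumes b: "b \<in> carrier B" and h: "continuous_on K h" and z: "z \<in> K" "h z \<noteq> 0" and "ten b h = \<zero>"
  shows "b = \<zero>\<^bsub>B\<^esub>"
proof -
  interpret C: abelian_monoid "continuous_functions K"
    by (rule abelian_monoidI)
      (auto simp: continuous_functions_def fun_eq_iff extensional_def intro!: continuous_intros
        split: if_splits cong: continuous_on_cong)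
  have hc: "restrict h K \<in> carrier (continuous_functions K)" by (rule restrict_carrier[OF h])
  have one: "{..<1::nat} = {0}" by auto
  have "lin_indep (continuous_functions K) 1 (\<lambda>_. restrict h K)"
    unfolding lin_indep_def
  proof (intro conjI allI impI)
    fix c :: "nat => complex" and i :: nat
    assume s: "(\<Oplus>\<^bsub>continuous_functions K\<^esub>i\<in>{..<1}. c i \<odot>\<^bsub>continuous_functions K\<^esub> restrict h K)
      = \<zero>\<^bsub>continuous_functions K\<^esub>" and i: "i < 1"
    have "(\<lambda>y. c 0 * h y) \<in> {f. continuous_on K f}" using h by (simp add: continuous_on_mult_left)
    then have "restrict (\<lambda>y. c 0 * h y) K = restrict (\<lambda>_. 0) K"
      using s restrict_carrier[of "\<lambda>y. c 0 * h y"] C.finsum_insert[of "{}" "0::nat" "\<lambda>i. restrict (\<lambda>y. c i * h y) K"]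
      unfolding one by (simp add: restrict_smult restrict_zero restrict_add)
    then have "restrict (\<lambda>y. c 0 * h y) K z = restrict (\<lambda>_. 0) K z" by simp
    then show "c i = 0" using z i by simp
  qed (use hc in simp)
  moreover have "(\<Oplus>i\<in>{..<1::nat}. j b (restrict h K)) = \<zero>"
    using assms(5) unfolding one ten_def by simp
  moreover have "\<forall>(n :: nat) a b. (\<forall>i<n. a i \<in> carrier B) \<and> lin_indep (continuous_functions K) n b \<and>
      (\<Oplus>i\<in>{..<n}. j (a i) (b i)) = \<zero> --> (\<forall>i<n. a i = \<zero>\<^bsub>B\<^esub>)"
    using tensor by (simp add: is_cstar_tensor_product_def)
  ultimately have "\<forall>i<1::nat. b = \<zero>\<^bsub>B\<^esub>"
    using b by (elim allE[of _ 1] allE[of _ "\<lambda>_. b"] allE[of _ "\<lambda>_. restrict h K"]) auto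
  then show ?thesis by auto
qed

lemma el_hom: "el \<in> unital_star_hom B T"
  using ten_mult[of _ _ "\<lambda>_. 1" "\<lambda>_. 1"] ten_star[of _ "\<lambda>_. 1"]
  by (intro unital_star_homI) (auto simp: el_def ten_add_left ten_scal_left ten_one)

lemmas el_simps = unital_star_homD[OF el_hom]

lemma el_closed [simp]: "b \<in> carrier B ==> el b \<in> carrier T"
  by (rule el_simps(1))

lemma el_diff: "[|b \<in> carrier B; b' \<in> carrier B|] ==> el (b \<ominus>\<^bsub>B\<^esub> b') = el b \<ominus> el b'"
  by (rule unital_star_hom_diff[OF B.unital_cstar_algebra_axioms unital_cstar_algebra_axioms el_hom])

lemma el_cnorm: "b \<in> carrier B ==> cnorm T (el b) \<le> cnorm B b"
  by (rule unital_star_hom_contractive[OF B.unital_cstar_algebra_axioms unital_cstar_algebra_axioms el_hom])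

lemma fn_closed [simp]: "continuous_on K f ==> fn f \<in> carrier T"
  by (simp add: fn_def)

lemma fn_mult: "[|continuous_on K f; continuous_on K g|] ==> fn (\<lambda>y. f y * g y) = fn f \<otimes> fn g"
  by (simp add: fn_def ten_mult)

lemma fn_add: "[|continuous_on K f; continuous_on K g|] ==> fn (\<lambda>y. f y + g y) = fn f \<oplus> fn g"
  by (simp add: fn_def ten_add_right)

lemma fn_scal: "continuous_on K f ==> fn (\<lambda>y. c * f y) = c \<odot> fn f"
  by (simp add: fn_def ten_scal_right)

lemma fn_star: "continuous_on K f ==> star T (fn f) = fn (\<lambda>y. cnj (f y))"
  by (simp add: fn_def ten_star)

lemma fn_const: "fn (\<lambda>_. c) = c \<odot> \<one>"
  using fn_scal[of "\<lambda>_. 1" c] by (simp add: fn_def ten_one)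

lemma fn_cong: "(!!y. y \<in> K ==> f y = g y) ==> fn f = fn g"
  unfolding fn_def by (rule ten_cong)

lemma fn_diff:
  assumes "continuous_on K f" "continuous_on K g" shows "fn (\<lambda>y. f y - g y) = fn f \<ominus> fn g"
  using fn_add[OF assms(1) continuous_on_mult_left[OF assms(2), of "-1"]] fn_scal[OF assms(2), of "-1"] assms
  by (simp add: scal_uminus minus_eq)

lemma ten_el_fn: "[|b \<in> carrier B; continuous_on K f|] ==> ten b f = el b \<otimes> fn f"
  unfolding el_def fn_def by (simp add: ten_mult)

text \<open>A real function bounded by \<open>1\<close> is the real part of the unitary function
  \<open>f + \<i> sqrt (1 - f\<^sup>2)\<close>.\<close>

lemma fn_real_cnorm_le_one:
  assumes f: "continuous_on K f" and f1: "!!y. y \<in> K ==> \<bar>f y\<bar> \<le> 1"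
  shows "cnorm T (fn (\<lambda>y. complex_of_real (f y))) \<le> 1"
proof -
  define u where "u = (\<lambda>y. Complex (f y) (sqrt (1 - (f y)\<^sup>2)))"
  have cu: "continuous_on K u" "continuous_on K (\<lambda>y. cnj (u y))"
    unfolding u_def Complex_eq by (intro continuous_intros f)+
  have "star T (fn u) \<otimes> fn u = fn (\<lambda>y. cnj (u y) * u y)" by (simp add: fn_star fn_mult cu)
  also have "\<dots> = fn (\<lambda>y. 1)"
  proof (rule fn_cong)
    fix y assume "y \<in> K"
    then have "(f y)\<^sup>2 \<le> 1" using f1 by (simp add: abs_square_le_1)
    then show "cnj (u y) * u y = 1" by (simp add: u_def complex_eq_iff power2_eq_square[symmetric])
  qed
  finally have "cnorm T (fn u) \<le> 1" by (intro unitary_cnorm_le) (simp_all add: cu fn_const)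
  moreover have "fn (\<lambda>y. complex_of_real (f y)) = (1/2) \<odot> (fn u \<oplus> star T (fn u))"
  proof -
    have "(1/2) \<odot> (fn u \<oplus> star T (fn u)) = fn (\<lambda>y. (1/2) * (u y + cnj (u y)))"
      using cu by (simp add: fn_star fn_add[symmetric] fn_scal[symmetric] continuous_on_add)
    also have "\<dots> = fn (\<lambda>y. complex_of_real (f y))" by (rule fn_cong) (simp add: u_def complex_eq_iff)
    finally show ?thesis by simp
  qed
  ultimately show ?thesis
    using cnorm_triangle[of "fn u" "star T (fn u)"] cu by (simp add: cnorm_smult)
qed

lemma fn_cnorm_le:
  assumes f: "continuous_on K f" and fC: "!!y. y \<in> K ==> cmod (f y) \<le> C" and C: "C > 0"
  shows "cnorm T (fn f) \<le> C"
proof -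
  define g where "g = (\<lambda>y. complex_of_real (1/C) * f y)"
  have cg: "continuous_on K g" unfolding g_def by (intro continuous_intros f)
  have g1: "cmod (g y) \<le> 1" if "y \<in> K" for y using fC[OF that] C by (simp add: g_def norm_mult norm_divide)
  have "(cnorm T (fn g))\<^sup>2 = cnorm T (fn (\<lambda>y. cnj (g y)) \<otimes> fn g)"
    using cg by (simp add: cstar_identity[symmetric] fn_star)
  also have "fn (\<lambda>y. cnj (g y)) \<otimes> fn g = fn (\<lambda>y. complex_of_real ((cmod (g y))\<^sup>2))"
    unfolding fn_mult[OF continuous_on_cnj[OF cg] cg, symmetric]
    by (rule fn_cong) (simp add: complex_norm_square mult.commute del: of_real_power)
  also have "cnorm T \<dots> \<le> 1"
    using g1 cg by (intro fn_real_cnorm_le_one continuous_intros) (auto simp: abs_square_le_1)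
  finally have "cnorm T (fn g) \<le> 1"
    using cnorm_nonneg[of "fn g"] cg by (simp add: abs_square_le_1)
  moreover have "fn f = of_real C \<odot> fn g"
    unfolding fn_scal[OF cg, symmetric] using C by (intro fn_cong) (simp add: g_def)
  ultimately show ?thesis using C cg by (simp add: cnorm_smult)
qed

lemma ten_cnorm_le:
  assumes b: "b \<in> carrier B" and f: "continuous_on K f" and fC: "!!y. y \<in> K ==> cmod (f y) \<le> C" and C: "C > 0"
  shows "cnorm T (ten b f) \<le> cnorm B b * C"
proof -
  have "cnorm T (ten b f) \<le> cnorm T (el b) * cnorm T (fn f)"
    using cnorm_mult[of "el b" "fn f"] b f by (simp add: ten_el_fn)
  also have "\<dots> \<le> cnorm B b * C"
    using b f by (intro mult_mono el_cnorm fn_cnorm_le[OF f fC C] cnorm_nonneg B.cnorm_nonneg) auto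
  finally show ?thesis .
qed

lemma fn_comm_ten: "[|b \<in> carrier B; continuous_on K f; continuous_on K g|] ==> fn g \<otimes> ten b f = ten b f \<otimes> fn g"
  unfolding fn_def by (simp add: ten_mult mult.commute)

lemma fn_comm_finsum:
  assumes g: "continuous_on K g"
    and "!!i. i < n ==> b i \<in> carrier B" "!!i. i < n ==> continuous_on K (f i)"
  shows "fn g \<otimes> (\<Oplus>i\<in>{..<n::nat}. ten (b i) (f i)) = (\<Oplus>i\<in>{..<n}. ten (b i) (f i)) \<otimes> fn g"
  using assms(2,3)
proof (induction n)
  case (Suc n)
  have "(\<Oplus>i\<in>{..<n}. ten (b i) (f i)) \<in> carrier T" using Suc by (intro finsum_closed) auto
  moreover have "(\<Oplus>i\<in>{..<Suc n}. ten (b i) (f i)) = ten (b n) (f n) \<oplus> (\<Oplus>i\<in>{..<n}. ten (b i) (f i))"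
    unfolding lessThan_Suc using Suc by (intro finsum_insert) auto
  ultimately show ?case using Suc g by (simp add: r_distr l_distr fn_comm_ten)
qed (use g in simp)

text \<open>The function commutes with elementary tensors, whose sums are dense.\<close>

lemma fn_central:
  assumes g: "continuous_on K g" and t: "t \<in> carrier T"
  shows "fn g \<otimes> t = t \<otimes> fn g"
proof -
  have gc [simp]: "fn g \<in> carrier T" using g by simp
  have "cnorm T (fn g \<otimes> t \<ominus> t \<otimes> fn g) \<le> 0 + e" if e: "e > 0" for e
  proof -
    define C where "C = cnorm T (fn g) + 1"
    have C: "C > 0" "cnorm T (fn g) \<le> C" using cnorm_nonneg[OF gc] by (auto simp: C_def)
    obtain n :: nat and b f where b: "!!i. i < n ==> b i \<in> carrier B" and f: "!!i. i < n ==> continuous_on K (f i)"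
      and near: "cnorm T (t \<ominus> (\<Oplus>i\<in>{..<n}. ten (b i) (f i))) < e / (2 * C)"
      using ten_sums_dense[OF t, of "e / (2 * C)"] e C by auto
    define s where "s = (\<Oplus>i\<in>{..<n}. ten (b i) (f i))"
    have s: "s \<in> carrier T" unfolding s_def using b f by (intro finsum_closed) auto
    have comm: "fn g \<otimes> s = s \<otimes> fn g" unfolding s_def by (rule fn_comm_finsum[OF g b f])
    have "fn g \<otimes> t \<ominus> t \<otimes> fn g = (fn g \<otimes> t \<ominus> fn g \<otimes> s) \<oplus> (s \<otimes> fn g \<ominus> t \<otimes> fn g)"
      unfolding comm[symmetric] using t s by (simp add: diff_add_diff)
    also have "\<dots> = fn g \<otimes> (t \<ominus> s) \<oplus> (s \<ominus> t) \<otimes> fn g"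
      using t s by (simp add: diff_distr_left diff_distr_right)
    finally have "cnorm T (fn g \<otimes> t \<ominus> t \<otimes> fn g) \<le> cnorm T (fn g) * cnorm T (t \<ominus> s) + cnorm T (s \<ominus> t) * cnorm T (fn g)"
      using cnorm_triangle[of "fn g \<otimes> (t \<ominus> s)" "(s \<ominus> t) \<otimes> fn g"] cnorm_mult[of "fn g" "t \<ominus> s"]
        cnorm_mult[of "s \<ominus> t" "fn g"] t s by simp
    also have "\<dots> = 2 * (cnorm T (fn g) * cnorm T (t \<ominus> s))" using t s by (simp add: cnorm_diff_commute[of s])
    also have "\<dots> \<le> 2 * (C * (e / (2 * C)))"
      using near C t s by (intro mult_left_mono mult_mono cnorm_nonneg) (auto simp: s_def)
    also have "\<dots> = e" using C by simp
    finally show ?thesis by simp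
  qed
  then have "cnorm T (fn g \<otimes> t \<ominus> t \<otimes> fn g) \<le> 0" by (rule field_le_epsilon)
  then show ?thesis
    using cnorm_nonneg[of "fn g \<otimes> t \<ominus> t \<otimes> fn g"] t by (simp add: cnorm_eq_zero_iff diff_eq_zero)
qed

definition bump :: "'x => ('x => complex) => bool"
  where "bump z g \<longleftrightarrow> continuous_on K g \<and> (\<forall>y\<in>K. cmod (g y) \<le> 1) \<and>
    (\<exists>d>0. \<forall>y\<in>K. dist y z < d --> g y = 1)"

lemma bump_cont: "bump z g ==> continuous_on K g"
  by (simp add: bump_def)

lemma bump_cnorm: "bump z g ==> cnorm T (fn g) \<le> 1"
  by (intro fn_cnorm_le) (auto simp: bump_def)

lemma bump_mult: assumes "bump z g" "bump z h" shows "bump z (\<lambda>y. g y * h y)"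
proof -
  obtain d where d: "d > 0" "\<forall>y\<in>K. dist y z < d --> g y = 1" using assms by (auto simp: bump_def)
  obtain d' where d': "d' > 0" "\<forall>y\<in>K. dist y z < d' --> h y = 1" using assms by (auto simp: bump_def)
  have "\<exists>d>0. \<forall>y\<in>K. dist y z < d --> g y * h y = 1"
    using d d' by (intro exI[of _ "min d d'"]) auto
  then show ?thesis using assms
    by (auto simp: bump_def norm_mult intro!: continuous_intros mult_le_one)
qed

lemma bump_exists:
  assumes "r > 0"
  obtains h where "bump z h" "h z = 1" "!!y. dist y z \<ge> r ==> h y = 0"
proof -
  define h where "h = (\<lambda>y. complex_of_real (max 0 (min 1 (2 - 2 * dist y z / r))))"
  have "continuous_on K h" unfolding h_def using assms by (intro continuous_intros) auto
  moreover have "\<exists>d>0. \<forall>y\<in>K. dist y z < d --> h y = 1"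
  proof (intro exI[of _ "r/2"] conjI ballI impI)
    fix y assume "dist y z < r/2"
    then have "2 * dist y z / r \<le> 1" using assms by simp
    then show "h y = 1" by (simp add: h_def)
  qed (use assms in simp)
  ultimately have "bump z h" by (auto simp: bump_def h_def)
  moreover have "h z = 1" by (simp add: h_def)
  moreover have "h y = 0" if "dist y z \<ge> r" for y
  proof -
    have "2 * dist y z / r \<ge> 2" using that assms by (simp add: field_simps)
    then show ?thesis by (simp add: h_def)
  qed
  ultimately show thesis by (rule that)
qed

text \<open>The compression of \<open>el b\<close> to the elements on which \<open>fn g\<close> acts as the identity defines a
  C*-seminorm in \<open>b\<close>. As \<open>g = 1\<close> near \<open>z\<close>, injectivity of the tensor product makes it definite,
  hence it is the norm.\<close>

lemma bump_norm:
  assumes z: "z \<in> K" and g: "bump z g" and b: "b \<in> carrier B"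
  shows "cnorm B b \<le> cnorm T (el b \<otimes> fn g)"
proof -
  note cg = bump_cont[OF g]
  have gc [simp]: "fn g \<in> carrier T" using cg by simp
  define S where "S = {s \<in> carrier T. cnorm T s \<le> 1 \<and> fn g \<otimes> s = s}"
  define M where "M = (\<lambda>b. SUP s\<in>S. cnorm T (el b \<otimes> s))"
  have S0: "\<zero> \<in> S" by (simp add: S_def)
  have bound: "cnorm T (el b \<otimes> s) \<le> cnorm B b" if "b \<in> carrier B" "s \<in> S" for b s
  proof -
    have "cnorm T (el b \<otimes> s) \<le> cnorm T (el b) * cnorm T s" using that by (intro cnorm_mult) (auto simp: S_def)
    also have "\<dots> \<le> cnorm B b * 1"
      using that by (intro mult_mono el_cnorm cnorm_nonneg B.cnorm_nonneg) (auto simp: S_def)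
    finally show ?thesis by simp
  qed
  have bdd: "bdd_above ((\<lambda>s. cnorm T (el b \<otimes> s)) ` S)" if "b \<in> carrier B" for b
    using bound[OF that] by (intro bdd_aboveI2)
  have upper: "cnorm T (el b \<otimes> s) \<le> M b" if "b \<in> carrier B" "s \<in> S" for b s
    unfolding M_def by (intro cSUP_upper bdd that)
  have least: "M b \<le> C" if "!!s. s \<in> S ==> cnorm T (el b \<otimes> s) \<le> C" for b C
    unfolding M_def using S0 that by (intro cSUP_least) auto
  have M0: "0 \<le> M b" if "b \<in> carrier B" for b using upper[OF that S0] that by simp
  have scaled: "cnorm T (el b \<otimes> s) \<le> M b * cnorm T s"
    if b: "b \<in> carrier B" and s: "s \<in> carrier T" "fn g \<otimes> s = s" for b s
  proof (cases "cnorm T s = 0")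
    case True then show ?thesis using s b by (simp add: cnorm_eq_zero_iff)
  next
    case False
    then have pos: "cnorm T s > 0" using cnorm_nonneg[OF s(1)] by simp
    define r where "r = of_real (1 / cnorm T s) \<odot> s"
    have "r \<in> S" using s pos by (simp add: S_def r_def cnorm_smult norm_divide smult_mult_right)
    then have "cnorm T (el b \<otimes> r) \<le> M b" by (intro upper b)
    then show ?thesis using b s pos by (simp add: r_def smult_mult_right cnorm_smult norm_divide field_simps)
  qed
  have "M b = cnorm B b"
  proof (rule B.cstar_seminorm_eq_norm[OF M0 _ _ _ _ b])
    fix x assume x: "x \<in> carrier B"
    show "M x \<le> cnorm B x" by (rule least[OF bound[OF x]])
    show "M (x \<otimes>\<^bsub>B\<^esub> y) \<le> M x * M y" if y: "y \<in> carrier B" for y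
    proof (rule least)
      fix s assume s: "s \<in> S"
      have sc: "s \<in> carrier T" "fn g \<otimes> s = s" using s by (auto simp: S_def)
      have e: "fn g \<otimes> (el y \<otimes> s) = el y \<otimes> s"
      proof -
        have "fn g \<otimes> (el y \<otimes> s) = (fn g \<otimes> el y) \<otimes> s" using y sc(1) by (simp add: m_assoc)
        also have "\<dots> = (el y \<otimes> fn g) \<otimes> s" using y by (simp add: fn_central[OF cg])
        also have "\<dots> = el y \<otimes> s" using y sc by (simp add: m_assoc)
        finally show ?thesis .
      qed
      have "cnorm T (el (x \<otimes>\<^bsub>B\<^esub> y) \<otimes> s) = cnorm T (el x \<otimes> (el y \<otimes> s))"
        using x y sc by (simp add: el_simps m_assoc)
      also have "\<dots> \<le> M x * cnorm T (el y \<otimes> s)" using x y sc e by (intro scaled) auto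
      also have "\<dots> \<le> M x * M y" by (intro mult_left_mono upper y s M0 x)
      finally show "cnorm T (el (x \<otimes>\<^bsub>B\<^esub> y) \<otimes> s) \<le> M x * M y" .
    qed
    show "(M x)\<^sup>2 \<le> M (star B x \<otimes>\<^bsub>B\<^esub> x)"
    proof -
      have xx: "star B x \<otimes>\<^bsub>B\<^esub> x \<in> carrier B" using x by simp
      have "M x \<le> sqrt (M (star B x \<otimes>\<^bsub>B\<^esub> x))"
      proof (rule least)
        fix s assume s: "s \<in> S"
        then have sc: "s \<in> carrier T" "fn g \<otimes> s = s" "cnorm T s \<le> 1" by (auto simp: S_def)
        have "(cnorm T (el x \<otimes> s))\<^sup>2 = cnorm T (star T s \<otimes> (el (star B x \<otimes>\<^bsub>B\<^esub> x) \<otimes> s))"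
          using x sc(1) cstar_identity[of "el x \<otimes> s"] by (simp add: el_simps star_mult m_assoc)
        also have "\<dots> \<le> cnorm T (star T s) * cnorm T (el (star B x \<otimes>\<^bsub>B\<^esub> x) \<otimes> s)"
          using xx sc(1) by (intro cnorm_mult) auto
        also have "\<dots> \<le> 1 * M (star B x \<otimes>\<^bsub>B\<^esub> x)"
          using sc xx s by (intro mult_mono upper cnorm_nonneg) auto
        finally show "cnorm T (el x \<otimes> s) \<le> sqrt (M (star B x \<otimes>\<^bsub>B\<^esub> x))" by (simp add: real_le_rsqrt)
      qed
      then have "(M x)\<^sup>2 \<le> (sqrt (M (star B x \<otimes>\<^bsub>B\<^esub> x)))\<^sup>2" by (rule power_mono) (rule M0[OF x])
      then show ?thesis using M0[OF xx] by simp
    qed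
    assume "M x = 0"
    obtain d where d: "d > 0" "\<forall>y\<in>K. dist y z < d --> g y = 1" using g by (auto simp: bump_def)
    obtain h where h: "bump z h" "h z = 1" "!!y. dist y z \<ge> d ==> h y = 0" using bump_exists[OF d(1)] by metis
    note ch = bump_cont[OF h(1)]
    have "fn g \<otimes> fn h = fn h" unfolding fn_mult[OF cg ch, symmetric]
      by (rule fn_cong) (metis d(2) h(3) mult_1 mult_zero_right not_le)
    then have "fn h \<in> S" using bump_cnorm[OF h(1)] ch by (simp add: S_def)
    then have "cnorm T (el x \<otimes> fn h) \<le> 0" using upper[OF x] \<open>M x = 0\<close> by fastforce
    then have "ten x h = \<zero>"
      using x ch cnorm_nonneg[of "el x \<otimes> fn h"] by (simp add: ten_el_fn cnorm_eq_zero_iff)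
    then show "x = \<zero>\<^bsub>B\<^esub>" using ten_injective[OF x ch z] h(2) by simp
  qed
  moreover have "M b \<le> cnorm T (el b \<otimes> fn g)"
  proof (rule least)
    fix s assume s: "s \<in> S"
    then have sc: "s \<in> carrier T" "fn g \<otimes> s = s" "cnorm T s \<le> 1" by (auto simp: S_def)
    have "el b \<otimes> s = (el b \<otimes> fn g) \<otimes> s" using b sc by (simp add: m_assoc)
    then have "cnorm T (el b \<otimes> s) \<le> cnorm T (el b \<otimes> fn g) * cnorm T s"
      using cnorm_mult[of "el b \<otimes> fn g" s] b sc by simp
    also have "\<dots> \<le> cnorm T (el b \<otimes> fn g)"
      using sc b by (intro mult_left_le cnorm_nonneg) auto
    finally show "cnorm T (el b \<otimes> s) \<le> cnorm T (el b \<otimes> fn g)" .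
  qed
  ultimately show ?thesis by simp
qed

text \<open>\<open>has_value z t b\<close>: near \<open>z\<close>, the element \<open>t\<close> is close to the constant \<open>b\<close>.\<close>

definition has_value :: "'x => 't => 'b => bool"
  where "has_value z t b \<longleftrightarrow> t \<in> carrier T \<and> b \<in> carrier B \<and>
    (\<forall>e>0. \<exists>g. bump z g \<and> cnorm T ((t \<ominus> el b) \<otimes> fn g) < e)"

lemma has_value_closed: "has_value z t b ==> t \<in> carrier T" "has_value z t b ==> b \<in> carrier B"
  by (auto simp: has_value_def)

lemma bump_mult_cnorm_le:
  assumes "s \<in> carrier T" "bump z g" shows "cnorm T (s \<otimes> fn g) \<le> cnorm T s"
  using cnorm_mult[of s "fn g"] mult_left_le[OF bump_cnorm[OF assms(2)] cnorm_nonneg[OF assms(1)]]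
    assms bump_cont[OF assms(2)] by fastforce

lemma has_value_pair:
  assumes s: "has_value z s a" and t: "has_value z t b" and e: "e > 0"
  obtains g where "bump z g" "cnorm T ((s \<ominus> el a) \<otimes> fn g) < e" "cnorm T ((t \<ominus> el b) \<otimes> fn g) < e"
proof -
  obtain g where g: "bump z g" "cnorm T ((s \<ominus> el a) \<otimes> fn g) < e" using s e by (auto simp: has_value_def)
  obtain h where h: "bump z h" "cnorm T ((t \<ominus> el b) \<otimes> fn h) < e" using t e by (auto simp: has_value_def)
  note c [simp] = has_value_closed[OF s] has_value_closed[OF t] bump_cont[OF g(1)] bump_cont[OF h(1)]
  have 1: "fn (\<lambda>y. g y * h y) = fn g \<otimes> fn h" by (rule fn_mult) auto
  have 2: "fn g \<otimes> fn h = fn h \<otimes> fn g" by (rule fn_central) auto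
  have "(s \<ominus> el a) \<otimes> fn (\<lambda>y. g y * h y) = ((s \<ominus> el a) \<otimes> fn g) \<otimes> fn h" unfolding 1 by (simp add: m_assoc)
  then have 3: "cnorm T ((s \<ominus> el a) \<otimes> fn (\<lambda>y. g y * h y)) < e"
    using bump_mult_cnorm_le[OF _ h(1), of "(s \<ominus> el a) \<otimes> fn g"] g(2) by simp
  have "(t \<ominus> el b) \<otimes> fn (\<lambda>y. g y * h y) = ((t \<ominus> el b) \<otimes> fn h) \<otimes> fn g" unfolding 1 2 by (simp add: m_assoc)
  then have 4: "cnorm T ((t \<ominus> el b) \<otimes> fn (\<lambda>y. g y * h y)) < e"
    using bump_mult_cnorm_le[OF _ g(1), of "(t \<ominus> el b) \<otimes> fn h"] h(2) by simp
  show thesis by (rule that[OF bump_mult[OF g(1) h(1)] 3 4])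
qed

text \<open>This bound makes values unique and lets them pass to limits.\<close>

lemma has_value_bound:
  assumes z: "z \<in> K" and t: "has_value z t b" shows "cnorm B b \<le> cnorm T t"
proof (rule field_le_epsilon)
  fix e :: real assume "e > 0"
  then obtain g where g: "bump z g" "cnorm T ((t \<ominus> el b) \<otimes> fn g) < e" using t by (auto simp: has_value_def)
  note [simp] = has_value_closed[OF t] bump_cont[OF g(1)]
  have "cnorm B b \<le> cnorm T (el b \<otimes> fn g)" by (rule bump_norm[OF z g(1)]) simp
  also have "\<dots> \<le> cnorm T (t \<otimes> fn g) + cnorm T (el b \<otimes> fn g \<ominus> t \<otimes> fn g)" by (intro cnorm_le_diff) auto
  also have "cnorm T (el b \<otimes> fn g \<ominus> t \<otimes> fn g) = cnorm T ((t \<ominus> el b) \<otimes> fn g)"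
    by (simp add: diff_distr_left cnorm_diff_commute[of "el b \<otimes> fn g"])
  also have "cnorm T (t \<otimes> fn g) + \<dots> \<le> cnorm T t + e"
    using g(2) bump_mult_cnorm_le[OF _ g(1), of t] by simp
  finally show "cnorm B b \<le> cnorm T t + e" .
qed

lemma has_valueI:
  assumes "t \<in> carrier T" "b \<in> carrier B" and C: "C > 0"
    and "!!e. e > 0 ==> \<exists>g. bump z g \<and> cnorm T ((t \<ominus> el b) \<otimes> fn g) \<le> C * e"
  shows "has_value z t b"
  unfolding has_value_def
proof (intro conjI allI impI assms)
  fix e :: real assume e: "e > 0"
  then obtain g where g: "bump z g" "cnorm T ((t \<ominus> el b) \<otimes> fn g) \<le> C * (e / (2 * C))"
    using assms(4)[of "e / (2 * C)"] C by auto
  then have "cnorm T ((t \<ominus> el b) \<otimes> fn g) < e" using C e by simp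
  then show "\<exists>g. bump z g \<and> cnorm T ((t \<ominus> el b) \<otimes> fn g) < e" using g(1) by blast
qed

lemma has_value_add:
  assumes s: "has_value z s a" and t: "has_value z t b"
  shows "has_value z (s \<oplus> t) (a \<oplus>\<^bsub>B\<^esub> b)"
proof (rule has_valueI[where C = 2])
  note [simp] = has_value_closed[OF s] has_value_closed[OF t]
  show "s \<oplus> t \<in> carrier T" "a \<oplus>\<^bsub>B\<^esub> b \<in> carrier B" by auto
  fix e :: real assume "e > 0"
  from has_value_pair[OF s t this] obtain g where g: "bump z g"
    "cnorm T ((s \<ominus> el a) \<otimes> fn g) < e" "cnorm T ((t \<ominus> el b) \<otimes> fn g) < e" by blast
  have [simp]: "continuous_on K g" by (rule bump_cont[OF g(1)])
  have "(s \<oplus> t) \<ominus> el (a \<oplus>\<^bsub>B\<^esub> b) = (s \<ominus> el a) \<oplus> (t \<ominus> el b)" by (simp add: el_simps add_diff_add)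
  then have "((s \<oplus> t) \<ominus> el (a \<oplus>\<^bsub>B\<^esub> b)) \<otimes> fn g = (s \<ominus> el a) \<otimes> fn g \<oplus> (t \<ominus> el b) \<otimes> fn g"
    by (simp add: l_distr)
  then have "cnorm T (((s \<oplus> t) \<ominus> el (a \<oplus>\<^bsub>B\<^esub> b)) \<otimes> fn g) \<le> 2 * e"
    using cnorm_triangle[of "(s \<ominus> el a) \<otimes> fn g" "(t \<ominus> el b) \<otimes> fn g"] g(2,3) by simp
  then show "\<exists>g. bump z g \<and> cnorm T (((s \<oplus> t) \<ominus> el (a \<oplus>\<^bsub>B\<^esub> b)) \<otimes> fn g) \<le> 2 * e" using g(1) by blast
qed simp

lemma has_value_scal:
  assumes t: "has_value z t b" shows "has_value z (c \<odot> t) (c \<odot>\<^bsub>B\<^esub> b)"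
proof (rule has_valueI[where C = "cmod c + 1"])
  note [simp] = has_value_closed[OF t]
  show "c \<odot> t \<in> carrier T" "c \<odot>\<^bsub>B\<^esub> b \<in> carrier B" by auto
  show "0 < cmod c + 1" using norm_ge_zero[of c] by linarith
  fix e :: real assume e: "e > 0"
  then obtain g where g: "bump z g" "cnorm T ((t \<ominus> el b) \<otimes> fn g) < e" using t by (auto simp: has_value_def)
  have [simp]: "continuous_on K g" by (rule bump_cont[OF g(1)])
  have "c \<odot> t \<ominus> el (c \<odot>\<^bsub>B\<^esub> b) = c \<odot> (t \<ominus> el b)" by (simp add: el_simps scal_diff_right)
  then have "cnorm T ((c \<odot> t \<ominus> el (c \<odot>\<^bsub>B\<^esub> b)) \<otimes> fn g) = cmod c * cnorm T ((t \<ominus> el b) \<otimes> fn g)"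
    by (simp add: smult_mult_left cnorm_smult)
  also have "\<dots> \<le> (cmod c + 1) * e" using g(2) by (intro mult_mono cnorm_nonneg) auto
  finally show "\<exists>g. bump z g \<and> cnorm T ((c \<odot> t \<ominus> el (c \<odot>\<^bsub>B\<^esub> b)) \<otimes> fn g) \<le> (cmod c + 1) * e" using g(1) by blast
qed

lemma has_value_unique:
  assumes z: "z \<in> K" and "has_value z t a" "has_value z t b" shows "a = b"
proof -
  note [simp] = has_value_closed[OF assms(2)] has_value_closed[OF assms(3)]
  have "has_value z (t \<oplus> (-1) \<odot> t) (a \<oplus>\<^bsub>B\<^esub> (-1) \<odot>\<^bsub>B\<^esub> b)" by (intro has_value_add has_value_scal assms)
  then have "has_value z \<zero> (a \<ominus>\<^bsub>B\<^esub> b)" by (simp add: scal_uminus B.scal_uminus r_neg B.minus_eq)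
  from has_value_bound[OF z this] have "cnorm B (a \<ominus>\<^bsub>B\<^esub> b) = 0" using B.cnorm_nonneg[of "a \<ominus>\<^bsub>B\<^esub> b"] by simp
  then show ?thesis by (simp add: B.cnorm_eq_zero_iff B.diff_eq_zero)
qed

lemma has_value_star:
  assumes t: "has_value z t b" shows "has_value z (star T t) (star B b)"
proof (rule has_valueI[where C = 1])
  note [simp] = has_value_closed[OF t]
  show "star T t \<in> carrier T" "star B b \<in> carrier B" by auto
  fix e :: real assume e: "e > 0"
  then obtain g where g: "bump z g" "cnorm T ((t \<ominus> el b) \<otimes> fn g) < e" using t by (auto simp: has_value_def)
  have [simp]: "continuous_on K g" "continuous_on K (\<lambda>y. cnj (g y))"
    using bump_cont[OF g(1)] by (auto intro: continuous_intros)
  have "star T ((t \<ominus> el b) \<otimes> fn g) = fn (\<lambda>y. cnj (g y)) \<otimes> (star T t \<ominus> el (star B b))"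
    by (simp add: star_mult star_diff el_simps fn_star)
  also have "\<dots> = (star T t \<ominus> el (star B b)) \<otimes> fn (\<lambda>y. cnj (g y))" by (intro fn_central) auto
  finally have "cnorm T ((star T t \<ominus> el (star B b)) \<otimes> fn (\<lambda>y. cnj (g y))) = cnorm T ((t \<ominus> el b) \<otimes> fn g)"
    using cnorm_star[of "(t \<ominus> el b) \<otimes> fn g"] by simp
  moreover have "bump z (\<lambda>y. cnj (g y))" using g(1) by (auto simp: bump_def intro!: continuous_intros)
  ultimately show "\<exists>g. bump z g \<and> cnorm T ((star T t \<ominus> el (star B b)) \<otimes> fn g) \<le> 1 * e"
    using g(2) by (intro exI[of _ "\<lambda>y. cnj (g y)"]) simp
qed simp

lemma has_value_mult:
  assumes s: "has_value z s a" and t: "has_value z t b"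
  shows "has_value z (s \<otimes> t) (a \<otimes>\<^bsub>B\<^esub> b)"
proof (rule has_valueI[where C = "cnorm T s + cnorm B b + 1"])
  note [simp] = has_value_closed[OF s] has_value_closed[OF t]
  show "s \<otimes> t \<in> carrier T" "a \<otimes>\<^bsub>B\<^esub> b \<in> carrier B" by auto
  show "0 < cnorm T s + cnorm B b + 1" using cnorm_nonneg[of s] B.cnorm_nonneg[of b] by simp
  fix e :: real assume e: "e > 0"
  from has_value_pair[OF s t this] obtain g where g: "bump z g"
    "cnorm T ((s \<ominus> el a) \<otimes> fn g) < e" "cnorm T ((t \<ominus> el b) \<otimes> fn g) < e" by blast
  have [simp]: "continuous_on K g" by (rule bump_cont[OF g(1)])
  have "s \<otimes> t \<ominus> el (a \<otimes>\<^bsub>B\<^esub> b) = s \<otimes> (t \<ominus> el b) \<oplus> (s \<ominus> el a) \<otimes> el b"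
    by (simp add: el_simps diff_distr_left diff_distr_right diff_add_diff)
  then have "(s \<otimes> t \<ominus> el (a \<otimes>\<^bsub>B\<^esub> b)) \<otimes> fn g = s \<otimes> ((t \<ominus> el b) \<otimes> fn g) \<oplus> (s \<ominus> el a) \<otimes> (el b \<otimes> fn g)"
    by (simp add: l_distr m_assoc)
  also have "el b \<otimes> fn g = fn g \<otimes> el b" by (simp add: fn_central)
  also have "(s \<ominus> el a) \<otimes> (fn g \<otimes> el b) = ((s \<ominus> el a) \<otimes> fn g) \<otimes> el b" by (simp add: m_assoc)
  finally have "cnorm T ((s \<otimes> t \<ominus> el (a \<otimes>\<^bsub>B\<^esub> b)) \<otimes> fn g) \<le>
      cnorm T s * cnorm T ((t \<ominus> el b) \<otimes> fn g) + cnorm T ((s \<ominus> el a) \<otimes> fn g) * cnorm T (el b)"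
    using cnorm_triangle[of "s \<otimes> ((t \<ominus> el b) \<otimes> fn g)" "((s \<ominus> el a) \<otimes> fn g) \<otimes> el b"]
      cnorm_mult[of s "(t \<ominus> el b) \<otimes> fn g"] cnorm_mult[of "(s \<ominus> el a) \<otimes> fn g" "el b"] by simp
  also have "\<dots> \<le> cnorm T s * e + e * cnorm B b"
    using g(2,3) e by (intro add_mono mult_mono el_cnorm cnorm_nonneg) auto
  also have "\<dots> \<le> (cnorm T s + cnorm B b + 1) * e" using e by (simp add: algebra_simps)
  finally show "\<exists>g. bump z g \<and> cnorm T ((s \<otimes> t \<ominus> el (a \<otimes>\<^bsub>B\<^esub> b)) \<otimes> fn g) \<le> (cnorm T s + cnorm B b + 1) * e"
    using g(1) by blast
qed

lemma has_value_ten: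
  assumes z: "z \<in> K" and b: "b \<in> carrier B" and f: "continuous_on K f"
  shows "has_value z (ten b f) (f z \<odot>\<^bsub>B\<^esub> b)"
proof (rule has_valueI[where C = "cnorm B b + 1"])
  show "ten b f \<in> carrier T" "f z \<odot>\<^bsub>B\<^esub> b \<in> carrier B" using b f by auto
  show "0 < cnorm B b + 1" using B.cnorm_nonneg[OF b] by simp
  fix e :: real assume e: "e > 0"
  from f[unfolded continuous_on_iff, rule_format, OF z e]
  obtain d where d: "d > 0" "!!y. y \<in> K ==> dist y z < d ==> dist (f y) (f z) < e" by blast
  obtain g where g: "bump z g" "g z = 1" "!!y. dist y z \<ge> d ==> g y = 0" using bump_exists[OF d(1)] by metis
  note [simp] = bump_cont[OF g(1)] b f
  have cd: "continuous_on K (\<lambda>y. f y - f z)" by (intro continuous_intros f)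
  have "ten b f \<ominus> el (f z \<odot>\<^bsub>B\<^esub> b) = el b \<otimes> (fn f \<ominus> fn (\<lambda>_. f z))"
    by (simp add: ten_el_fn el_simps diff_distr_right fn_const smult_mult_right)
  also have "\<dots> = el b \<otimes> fn (\<lambda>y. f y - f z)" by (simp add: fn_diff)
  finally have "(ten b f \<ominus> el (f z \<odot>\<^bsub>B\<^esub> b)) \<otimes> fn g = ten b (\<lambda>y. (f y - f z) * g y)"
    using cd by (simp add: m_assoc fn_mult[symmetric] ten_el_fn continuous_on_mult)
  moreover have "cnorm T (ten b (\<lambda>y. (f y - f z) * g y)) \<le> cnorm B b * e"
  proof (rule ten_cnorm_le[OF b _ _ e])
    show "continuous_on K (\<lambda>y. (f y - f z) * g y)" using cd by (intro continuous_on_mult) auto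
    fix y assume y: "y \<in> K"
    show "cmod ((f y - f z) * g y) \<le> e"
    proof (cases "dist y z < d")
      case True
      then have "cmod (f y - f z) * cmod (g y) \<le> e * 1"
        using d(2)[OF y True] g(1) y e by (intro mult_mono) (auto simp: bump_def dist_norm)
      then show ?thesis by (simp add: norm_mult)
    next
      case False then show ?thesis using g(3)[of y] e by simp
    qed
  qed
  moreover have "cnorm B b * e \<le> (cnorm B b + 1) * e" using e by (simp add: algebra_simps)
  ultimately show "\<exists>g. bump z g \<and> cnorm T ((ten b f \<ominus> el (f z \<odot>\<^bsub>B\<^esub> b)) \<otimes> fn g) \<le> (cnorm B b + 1) * e"
    using g(1) by (intro exI[of _ g]) simp
qed

lemma has_value_el: "[|z \<in> K; b \<in> carrier B|] ==> has_value z (el b) b"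
  using has_value_ten[of z b "\<lambda>_. 1"] by (simp add: el_def)

lemma has_value_finsum:
  assumes z: "z \<in> K" and "!!i. i < n ==> b i \<in> carrier B" "!!i. i < n ==> continuous_on K (f i)"
  shows "\<exists>a. has_value z (\<Oplus>i\<in>{..<n::nat}. ten (b i) (f i)) a"
  using assms(2,3)
proof (induction n)
  case 0
  have "has_value z (el \<zero>\<^bsub>B\<^esub>) \<zero>\<^bsub>B\<^esub>" by (intro has_value_el z) simp
  moreover have "el \<zero>\<^bsub>B\<^esub> = \<zero>" using el_simps(5)[of "\<zero>\<^bsub>B\<^esub>" 0] by simp
  ultimately show ?case by auto
next
  case (Suc n)
  have "(\<Oplus>i\<in>{..<Suc n}. ten (b i) (f i)) = ten (b n) (f n) \<oplus> (\<Oplus>i\<in>{..<n}. ten (b i) (f i))"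
    unfolding lessThan_Suc using Suc by (intro finsum_insert) auto
  moreover obtain a where "has_value z (\<Oplus>i\<in>{..<n}. ten (b i) (f i)) a" using Suc by auto
  ultimately show ?case
    using has_value_add[OF has_value_ten[OF z, of "b n" "f n"]] Suc.prems by auto
qed

text \<open>Sums of elementary tensors have values; along an approximating sequence of them the values form a
  Cauchy sequence in \<open>B\<close>.\<close>

lemma has_value_exists:
  assumes z: "z \<in> K" and t: "t \<in> carrier T" shows "\<exists>b. has_value z t b"
proof -
  have "\<exists>s b. has_value z s b \<and> cnorm T (t \<ominus> s) < 1 / real (Suc n)" for n
    using ten_sums_dense[OF t, of "1 / real (Suc n)"] has_value_finsum[OF z] by (metis of_nat_0_less_iff zero_less_Suc zero_less_divide_1_iff)
  then obtain s b where sb: "!!n. has_value z (s n) (b n)" and near: "!!n. cnorm T (t \<ominus> s n) < 1 / real (Suc n)"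
    by metis
  note [simp] = has_value_closed[OF sb] t
  have diff: "cnorm B (b m \<ominus>\<^bsub>B\<^esub> b n) \<le> 1 / real (Suc m) + 1 / real (Suc n)" for m n
  proof -
    have "has_value z (s m \<oplus> (-1) \<odot> s n) (b m \<oplus>\<^bsub>B\<^esub> (-1) \<odot>\<^bsub>B\<^esub> b n)" by (intro has_value_add has_value_scal sb)
    then have "has_value z (s m \<ominus> s n) (b m \<ominus>\<^bsub>B\<^esub> b n)" by (simp add: scal_uminus B.scal_uminus minus_eq B.minus_eq)
    from has_value_bound[OF z this] have "cnorm B (b m \<ominus>\<^bsub>B\<^esub> b n) \<le> cnorm T (s m \<ominus> t) + cnorm T (t \<ominus> s n)"
      using cnorm_diff_triangle[of "s m" t "s n"] by simp
    then show ?thesis using near[of m] near[of n] by (simp add: cnorm_diff_commute[of "s m"])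
  qed
  have cau: "\<exists>N. \<forall>m\<ge>N. \<forall>n\<ge>N. cnorm B (b m \<ominus>\<^bsub>B\<^esub> b n) < e" if e: "e > 0" for e
  proof -
    obtain N :: nat where N: "1 / real (Suc N) < e/2" using nat_approx_posE[of "e/2"] e by auto
    have le: "1 / real (Suc n) \<le> 1 / real (Suc N)" if "n \<ge> N" for n using that by (simp add: frac_le)
    have "cnorm B (b m \<ominus>\<^bsub>B\<^esub> b n) < e" if "m \<ge> N" "n \<ge> N" for m n
      using diff[of m n] le[OF that(1)] le[OF that(2)] N by linarith
    then show ?thesis by blast
  qed
  obtain l where l [simp]: "l \<in> carrier B" and lim: "(\<lambda>n. cnorm B (b n \<ominus>\<^bsub>B\<^esub> l)) \<longlonglongrightarrow> 0"
    by (rule B.Cauchy_limit[OF has_value_closed(2)[OF sb] cau])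
  have "has_value z t l"
  proof (rule has_valueI[where C = 3])
    fix e :: real assume e: "e > 0"
    obtain N where N: "!!n. n \<ge> N ==> cnorm B (b n \<ominus>\<^bsub>B\<^esub> l) < e"
      using order_tendstoD(2)[OF lim e] by (auto simp: eventually_sequentially)
    obtain M :: nat where M: "1 / real (Suc M) < e" using nat_approx_posE[OF e] by auto
    define n where "n = max M N"
    have n1: "cnorm B (b n \<ominus>\<^bsub>B\<^esub> l) < e" by (rule N) (simp add: n_def)
    have "1 / real (Suc n) \<le> 1 / real (Suc M)" by (intro frac_le) (auto simp: n_def)
    then have n2: "cnorm T (t \<ominus> s n) < e" using near[of n] M by linarith
    obtain g where g: "bump z g" "cnorm T ((s n \<ominus> el (b n)) \<otimes> fn g) < e" using sb[of n] e by (auto simp: has_value_def)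
    have [simp]: "continuous_on K g" by (rule bump_cont[OF g(1)])
    have "t \<ominus> el l = (t \<ominus> s n) \<oplus> ((s n \<ominus> el (b n)) \<oplus> (el (b n) \<ominus> el l))" by (simp add: diff_add_diff)
    then have "(t \<ominus> el l) \<otimes> fn g = (t \<ominus> s n) \<otimes> fn g \<oplus> ((s n \<ominus> el (b n)) \<otimes> fn g \<oplus> (el (b n) \<ominus> el l) \<otimes> fn g)"
      by (simp add: l_distr)
    then have "cnorm T ((t \<ominus> el l) \<otimes> fn g) \<le> cnorm T ((t \<ominus> s n) \<otimes> fn g) +
        (cnorm T ((s n \<ominus> el (b n)) \<otimes> fn g) + cnorm T ((el (b n) \<ominus> el l) \<otimes> fn g))"
      using cnorm_triangle[of "(t \<ominus> s n) \<otimes> fn g" "(s n \<ominus> el (b n)) \<otimes> fn g \<oplus> (el (b n) \<ominus> el l) \<otimes> fn g"]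
        cnorm_triangle[of "(s n \<ominus> el (b n)) \<otimes> fn g" "(el (b n) \<ominus> el l) \<otimes> fn g"] by simp
    also have "\<dots> \<le> e + (e + e)"
      using n1 n2 g(2) bump_mult_cnorm_le[OF _ g(1), of "t \<ominus> s n"] bump_mult_cnorm_le[OF _ g(1), of "el (b n) \<ominus> el l"]
        el_cnorm[of "b n \<ominus>\<^bsub>B\<^esub> l"] by (simp add: el_diff)
    finally show "\<exists>g. bump z g \<and> cnorm T ((t \<ominus> el l) \<otimes> fn g) \<le> 3 * e" using g(1) by (intro exI[of _ g]) simp
  qed auto
  then show ?thesis ..
qed

definition ev :: "'x => 't => 'b" where "ev z t = (THE b. has_value z t b)"

lemma ev_eqI: "z \<in> K ==> has_value z t b ==> ev z t = b"
  unfolding ev_def using has_value_unique by blast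

lemma has_value_ev: "z \<in> K ==> t \<in> carrier T ==> has_value z t (ev z t)"
  using has_value_exists ev_eqI by metis

lemma ev_hom: assumes z: "z \<in> K" shows "ev z \<in> unital_star_hom T B"
proof (rule unital_star_homI)
  show "ev z \<one> = \<one>\<^bsub>B\<^esub>" using has_value_el[OF z B.one_closed] by (intro ev_eqI z) (simp add: el_simps)
qed (auto intro!: ev_eqI z has_value_add has_value_mult has_value_scal has_value_star has_value_ev
    has_value_closed(2)[OF has_value_ev])

lemma ev_ten: "[|z \<in> K; b \<in> carrier B; continuous_on K f|] ==> ev z (ten b f) = f z \<odot>\<^bsub>B\<^esub> b"
  by (intro ev_eqI has_value_ten)

end

section \<open>Separability of the tensor product\<close>

text \<open>Normalized tents on a net of mesh \<open>d\<close> form a partition of unity; \<open>\<Sum>\<^sub>x f(x) p\<^sub>x\<close> differs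
  from \<open>f\<close> at most by its oscillation on balls of radius \<open>d\<close>.\<close>

definition tent_net :: "'x :: metric_space set => real => 'x => 'x => real"
  where "tent_net N d x y = max 0 (d - dist y x) / (\<Sum>x'\<in>N. max 0 (d - dist y x'))"

lemma tent_net_partition:
  assumes N: "finite N" and cover: "!!y. y \<in> K ==> \<exists>x\<in>N. dist y x < d"
  shows "x \<in> N ==> continuous_on K (tent_net N d x)"
    and "y \<in> K ==> 0 \<le> tent_net N d x y"
    and "y \<in> K ==> (\<Sum>x\<in>N. tent_net N d x y) = 1"
    and "dist y x \<ge> d ==> tent_net N d x y = 0"
proof -
  have pos: "(\<Sum>x'\<in>N. max 0 (d - dist y x')) > 0" if y: "y \<in> K" for y
  proof -
    obtain x where x: "x \<in> N" "dist y x < d" using cover[OF y] by blast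
    then show ?thesis by (intro sum_pos2[OF N x(1)]) auto
  qed
  show "continuous_on K (tent_net N d x)" if "x \<in> N"
    unfolding tent_net_def using pos by (intro continuous_intros) (metis less_irrefl)
  show "0 \<le> tent_net N d x y" if "y \<in> K" using pos[OF that] by (simp add: tent_net_def)
  show "(\<Sum>x\<in>N. tent_net N d x y) = 1" if "y \<in> K"
    using pos[OF that] by (simp add: tent_net_def sum_divide_distrib[symmetric])
  show "tent_net N d x y = 0" if "dist y x \<ge> d" using that by (simp add: tent_net_def)
qed

lemma compact_countable_partitions:
  fixes K :: "'x :: metric_space set"
  assumes K: "compact K"
  obtains \<Psi> :: "('x => complex) set" where "countable \<Psi>"
    "\<forall>p\<in>\<Psi>. continuous_on K p" "\<forall>p\<in>\<Psi>. \<forall>y\<in>K. cmod (p y) \<le> 1"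
    "\<forall>f e. continuous_on K f --> e > 0 -->
      (\<exists>N p c. finite N \<and> (\<forall>x\<in>N. p x \<in> \<Psi>) \<and> (\<forall>y\<in>K. cmod (f y - (\<Sum>x\<in>(N :: 'x set). c x * p x y)) \<le> e))"
proof -
  have "\<exists>N. finite N \<and> N \<subseteq> K \<and> K \<subseteq> (\<Union>x\<in>N. ball x (1 / real (Suc n)))" for n
    using seq_compact_imp_totally_bounded[OF compact_imp_seq_compact[OF K]] by simp
  then obtain N where N: "!!n. finite (N n)" "!!n. N n \<subseteq> K"
    and cov: "!!n. K \<subseteq> (\<Union>x\<in>N n. ball x (1 / real (Suc n)))" by metis
  let ?d = "\<lambda>n. 1 / real (Suc n)"
  define p where "p = (\<lambda>n x y. complex_of_real (tent_net (N n) (?d n) x y))"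
  have cover: "\<exists>x\<in>N n. dist y x < ?d n" if y: "y \<in> K" for y n
  proof -
    obtain x where "x \<in> N n" "dist x y < ?d n" using subsetD[OF cov[of n] y] by auto
    then show ?thesis by (metis dist_commute)
  qed
  note part = tent_net_partition[OF N(1) cover]
  show thesis
  proof (rule that[of "\<Union>n. p n ` N n"]; (intro ballI allI impI)?)
    show "countable (\<Union>n. p n ` N n)" using N(1) by (intro countable_UN) (auto intro: countable_finite)
    show "continuous_on K q" if "q \<in> (\<Union>n. p n ` N n)" for q
      using that part(1) by (auto simp: p_def intro!: continuous_on_of_real)
    show "cmod (q y) \<le> 1" if qy: "q \<in> (\<Union>n. p n ` N n)" "y \<in> K" for q y
    proof -
      obtain n x where x: "x \<in> N n" "q = p n x" using qy(1) by blast
      have "tent_net (N n) (?d n) x y \<le> (\<Sum>x\<in>N n. tent_net (N n) (?d n) x y)"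
        using part(2)[OF _ qy(2)] x N by (intro member_le_sum) auto
      also have "\<dots> = 1" using part(3)[OF _ qy(2)] qy(2) by auto
      finally show ?thesis using part(2)[OF _ qy(2), of n x] qy(2) by (simp add: x p_def)
    qed
    fix f :: "'x => complex" and e :: real assume f: "continuous_on K f" and e: "e > 0"
    obtain d where d: "d > 0" "!!x y. x \<in> K ==> y \<in> K ==> dist y x < d ==> dist (f y) (f x) < e"
      using compact_uniformly_continuous[OF f K, unfolded uniformly_continuous_on_def] e by meson
    obtain n :: nat where n: "?d n < d" using nat_approx_posE[OF d(1)] by auto
    have fin: "cmod (f y - (\<Sum>x\<in>N n. f x * p n x y)) \<le> e" if y: "y \<in> K" for y
    proof -
      have "f y = f y * complex_of_real (\<Sum>x\<in>N n. tent_net (N n) (?d n) x y)"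
        using part(3)[OF _ y] y by simp
      then have "f y - (\<Sum>x\<in>N n. f x * p n x y) = (\<Sum>x\<in>N n. (f y - f x) * p n x y)"
        by (simp add: sum_distrib_left sum_subtractf left_diff_distrib p_def)
      also have "cmod \<dots> \<le> (\<Sum>x\<in>N n. e * tent_net (N n) (?d n) x y)"
      proof (rule sum_norm_le)
        fix x assume x: "x \<in> N n"
        have t0: "0 \<le> tent_net (N n) (?d n) x y" using part(2)[OF _ y] y by auto
        show "cmod ((f y - f x) * p n x y) \<le> e * tent_net (N n) (?d n) x y"
        proof (cases "dist y x < ?d n")
          case True
          then have "cmod (f y - f x) \<le> e" using d(2)[of x y] N(2)[of n] x y n by (auto simp: dist_norm)
          then show ?thesis using t0 by (simp add: norm_mult p_def mult_right_mono)
        next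
          case False
          then have "tent_net (N n) (?d n) x y = 0" by (simp add: tent_net_def)
          then show ?thesis by (simp add: p_def)
        qed
      qed
      also have "\<dots> = e" using part(3)[OF _ y] y by (simp add: sum_distrib_left[symmetric])
      finally show ?thesis .
    qed
    show "\<exists>Y q c. finite Y \<and> (\<forall>x\<in>Y. q x \<in> (\<Union>n. p n ` N n)) \<and>
        (\<forall>y\<in>K. cmod (f y - (\<Sum>x\<in>(Y :: 'x set). c x * q x y)) \<le> e)"
      by (intro exI[of _ "N n"] exI[of _ "p n"] exI[of _ f] conjI ballI N(1) fin) blast+
  qed
qed

context tensor_with_functions
begin

text \<open>The countable set consists of finite sums of tensors of members of a dense sequence in \<open>B\<close> with
  members of countably many partitions of unity.\<close>

lemma separable_tensor:
  assumes sep: "separable_cstar B" shows "separable_cstar T"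
proof -
  obtain d where d: "!!k :: nat. d k \<in> carrier B"
    and dense: "!!b e. b \<in> carrier B ==> e > 0 ==> \<exists>k. cnorm B (b \<ominus>\<^bsub>B\<^esub> d k) < e"
    using separable_sequence[OF B.unital_cstar_algebra_axioms sep] by blast
  obtain \<Psi> where \<Psi>: "countable \<Psi>" and pc0: "\<forall>p\<in>\<Psi>. continuous_on K p"
    and p10: "\<forall>p\<in>\<Psi>. \<forall>y\<in>K. cmod (p y) \<le> 1"
    and papp: "\<forall>f e. continuous_on K f --> e > 0 -->
      (\<exists>N p c. finite N \<and> (\<forall>x\<in>N. p x \<in> \<Psi>) \<and> (\<forall>y\<in>K. cmod (f y - (\<Sum>x\<in>(N :: 'x set). c x * p x y)) \<le> e))"
    by (rule compact_countable_partitions[OF compact_K])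
  have pc: "!!p. p \<in> \<Psi> ==> continuous_on K p"
    and p1: "!!p y. p \<in> \<Psi> ==> y \<in> K ==> cmod (p y) \<le> 1" using pc0 p10 by blast+
  \<comment> \<open>recursion on lists makes the set of sums closed under addition by concatenation\<close>
  define tsum where "tsum = (\<lambda>ks. foldr (\<lambda>kp t. ten (d (fst kp)) (snd kp) \<oplus> t) ks \<zero>)"
  have tsum_simps: "tsum [] = \<zero>" "tsum (kp # ks) = ten (d (fst kp)) (snd kp) \<oplus> tsum ks" for kp ks
    by (auto simp: tsum_def)
  let ?L = "lists (UNIV \<times> \<Psi>)"
  have tc [simp]: "ks \<in> ?L ==> tsum ks \<in> carrier T" for ks
    by (induction ks) (auto simp: tsum_simps d pc)
  have tapp: "tsum (ks @ ls) = tsum ks \<oplus> tsum ls" if "ks \<in> ?L" and ls: "ls \<in> ?L" for ks ls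
    using that(1)
  proof (induction ks)
    case (Cons kp ks)
    have "ten (d (fst kp)) (snd kp) \<in> carrier T" using Cons by (auto simp: d pc)
    then show ?case using Cons tc[of ks] tc[OF ls] by (simp add: tsum_simps a_assoc)
  qed (use tc[OF ls] in \<open>simp add: tsum_simps\<close>)
  define near where "near = (\<lambda>t. t \<in> carrier T \<and> (\<forall>e>0. \<exists>ks\<in>?L. cnorm T (t \<ominus> tsum ks) < e))"
  have near_add: "near (s \<oplus> t)" if st: "near s" "near t" for s t
    unfolding near_def
  proof (intro conjI allI impI)
    have c [simp]: "s \<in> carrier T" "t \<in> carrier T" using st by (auto simp: near_def)
    show "s \<oplus> t \<in> carrier T" by simp
    fix e :: real assume "e > 0"
    then have e2: "e/2 > 0" by simp
    obtain ks where ks: "ks \<in> ?L" "cnorm T (s \<ominus> tsum ks) < e/2" using st(1) e2 unfolding near_def by blast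
    obtain ls where ls: "ls \<in> ?L" "cnorm T (t \<ominus> tsum ls) < e/2" using st(2) e2 unfolding near_def by blast
    note [simp] = tc[OF ks(1)] tc[OF ls(1)]
    have "(s \<oplus> t) \<ominus> tsum (ks @ ls) = (s \<ominus> tsum ks) \<oplus> (t \<ominus> tsum ls)"
      unfolding tapp[OF ks(1) ls(1)] by (intro add_diff_add) auto
    then have "cnorm T ((s \<oplus> t) \<ominus> tsum (ks @ ls)) < e"
      using cnorm_triangle[of "s \<ominus> tsum ks" "t \<ominus> tsum ls"] ks(2) ls(2) by simp
    moreover have "ks @ ls \<in> ?L" using ks(1) ls(1) by simp
    ultimately show "\<exists>ks\<in>?L. cnorm T ((s \<oplus> t) \<ominus> tsum ks) < e" by blast
  qed
  have near_lim: "near t" if t: "t \<in> carrier T" and l: "!!e. e > 0 ==> \<exists>s. near s \<and> cnorm T (t \<ominus> s) \<le> e" for t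
    unfolding near_def
  proof (intro conjI allI impI t)
    fix e :: real assume "e > 0"
    then obtain s where s: "near s" "cnorm T (t \<ominus> s) \<le> e/2" using l[of "e/2"] by auto
    then have sc: "s \<in> carrier T" by (simp add: near_def)
    obtain ks where ks: "ks \<in> ?L" "cnorm T (s \<ominus> tsum ks) < e/2"
      using s(1) half_gt_zero[OF \<open>e > 0\<close>] unfolding near_def by blast
    have "cnorm T (t \<ominus> tsum ks) < e"
      using cnorm_diff_triangle[OF t sc tc[OF ks(1)]] s(2) ks(2) by simp
    then show "\<exists>ks\<in>?L. cnorm T (t \<ominus> tsum ks) < e" using ks(1) by blast
  qed
  have near_zero: "near \<zero>"
    unfolding near_def using tsum_simps(1) by (auto intro!: bexI[of _ "[]"])
  have near_gen: "near (ten b p)" if b: "b \<in> carrier B" and p: "p \<in> \<Psi>" for b p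
    unfolding near_def
  proof (intro conjI allI impI)
    show "ten b p \<in> carrier T" using b pc[OF p] by simp
    fix e :: real assume "e > 0"
    then obtain k where k: "cnorm B (b \<ominus>\<^bsub>B\<^esub> d k) < e" using dense[OF b] by blast
    have s: "b \<ominus>\<^bsub>B\<^esub> d k \<in> carrier B" using b d by simp
    have "ten b p \<ominus> tsum [(k, p)] = ten (b \<ominus>\<^bsub>B\<^esub> d k) p"
      using b d[of k] pc[OF p] by (simp add: tsum_simps ten_el_fn el_diff diff_distr_left)
    also have "cnorm T \<dots> \<le> cnorm B (b \<ominus>\<^bsub>B\<^esub> d k) * 1" by (rule ten_cnorm_le[OF s pc[OF p] p1[OF p]]) auto
    finally have "cnorm T (ten b p \<ominus> tsum [(k, p)]) < e" using k by simp
    moreover have "[(k, p)] \<in> ?L" using p by simp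
    ultimately show "\<exists>ks\<in>?L. cnorm T (ten b p \<ominus> tsum ks) < e" by blast
  qed
  have near_sum: "continuous_on K (\<lambda>y. \<Sum>x\<in>N. c x * p x y) \<and> near (ten b (\<lambda>y. \<Sum>x\<in>N. c x * p x y))"
    if "finite N" "\<forall>x\<in>N. p x \<in> \<Psi>" "b \<in> carrier B" for N :: "'x set" and p c b
    using that(1,2)
  proof (induction N rule: finite_induct)
    case empty
    have "ten b (\<lambda>y. 0) = \<zero>" using ten_scal_right[OF that(3), of "\<lambda>_. 1" 0] that(3) by simp
    then show ?case using near_zero by simp
  next
    case (insert x N)
    have px: "continuous_on K (\<lambda>y. c x * p x y)" using pc insert.prems by (intro continuous_on_mult_left) auto
    have "ten b (\<lambda>y. c x * p x y) = ten (c x \<odot>\<^bsub>B\<^esub> b) (p x)"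
      using pc insert.prems that(3) by (simp add: ten_scal_right ten_scal_left)
    then have "near (ten b (\<lambda>y. c x * p x y))" using near_gen insert.prems that(3) by simp
    then show ?case
      using insert px near_add ten_add_right[OF that(3) px] by (simp add: continuous_on_add)
  qed
  have near_ten: "near (ten b f)" if b: "b \<in> carrier B" and f: "continuous_on K f" for b f
  proof (rule near_lim)
    show "ten b f \<in> carrier T" using b f by simp
    fix e :: real assume e: "e > 0"
    define r where "r = e / (cnorm B b + 1)"
    have b0: "0 \<le> cnorm B b" using b by (rule B.cnorm_nonneg)
    have r: "r > 0" using e b0 by (simp add: r_def)
    obtain N p c where N: "finite N" "\<forall>x\<in>N. p x \<in> \<Psi>"
      and app: "\<forall>y\<in>K. cmod (f y - (\<Sum>x\<in>(N :: 'x set). c x * p x y)) \<le> r"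
      using papp[rule_format, OF f r] by (elim exE conjE) (rule that)
    define g where "g = (\<lambda>y. \<Sum>x\<in>N. c x * p x y)"
    have g: "continuous_on K g" "near (ten b g)" using near_sum[OF N b, of c] by (auto simp: g_def)
    have "ten b f \<ominus> ten b g = ten b (\<lambda>y. f y - g y)"
      using b f g(1) by (simp add: ten_el_fn fn_diff diff_distr_right continuous_on_diff)
    also have "cnorm T \<dots> \<le> cnorm B b * r"
      using f g(1) app r by (intro ten_cnorm_le b continuous_intros) (auto simp: g_def)
    also have "\<dots> \<le> (cnorm B b + 1) * r" using r by (simp add: algebra_simps)
    also have "\<dots> = e" using b0 by (simp add: r_def)
    finally show "\<exists>s. near s \<and> cnorm T (ten b f \<ominus> s) \<le> e" using g(2) by blast
  qed
  have near_finsum: "near (\<Oplus>i\<in>{..<n}. ten (b i) (f i))"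
    if "!!i. i < n ==> b i \<in> carrier B" "!!i. i < n ==> continuous_on K (f i)" for n :: nat and b f
    using that
  proof (induction n)
    case (Suc n)
    have "(\<Oplus>i\<in>{..<Suc n}. ten (b i) (f i)) = ten (b n) (f n) \<oplus> (\<Oplus>i\<in>{..<n}. ten (b i) (f i))"
      unfolding lessThan_Suc using Suc by (intro finsum_insert) auto
    then show ?case using Suc near_add near_ten by simp
  qed (simp add: near_zero)
  have all: "near t" if t: "t \<in> carrier T" for t
  proof (rule near_lim[OF t])
    fix e :: real assume "e > 0"
    then show "\<exists>s. near s \<and> cnorm T (t \<ominus> s) \<le> e"
      using ten_sums_dense[OF t] near_finsum by (metis less_imp_le)
  qed
  show ?thesis unfolding separable_cstar_def
  proof (intro exI[of _ "tsum ` ?L"] conjI)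
    show sub: "tsum ` ?L \<subseteq> carrier T" using tc by blast
    show "countable (tsum ` ?L)" using \<Psi> by (intro countable_image countable_lists countable_SIGMA) auto
    have "t \<in> norm_topology T closure_of (tsum ` ?L) \<longleftrightarrow> t \<in> carrier T" for t
      unfolding in_closure_iff[OF sub] using all[of t] unfolding near_def by blast
    then show "norm_topology T closure_of (tsum ` ?L) = carrier T" by blast
  qed
qed

end

section \<open>Stability of the tensor product\<close>

lemma (in representation) asym_hom_compose:
  assumes B: "unital_cstar_algebra B" and h: "h \<in> unital_star_hom B T"
  shows "asym_hom I \<alpha> A \<rho> B (\<lambda>b. x (h b))"
proof -
  note [simp] = unital_star_homD[OF h]
  show ?thesis unfolding asym_hom_def
    by (auto intro!: x_bdd x_add x_mult x_scal x_star x_one)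
qed

text \<open>The classes of the families \<open>x (h b)\<close> form a homomorphism of \<open>B\<close> into the ultraproduct, and
  changing a lift of it on a negligible set of indices does not affect equivalence.\<close>

lemma (in representation) stable_lift:
  assumes stable: "tracially_stable TYPE('i) \<C> B" and inf: "infinite (I :: 'i set)"
    and A: "\<forall>i\<in>I. A i \<in> \<C> \<and> tracial_state (A i) (\<rho> i)" and h: "h \<in> unital_star_hom B T"
  obtains \<phi> where "\<forall>\<^sub>F i in \<alpha>. \<phi> i \<in> unital_star_hom B (A i)"
    "\<forall>b\<in>carrier B. x (h b) \<asymp> (\<lambda>i. \<phi> i b)"
proof -
  have B: "unital_cstar_algebra B" using stable by (simp add: tracially_stable_def)
  interpret B: unital_cstar_algebra B by (rule B)
  have y: "asym_hom I \<alpha> A \<rho> B (\<lambda>b. x (h b))" by (rule asym_hom_compose[OF B h])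
  have "(\<lambda>b. coset_of I \<alpha> A \<rho> (restrict (x (h b)) I)) \<in> unital_star_hom B (tracial_ultraproduct I \<alpha> A \<rho>)"
    by (rule representatives_hom[OF B y])
  then have "approximately_liftable B I \<alpha> A \<rho> (\<lambda>b. coset_of I \<alpha> A \<rho> (restrict (x (h b)) I))"
    using stable inf nontrivial A unfolding tracially_stable_def by blast
  then obtain E \<phi> where E: "E \<subseteq> I" "\<forall>\<^sub>F i in \<alpha>. i \<in> E" and \<phi>0: "\<forall>i\<in>E. \<phi> i \<in> unital_star_hom B (A i)"
    and eq: "\<forall>b\<in>carrier B. coset_of I \<alpha> A \<rho> (restrict (x (h b)) I) =
      coset_of I \<alpha> A \<rho> (\<lambda>i\<in>I. if i \<in> E then \<phi> i b else \<zero>\<^sub>i)"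
    unfolding approximately_liftable_def by (elim exE conjE) (rule that)
  have \<phi>: "!!i. i \<in> E ==> \<phi> i \<in> unital_star_hom B (A i)" using \<phi>0 by blast
  have "x (h b) \<asymp> (\<lambda>i. \<phi> i b)" if b: "b \<in> carrier B" for b
  proof -
    define f where "f = (\<lambda>i. if i \<in> E then \<phi> i b else \<zero>\<^sub>i)"
    have fb: "bounded_fam f" unfolding f_def by (rule lift_bounded[OF B \<phi> b])
    have hb: "h b \<in> carrier T" by (rule unital_star_homD(1)[OF h b])
    have "x (h b) \<asymp> f" using bspec[OF eq b] cos_restrict_eq_iff[OF x_bdd[OF hb] fb] by (simp add: f_def)
    then have lim: "((\<lambda>i. nrm i (x (h b) i \<ominus>\<^sub>i f i)) \<longlongrightarrow> 0) \<alpha>" by (simp add: eqv_def)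
    show ?thesis unfolding eqv_def
      by (rule Lim_transform_eventually[OF lim])
        (use E(2) in \<open>auto elim!: eventually_mono simp: f_def\<close>)
  qed
  moreover have "\<forall>\<^sub>F i in \<alpha>. \<phi> i \<in> unital_star_hom B (A i)" using E(2) by (rule eventually_mono) (rule \<phi>)
  ultimately show thesis by (intro that ballI)
qed

context tensor_with_functions
begin

text \<open>The distance of \<open>t\<close> to the constant \<open>ev z t\<close>, measured in any state, is at most \<open>e\<close> as soon as
  the functions in \<open>P\<close> are \<open>\<delta>\<close>-close to their values at \<open>z\<close> in that state. The elements that can be
  controlled in this way form a closed subspace with all elementary tensors, hence everything.\<close>

definition controls :: "('x => real) set => real => 't => real => bool"
  where "controls P \<delta> t e \<longleftrightarrow> (\<forall>w z. cstar_state T w --> z \<in> K -->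
    (\<forall>f\<in>P. norm2 T w (fn (\<lambda>y. complex_of_real (f y)) \<ominus> of_real (f z) \<odot> \<one>) \<le> \<delta>) -->
    norm2 T w (t \<ominus> el (ev z t)) \<le> e)"

definition controlled :: "'t => bool"
  where "controlled t \<longleftrightarrow> t \<in> carrier T \<and> (\<forall>e>0. \<exists>P \<delta>. finite P \<and> (\<forall>f\<in>P. continuous_on K f) \<and> 0 < \<delta> \<and>
    controls P \<delta> t e)"

lemma controls_mono: "controls P \<delta> t e ==> P \<subseteq> P' ==> \<delta>' \<le> \<delta> ==> controls P' \<delta>' t e"
  unfolding controls_def by (meson order_trans subsetD)

lemma ev_closed [simp]: "z \<in> K ==> t \<in> carrier T ==> ev z t \<in> carrier B"
  by (rule unital_star_homD(1)[OF ev_hom])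

lemma controlled_add: assumes s: "controlled s" and t: "controlled t" shows "controlled (s \<oplus> t)"
  unfolding controlled_def
proof (intro conjI allI impI)
  have [simp]: "s \<in> carrier T" "t \<in> carrier T" using s t by (auto simp: controlled_def)
  show "s \<oplus> t \<in> carrier T" by simp
  fix e :: real assume "e > 0"
  then have e2: "e/2 > 0" by simp
  obtain P \<delta> where P: "finite P" "\<forall>f\<in>P. continuous_on K f" "0 < \<delta>" "controls P \<delta> s (e/2)"
    using s e2 unfolding controlled_def by blast
  obtain Q \<eta> where Q: "finite Q" "\<forall>f\<in>Q. continuous_on K f" "0 < \<eta>" "controls Q \<eta> t (e/2)"
    using t e2 unfolding controlled_def by blast
  have 1: "controls (P \<union> Q) (min \<delta> \<eta>) s (e/2)" by (rule controls_mono[OF P(4)]) auto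
  have 2: "controls (P \<union> Q) (min \<delta> \<eta>) t (e/2)" by (rule controls_mono[OF Q(4)]) auto
  have "controls (P \<union> Q) (min \<delta> \<eta>) (s \<oplus> t) e" unfolding controls_def
  proof (intro allI impI)
    fix w z assume w: "cstar_state T w" and z: "z \<in> K" and
      P': "\<forall>f\<in>P \<union> Q. norm2 T w (fn (\<lambda>y. complex_of_real (f y)) \<ominus> of_real (f z) \<odot> \<one>) \<le> min \<delta> \<eta>"
    interpret cstar_state T w by (rule w)
    have "(s \<oplus> t) \<ominus> el (ev z (s \<oplus> t)) = (s \<ominus> el (ev z s)) \<oplus> (t \<ominus> el (ev z t))"
      using z by (simp add: unital_star_homD(2)[OF ev_hom[OF z]] el_simps add_diff_add)
    moreover have "norm2 T w (s \<ominus> el (ev z s)) \<le> e/2" using 1 w z P' unfolding controls_def by blast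
    moreover have "norm2 T w (t \<ominus> el (ev z t)) \<le> e/2" using 2 w z P' unfolding controls_def by blast
    ultimately show "norm2 T w ((s \<oplus> t) \<ominus> el (ev z (s \<oplus> t))) \<le> e"
      using norm2_triangle[of "s \<ominus> el (ev z s)" "t \<ominus> el (ev z t)"] z by simp
  qed
  then show "\<exists>P \<delta>. finite P \<and> (\<forall>f\<in>P. continuous_on K f) \<and> 0 < \<delta> \<and> controls P \<delta> (s \<oplus> t) e"
    using P Q by (intro exI[of _ "P \<union> Q"] exI[of _ "min \<delta> \<eta>"]) auto
qed

lemma controlled_limit:
  assumes t: "t \<in> carrier T" and l: "!!e. e > 0 ==> \<exists>s. controlled s \<and> cnorm T (t \<ominus> s) \<le> e"
  shows "controlled t"
  unfolding controlled_def
proof (intro conjI allI impI t)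
  fix e :: real assume "e > 0"
  then have e3: "e/3 > 0" by simp
  obtain s where s: "controlled s" "cnorm T (t \<ominus> s) \<le> e/3" using l[OF e3] by blast
  have [simp]: "s \<in> carrier T" "t \<in> carrier T" using s t by (auto simp: controlled_def)
  obtain P \<delta> where P: "finite P" "\<forall>f\<in>P. continuous_on K f" "0 < \<delta>" "controls P \<delta> s (e/3)"
    using s e3 unfolding controlled_def by blast
  have "controls P \<delta> t e" unfolding controls_def
  proof (intro allI impI)
    fix w z assume w: "cstar_state T w" and z: "z \<in> K" and
      P': "\<forall>f\<in>P. norm2 T w (fn (\<lambda>y. complex_of_real (f y)) \<ominus> of_real (f z) \<odot> \<one>) \<le> \<delta>"
    interpret cstar_state T w by (rule w)
    have 1: "norm2 T w (s \<ominus> el (ev z s)) \<le> e/3" using P(4) w z P' unfolding controls_def by blast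
    have 2: "norm2 T w (t \<ominus> s) \<le> e/3" using norm2_le_cnorm[of "t \<ominus> s"] s(2) by simp
    have "norm2 T w (el (ev z s) \<ominus> el (ev z t)) \<le> cnorm T (el (ev z s \<ominus>\<^bsub>B\<^esub> ev z t))"
      using norm2_le_cnorm[of "el (ev z s) \<ominus> el (ev z t)"] z by (simp add: el_diff)
    also have "\<dots> \<le> cnorm B (ev z s \<ominus>\<^bsub>B\<^esub> ev z t)" using z by (intro el_cnorm) auto
    also have "\<dots> = cnorm B (ev z (s \<ominus> t))"
      by (simp add: unital_star_hom_diff[OF unital_cstar_algebra_axioms B.unital_cstar_algebra_axioms ev_hom[OF z]])
    also have "\<dots> \<le> cnorm T (s \<ominus> t)"
      by (intro unital_star_hom_contractive[OF unital_cstar_algebra_axioms B.unital_cstar_algebra_axioms ev_hom[OF z]]) auto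
    also have "\<dots> \<le> e/3" using s(2) by (simp add: cnorm_diff_commute[of s])
    finally have 3: "norm2 T w (el (ev z s) \<ominus> el (ev z t)) \<le> e/3" .
    have "norm2 T w (t \<ominus> el (ev z t)) \<le> norm2 T w (t \<ominus> s) +
        (norm2 T w (s \<ominus> el (ev z s)) + norm2 T w (el (ev z s) \<ominus> el (ev z t)))"
      using z by (intro order_trans[OF norm2_diff_triangle[of _ s]] add_left_mono norm2_diff_triangle) auto
    then show "norm2 T w (t \<ominus> el (ev z t)) \<le> e" using 1 2 3 by linarith
  qed
  then show "\<exists>P \<delta>. finite P \<and> (\<forall>f\<in>P. continuous_on K f) \<and> 0 < \<delta> \<and> controls P \<delta> t e" using P by blast
qed

lemma controlled_ten:
  assumes b: "b \<in> carrier B" and f: "continuous_on K f" shows "controlled (ten b f)"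
  unfolding controlled_def
proof (intro conjI allI impI)
  show "ten b f \<in> carrier T" using b f by simp
  fix e :: real assume e: "e > 0"
  define m where "m = cnorm B b + 1"
  define \<delta> where "\<delta> = e / (2 * m)"
  have b0: "0 \<le> cnorm B b" using b by (rule B.cnorm_nonneg)
  have m: "m > 0" "cnorm B b \<le> m" using b0 by (auto simp: m_def)
  have \<delta>: "\<delta> > 0" using e m by (simp add: \<delta>_def)
  let ?u = "\<lambda>y. Re (f y)" and ?v = "\<lambda>y. Im (f y)"
  have uv: "continuous_on K ?u" "continuous_on K ?v" using f by (auto intro: continuous_intros)
  have cuv: "continuous_on K (\<lambda>y. complex_of_real (?u y))" "continuous_on K (\<lambda>y. complex_of_real (?v y))"
    by (intro continuous_on_of_real uv)+
  have "controls {?u, ?v} \<delta> (ten b f) e" unfolding controls_def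
  proof (intro allI impI)
    fix w z assume w: "cstar_state T w" and z: "z \<in> K" and
      P: "\<forall>g\<in>{?u, ?v}. norm2 T w (fn (\<lambda>y. complex_of_real (g y)) \<ominus> of_real (g z) \<odot> \<one>) \<le> \<delta>"
    interpret cstar_state T w by (rule w)
    let ?a = "fn (\<lambda>y. complex_of_real (?u y)) \<ominus> of_real (?u z) \<odot> \<one>"
    let ?c = "fn (\<lambda>y. complex_of_real (?v y)) \<ominus> of_real (?v z) \<odot> \<one>"
    have ac [simp]: "?a \<in> carrier T" "?c \<in> carrier T" using cuv by auto
    have "fn f = fn (\<lambda>y. complex_of_real (?u y) + \<i> * complex_of_real (?v y))"
      by (rule fn_cong) (simp add: complex_eq_iff)
    also have "\<dots> = fn (\<lambda>y. complex_of_real (?u y)) \<oplus> \<i> \<odot> fn (\<lambda>y. complex_of_real (?v y))"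
      using cuv by (simp add: fn_add fn_scal continuous_on_mult_left)
    finally have ff: "fn f = fn (\<lambda>y. complex_of_real (?u y)) \<oplus> \<i> \<odot> fn (\<lambda>y. complex_of_real (?v y))" .
    have fz: "f z \<odot> \<one> = of_real (?u z) \<odot> \<one> \<oplus> \<i> \<odot> (of_real (?v z) \<odot> \<one>)"
      using complex_eq[of "f z"] by (simp add: scal_add_left[symmetric] mult.commute)
    have "fn f \<ominus> f z \<odot> \<one> = ?a \<oplus> \<i> \<odot> ?c"
      unfolding ff fz using cuv by (simp add: scal_diff_right add_diff_add)
    then have "norm2 T w (fn f \<ominus> f z \<odot> \<one>) \<le> norm2 T w ?a + norm2 T w ?c"
      using norm2_triangle[of ?a "\<i> \<odot> ?c"] by (simp add: norm2_scal)
    then have le: "norm2 T w (fn f \<ominus> f z \<odot> \<one>) \<le> 2 * \<delta>" using P by simp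
    have "ten b f \<ominus> el (ev z (ten b f)) = el b \<otimes> (fn f \<ominus> f z \<odot> \<one>)"
      unfolding ev_ten[OF z b f] using b f by (simp add: ten_el_fn el_simps diff_distr_right smult_mult_right)
    then have "norm2 T w (ten b f \<ominus> el (ev z (ten b f))) \<le> cnorm T (el b) * norm2 T w (fn f \<ominus> f z \<odot> \<one>)"
      using norm2_mult_le[of "el b" "fn f \<ominus> f z \<odot> \<one>"] b f by simp
    also have "\<dots> \<le> m * (2 * \<delta>)"
      using le el_cnorm[OF b] m f by (intro mult_mono norm2_nonneg) auto
    also have "\<dots> = e" using m by (simp add: \<delta>_def)
    finally show "norm2 T w (ten b f \<ominus> el (ev z (ten b f))) \<le> e" .
  qed
  then show "\<exists>P \<delta>. finite P \<and> (\<forall>f\<in>P. continuous_on K f) \<and> 0 < \<delta> \<and> controls P \<delta> (ten b f) e"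
    using \<delta> uv by (intro exI[of _ "{?u, ?v}"] exI[of _ \<delta>]) auto
qed

lemma all_controlled: assumes t: "t \<in> carrier T" shows "controlled t"
proof (rule controlled_limit[OF t])
  have sums: "controlled (\<Oplus>i\<in>{..<n}. ten (b i) (f i))"
    if "!!i. i < n ==> b i \<in> carrier B" "!!i. i < n ==> continuous_on K (f i)" for n :: nat and b f
    using that
  proof (induction n)
    case 0
    have "ten \<one>\<^bsub>B\<^esub> (\<lambda>_. 0) = \<zero>" using fn_const[of 0] by (simp add: fn_def)
    then show ?case using controlled_ten[of "\<one>\<^bsub>B\<^esub>" "\<lambda>_. 0"] by simp
  next
    case (Suc n)
    have "(\<Oplus>i\<in>{..<Suc n}. ten (b i) (f i)) = ten (b n) (f n) \<oplus> (\<Oplus>i\<in>{..<n}. ten (b i) (f i))"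
      unfolding lessThan_Suc using Suc by (intro finsum_insert) auto
    then show ?case using Suc controlled_add controlled_ten by simp
  qed
  fix e :: real assume "e > 0"
  then show "\<exists>s. controlled s \<and> cnorm T (t \<ominus> s) \<le> e"
    using ten_sums_dense[OF t] sums by (metis less_imp_le)
qed

lemma finitely_many_controlled:
  assumes "finite F" "F \<subseteq> carrier T" "e > 0"
  shows "\<exists>P \<delta>. finite P \<and> (\<forall>f\<in>P. continuous_on K f) \<and> 0 < \<delta> \<and> (\<forall>t\<in>F. controls P \<delta> t e)"
  using assms(1,2)
proof (induction F rule: finite_induct)
  case empty show ?case by (intro exI[of _ "{}"] exI[of _ 1]) auto
next
  case (insert t F)
  then obtain P \<delta> where P: "finite P" "\<forall>f\<in>P. continuous_on K f" "0 < \<delta>" "\<forall>t\<in>F. controls P \<delta> t e" by auto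
  obtain Q \<eta> where Q: "finite Q" "\<forall>f\<in>Q. continuous_on K f" "0 < \<eta>" "controls Q \<eta> t e"
    using all_controlled[of t] insert.prems assms(3) unfolding controlled_def by blast
  have "controls (P \<union> Q) (min \<delta> \<eta>) s e" if "s \<in> insert t F" for s
    using that P(4) Q(4) controls_mono[of P \<delta> s e "P \<union> Q" "min \<delta> \<eta>"] controls_mono[of Q \<eta> s e "P \<union> Q" "min \<delta> \<eta>"]
    by auto
  then show ?case using P Q by (intro exI[of _ "P \<union> Q"] exI[of _ "min \<delta> \<eta>"]) auto
qed

text \<open>If \<open>\<Sum> (f - c f)\<^sup>2\<close> exceeded \<open>\<kappa>\<close> on all of \<open>K\<close>, then \<open>\<Sum> (f - c f)\<^sup>2 - \<kappa>\<close> would be the square of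
  a real continuous function, so its expectation would be nonnegative.\<close>

lemma point_from_state:
  assumes w: "cstar_state T w" and P: "finite P" "\<forall>f\<in>P. continuous_on K f"
    and dev: "!!f. f \<in> P ==> norm2 T w (fn (\<lambda>y. complex_of_real (f y)) \<ominus> of_real (c f) \<odot> \<one>) \<le> \<delta>"
    and \<kappa>: "real (card P) * \<delta>\<^sup>2 < \<kappa>"
  obtains z where "z \<in> K" "(\<Sum>f\<in>P. (f z - c f)\<^sup>2) \<le> \<kappa>"
proof -
  interpret cstar_state T w by (rule w)
  let ?e = "\<lambda>f :: 'x => real. Re (w (fn (\<lambda>y. complex_of_real (f y))))"
  have add: "?e (\<lambda>y. f y + g y) = ?e f + ?e g" if "continuous_on K f" "continuous_on K g" for f g
    using that by (simp add: fn_add st continuous_on_of_real)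
  have sq: "?e (\<lambda>y. (g y)\<^sup>2) = (norm2 T w (fn (\<lambda>y. complex_of_real (g y))))\<^sup>2" if g: "continuous_on K g" for g
  proof -
    have cg: "continuous_on K (\<lambda>y. complex_of_real (g y))" by (intro continuous_on_of_real g)
    have "fn (\<lambda>y. complex_of_real ((g y)\<^sup>2)) = star T (fn (\<lambda>y. complex_of_real (g y))) \<otimes> fn (\<lambda>y. complex_of_real (g y))"
      using cg by (simp add: fn_star fn_mult[symmetric] power2_eq_square)
    then show ?thesis using cg by (simp add: norm2_sq)
  qed
  let ?q = "\<lambda>P y. \<Sum>f\<in>P. (f y - c f)\<^sup>2"
  have cq: "continuous_on K (?q P)" if "\<forall>f\<in>P. continuous_on K f" for P
    using that by (intro continuous_intros) auto
  have "?e (?q P) \<le> real (card P) * \<delta>\<^sup>2"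
    using P dev
  proof (induction P rule: finite_induct)
    case empty show ?case using fn_const[of 0] by (simp add: st)
  next
    case (insert f P)
    have cf: "continuous_on K (\<lambda>y. f y - c f)" using insert.prems by (auto intro: continuous_intros)
    have "fn (\<lambda>y. complex_of_real (f y - c f)) = fn (\<lambda>y. complex_of_real (f y)) \<ominus> of_real (c f) \<odot> \<one>"
      using insert.prems by (simp add: fn_diff fn_const continuous_on_of_real)
    then have "?e (\<lambda>y. (f y - c f)\<^sup>2) \<le> \<delta>\<^sup>2"
      unfolding sq[OF cf] using insert.prems(2)[of f] cf
      by (intro power_mono norm2_nonneg fn_closed continuous_on_of_real) auto
    moreover have "?e (?q (insert f P)) = ?e (\<lambda>y. (f y - c f)\<^sup>2) + ?e (?q P)"
      using add[of "\<lambda>y. (f y - c f)\<^sup>2" "?q P"] cq[of P] insert cf by (simp add: continuous_on_power)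
    ultimately show ?case using insert by (simp add: algebra_simps)
  qed
  then have less: "?e (?q P) < \<kappa>" using \<kappa> by simp
  have "\<exists>z\<in>K. ?q P z \<le> \<kappa>"
  proof (rule ccontr)
    assume "\<not> ?thesis"
    then have pos: "?q P y - \<kappa> > 0" if "y \<in> K" for y using that by (auto simp: not_le)
    let ?r = "\<lambda>y. sqrt (?q P y - \<kappa>)"
    have cr: "continuous_on K ?r" 
      by (intro continuous_on_real_sqrt continuous_on_diff continuous_on_const cq P)
    have "0 \<le> ?e (\<lambda>y. (?r y)\<^sup>2)" unfolding sq[OF cr] by simp
    also have "\<dots> = ?e (\<lambda>y. ?q P y + (- \<kappa>))"
    proof -
      have "fn (\<lambda>y. complex_of_real ((?r y)\<^sup>2)) = fn (\<lambda>y. complex_of_real (?q P y + (- \<kappa>)))"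
        by (rule fn_cong) (use pos in \<open>simp add: less_imp_le del: of_real_power\<close>)
      then show ?thesis by (rule arg_cong)
    qed
    also have "\<dots> = ?e (?q P) + ?e (\<lambda>_. - \<kappa>)" by (rule add[OF cq[OF P(2)] continuous_on_const])
    also have "?e (\<lambda>_. - \<kappa>) = - \<kappa>" by (simp add: fn_const st)
    finally show False using less by simp
  qed
  then show thesis using that by blast
qed

end

lemma (in representation) evaluations_approximate:
  fixes K :: "'x :: metric_space set" and B :: "'b cstar_algebra"
  assumes tens: "tensor_with_functions T B K j"
    and stable: "tracially_stable TYPE('i) \<C> B" and inf: "infinite (I :: 'i set)"
    and A: "\<forall>i\<in>I. A i \<in> \<C> \<and> tracial_state (A i) (\<rho> i)"
    and G: "finite G" "\<forall>f\<in>G. continuous_on K f" and \<delta>: "0 < \<delta>"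
    and l: "!!f. f \<in> G ==>
      loc I \<alpha> A \<rho> (x (tensor_with_functions.fn B K j (\<lambda>y. complex_of_real (f y)))) (c f) \<delta>"
    and F: "finite F" "F \<subseteq> carrier T"
    and ctrl: "!!t. t \<in> F ==> tensor_with_functions.controls T B K j G ((real (card G) + 2) * \<delta>) t \<epsilon>"
  shows "good \<alpha> A \<rho> T x F \<epsilon>"
proof -
  interpret U: tensor_with_functions T B K j by (rule tens)
  have w: "cstar_state T lim_state" by (rule L.cstar_state_axioms)
  let ?f = "\<lambda>f :: 'x => real. U.fn (\<lambda>y. complex_of_real (f y))"
  have fc: "?f f \<in> carrier T" if "f \<in> G" for f using G that by (intro U.fn_closed continuous_on_of_real) auto
  have dev: "norm2 T lim_state (?f f \<ominus> of_real (c f) \<odot> \<one>) \<le> \<delta>" if f: "f \<in> G" for f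
    by (rule norm2_deviation_le[OF fc[OF f] l[OF f]])
  have "real (card G) * \<delta>\<^sup>2 < real (card G) * \<delta>\<^sup>2 + \<delta>\<^sup>2" using \<delta> by simp
  from U.point_from_state[where c = c, OF w G dev this]
  obtain z where z: "z \<in> K" "(\<Sum>f\<in>G. (f z - c f)\<^sup>2) \<le> real (card G) * \<delta>\<^sup>2 + \<delta>\<^sup>2" by blast
  have "norm2 T lim_state (?f f \<ominus> of_real (f z) \<odot> \<one>) \<le> (real (card G) + 2) * \<delta>"
    if f: "f \<in> G" for f
  proof -
    note [simp] = fc[OF f]
    have "\<bar>f z - c f\<bar> \<le> (real (card G) + 1) * \<delta>"
      using sum_squares_component_bound[of G "\<lambda>f. f z" c \<delta> f] G(1) z(2) f \<delta> by simp
    moreover have "norm2 T lim_state (of_real (c f) \<odot> \<one> \<ominus> of_real (f z) \<odot> \<one>) = \<bar>f z - c f\<bar>"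
      unfolding T.scal_diff_left[OF T.one_closed, symmetric] of_real_diff[symmetric]
      by (simp add: L.norm2_scal del: of_real_diff)
    moreover have "norm2 T lim_state (?f f \<ominus> of_real (f z) \<odot> \<one>) \<le>
        norm2 T lim_state (?f f \<ominus> of_real (c f) \<odot> \<one>)
        + norm2 T lim_state (of_real (c f) \<odot> \<one> \<ominus> of_real (f z) \<odot> \<one>)"
      by (intro L.norm2_diff_triangle) auto
    ultimately show ?thesis using dev[OF f] by (simp add: algebra_simps)
  qed
  then have close: "norm2 T lim_state (t \<ominus> U.el (U.ev z t)) \<le> \<epsilon>" if "t \<in> F" for t
    using ctrl[OF that] w z(1) unfolding U.controls_def by blast
  obtain \<phi> where \<phi>: "\<forall>\<^sub>F i in \<alpha>. \<phi> i \<in> unital_star_hom B (A i)"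
    "\<forall>b\<in>carrier B. x (U.el b) \<asymp> (\<lambda>i. \<phi> i b)"
    by (rule stable_lift[OF stable inf A U.el_hom])
  show ?thesis
  proof (rule good_by_approximate_homs[OF F(1) _ _ close])
    show "\<forall>\<^sub>F i in \<alpha>. (\<lambda>t. \<phi> i (U.ev z t)) \<in> unital_star_hom T (A i)"
      using \<phi>(1)
    proof eventually_elim
      case (elim i)
      note [simp] = unital_star_homD[OF elim] unital_star_homD[OF U.ev_hom[OF z(1)]]
      show ?case by (rule unital_star_homI) simp_all
    qed
  qed (use F(2) z(1) \<phi>(2) in auto)
qed

text \<open>The functions are central. If finitely many of them are almost scalar in a representation, then
  they are close to their values at some point \<open>z\<close>, and a lift of \<open>b \<mapsto> x (el b)\<close>, which stability of \<open>B\<close>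
  provides, composed with evaluation at \<open>z\<close> is a model.\<close>

theorem tensor_tracially_stable:
  fixes \<C> :: "'u cstar_algebra set" and T :: "'t cstar_algebra" and B :: "'b cstar_algebra"
    and K :: "'x :: metric_space set"
  assumes cls: "!!A. A \<in> \<C> ==> unital_cstar_algebra A \<and> real_rank_zero A"
    and corner: "corner_closed \<C>" and stable: "tracially_stable TYPE('i) \<C> B"
    and K: "compact K" and tensor: "is_cstar_tensor_product B (continuous_functions K) T j"
  shows "tracially_stable TYPE('i) \<C> T"
proof -
  have T: "unital_cstar_algebra T" using tensor by (simp add: is_cstar_tensor_product_def)
  have B: "unital_cstar_algebra B" "separable_cstar B" using stable by (auto simp: tracially_stable_def)
  have tens: "tensor_with_functions T B K j"
    by (intro tensor_with_functions.intro tensor_with_functions_axioms.intro T B K tensor)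
  interpret tensor_with_functions T B K j by (rule tens)
  show ?thesis
  proof (rule tracially_stable_by_local_models[OF cls corner T separable_tensor[OF B(2)]])
    fix F \<epsilon> assume F: "finite F" "F \<subseteq> carrier T" and \<epsilon>: "0 < (\<epsilon> :: real)"
    obtain P \<eta> where P: "finite P" "\<forall>f\<in>P. continuous_on K f" and \<eta>: "0 < \<eta>" and ctrl: "\<forall>t\<in>F. controls P \<eta> t \<epsilon>"
      using finitely_many_controlled[OF F \<epsilon>] by blast
    let ?f = "\<lambda>f :: 'x => real. fn (\<lambda>y. complex_of_real (f y))"
    have co: "continuous_on K (\<lambda>y. complex_of_real (f y))" if "f \<in> P" for f
      using P that by (intro continuous_on_of_real) auto
    define S where "S = ?f ` P"
    define \<delta> where "\<delta> = \<eta> / (real (card P) + 2)"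
    have \<delta>: "\<delta> > 0" "(real (card P) + 2) * \<delta> = \<eta>" using \<eta> by (simp_all add: \<delta>_def)
    have S: "finite S" "S \<subseteq> carrier T" "\<forall>a\<in>S. self_adjoint T a" "\<forall>a\<in>S. \<forall>t\<in>carrier T. a \<otimes>\<^bsub>T\<^esub> t = t \<otimes>\<^bsub>T\<^esub> a"
      using P(1) co by (auto simp: S_def self_adjoint_def fn_star fn_central)
    have base: "good \<alpha> A \<rho> T x F \<epsilon>" if "nontrivial_ultrafilter_on I \<alpha>" "infinite I"
        "\<forall>i\<in>I. A i \<in> \<C> \<and> tracial_state (A i) (\<rho> i)" "asym_hom I \<alpha> A \<rho> T x"
        "\<forall>a\<in>S. loc I \<alpha> A \<rho> (x a) (c a) \<delta>" for I :: "'i set" and \<alpha> A \<rho> x c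
    proof -
      have "family I \<alpha> A \<rho>" using that(1,3) cls
        by (intro family.intro) (auto simp: tracial_algebra_def tracial_algebra_axioms_def)
      then interpret representation I \<alpha> A \<rho> T x
        by (intro representation.intro representation_axioms.intro T that)
      show ?thesis
        by (rule evaluations_approximate[OF tens stable that(2,3) P \<delta>(1) _ F, where c = "\<lambda>f. c (?f f)"])
          (use that(5) ctrl \<delta>(2) in \<open>auto simp: S_def\<close>)
    qed
    show "\<exists>S \<delta>. finite S \<and> S \<subseteq> carrier T \<and> (\<forall>a\<in>S. self_adjoint T a) \<and>
        (\<forall>a\<in>S. \<forall>t\<in>carrier T. a \<otimes>\<^bsub>T\<^esub> t = t \<otimes>\<^bsub>T\<^esub> a) \<and> 0 < \<delta> \<and>
        (\<forall>(I :: 'i set) \<alpha> A \<rho> x c. nontrivial_ultrafilter_on I \<alpha> --> infinite I -->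
          (\<forall>i\<in>I. A i \<in> \<C> \<and> tracial_state (A i) (\<rho> i)) --> asym_hom I \<alpha> A \<rho> T x -->
          (\<forall>a\<in>S. loc I \<alpha> A \<rho> (x a) (c a) \<delta>) --> good \<alpha> A \<rho> T x F \<epsilon>)"
      using S \<delta>(1) base by (intro exI[of _ S] exI[of _ \<delta>]) auto
  qed
qed

theorem theorem2p7:
  fixes \<C> :: "'u cstar_algebra set"
  assumes "\<forall>A \<in> \<C>. unital_cstar_algebra A \<and> real_rank_zero A"
    and "iso_closed \<C>"
    and "direct_sum_closed \<C>"
    and "corner_closed \<C>"
  shows "(\<forall>(B :: 'b cstar_algebra) (K :: 'x :: metric_space set) (T :: 't cstar_algebra) j.
            tracially_stable TYPE('i) \<C> B \<and> compact K \<and>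
            is_cstar_tensor_product B (continuous_functions K) T j \<longrightarrow>
            tracially_stable TYPE('i) \<C> T) \<and>
         (\<forall>A :: 'd cstar_algebra.
            unital_cstar_algebra A \<and> separable_cstar A \<and> cring A \<longrightarrow>
            tracially_stable TYPE('i) \<C> A)"
  using tensor_tracially_stable[of \<C>] commutative_tracially_stable[of \<C>] assms(1,4) by blast

end
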